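(* For real $k$, let $N(k)$ be the set of all solutions $u$ of the Liouville equation $-\Delta u=e^{2u}$ in $\mathbb{R}^2=\mathbb{C}$ such that $$\limsup_{z\to\infty}\frac{u(z)}{\log|z|}=k.$$ For a solution $u$, let $f$ denote a developing map of $u$. Then: (i) $N(k)$ is non-empty if and only if either $k=-2$ or $2k$ is a non-negative integer. (ii) $N(-2)$ consists exactly of those solutions $u$ for which $f$ is a linear-fractional transformation. For all other solutions of the Liouville equation, $f$ is transcendental. (iii) For $k\ge 0$, $u\in N(k)$ if and only if $f=w_1/w_2$, where $w_1$ and $w_2$ are two linearly independent solutions of the complex differential equation $$w''+P(z)w=0,\quad z\in\mathbb{C},$$ where $P$ is a polynomial of degree $d=2k$. (iv) If $u\in N(k)$ with $k\ge 0$, then there exist $c>0$ and $\theta_0\in\mathbb{R}$ such that $$u(re^{i\theta})=-c\,r^{k+1}\left|\sin\left((k+1)(\theta-\theta_0)\right)\right|+o(r^{k+1}),\quad r\to\infty.$$ Moreover, there exist curves tending to $\infty$, with asymptotic directions $\theta$ satisfying $\sin\left((k+1)(\theta-\theta_0)\right)=0$, along which $u(z)/\log|z|\to k$ as $|z|\to\infty$.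
   Context: $\mathbb{R}^2$ is identified with $\mathbb{C}$ via $z=x+iy$. A solution means a classical ($C^2$) real-valued solution on all of $\mathbb{R}^2$. Every solution $u$ of $-\Delta u=e^{2u}$ in $\mathbb{R}^2$ can be written as $$u(z)=\log\frac{2|f'(z)|}{1+|f(z)|^2},$$ where $f$ is a locally univalent meromorphic function on $\mathbb{C}$ (i.e. $f'(z)\ne0$ away from poles and all poles are simple; at poles the right-hand side is understood by continuous extension). Such an $f$ is called a developing map (developing function) of $u$; it is unique up to replacing $f$ by $\phi\circ f$ with $\phi(z)=\frac{pz-\bar q}{qz+\bar p}$, $p,q\in\mathbb{C}$, $|p|^2+|q|^2=1$. Transcendental means meromorphic in $\mathbb{C}$ and not rational. A polynomial of degree $0$ is a nonzero constant. A curve tending to $\infty$ has asymptotic direction $\theta$ if $\arg z\to\theta$ (mod $2\pi$) as $z\to\infty$ along the curve. *)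

theory Defs
  imports "HOL-Complex_Analysis.Complex_Analysis"
begin

section \<open>Classical solutions of the Liouville equation\<close>

text \<open>The plane is the real Euclidean space \<open>complex\<close>, whose \<open>Basis\<close> is \<open>{1, \<i>}\<close>.\<close>

definition partial_deriv :: "complex \<Rightarrow> (complex \<Rightarrow> real) \<Rightarrow> complex \<Rightarrow> real" where
  "partial_deriv b u z = deriv (\<lambda>t::real. u (z + t *\<^sub>R b)) 0"

definition C1_plane :: "(complex \<Rightarrow> real) \<Rightarrow> bool" where
  "C1_plane u \<longleftrightarrow>
     (\<forall>b\<in>Basis. (\<forall>z. (\<lambda>t::real. u (z + t *\<^sub>R b)) field_differentiable (at 0)) \<and>
                continuous_on UNIV (partial_deriv b u))"

definition C2_plane :: "(complex \<Rightarrow> real) \<Rightarrow> bool" where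
  "C2_plane u \<longleftrightarrow> C1_plane u \<and> (\<forall>b\<in>Basis. C1_plane (partial_deriv b u))"

definition laplacian :: "(complex \<Rightarrow> real) \<Rightarrow> complex \<Rightarrow> real" where
  "laplacian u z = (\<Sum>b\<in>Basis. partial_deriv b (partial_deriv b u) z)"

definition liouville_solution :: "(complex \<Rightarrow> real) \<Rightarrow> bool" where
  "liouville_solution u \<longleftrightarrow> C2_plane u \<and> (\<forall>z. - laplacian u z = exp (2 * u z))"

definition N :: "real \<Rightarrow> (complex \<Rightarrow> real) set" where
  "N k = {u. liouville_solution u \<and>
             Limsup at_infinity (\<lambda>z. ereal (u z / ln (norm z))) = ereal k}"


section \<open>Developing maps\<close>

text \<open>A meromorphic function on the plane is represented by a function \<open>f\<close> with
  \<open>f nicely_meromorphic_on UNIV\<close>: all removable singularities are removed, and \<open>f\<close> takes the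
  dummy value 0 at its poles.\<close>

definition locally_univalent_meromorphic :: "(complex \<Rightarrow> complex) \<Rightarrow> bool" where
  "locally_univalent_meromorphic f \<longleftrightarrow>
     f nicely_meromorphic_on UNIV \<and>
     (\<forall>z. if is_pole f z then zorder f z = - 1 else deriv f z \<noteq> 0)"

text \<open>At a pole of \<open>f\<close> the right-hand side of Liouville's formula is read as its limit.\<close>

definition developing_map :: "(complex \<Rightarrow> complex) \<Rightarrow> (complex \<Rightarrow> real) \<Rightarrow> bool" where
  "developing_map f u \<longleftrightarrow>
     locally_univalent_meromorphic f \<and>
     (let F = (\<lambda>z. ln (2 * norm (deriv f z) / (1 + (norm (f z))\<^sup>2))) in
        \<forall>z. if is_pole f z then F \<midarrow>z\<rightarrow> u z else u z = F z)"

definition linear_fractional :: "(complex \<Rightarrow> complex) \<Rightarrow> bool" where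
  "linear_fractional f \<longleftrightarrow>
     (\<exists>a b c d. a * d - b * c \<noteq> 0 \<and>
        (\<forall>z. c * z + d \<noteq> 0 \<longrightarrow> f z = (a * z + b) / (c * z + d)))"

definition rational_function :: "(complex \<Rightarrow> complex) \<Rightarrow> bool" where
  "rational_function f \<longleftrightarrow>
     (\<exists>p q. q \<noteq> 0 \<and> (\<forall>z. poly q z \<noteq> 0 \<longrightarrow> f z = poly p z / poly q z))"

definition transcendental :: "(complex \<Rightarrow> complex) \<Rightarrow> bool" where
  "transcendental f \<longleftrightarrow> f meromorphic_on UNIV \<and> \<not> rational_function f"


section \<open>The equation \<open>w'' + P w = 0\<close>\<close>

definition ode_solution :: "complex poly \<Rightarrow> (complex \<Rightarrow> complex) \<Rightarrow> bool" where
  "ode_solution P w \<longleftrightarrow>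
     w holomorphic_on UNIV \<and> (\<forall>z. deriv (deriv w) z + poly P z * w z = 0)"

definition lin_indep_pair :: "(complex \<Rightarrow> complex) \<Rightarrow> (complex \<Rightarrow> complex) \<Rightarrow> bool" where
  "lin_indep_pair w1 w2 \<longleftrightarrow>
     (\<forall>a b. (\<forall>z. a * w1 z + b * w2 z = 0) \<longrightarrow> a = 0 \<and> b = 0)"

definition is_quotient :: "(complex \<Rightarrow> complex) \<Rightarrow> (complex \<Rightarrow> complex) \<Rightarrow> (complex \<Rightarrow> complex) \<Rightarrow> bool" where
  "is_quotient f w1 w2 \<longleftrightarrow> (\<forall>z. w2 z \<noteq> 0 \<longrightarrow> f z = w1 z / w2 z)"


section \<open>Curves tending to infinity\<close>

definition curve_to_infinity :: "(real \<Rightarrow> complex) \<Rightarrow> bool" where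
  "curve_to_infinity \<gamma> \<longleftrightarrow> continuous_on {0..} \<gamma> \<and> filterlim \<gamma> at_infinity at_top"

text \<open>\<open>\<alpha> t\<close> is some choice of the argument of \<open>\<gamma> t\<close>; convergence of the principal value \<open>Arg\<close>
  would be the wrong condition when \<open>\<theta>\<close> is the direction of the branch cut.\<close>

definition asymptotic_direction :: "(real \<Rightarrow> complex) \<Rightarrow> real \<Rightarrow> bool" where
  "asymptotic_direction \<gamma> \<theta> \<longleftrightarrow>
     (\<exists>\<alpha>. (\<forall>\<^sub>F t in at_top. \<gamma> t = complex_of_real (norm (\<gamma> t)) * cis (\<alpha> t)) \<and>
          (\<alpha> \<longlongrightarrow> \<theta>) at_top)"

end

theory Submission
  imports Defs
begin

text \<open>Everything is read off from one entire function attached to a solution \<open>u\<close>. With subscripts for the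
  complex derivatives, the equation is \<open>u\<^bsub>z z'\<^esub> = - e\<^sup>2\<^sup>u / 4\<close>, where \<open>z'\<close> is the conjugate variable, and it makes
  the potential \<open>T = u\<^bsub>zz\<^esub> - (u\<^bsub>z\<^esub>)\<^sup>2\<close> holomorphic. Take two solutions \<open>w1\<close>, \<open>w2\<close> of \<open>w'' + T w = 0\<close> with Wronskian 1
  and with values at the origin adapted to those of \<open>u\<close> and its gradient. Then
  \<open>ln 2 - ln (\<bar>w1\<bar>\<^sup>2 + \<bar>w2\<bar>\<^sup>2)\<close> is a solution with the same potential, value and gradient, so it is \<open>u\<close>
  (\<open>liouville_solution_representation\<close>). The developing maps of \<open>u\<close> are quotients of such pairs
  (\<open>developing_map_quotient\<close>), and conversely a quotient of two solutions of \<open>w'' + S w = 0\<close> that develops \<open>u\<close>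
  forces \<open>S = T\<close> (\<open>potential_eq_of_quotient\<close>). The theorem is therefore a statement about \<open>T\<close>:
  \<open>u\<close> belongs to \<open>N k\<close> exactly if \<open>T = 0\<close> and \<open>k = - 2\<close>, or \<open>T\<close> is a nonzero polynomial of degree \<open>2 k\<close>.

  That membership in some \<open>N k\<close> makes \<open>T\<close> a polynomial is seen as follows. The upper bound for \<open>u\<close> makes the Laplacian
  \<open>- e\<^sup>2\<^sup>u\<close> at most polynomially negative, so circle means together with Harnack's inequality bound \<open>u\<close>
  from below by the negative of a power of \<open>\<bar>z\<bar>\<close> (\<open>liouville_jet_polynomial_lower_bound\<close>). Around any point one may rotate
  the pair unitarily so that its second member has no zero in a disc whose radius is an inverse power of \<open>\<bar>z\<bar>\<close>.
  A logarithm \<open>G\<close> of this member has a polynomially bounded real part, and \<open>T = - G'' - G'\<^sup>2\<close>. So \<open>T\<close> grows at most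
  polynomially (\<open>potential_local_bound\<close>, \<open>potential_polynomial\<close>).

  If \<open>T\<close> is a nonzero polynomial of degree \<open>d\<close>, the Liouville-Green (WKB) method applies: in the coordinate
  \<open>\<zeta> = \<integral> \<surd>T dz\<close>, which is asymptotic to a multiple of a power of \<open>z\<close> with exponent \<open>d / 2 + 1\<close>, the functions
  \<open>T\<^sup>1\<^sup>/\<^sup>4 w\<close> satisfy a small perturbation of \<open>v'' + v = 0\<close>, and \<open>\<bar>w1\<bar>\<^sup>2 + \<bar>w2\<bar>\<^sup>2\<close> is comparable with
  \<open>exp (2 \<bar>Im \<zeta>\<bar>) / \<bar>z\<bar>\<^sup>d\<^sup>/\<^sup>2\<close> (\<open>wkb_half_plane\<close>, \<open>wkb_polynomial_plane\<close>). This is the sine asymptotics of \<open>u\<close>. The limit superior \<open>d / 2\<close> is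
  attained on the curves \<open>Im \<zeta> = 0\<close>, of which there is one for each of the \<open>d + 2\<close> critical directions.
  For \<open>T = 0\<close> the pair is affine and \<open>u\<close> is \<open>- 2 ln \<bar>z\<bar>\<close> up to a bounded term. Finally, a rational developing map forces the
  members of the pair to be polynomials, and then \<open>T = - w2'' / w2\<close> tends to 0 at infinity, so \<open>T = 0\<close>
  (\<open>rational_quotient_potential_zero\<close>).\<close>

section \<open>Perturbed oscillators on an interval\<close>

lemma inner_mult_self_complex: "inner (X::complex) (c * X) = Re c * (cmod X)\<^sup>2"
  unfolding cmod_power2 by (simp add: inner_complex_def power2_eq_square algebra_simps)

text \<open>\<open>X\<close> and \<open>Y\<close> are the amplitudes of the decaying and of the growing exponential. The sum of the
  squares cannot grow faster than at rate \<open>2 Im w + 4 \<bar>e\<bar>\<close>. If \<open>X\<close> starts at 0 and the coupling \<open>e\<close> is small against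
  \<open>Im w\<close>, then \<open>Y\<close> keeps dominating, and the difference of the squares grows at rate at least \<open>2 Im w - 4 \<bar>e\<bar>\<close>.
  The integral of the bound on \<open>e\<close> is at most \<open>D / s\<close> whatever the length of the interval.\<close>

lemma wkb_growth:
  fixes X Y e :: "real \<Rightarrow> complex" and w :: complex and s L D :: real
  assumes "0 \<le> L" "0 < s" "0 \<le> Im w"
    and dX: "\<And>t. t \<in> {0..L} \<Longrightarrow>
      (X has_vector_derivative \<i> * w * X t + e t * (X t + Y t)) (at t within {0..L})"
    and dY: "\<And>t. t \<in> {0..L} \<Longrightarrow>
      (Y has_vector_derivative - \<i> * w * Y t - e t * (X t + Y t)) (at t within {0..L})"
    and e: "\<And>t. t \<in> {0..L} \<Longrightarrow> cmod (e t) \<le> D / (s + t)\<^sup>2"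
  shows wkb_growth_upper:
      "(cmod (X L))\<^sup>2 + (cmod (Y L))\<^sup>2
         \<le> ((cmod (X 0))\<^sup>2 + (cmod (Y 0))\<^sup>2) * exp (2 * L * Im w + 4 * D / s)"
    and wkb_growth_lower:
      "4 * D / s\<^sup>2 \<le> 2 * Im w \<Longrightarrow> X 0 = 0 \<Longrightarrow>
         (cmod (Y 0))\<^sup>2 * exp (2 * L * Im w - 4 * D / s) \<le> (cmod (Y L))\<^sup>2 - (cmod (X L))\<^sup>2"
proof -
  have D: "0 \<le> D"
    using e[of 0] assms(1,2) norm_ge_zero[of "e 0"]
    by (smt (verit, best) atLeastAtMost_iff divide_less_0_iff zero_less_power)
  define X' where "X' t = \<i> * w * X t + e t * (X t + Y t)" for t
  define Y' where "Y' t = - \<i> * w * Y t - e t * (X t + Y t)" for t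
  have dXX: "((\<lambda>t. (cmod (X t))\<^sup>2) has_real_derivative 2 * inner (X t) (X' t)) (at t within {0..L})"
    if "t \<in> {0..L}" for t
    using bounded_bilinear.has_vector_derivative[OF bounded_bilinear_inner dX[OF that] dX[OF that]]
    by (simp add: X'_def dot_square_norm inner_commute has_real_derivative_iff_has_vector_derivative)
  have dYY: "((\<lambda>t. (cmod (Y t))\<^sup>2) has_real_derivative 2 * inner (Y t) (Y' t)) (at t within {0..L})"
    if "t \<in> {0..L}" for t
    using bounded_bilinear.has_vector_derivative[OF bounded_bilinear_inner dY[OF that] dY[OF that]]
    by (simp add: Y'_def dot_square_norm inner_commute has_real_derivative_iff_has_vector_derivative)
  define k where "k t = D / (s + t)\<^sup>2" for t
  have kn: "0 \<le> k t" for t using D by (simp add: k_def)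
  have err: "\<bar>inner (X t) (e t * (X t + Y t))\<bar> + \<bar>inner (Y t) (e t * (X t + Y t))\<bar>
     \<le> 2 * k t * ((cmod (X t))\<^sup>2 + (cmod (Y t))\<^sup>2)" if "t \<in> {0..L}" for t
  proof -
    have "\<bar>inner (X t) (e t * (X t + Y t))\<bar> + \<bar>inner (Y t) (e t * (X t + Y t))\<bar>
      \<le> (cmod (X t) + cmod (Y t)) * cmod (e t * (X t + Y t))"
      using Cauchy_Schwarz_ineq2[of "X t" "e t * (X t + Y t)"] Cauchy_Schwarz_ineq2[of "Y t" "e t * (X t + Y t)"]
      by (simp add: algebra_simps)
    also have "\<dots> \<le> (cmod (X t) + cmod (Y t)) * (k t * (cmod (X t) + cmod (Y t)))"
      using e[OF that] kn unfolding norm_mult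
      by (intro mult_left_mono mult_mono norm_triangle_ineq) (auto simp: k_def)
    also have "\<dots> = k t * (cmod (X t) + cmod (Y t))\<^sup>2" by (simp add: power2_eq_square)
    also have "\<dots> \<le> k t * (2 * ((cmod (X t))\<^sup>2 + (cmod (Y t))\<^sup>2))"
      using kn[of t] sum_squares_bound[of "cmod (X t)" "cmod (Y t)"]
      by (intro mult_left_mono) (auto simp: power2_sum)
    finally show ?thesis by (simp add: algebra_simps)
  qed
  have iX: "inner (X t) (X' t) = - Im w * (cmod (X t))\<^sup>2 + inner (X t) (e t * (X t + Y t))" for t
    using inner_mult_self_complex[of "X t" "\<i> * w"] by (simp add: X'_def inner_add_right)
  have iY: "inner (Y t) (Y' t) = Im w * (cmod (Y t))\<^sup>2 - inner (Y t) (e t * (X t + Y t))" for t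
    using inner_mult_self_complex[of "Y t" "- \<i> * w"] by (simp add: Y'_def inner_diff_right)
  define Nn where "Nn t = (cmod (X t))\<^sup>2 + (cmod (Y t))\<^sup>2" for t
  define M where "M t = (cmod (Y t))\<^sup>2 - (cmod (X t))\<^sup>2" for t
  have NM: "M t \<le> Nn t" "0 \<le> Nn t" for t by (simp_all add: Nn_def M_def)
  have dN: "(Nn has_real_derivative 2 * inner (X t) (X' t) + 2 * inner (Y t) (Y' t)) (at t within {0..L})"
    if "t \<in> {0..L}" for t
    unfolding Nn_def by (intro DERIV_add dXX dYY that)
  have dM: "(M has_real_derivative 2 * inner (Y t) (Y' t) - 2 * inner (X t) (X' t)) (at t within {0..L})"
    if "t \<in> {0..L}" for t
    unfolding M_def by (intro DERIV_diff dXX dYY that)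
  \<comment> \<open>Integrating factors for the two differential inequalities; \<open>- 4 k\<close> is the derivative of \<open>4 D / (s + t)\<close>.\<close>
  define E where "E t = exp (- 2 * t * Im w + 4 * D / (s + t))" for t
  define E2 where "E2 t = exp (- 2 * t * Im w - 4 * D / (s + t))" for t
  have dE: "(E has_real_derivative (- 2 * Im w - 4 * k t) * E t) (at t within {0..L})"
    if "t \<in> {0..L}" for t
    unfolding E_def k_def using that assms
    by (auto intro!: derivative_eq_intros simp: field_simps power2_eq_square)
  have dE2: "(E2 has_real_derivative (- 2 * Im w + 4 * k t) * E2 t) (at t within {0..L})"
    if "t \<in> {0..L}" for t
    unfolding E2_def k_def using that assms
    by (auto intro!: derivative_eq_intros simp: field_simps power2_eq_square)
  have Epos: "0 < E t" "0 < E2 t" for t by (simp_all add: E_def E2_def)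
  have dNE: "((\<lambda>t. Nn t * E t) has_real_derivative
      (2 * inner (X t) (X' t) + 2 * inner (Y t) (Y' t)) * E t + (- 2 * Im w - 4 * k t) * E t * Nn t) (at t within {0..L})"
    if "t \<in> {0..L}" for t by (rule DERIV_mult[OF dN dE]) (use that in auto)
  have "Nn L * E L \<le> Nn 0 * E 0"
  proof (rule DERIV_nonpos_imp_decreasing_open[OF \<open>0 \<le> L\<close>, where f = "\<lambda>t. Nn t * E t"])
    fix t assume t: "0 < t" "t < L"
    then have t': "t \<in> {0..L}" by simp
    have "2 * inner (X t) (X' t) + 2 * inner (Y t) (Y' t) \<le> (2 * Im w + 4 * k t) * Nn t"
    proof -
      have "0 \<le> Im w * (cmod (X t))\<^sup>2" using \<open>0 \<le> Im w\<close> by simp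
      then show ?thesis
        using err[OF t'] by (simp add: iX iY Nn_def algebra_simps)
    qed
    then have "(2 * inner (X t) (X' t) + 2 * inner (Y t) (Y' t)) * E t \<le> (2 * Im w + 4 * k t) * Nn t * E t"
      using Epos[of t] by (intro mult_right_mono) auto
    note * = this
    show "\<exists>y. ((\<lambda>t. Nn t * E t) has_real_derivative y) (at t) \<and> y \<le> 0"
      by (rule exI, rule conjI, rule dNE[OF t', unfolded at_within_Icc_at[OF t]])
        (use * in \<open>simp add: algebra_simps\<close>)
  qed (rule DERIV_continuous_on[where f = "\<lambda>t. Nn t * E t"], rule dNE, assumption)
  then have "Nn L \<le> Nn 0 * (E 0 / E L)" using Epos[of L] by (simp add: field_simps)
  also have "E 0 / E L = exp (2 * L * Im w + 4 * D / s - 4 * D / (s + L))"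
    by (simp add: E_def flip: exp_diff)
  also have "Nn 0 * \<dots> \<le> Nn 0 * exp (2 * L * Im w + 4 * D / s)"
    using D NM assms(1,2) by (intro mult_left_mono) auto
  finally show "(cmod (X L))\<^sup>2 + (cmod (Y L))\<^sup>2
         \<le> ((cmod (X 0))\<^sup>2 + (cmod (Y 0))\<^sup>2) * exp (2 * L * Im w + 4 * D / s)"
    by (simp add: Nn_def)
  assume large: "4 * D / s\<^sup>2 \<le> 2 * Im w" and X0: "X 0 = 0"
  have kle: "4 * k t \<le> 2 * Im w" if "t \<in> {0..L}" for t
  proof -
    have "k t \<le> D / s\<^sup>2" unfolding k_def using that assms D
      by (intro divide_left_mono power_mono) auto
    then show ?thesis using large by simp
  qed
  have dMle: "2 * inner (Y t) (Y' t) - 2 * inner (X t) (X' t) \<ge> (2 * Im w - 4 * k t) * Nn t" if "t \<in> {0..L}" for t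
    using err[OF that] by (simp add: iX iY Nn_def algebra_simps)
  have M0: "0 \<le> M t" if "t \<in> {0..L}" for t
  proof -
    have "M 0 \<le> M t"
    proof (rule DERIV_nonneg_imp_increasing_open[where f = M])
      fix x assume x: "0 < x" "x < t"
      then have x': "x \<in> {0..L}" and xL: "x < L" using that by auto
      have "0 \<le> (2 * Im w - 4 * k x) * Nn x" using kle[OF x'] NM by simp
      note * = this
      show "\<exists>y. (M has_real_derivative y) (at x) \<and> 0 \<le> y"
        by (rule exI, rule conjI, rule dM[OF x', unfolded at_within_Icc_at[OF x(1) xL]])
          (use dMle[OF x'] * in linarith)
    next
      have "continuous_on {0..L} M" using dM by (rule DERIV_continuous_on)
      then show "continuous_on {0..t} M" by (rule continuous_on_subset) (use that in auto)
    qed (use that in auto)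
    moreover have "0 \<le> M 0" by (simp add: M_def X0)
    ultimately show ?thesis by linarith
  qed
  have dME: "((\<lambda>t. M t * E2 t) has_real_derivative
      (2 * inner (Y t) (Y' t) - 2 * inner (X t) (X' t)) * E2 t + (- 2 * Im w + 4 * k t) * E2 t * M t) (at t within {0..L})"
    if "t \<in> {0..L}" for t by (rule DERIV_mult[OF dM dE2]) (use that in auto)
  have "M 0 * E2 0 \<le> M L * E2 L"
  proof (rule DERIV_nonneg_imp_increasing_open[OF \<open>0 \<le> L\<close>, where f = "\<lambda>t. M t * E2 t"])
    fix t assume t: "0 < t" "t < L"
    then have t': "t \<in> {0..L}" by simp
    have "(2 * Im w - 4 * k t) * M t \<le> (2 * Im w - 4 * k t) * Nn t"
      using kle[OF t'] NM by (intro mult_left_mono) auto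
    then have "(2 * Im w - 4 * k t) * M t * E2 t \<le> (2 * inner (Y t) (Y' t) - 2 * inner (X t) (X' t)) * E2 t"
      using Epos[of t] dMle[OF t'] by (intro mult_right_mono) auto
    note * = this
    show "\<exists>y. ((\<lambda>t. M t * E2 t) has_real_derivative y) (at t) \<and> 0 \<le> y"
      by (rule exI, rule conjI, rule dME[OF t', unfolded at_within_Icc_at[OF t]])
        (use * in \<open>simp add: algebra_simps\<close>)
  qed (rule DERIV_continuous_on[where f = "\<lambda>t. M t * E2 t"], rule dME, assumption)
  then have "M 0 * (E2 0 / E2 L) \<le> M L" using Epos[of L] by (simp add: field_simps)
  also have "E2 0 / E2 L = exp (2 * L * Im w - 4 * D / s + 4 * D / (s + L))"
    by (simp add: E2_def flip: exp_diff)
  finally have *: "M 0 * exp (2 * L * Im w - 4 * D / s + 4 * D / (s + L)) \<le> M L" .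
  have "M 0 * exp (2 * L * Im w - 4 * D / s) \<le> M 0 * exp (2 * L * Im w - 4 * D / s + 4 * D / (s + L))"
    using D M0[of 0] assms(1,2) by (intro mult_left_mono) auto
  with * show "(cmod (Y 0))\<^sup>2 * exp (2 * L * Im w - 4 * D / s) \<le> (cmod (Y L))\<^sup>2 - (cmod (X L))\<^sup>2"
    by (simp add: M_def X0)
qed

text \<open>One solution of the system may decay, but two independent ones cannot decay together: the
  combination starting from \<open>X = 0\<close>, \<open>Y = 1\<close> grows, its coefficients are controlled by the determinant \<open>\<Delta>\<close>, and the
  dominance of \<open>Y\<close> over \<open>X\<close> excludes cancellation in \<open>X + Y\<close>.\<close>

lemma wkb_two_sided:
  fixes X1 Y1 X2 Y2 e :: "real \<Rightarrow> complex" and w :: complex and s L D B :: real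
  assumes "0 \<le> L" "0 < s" "0 \<le> Im w"
    and d: "\<And>t. t \<in> {0..L} \<Longrightarrow>
      (X1 has_vector_derivative \<i> * w * X1 t + e t * (X1 t + Y1 t)) (at t within {0..L})"
      "\<And>t. t \<in> {0..L} \<Longrightarrow>
      (Y1 has_vector_derivative - \<i> * w * Y1 t - e t * (X1 t + Y1 t)) (at t within {0..L})"
      "\<And>t. t \<in> {0..L} \<Longrightarrow>
      (X2 has_vector_derivative \<i> * w * X2 t + e t * (X2 t + Y2 t)) (at t within {0..L})"
      "\<And>t. t \<in> {0..L} \<Longrightarrow>
      (Y2 has_vector_derivative - \<i> * w * Y2 t - e t * (X2 t + Y2 t)) (at t within {0..L})"
    and e: "\<And>t. t \<in> {0..L} \<Longrightarrow> cmod (e t) \<le> D / (s + t)\<^sup>2"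
    and large: "4 * D / s\<^sup>2 \<le> 2 * Im w"
    and B: "(cmod (X1 0))\<^sup>2 + (cmod (Y1 0))\<^sup>2 \<le> B" "(cmod (X2 0))\<^sup>2 + (cmod (Y2 0))\<^sup>2 \<le> B"
    and det: "X1 0 * Y2 0 - X2 0 * Y1 0 = \<Delta>" "\<Delta> \<noteq> 0"
  shows "(cmod (X1 L + Y1 L))\<^sup>2 + (cmod (X2 L + Y2 L))\<^sup>2 \<le> 4 * B * exp (2 * L * Im w + 4 * D / s)"
    and "(cmod \<Delta>)\<^sup>2 / (4 * B) * exp (2 * L * Im w - 12 * D / s)
          \<le> (cmod (X1 L + Y1 L))\<^sup>2 + (cmod (X2 L + Y2 L))\<^sup>2"
proof -
  have sq: "(cmod (a + b))\<^sup>2 \<le> 2 * ((cmod a)\<^sup>2 + (cmod b)\<^sup>2)" for a b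
  proof -
    have "(cmod (a + b))\<^sup>2 \<le> (cmod a + cmod b)\<^sup>2" by (intro power_mono norm_triangle_ineq) auto
    also have "\<dots> \<le> 2 * ((cmod a)\<^sup>2 + (cmod b)\<^sup>2)"
      using sum_squares_bound[of "cmod a" "cmod b"] by (simp add: power2_sum)
    finally show ?thesis .
  qed
  have up: "(cmod (X L + Y L))\<^sup>2 \<le> 2 * (B * exp (2 * L * Im w + 4 * D / s))"
    if "(cmod (X L))\<^sup>2 + (cmod (Y L))\<^sup>2 \<le> ((cmod (X 0))\<^sup>2 + (cmod (Y 0))\<^sup>2) * exp (2 * L * Im w + 4 * D / s)"
       "(cmod (X 0))\<^sup>2 + (cmod (Y 0))\<^sup>2 \<le> B" for X Y :: "real \<Rightarrow> complex"
  proof -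
    have "((cmod (X 0))\<^sup>2 + (cmod (Y 0))\<^sup>2) * exp (2 * L * Im w + 4 * D / s) \<le> B * exp (2 * L * Im w + 4 * D / s)"
      by (rule mult_right_mono) (use that in auto)
    then show ?thesis using that(1) sq[of "X L" "Y L"] by argo
  qed
  from up[OF wkb_growth_upper[OF assms(1-3) d(1,2) e] B(1)] up[OF wkb_growth_upper[OF assms(1-3) d(3,4) e] B(2)]
  show "(cmod (X1 L + Y1 L))\<^sup>2 + (cmod (X2 L + Y2 L))\<^sup>2 \<le> 4 * B * exp (2 * L * Im w + 4 * D / s)"
    by simp
  define c1 where "c1 = - X2 0 / \<Delta>"
  define c2 where "c2 = X1 0 / \<Delta>"
  define X where "X t = c1 * X1 t + c2 * X2 t" for t
  define Y where "Y t = c1 * Y1 t + c2 * Y2 t" for t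
  have X0: "X 0 = 0" by (simp add: X_def c1_def c2_def)
  have "Y 0 = (X1 0 * Y2 0 - X2 0 * Y1 0) / \<Delta>"
    by (simp add: Y_def c1_def c2_def diff_divide_distrib)
  with det have Y0: "Y 0 = 1" by simp
  have dX: "(X has_vector_derivative \<i> * w * X t + e t * (X t + Y t)) (at t within {0..L})"
    if "t \<in> {0..L}" for t
  proof -
    have "(X has_vector_derivative c1 * (\<i> * w * X1 t + e t * (X1 t + Y1 t)) + c2 * (\<i> * w * X2 t + e t * (X2 t + Y2 t))) (at t within {0..L})"
      unfolding X_def by (intro has_vector_derivative_add has_vector_derivative_mult_right d that)
    then show ?thesis by (simp add: X_def Y_def algebra_simps)
  qed
  have dY: "(Y has_vector_derivative - \<i> * w * Y t - e t * (X t + Y t)) (at t within {0..L})"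
    if "t \<in> {0..L}" for t
  proof -
    have "(Y has_vector_derivative c1 * (- \<i> * w * Y1 t - e t * (X1 t + Y1 t)) + c2 * (- \<i> * w * Y2 t - e t * (X2 t + Y2 t))) (at t within {0..L})"
      unfolding Y_def by (intro has_vector_derivative_add has_vector_derivative_mult_right d that)
    then show ?thesis by (simp add: X_def Y_def algebra_simps)
  qed
  define N where "N = (cmod (X L))\<^sup>2 + (cmod (Y L))\<^sup>2"
  define M where "M = (cmod (Y L))\<^sup>2 - (cmod (X L))\<^sup>2"
  have N: "N \<le> exp (2 * L * Im w + 4 * D / s)"
    using wkb_growth_upper[OF assms(1-3) dX dY e] by (simp add: X0 Y0 N_def)
  have M: "exp (2 * L * Im w - 4 * D / s) \<le> M"
    using wkb_growth_lower[OF assms(1-3) dX dY e large X0] by (simp add: Y0 M_def)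
  have Mpos: "0 < M" using M exp_gt_zero order_less_le_trans by blast
  have "M = (cmod (Y L) - cmod (X L)) * (cmod (Y L) + cmod (X L))"
    by (simp add: M_def power2_eq_square algebra_simps)
  also have "\<dots> \<le> cmod (X L + Y L) * (cmod (Y L) + cmod (X L))"
    by (intro mult_right_mono) (use norm_diff_ineq[of "Y L" "X L"] in \<open>auto simp: add.commute\<close>)
  finally have "M\<^sup>2 \<le> (cmod (X L + Y L) * (cmod (Y L) + cmod (X L)))\<^sup>2"
    using Mpos by (intro power_mono) auto
  also have "\<dots> = (cmod (X L + Y L))\<^sup>2 * (cmod (Y L) + cmod (X L))\<^sup>2" by (simp add: power_mult_distrib)
  also have "\<dots> \<le> (cmod (X L + Y L))\<^sup>2 * (2 * N)"
  proof (rule mult_left_mono)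
    show "(cmod (Y L) + cmod (X L))\<^sup>2 \<le> 2 * N"
      using sum_squares_bound[of "cmod (X L)" "cmod (Y L)"] unfolding N_def power2_sum by argo
  qed simp
  also have "\<dots> \<le> (cmod (X L + Y L))\<^sup>2 * (2 * exp (2 * L * Im w + 4 * D / s))"
    by (intro mult_left_mono) (use N in auto)
  finally have "(exp (2 * L * Im w - 4 * D / s))\<^sup>2 \<le> (cmod (X L + Y L))\<^sup>2 * (2 * exp (2 * L * Im w + 4 * D / s))"
    using M by (smt (verit) exp_ge_zero power_mono)
  moreover have "(exp (2 * L * Im w - 4 * D / s))\<^sup>2 = exp (2 * L * Im w - 12 * D / s) * exp (2 * L * Im w + 4 * D / s)"
    by (simp add: power2_eq_square flip: exp_add)
  ultimately have "exp (2 * L * Im w - 12 * D / s) * exp (2 * L * Im w + 4 * D / s)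
      \<le> 2 * (cmod (X L + Y L))\<^sup>2 * exp (2 * L * Im w + 4 * D / s)"
    by (simp only: mult_ac)
  then have low: "exp (2 * L * Im w - 12 * D / s) \<le> 2 * (cmod (X L + Y L))\<^sup>2"
    by (rule mult_right_le_imp_le) simp
  have Bpos: "0 < B"
  proof (rule ccontr)
    assume "\<not> 0 < B"
    then have "(cmod (X1 0))\<^sup>2 + (cmod (Y1 0))\<^sup>2 \<le> 0" using B by linarith
    then have "X1 0 = 0" "Y1 0 = 0" by (auto simp: sum_power2_le_zero_iff)
    with det show False by simp
  qed
  have le_B: "(cmod (X1 0))\<^sup>2 \<le> B" "(cmod (X2 0))\<^sup>2 \<le> B"
    using B zero_le_power2[of "cmod (Y1 0)"] zero_le_power2[of "cmod (Y2 0)"] by linarith+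
  have c1: "(cmod c1)\<^sup>2 \<le> B / (cmod \<Delta>)\<^sup>2"
    unfolding c1_def norm_divide power_divide norm_minus_cancel
    by (rule divide_right_mono) (use le_B in auto)
  have c2: "(cmod c2)\<^sup>2 \<le> B / (cmod \<Delta>)\<^sup>2"
    unfolding c2_def norm_divide power_divide norm_minus_cancel
    by (rule divide_right_mono) (use le_B in auto)
  have "(cmod (X L + Y L))\<^sup>2 \<le> (cmod (c1 * (X1 L + Y1 L) + c2 * (X2 L + Y2 L)))\<^sup>2"
    by (simp add: X_def Y_def algebra_simps)
  also have "\<dots> \<le> 2 * ((cmod c1)\<^sup>2 * (cmod (X1 L + Y1 L))\<^sup>2 + (cmod c2)\<^sup>2 * (cmod (X2 L + Y2 L))\<^sup>2)"
    using sq[of "c1 * (X1 L + Y1 L)" "c2 * (X2 L + Y2 L)"] by (simp add: norm_mult power_mult_distrib)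
  also have "\<dots> \<le> 2 * (B / (cmod \<Delta>)\<^sup>2 * (cmod (X1 L + Y1 L))\<^sup>2 + B / (cmod \<Delta>)\<^sup>2 * (cmod (X2 L + Y2 L))\<^sup>2)"
    by (intro mult_left_mono add_mono mult_right_mono c1 c2) auto
  also have "\<dots> = 2 * B / (cmod \<Delta>)\<^sup>2 * ((cmod (X1 L + Y1 L))\<^sup>2 + (cmod (X2 L + Y2 L))\<^sup>2)"
    by (simp add: algebra_simps)
  finally have "exp (2 * L * Im w - 12 * D / s) \<le> 4 * B / (cmod \<Delta>)\<^sup>2 * ((cmod (X1 L + Y1 L))\<^sup>2 + (cmod (X2 L + Y2 L))\<^sup>2)"
    using low by simp
  then show "(cmod \<Delta>)\<^sup>2 / (4 * B) * exp (2 * L * Im w - 12 * D / s)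
          \<le> (cmod (X1 L + Y1 L))\<^sup>2 + (cmod (X2 L + Y2 L))\<^sup>2"
    using Bpos det by (simp add: field_simps)
qed

section \<open>The equation \<open>v'' + (1 + \<epsilon>) v = 0\<close> near a critical direction\<close>

text \<open>A translated cone with edges in the directions \<open>- 1 + 3 \<i>\<close> and \<open>4 - \<i>\<close>. It contains the far part of
  the first quadrant with some room on both sides, which absorbs the difference between a coordinate and its
  approximation. Every point of it is reached inside the cone from a real point to the right of \<open>S\<close>, along a segment of direction
  \<open>- 1 + 3 \<i>\<close> or \<open>- \<i>\<close>; its point at parameter \<open>t\<close> has modulus at least \<open>(s + t) / 2\<close>, where \<open>s\<close> is the starting point.\<close>

definition stokes_cone :: "real \<Rightarrow> complex set" where
  "stokes_cone S = {\<zeta>. 3 * S \<le> 3 * Re \<zeta> + Im \<zeta> \<and> 0 \<le> Re \<zeta> + 4 * Im \<zeta>}"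

text \<open>Along a line of direction \<open>w\<close>, the functions \<open>v - \<i> v'\<close> and \<open>v + \<i> v'\<close> satisfy the system of
  \<open>wkb_growth\<close>. On the positive real axis \<open>Im w = 0\<close>, so they stay bounded and their determinant is constant;
  leaving the axis along a line with \<open>Im w \<noteq> 0\<close> produces the exponential factor.\<close>

lemma wkb_cone:
  fixes v1 v2 V1 V2 \<epsilon> :: "complex \<Rightarrow> complex"
  assumes S: "0 < S" "16 * D \<le> S\<^sup>2"
    and d: "\<And>\<zeta>. \<zeta> \<in> stokes_cone S \<Longrightarrow> (v1 has_field_derivative V1 \<zeta>) (at \<zeta>)"
      "\<And>\<zeta>. \<zeta> \<in> stokes_cone S \<Longrightarrow> (V1 has_field_derivative - (1 + \<epsilon> \<zeta>) * v1 \<zeta>) (at \<zeta>)"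
      "\<And>\<zeta>. \<zeta> \<in> stokes_cone S \<Longrightarrow> (v2 has_field_derivative V2 \<zeta>) (at \<zeta>)"
      "\<And>\<zeta>. \<zeta> \<in> stokes_cone S \<Longrightarrow> (V2 has_field_derivative - (1 + \<epsilon> \<zeta>) * v2 \<zeta>) (at \<zeta>)"
    and \<epsilon>: "\<And>\<zeta>. \<zeta> \<in> stokes_cone S \<Longrightarrow> cmod (\<epsilon> \<zeta>) \<le> D / (cmod \<zeta>)\<^sup>2"
    and wr: "\<And>\<zeta>. \<zeta> \<in> stokes_cone S \<Longrightarrow> v1 \<zeta> * V2 \<zeta> - v2 \<zeta> * V1 \<zeta> = c" "c \<noteq> 0"
  shows "\<exists>A B. 0 < A \<and> 0 < B \<and> (\<forall>\<zeta> \<in> stokes_cone S.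
    A * exp (2 * \<bar>Im \<zeta>\<bar>) \<le> (cmod (v1 \<zeta>))\<^sup>2 + (cmod (v2 \<zeta>))\<^sup>2 \<and>
    (cmod (v1 \<zeta>))\<^sup>2 + (cmod (v2 \<zeta>))\<^sup>2 \<le> B * exp (2 * \<bar>Im \<zeta>\<bar>))"
proof -
  have D: "0 \<le> D"
  proof -
    have "cmod (\<epsilon> (of_real S)) \<le> D / S\<^sup>2"
      using \<epsilon>[of "of_real S"] S(1) by (simp add: stokes_cone_def)
    then have "0 \<le> D / S\<^sup>2" using norm_ge_zero order.trans by blast
    then show ?thesis using S(1) by (simp add: zero_le_divide_iff)
  qed
  have conv: "convex (stokes_cone S)"
  proof -
    have "stokes_cone S = {\<zeta>. 3 * S \<le> inner (Complex 3 1) \<zeta>} \<inter> {\<zeta>. 0 \<le> inner (Complex 1 4) \<zeta>}"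
      by (auto simp: stokes_cone_def inner_complex_def)
    then show ?thesis by (auto intro!: convex_Int convex_halfspace_ge)
  qed
  define X where "X v V \<zeta> = v \<zeta> - \<i> * V \<zeta>" for v V :: "complex \<Rightarrow> complex" and \<zeta>
  define Y where "Y v V \<zeta> = v \<zeta> + \<i> * V \<zeta>" for v V :: "complex \<Rightarrow> complex" and \<zeta>
  have XY: "X v V \<zeta> + Y v V \<zeta> = 2 * v \<zeta>" for v V \<zeta> by (simp add: X_def Y_def)
  have dX: "((\<lambda>t. X v V (of_real s + of_real t * w)) has_vector_derivative
       \<i> * w * X v V (of_real s + of_real t * w) + (\<i> * w * \<epsilon> (of_real s + of_real t * w) / 2) *
         (X v V (of_real s + of_real t * w) + Y v V (of_real s + of_real t * w))) (at t within T)"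
    and dY: "((\<lambda>t. Y v V (of_real s + of_real t * w)) has_vector_derivative
       - \<i> * w * Y v V (of_real s + of_real t * w) - (\<i> * w * \<epsilon> (of_real s + of_real t * w) / 2) *
         (X v V (of_real s + of_real t * w) + Y v V (of_real s + of_real t * w))) (at t within T)"
    if v': "\<And>\<zeta>. \<zeta> \<in> stokes_cone S \<Longrightarrow> (v has_field_derivative V \<zeta>) (at \<zeta>)"
      and V': "\<And>\<zeta>. \<zeta> \<in> stokes_cone S \<Longrightarrow> (V has_field_derivative - (1 + \<epsilon> \<zeta>) * v \<zeta>) (at \<zeta>)"
      and z: "of_real s + of_real t * w \<in> stokes_cone S"
    for v V s t w T
  proof -
    let ?z = "of_real s + of_real t * w"
    note v = v'[OF z] and V = V'[OF z]
    have l: "((\<lambda>t. of_real s + of_real t * w) has_vector_derivative w) (at t within T)"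
      by (auto intro!: derivative_eq_intros simp: has_vector_derivative_def scaleR_conv_of_real)
    have "(X v V has_field_derivative V ?z - \<i> * (- (1 + \<epsilon> ?z) * v ?z)) (at ?z)"
      unfolding X_def by (intro DERIV_diff DERIV_add DERIV_cmult v V)
    from field_vector_diff_chain_within[OF l has_field_derivative_at_within[OF this]]
    have "((X v V \<circ> (\<lambda>t. of_real s + of_real t * w)) has_vector_derivative w * (V ?z - \<i> * (- (1 + \<epsilon> ?z) * v ?z))) (at t within T)" .
    moreover have "w * (V ?z - \<i> * (- (1 + \<epsilon> ?z) * v ?z)) =
        \<i> * w * X v V ?z + (\<i> * w * \<epsilon> ?z / 2) * (X v V ?z + Y v V ?z)"
      by (simp add: XY) (simp add: X_def algebra_simps)
    ultimately show "((\<lambda>t. X v V (of_real s + of_real t * w)) has_vector_derivative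
       \<i> * w * X v V ?z + (\<i> * w * \<epsilon> ?z / 2) * (X v V ?z + Y v V ?z)) (at t within T)" by (simp add: o_def)
    have "(Y v V has_field_derivative V ?z + \<i> * (- (1 + \<epsilon> ?z) * v ?z)) (at ?z)"
      unfolding Y_def by (intro DERIV_diff DERIV_add DERIV_cmult v V)
    from field_vector_diff_chain_within[OF l has_field_derivative_at_within[OF this]]
    have "((Y v V \<circ> (\<lambda>t. of_real s + of_real t * w)) has_vector_derivative w * (V ?z + \<i> * (- (1 + \<epsilon> ?z) * v ?z))) (at t within T)" .
    moreover have "w * (V ?z + \<i> * (- (1 + \<epsilon> ?z) * v ?z)) =
        - \<i> * w * Y v V ?z - (\<i> * w * \<epsilon> ?z / 2) * (X v V ?z + Y v V ?z)"
      by (simp add: XY) (simp add: Y_def algebra_simps)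
    ultimately show "((\<lambda>t. Y v V (of_real s + of_real t * w)) has_vector_derivative
       - \<i> * w * Y v V ?z - (\<i> * w * \<epsilon> ?z / 2) * (X v V ?z + Y v V ?z)) (at t within T)" by (simp add: o_def)
  qed
  \<comment> \<open>On all paths used, \<open>\<bar>w\<bar> \<le> 4\<close> and the modulus is at least \<open>(s + t) / 2\<close>; this gives the factor 8.\<close>
  have ebound: "cmod (\<i> * w * \<epsilon> (of_real s + of_real t * w) / 2) \<le> 8 * D / (s + t)\<^sup>2"
    if "of_real s + of_real t * w \<in> stokes_cone S" "cmod w \<le> 4" "0 < s" "0 \<le> t"
      "(s + t)\<^sup>2 / 4 \<le> (cmod (of_real s + of_real t * w))\<^sup>2" for s t w
  proof -
    have "cmod (\<epsilon> (of_real s + of_real t * w)) \<le> D / (cmod (of_real s + of_real t * w))\<^sup>2" using that(1) by (rule \<epsilon>)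
    also have "\<dots> \<le> D / ((s + t)\<^sup>2 / 4)"
    proof (rule divide_left_mono)
      have "0 < (s + t)\<^sup>2 / 4" using that(3,4) by (simp add: add_pos_nonneg)
      then show "0 < (cmod (of_real s + of_real t * w))\<^sup>2 * ((s + t)\<^sup>2 / 4)"
        using that(5) by (intro mult_pos_pos order_less_le_trans[OF _ that(5)]) auto
    qed (use that D in auto)
    finally have "cmod w * cmod (\<epsilon> (of_real s + of_real t * w)) \<le> 4 * (D / ((s + t)\<^sup>2 / 4))"
      using that(2) by (intro mult_mono) auto
    then show ?thesis by (simp add: norm_mult norm_divide)
  qed
  have real_in: "of_real s \<in> stokes_cone S" if "S \<le> s" for s
    using that S by (simp add: stokes_cone_def)
  \<comment> \<open>On the real axis the phase is real, so all solutions stay bounded.\<close>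
  have bdd: "(cmod (X v V (of_real s)))\<^sup>2 + (cmod (Y v V (of_real s)))\<^sup>2 \<le>
     ((cmod (X v V (of_real S)))\<^sup>2 + (cmod (Y v V (of_real S)))\<^sup>2) * exp (32 * D / S)"
    if "S \<le> s"
      and v: "\<And>\<zeta>. \<zeta> \<in> stokes_cone S \<Longrightarrow> (v has_field_derivative V \<zeta>) (at \<zeta>)"
      and V: "\<And>\<zeta>. \<zeta> \<in> stokes_cone S \<Longrightarrow> (V has_field_derivative - (1 + \<epsilon> \<zeta>) * v \<zeta>) (at \<zeta>)" for s v V
  proof -
    have i: "of_real S + of_real t * 1 \<in> stokes_cone S" if "t \<in> {0..s - S}" for t
      using real_in[of "S + t"] that by simp
    have "(cmod (X v V (of_real S + of_real (s - S) * 1)))\<^sup>2 + (cmod (Y v V (of_real S + of_real (s - S) * 1)))\<^sup>2 \<le>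
     ((cmod (X v V (of_real S + of_real 0 * 1)))\<^sup>2 + (cmod (Y v V (of_real S + of_real 0 * 1)))\<^sup>2) * exp (2 * (s - S) * Im 1 + 4 * (8 * D) / S)"
    proof (rule wkb_growth_upper)
      fix t assume t: "t \<in> {0..s - S}"
      show "cmod (\<i> * 1 * \<epsilon> (of_real S + of_real t * 1) / 2) \<le> 8 * D / (S + t)\<^sup>2"
        by (rule ebound[OF i[OF t]]) (use t S in \<open>auto simp flip: of_real_add simp: power2_eq_square\<close>)
    next
      fix t assume "t \<in> {0..s - S}"
      note vV = v V i[OF this]
      show "((\<lambda>a. X v V (of_real S + of_real a * 1)) has_vector_derivative
         \<i> * 1 * X v V (of_real S + of_real t * 1) + \<i> * 1 * \<epsilon> (of_real S + of_real t * 1) / 2 *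
         (X v V (of_real S + of_real t * 1) + Y v V (of_real S + of_real t * 1))) (at t within {0..s - S})"
        by (rule dX[OF vV])
      show "((\<lambda>a. Y v V (of_real S + of_real a * 1)) has_vector_derivative
         - \<i> * 1 * Y v V (of_real S + of_real t * 1) - \<i> * 1 * \<epsilon> (of_real S + of_real t * 1) / 2 *
         (X v V (of_real S + of_real t * 1) + Y v V (of_real S + of_real t * 1))) (at t within {0..s - S})"
        by (rule dY[OF vV])
    qed (use S that(1) in auto)
    then show ?thesis by simp
  qed
  define N where "N v V = ((cmod (X v V (of_real S)))\<^sup>2 + (cmod (Y v V (of_real S)))\<^sup>2) * exp (32 * D / S)" for v V
  define B where "B = 1 + N v1 V1 + N v2 V2"
  have Nn: "0 \<le> N v V" for v V by (simp add: N_def)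
  have B: "0 < B" "N v1 V1 \<le> B" "N v2 V2 \<le> B" using Nn[of v1 V1] Nn[of v2 V2] by (auto simp: B_def)
  have B1: "(cmod (X v1 V1 (of_real s)))\<^sup>2 + (cmod (Y v1 V1 (of_real s)))\<^sup>2 \<le> B" if "S \<le> s" for s
    using bdd[OF that d(1,2)] B by (simp add: N_def)
  have B2: "(cmod (X v2 V2 (of_real s)))\<^sup>2 + (cmod (Y v2 V2 (of_real s)))\<^sup>2 \<le> B" if "S \<le> s" for s
    using bdd[OF that d(3,4)] B by (simp add: N_def)
  have det: "X v1 V1 \<zeta> * Y v2 V2 \<zeta> - X v2 V2 \<zeta> * Y v1 V1 \<zeta> = 2 * \<i> * c" if "\<zeta> \<in> stokes_cone S" for \<zeta>
    unfolding wr(1)[OF that, symmetric] by (simp add: X_def Y_def algebra_simps)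
  define A where "A = (cmod (2 * \<i> * c))\<^sup>2 / (4 * B) * exp (- 96 * D / S)"
  have A: "0 < A" using B wr(2) by (simp add: A_def)
  have mono1: "exp (x + 4 * (8 * D) / s) \<le> exp x * exp (32 * D / S)" if "S \<le> s" for s x
  proof -
    have "32 * D / s \<le> 32 * D / S" using D S that by (intro divide_left_mono) auto
    then show ?thesis by (simp flip: exp_add)
  qed
  have mono2: "exp (- 96 * D / S) * exp x \<le> exp (x - 12 * (8 * D) / s)" if "S \<le> s" for s x
  proof -
    have "96 * D / s \<le> 96 * D / S" using D S that by (intro divide_left_mono) auto
    then show ?thesis by (simp flip: exp_add)
  qed
  have large: "4 * (8 * D) / s\<^sup>2 \<le> 2 * y" if "S \<le> s" "1 \<le> y" for s y
  proof -
    have "S\<^sup>2 \<le> s\<^sup>2" using that S by (intro power_mono) auto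
    then have "16 * D \<le> s\<^sup>2" using S by linarith
    then have "32 * D / s\<^sup>2 \<le> 2" using S that by (simp add: field_simps)
    then show ?thesis using that by simp
  qed
  have "A * exp (2 * \<bar>Im \<zeta>\<bar>) \<le> 4 * ((cmod (v1 \<zeta>))\<^sup>2 + (cmod (v2 \<zeta>))\<^sup>2) \<and>
    4 * ((cmod (v1 \<zeta>))\<^sup>2 + (cmod (v2 \<zeta>))\<^sup>2) \<le> 4 * B * exp (32 * D / S) * exp (2 * \<bar>Im \<zeta>\<bar>)"
    if \<zeta>: "\<zeta> \<in> stokes_cone S" for \<zeta>
  proof (cases "0 \<le> Im \<zeta>")
    case True
    \<comment> \<open>Reach \<open>\<zeta>\<close> from the real axis along a line that leans to the left.\<close>
    define w where "w = Complex (- 1) 3"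
    define s where "s = Re \<zeta> + Im \<zeta> / 3"
    define L where "L = Im \<zeta> / 3"
    have s: "S \<le> s" using \<zeta> by (simp add: s_def stokes_cone_def)
    have L: "0 \<le> L" using True by (simp add: L_def)
    have z: "\<zeta> = of_real s + of_real L * w" by (simp add: complex_eq_iff s_def L_def w_def)
    have i: "of_real s + of_real t * w \<in> stokes_cone S" if "t \<in> {0..L}" for t
      using that s S by (auto simp: stokes_cone_def w_def)
    have "cmod w \<le> 4" by (simp add: w_def cmod_def real_le_lsqrt)
    have q: "(s + t)\<^sup>2 / 4 \<le> (cmod (of_real s + of_real t * w))\<^sup>2" for t
    proof -
      have "(cmod (of_real s + of_real t * w))\<^sup>2 = (s - t)\<^sup>2 + (3 * t)\<^sup>2"
        unfolding cmod_power2 by (simp add: w_def)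
      also have "\<dots> - (s + t)\<^sup>2 / 4 = 3 / 4 * (s - 5 / 3 * t)\<^sup>2 + 23 / 3 * t\<^sup>2"
        by (simp add: power2_eq_square field_simps)
      finally show ?thesis using zero_le_power2[of "s - 5/3 * t"] zero_le_power2[of t] by linarith
    qed
    have Im: "2 * L * Im w = 2 * \<bar>Im \<zeta>\<bar>" using True by (simp add: L_def w_def)
    have e: "cmod (\<i> * w * \<epsilon> (of_real s + of_real t * w) / 2) \<le> 8 * D / (s + t)\<^sup>2" if "t \<in> {0..L}" for t
      by (rule ebound[OF i[OF that]]) (use that q s S \<open>cmod w \<le> 4\<close> in auto)
    have g: "0 < s" "0 \<le> Im w" "4 * (8 * D) / s\<^sup>2 \<le> 2 * Im w"
      using s S large[OF s, of "Im w"] by (auto simp: w_def)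
    note W = wkb_two_sided[where ?X1.0 = "\<lambda>t. X v1 V1 (of_real s + of_real t * w)" and ?Y1.0 = "\<lambda>t. Y v1 V1 (of_real s + of_real t * w)"
        and ?X2.0 = "\<lambda>t. X v2 V2 (of_real s + of_real t * w)" and ?Y2.0 = "\<lambda>t. Y v2 V2 (of_real s + of_real t * w)"
        and e = "\<lambda>t. \<i> * w * \<epsilon> (of_real s + of_real t * w) / 2" and w = w and s = s and L = L and D = "8 * D"
        and B = B and \<Delta> = "2 * \<i> * c"]
    note ds = dX[OF d(1,2)] dX[OF d(3,4)] dY[OF d(1,2)] dY[OF d(3,4)]
    have a: "(cmod (X v1 V1 (of_real s + of_real 0 * w)))\<^sup>2 + (cmod (Y v1 V1 (of_real s + of_real 0 * w)))\<^sup>2 \<le> B"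
      "(cmod (X v2 V2 (of_real s + of_real 0 * w)))\<^sup>2 + (cmod (Y v2 V2 (of_real s + of_real 0 * w)))\<^sup>2 \<le> B"
      using B1[OF s] B2[OF s] by auto
    have dd: "X v1 V1 (of_real s + of_real 0 * w) * Y v2 V2 (of_real s + of_real 0 * w)
       - X v2 V2 (of_real s + of_real 0 * w) * Y v1 V1 (of_real s + of_real 0 * w) = 2 * \<i> * c" "2 * \<i> * c \<noteq> 0"
      using det[OF real_in[OF s]] wr(2) by auto
    have W1: "(cmod (X v1 V1 (of_real s + of_real L * w) + Y v1 V1 (of_real s + of_real L * w)))\<^sup>2 + (cmod (X v2 V2 (of_real s + of_real L * w) + Y v2 V2 (of_real s + of_real L * w)))\<^sup>2 \<le> 4 * B * exp (2 * L * Im w + 4 * (8 * D) / s)"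
      by (rule W(1)) (rule L g a dd | erule e | (rule ds; (assumption | erule i)))+
    have W2: "(cmod (2 * \<i> * c))\<^sup>2 / (4 * B) * exp (2 * L * Im w - 12 * (8 * D) / s) \<le> (cmod (X v1 V1 (of_real s + of_real L * w) + Y v1 V1 (of_real s + of_real L * w)))\<^sup>2 + (cmod (X v2 V2 (of_real s + of_real L * w) + Y v2 V2 (of_real s + of_real L * w)))\<^sup>2"
      by (rule W(2)) (rule L g a dd | erule e | (rule ds; (assumption | erule i)))+
    have "4 * ((cmod (v1 \<zeta>))\<^sup>2 + (cmod (v2 \<zeta>))\<^sup>2) \<le> 4 * B * exp (2 * \<bar>Im \<zeta>\<bar> + 4 * (8 * D) / s)"
      using W1 unfolding z[symmetric] XY Im by (simp add: norm_mult power_mult_distrib)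
    also have "\<dots> \<le> 4 * B * (exp (2 * \<bar>Im \<zeta>\<bar>) * exp (32 * D / S))"
      using B by (intro mult_left_mono mono1 s) auto
    finally have up: "4 * ((cmod (v1 \<zeta>))\<^sup>2 + (cmod (v2 \<zeta>))\<^sup>2) \<le> 4 * B * exp (32 * D / S) * exp (2 * \<bar>Im \<zeta>\<bar>)"
      by (simp add: mult_ac)
    have "A * exp (2 * \<bar>Im \<zeta>\<bar>) = (cmod (2 * \<i> * c))\<^sup>2 / (4 * B) * (exp (- 96 * D / S) * exp (2 * \<bar>Im \<zeta>\<bar>))"
      by (simp add: A_def)
    also have "\<dots> \<le> (cmod (2 * \<i> * c))\<^sup>2 / (4 * B) * exp (2 * \<bar>Im \<zeta>\<bar> - 12 * (8 * D) / s)"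
      using B by (intro mult_left_mono mono2 s) auto
    also have "\<dots> \<le> 4 * ((cmod (v1 \<zeta>))\<^sup>2 + (cmod (v2 \<zeta>))\<^sup>2)"
      using W2 unfolding z[symmetric] XY Im by (simp add: norm_mult power_mult_distrib)
    finally show ?thesis using up by simp
  next
    case False
    \<comment> \<open>Below the axis the roles of the two exponentials are exchanged.\<close>
    define w where "w = - \<i>"
    define s where "s = Re \<zeta>"
    define L where "L = - Im \<zeta>"
    have s: "S \<le> s" using \<zeta> False by (simp add: s_def stokes_cone_def)
    have L: "0 \<le> L" using False by (simp add: L_def)
    have z: "\<zeta> = of_real s + of_real L * w" by (simp add: complex_eq_iff s_def L_def w_def)
    have i: "of_real s + of_real t * w \<in> stokes_cone S" if t: "t \<in> {0..L}" for t
      using t \<zeta> s S by (auto simp: stokes_cone_def w_def L_def s_def)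
    have q: "(s + t)\<^sup>2 / 4 \<le> (cmod (of_real s + of_real t * w))\<^sup>2" for t
    proof -
      have "(cmod (of_real s + of_real t * w))\<^sup>2 = s\<^sup>2 + t\<^sup>2"
        unfolding cmod_power2 by (simp add: w_def)
      moreover have s2: "(s + t)\<^sup>2 \<le> 2 * (s\<^sup>2 + t\<^sup>2)"
        using sum_squares_bound[of s t] by (simp add: power2_sum)
      moreover have "a / 4 \<le> b" if "a \<le> 2 * b" "0 \<le> b" for a b :: real
        using that by simp
      ultimately show ?thesis by (metis sum_power2_ge_zero)
    qed
    have Im: "2 * L * Im (- w) = 2 * \<bar>Im \<zeta>\<bar>" using False by (simp add: L_def w_def)
    have e: "cmod (- (\<i> * w * \<epsilon> (of_real s + of_real t * w) / 2)) \<le> 8 * D / (s + t)\<^sup>2" if "t \<in> {0..L}" for t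
      unfolding norm_minus_cancel by (rule ebound[OF i[OF that]]) (use that q s S in \<open>auto simp: w_def\<close>)
    have g: "0 < s" "0 \<le> Im (- w)" "4 * (8 * D) / s\<^sup>2 \<le> 2 * Im (- w)"
      using s S large[OF s, of "Im (- w)"] by (auto simp: w_def)
    have dX': "((\<lambda>t. X v V (of_real s + of_real t * w)) has_vector_derivative
       - \<i> * (- w) * X v V (of_real s + of_real t * w) - (- (\<i> * w * \<epsilon> (of_real s + of_real t * w) / 2)) *
         (Y v V (of_real s + of_real t * w) + X v V (of_real s + of_real t * w))) (at t within T)"
    and dY': "((\<lambda>t. Y v V (of_real s + of_real t * w)) has_vector_derivative
       \<i> * (- w) * Y v V (of_real s + of_real t * w) + (- (\<i> * w * \<epsilon> (of_real s + of_real t * w) / 2)) *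
         (Y v V (of_real s + of_real t * w) + X v V (of_real s + of_real t * w))) (at t within T)"
      if v: "\<And>\<zeta>. \<zeta> \<in> stokes_cone S \<Longrightarrow> (v has_field_derivative V \<zeta>) (at \<zeta>)"
        and V: "\<And>\<zeta>. \<zeta> \<in> stokes_cone S \<Longrightarrow> (V has_field_derivative - (1 + \<epsilon> \<zeta>) * v \<zeta>) (at \<zeta>)"
        and z: "of_real s + of_real t * w \<in> stokes_cone S"
      for v V t T
      using dX[OF v V z] dY[OF v V z] by (simp_all add: add.commute)
    note W = wkb_two_sided[where ?X1.0 = "\<lambda>t. Y v1 V1 (of_real s + of_real t * w)" and ?Y1.0 = "\<lambda>t. X v1 V1 (of_real s + of_real t * w)"
        and ?X2.0 = "\<lambda>t. Y v2 V2 (of_real s + of_real t * w)" and ?Y2.0 = "\<lambda>t. X v2 V2 (of_real s + of_real t * w)"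
        and e = "\<lambda>t. - (\<i> * w * \<epsilon> (of_real s + of_real t * w) / 2)" and w = "- w" and s = s and L = L and D = "8 * D"
        and B = B and \<Delta> = "- (2 * \<i> * c)"]
    note ds = dX'[OF d(1,2)] dX'[OF d(3,4)] dY'[OF d(1,2)] dY'[OF d(3,4)]
    have a: "(cmod (Y v1 V1 (of_real s + of_real 0 * w)))\<^sup>2 + (cmod (X v1 V1 (of_real s + of_real 0 * w)))\<^sup>2 \<le> B"
      "(cmod (Y v2 V2 (of_real s + of_real 0 * w)))\<^sup>2 + (cmod (X v2 V2 (of_real s + of_real 0 * w)))\<^sup>2 \<le> B"
      using B1[OF s] B2[OF s] by (auto simp: add.commute)
    have dd: "Y v1 V1 (of_real s + of_real 0 * w) * X v2 V2 (of_real s + of_real 0 * w)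
       - Y v2 V2 (of_real s + of_real 0 * w) * X v1 V1 (of_real s + of_real 0 * w) = - (2 * \<i> * c)" "- (2 * \<i> * c) \<noteq> 0"
      using det[OF real_in[OF s]] wr(2) by (auto simp: algebra_simps)
    have YX: "Y v V \<zeta> + X v V \<zeta> = 2 * v \<zeta>" for v V by (simp add: X_def Y_def)
    have W1: "(cmod (Y v1 V1 (of_real s + of_real L * w) + X v1 V1 (of_real s + of_real L * w)))\<^sup>2 + (cmod (Y v2 V2 (of_real s + of_real L * w) + X v2 V2 (of_real s + of_real L * w)))\<^sup>2 \<le> 4 * B * exp (2 * L * Im (- w) + 4 * (8 * D) / s)"
      by (rule W(1)) (rule L g a dd | erule e | (rule ds; (assumption | erule i)))+
    have W2: "(cmod (- (2 * \<i> * c)))\<^sup>2 / (4 * B) * exp (2 * L * Im (- w) - 12 * (8 * D) / s) \<le> (cmod (Y v1 V1 (of_real s + of_real L * w) + X v1 V1 (of_real s + of_real L * w)))\<^sup>2 + (cmod (Y v2 V2 (of_real s + of_real L * w) + X v2 V2 (of_real s + of_real L * w)))\<^sup>2"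
      by (rule W(2)) (rule L g a dd | erule e | (rule ds; (assumption | erule i)))+
    have "4 * ((cmod (v1 \<zeta>))\<^sup>2 + (cmod (v2 \<zeta>))\<^sup>2) \<le> 4 * B * exp (2 * \<bar>Im \<zeta>\<bar> + 4 * (8 * D) / s)"
      using W1 unfolding z[symmetric] YX Im by (simp add: norm_mult power_mult_distrib)
    also have "\<dots> \<le> 4 * B * (exp (2 * \<bar>Im \<zeta>\<bar>) * exp (32 * D / S))"
      using B by (intro mult_left_mono mono1 s) auto
    finally have up: "4 * ((cmod (v1 \<zeta>))\<^sup>2 + (cmod (v2 \<zeta>))\<^sup>2) \<le> 4 * B * exp (32 * D / S) * exp (2 * \<bar>Im \<zeta>\<bar>)"
      by (simp add: mult_ac)
    have "A * exp (2 * \<bar>Im \<zeta>\<bar>) = (cmod (- (2 * \<i> * c)))\<^sup>2 / (4 * B) * (exp (- 96 * D / S) * exp (2 * \<bar>Im \<zeta>\<bar>))"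
      by (simp add: A_def)
    also have "\<dots> \<le> (cmod (- (2 * \<i> * c)))\<^sup>2 / (4 * B) * exp (2 * \<bar>Im \<zeta>\<bar> - 12 * (8 * D) / s)"
      using B by (intro mult_left_mono mono2 s) auto
    also have "\<dots> \<le> 4 * ((cmod (v1 \<zeta>))\<^sup>2 + (cmod (v2 \<zeta>))\<^sup>2)"
      using W2 unfolding z[symmetric] YX Im by (simp add: norm_mult power_mult_distrib)
    finally show ?thesis using up by simp
  qed
  note bounds = this
  show ?thesis
  proof (rule exI[of _ "A / 4"], rule exI[of _ "B * exp (32 * D / S)"], intro conjI ballI)
    fix \<zeta> assume "\<zeta> \<in> stokes_cone S"
    from bounds[OF this] show "A / 4 * exp (2 * \<bar>Im \<zeta>\<bar>) \<le> (cmod (v1 \<zeta>))\<^sup>2 + (cmod (v2 \<zeta>))\<^sup>2"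
      and "(cmod (v1 \<zeta>))\<^sup>2 + (cmod (v2 \<zeta>))\<^sup>2 \<le> B * exp (32 * D / S) * exp (2 * \<bar>Im \<zeta>\<bar>)"
      by auto
  qed (use A B in auto)
qed

section \<open>The Liouville-Green transformation\<close>

text \<open>A half plane whose inner normal is the bisector of the first quadrant. It contains the far part of the closed first quadrant
  well inside, is convex (so primitives, square roots and logarithms exist on it), and avoids the branch cut of the logarithm
  for \<open>S \<ge> 0\<close>.\<close>

definition tilted_half_plane :: "real \<Rightarrow> complex set" where
  "tilted_half_plane S = {\<xi>. S < Re \<xi> + Im \<xi>}"

lemma convex_tilted_half_plane: "convex (tilted_half_plane S)"
  and open_tilted_half_plane: "open (tilted_half_plane S)"
proof -
  have "tilted_half_plane S = {\<xi>. inner (Complex 1 1) \<xi> > S}"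
    by (auto simp: tilted_half_plane_def inner_complex_def)
  then show "convex (tilted_half_plane S)" "open (tilted_half_plane S)"
    by (auto simp: convex_halfspace_gt open_halfspace_gt)
qed

lemma tilted_half_plane_mono: "S \<le> S' \<Longrightarrow> tilted_half_plane S' \<subseteq> tilted_half_plane S"
  by (auto simp: tilted_half_plane_def)

text \<open>A primitive \<open>\<zeta>\<close> of \<open>b\<close> differs from the identity by a map with Lipschitz constant
  \<open>sup \<bar>b - 1\<bar>\<close>. Hence it is injective, and \<open>\<zeta> \<xi> - \<xi>\<close> is \<open>o(\<bar>\<xi>\<bar>)\<close>. That the image contains discs of radius proportional
  to the modulus follows from Brouwer's theorem: a fixed point of \<open>\<xi> \<mapsto> \<xi> - \<zeta> \<xi> + \<omega>'\<close> is a preimage of \<open>\<omega>'\<close>.\<close>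

lemma near_identity_coordinate:
  fixes b :: "complex \<Rightarrow> complex"
  assumes holb: "b holomorphic_on tilted_half_plane S0"
    and lim: "\<And>\<delta>. 0 < \<delta> \<Longrightarrow> \<exists>S\<ge>S0. \<forall>\<xi>\<in>tilted_half_plane S. cmod (b \<xi> - 1) \<le> \<delta>"
  obtains S1 T0 \<zeta> g where "S0 \<le> S1" "0 < S1" "0 < T0"
    "\<And>\<xi>. \<xi> \<in> tilted_half_plane S1 \<Longrightarrow> cmod (b \<xi> - 1) \<le> 1/100"
    "\<And>\<xi>. \<xi> \<in> tilted_half_plane S1 \<Longrightarrow> (\<zeta> has_field_derivative b \<xi>) (at \<xi>)"
    "\<And>\<delta>. 0 < \<delta> \<Longrightarrow> \<exists>C. \<exists>S\<ge>S1. \<forall>\<xi>\<in>tilted_half_plane S. cmod (\<zeta> \<xi> - \<xi>) \<le> \<delta> * cmod \<xi> + C"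
    "open (\<zeta> ` tilted_half_plane S1)" "g holomorphic_on (\<zeta> ` tilted_half_plane S1)"
    "\<And>\<xi>. \<xi> \<in> tilted_half_plane S1 \<Longrightarrow> g (\<zeta> \<xi>) = \<xi>"
    "\<And>\<xi>. \<xi> \<in> tilted_half_plane S1 \<Longrightarrow> (g has_field_derivative 1 / b \<xi>) (at (\<zeta> \<xi>))"
    "\<And>\<omega> \<omega>'. cmod \<omega> / 2 \<le> Re \<omega> + Im \<omega> \<Longrightarrow> T0 \<le> cmod \<omega> \<Longrightarrow> \<omega>' \<in> cball \<omega> (cmod \<omega> / 20) \<Longrightarrow>
        \<omega>' \<in> \<zeta> ` tilted_half_plane S1 \<and> g \<omega>' \<in> cball \<omega> (cmod \<omega> / 10)"
proof -
  obtain S' where S': "S0 \<le> S'" "\<forall>\<xi>\<in>tilted_half_plane S'. cmod (b \<xi> - 1) \<le> 1/100"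
    using lim[of "1/100"] by auto
  define S1 where "S1 = max S' 1"
  let ?H = "tilted_half_plane S1"
  have S1: "S0 \<le> S1" "0 < S1" using S' by (auto simp: S1_def)
  have b1: "cmod (b \<xi> - 1) \<le> 1/100" if "\<xi> \<in> ?H" for \<xi>
    using S'(2) that tilted_half_plane_mono[of S' S1] by (auto simp: S1_def)
  have holb1: "b holomorphic_on ?H"
    using holb tilted_half_plane_mono[OF S1(1)] by (rule holomorphic_on_subset)
  obtain \<zeta> where "\<And>\<xi>. \<xi> \<in> ?H \<Longrightarrow> (\<zeta> has_field_derivative b \<xi>) (at \<xi> within ?H)"
    using holomorphic_convex_primitive'[OF convex_tilted_half_plane open_tilted_half_plane holb1] by blast
  then have d\<zeta>: "(\<zeta> has_field_derivative b \<xi>) (at \<xi>)" if "\<xi> \<in> ?H" for \<xi>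
    using that open_tilted_half_plane by (metis at_within_open)
  have close: "cmod ((\<zeta> x - x) - (\<zeta> y - y)) \<le> \<delta> * cmod (x - y)"
    if "S1 \<le> S" "\<And>\<xi>. \<xi> \<in> tilted_half_plane S \<Longrightarrow> cmod (b \<xi> - 1) \<le> \<delta>"
      "x \<in> tilted_half_plane S" "y \<in> tilted_half_plane S" for \<delta> S x y
  proof (rule field_differentiable_bound[OF convex_tilted_half_plane[of S]])
    fix z assume z: "z \<in> tilted_half_plane S"
    then have "z \<in> ?H" using tilted_half_plane_mono[OF that(1)] by auto
    then show "((\<lambda>z. \<zeta> z - z) has_field_derivative b z - 1) (at z within tilted_half_plane S)"
      by (intro DERIV_diff DERIV_ident has_field_derivative_at_within[OF d\<zeta>])
    show "cmod (b z - 1) \<le> \<delta>" using z by (rule that(2))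
  qed (use that in auto)
  have growth: "\<exists>C\<ge>0. \<forall>\<xi>\<in>tilted_half_plane S. cmod (\<zeta> \<xi> - \<xi>) \<le> \<delta> * cmod \<xi> + C"
    if "0 < \<delta>" "S1 \<le> S" "\<And>\<xi>. \<xi> \<in> tilted_half_plane S \<Longrightarrow> cmod (b \<xi> - 1) \<le> \<delta>" for \<delta> S
  proof -
    define \<xi>0 where "\<xi>0 = complex_of_real (S + 1)"
    have "\<xi>0 \<in> tilted_half_plane S" by (simp add: \<xi>0_def tilted_half_plane_def)
    have "cmod (\<zeta> \<xi> - \<xi>) \<le> \<delta> * cmod \<xi> + (\<delta> * cmod \<xi>0 + cmod (\<zeta> \<xi>0 - \<xi>0))"
      if "\<xi> \<in> tilted_half_plane S" for \<xi>
    proof -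
      have "cmod (\<zeta> \<xi> - \<xi>) \<le> cmod ((\<zeta> \<xi> - \<xi>) - (\<zeta> \<xi>0 - \<xi>0)) + cmod (\<zeta> \<xi>0 - \<xi>0)"
        by (metis add.commute norm_triangle_sub)
      also have "\<dots> \<le> \<delta> * cmod (\<xi> - \<xi>0) + cmod (\<zeta> \<xi>0 - \<xi>0)"
        using close[of S \<delta> \<xi> \<xi>0] \<open>S1 \<le> S\<close> \<open>\<And>\<xi>. \<xi> \<in> tilted_half_plane S \<Longrightarrow> cmod (b \<xi> - 1) \<le> \<delta>\<close> that \<open>\<xi>0 \<in> tilted_half_plane S\<close>
        by simp
      also have "\<dots> \<le> \<delta> * (cmod \<xi> + cmod \<xi>0) + cmod (\<zeta> \<xi>0 - \<xi>0)"
        using \<open>0 < \<delta>\<close> by (intro add_right_mono mult_left_mono norm_triangle_ineq4) auto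
      finally show ?thesis by (simp add: algebra_simps)
    qed
    then show ?thesis using \<open>0 < \<delta>\<close> by (intro exI[of _ "\<delta> * cmod \<xi>0 + cmod (\<zeta> \<xi>0 - \<xi>0)"]) auto
  qed
  have inj: "inj_on \<zeta> ?H"
  proof (rule inj_onI)
    fix x y assume xy: "x \<in> ?H" "y \<in> ?H" "\<zeta> x = \<zeta> y"
    have "cmod ((\<zeta> x - x) - (\<zeta> y - y)) \<le> 1/100 * cmod (x - y)"
      by (rule close[of S1]) (use b1 xy in auto)
    then show "x = y" using xy(3) by (simp add: norm_minus_commute)
  qed
  have hol\<zeta>: "\<zeta> holomorphic_on ?H"
    using d\<zeta> open_tilted_half_plane by (auto simp: holomorphic_on_open)
  obtain g where g: "g holomorphic_on (\<zeta> ` ?H)" "\<And>z. z \<in> ?H \<Longrightarrow> deriv \<zeta> z * deriv g (\<zeta> z) = 1"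
      "\<And>z. z \<in> ?H \<Longrightarrow> g (\<zeta> z) = z"
    using holomorphic_has_inverse[OF hol\<zeta> open_tilted_half_plane inj] by blast
  have op: "open (\<zeta> ` ?H)" by (rule open_mapping_thm3[OF hol\<zeta> open_tilted_half_plane inj])
  have dg: "(g has_field_derivative 1 / b \<xi>) (at (\<zeta> \<xi>))" if "\<xi> \<in> ?H" for \<xi>
  proof -
    have "(g has_field_derivative deriv g (\<zeta> \<xi>)) (at (\<zeta> \<xi>))"
      using g(1) op that by (intro holomorphic_derivI[OF g(1) op]) auto
    moreover have "b \<xi> * deriv g (\<zeta> \<xi>) = 1"
      using g(2)[OF that] DERIV_imp_deriv[OF d\<zeta>[OF that]] by simp
    then have "deriv g (\<zeta> \<xi>) = 1 / b \<xi>" by (metis div_by_0 nonzero_eq_divide_eq mult.commute mult_zero_left zero_neq_one)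
    ultimately show ?thesis by simp
  qed
  obtain C where C: "0 \<le> C" "\<And>\<xi>. \<xi> \<in> ?H \<Longrightarrow> cmod (\<zeta> \<xi> - \<xi>) \<le> 1/100 * cmod \<xi> + C"
    using growth[of "1/100" S1] b1 by auto
  \<comment> \<open>Large enough for discs of radius \<open>\<bar>\<omega>\<bar> / 10\<close> to stay in the half plane and for \<open>\<bar>\<zeta> \<xi> - \<xi>\<bar> \<le> \<bar>\<omega>\<bar> / 20\<close> on them.\<close>
  define T0 where "T0 = 4 * S1 + 26 * C"
  show ?thesis
  proof (rule that[OF S1 _ b1 d\<zeta> _ op g(1,3) dg])
    show "0 < T0" using S1 C by (simp add: T0_def)
    show "\<exists>C. \<exists>S\<ge>S1. \<forall>\<xi>\<in>tilted_half_plane S. cmod (\<zeta> \<xi> - \<xi>) \<le> \<delta> * cmod \<xi> + C" if "0 < \<delta>" for \<delta>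
    proof -
      obtain S where S: "S0 \<le> S" "\<forall>\<xi>\<in>tilted_half_plane S. cmod (b \<xi> - 1) \<le> \<delta>" using lim[OF \<open>0 < \<delta>\<close>] by auto
      have "cmod (b \<xi> - 1) \<le> \<delta>" if "\<xi> \<in> tilted_half_plane (max S S1)" for \<xi>
        using S(2) that tilted_half_plane_mono[of S "max S S1"] by auto
      from growth[OF \<open>0 < \<delta>\<close> _ this] show ?thesis by (meson max.cobounded2)
    qed
    fix \<omega> \<omega>' assume \<omega>: "cmod \<omega> / 2 \<le> Re \<omega> + Im \<omega>" "T0 \<le> cmod \<omega>" "\<omega>' \<in> cball \<omega> (cmod \<omega> / 20)"
    define r where "r = cmod \<omega> / 20"
    have large: "4 * S1 \<le> cmod \<omega>" "26 * C \<le> cmod \<omega>" using \<omega>(2) S1 C by (auto simp: T0_def)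
    have ball: "\<xi> \<in> ?H \<and> cmod (\<xi> - \<zeta> \<xi>) \<le> r \<and> \<xi> \<in> cball \<omega> (cmod \<omega> / 10)" if "\<xi> \<in> cball \<omega>' r" for \<xi>
    proof -
      have dist: "cmod (\<xi> - \<omega>) \<le> cmod \<omega> / 10"
        using that \<omega>(3) norm_triangle_ineq[of "\<xi> - \<omega>'" "\<omega>' - \<omega>"]
        by (simp add: r_def dist_norm norm_minus_commute)
      have "\<bar>Re (\<xi> - \<omega>)\<bar> \<le> cmod (\<xi> - \<omega>)" "\<bar>Im (\<xi> - \<omega>)\<bar> \<le> cmod (\<xi> - \<omega>)"
        using abs_Re_le_cmod abs_Im_le_cmod by blast+
      then have "Re \<omega> + Im \<omega> - cmod \<omega> / 5 \<le> Re \<xi> + Im \<xi>" using dist by simp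
      then have H: "\<xi> \<in> ?H" using \<omega>(1) large S1 by (simp add: tilted_half_plane_def)
      have "cmod \<xi> \<le> cmod \<omega> + cmod \<omega> / 10" using dist norm_triangle_ineq[of \<omega> "\<xi> - \<omega>"] by simp
      then have "cmod (\<xi> - \<zeta> \<xi>) \<le> r" using C(2)[OF H] large norm_ge_zero[of \<omega>]
        unfolding r_def norm_minus_commute[of \<xi>] by linarith
      then show ?thesis using H dist by (simp add: dist_norm norm_minus_commute)
    qed
    obtain \<xi> where \<xi>: "\<xi> \<in> cball \<omega>' r" "\<xi> - \<zeta> \<xi> + \<omega>' = \<xi>"
    proof (rule brouwer[of "cball \<omega>' r" "\<lambda>\<xi>. \<xi> - \<zeta> \<xi> + \<omega>'"])
      have "continuous_on (cball \<omega>' r) \<zeta>"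
        using holomorphic_on_imp_continuous_on[OF hol\<zeta>] by (rule continuous_on_subset) (use ball in auto)
      then show "continuous_on (cball \<omega>' r) (\<lambda>\<xi>. \<xi> - \<zeta> \<xi> + \<omega>')" by (intro continuous_intros)
      show "(\<lambda>\<xi>. \<xi> - \<zeta> \<xi> + \<omega>') \<in> cball \<omega>' r \<rightarrow> cball \<omega>' r"
        using ball by (auto simp: dist_norm norm_minus_commute)
      show "cball \<omega>' r \<noteq> {}" using large S1 by (simp add: r_def)
    qed auto
    then have "\<zeta> \<xi> = \<omega>'" by (simp add: algebra_simps)
    then show "\<omega>' \<in> \<zeta> ` ?H \<and> g \<omega>' \<in> cball \<omega> (cmod \<omega> / 10)"
      using ball[OF \<xi>(1)] g(3) by (metis imageI)
  qed
qed

lemma stokes_cone_sum_ge: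
  assumes "\<omega> \<in> stokes_cone S" "0 \<le> S"
  shows "cmod \<omega> / 2 \<le> Re \<omega> + Im \<omega>" "3 * S / 4 \<le> cmod \<omega>"
proof -
  \<comment> \<open>Coordinates in which the cone is part of the quadrant \<open>p, q \<ge> 0\<close>.\<close>
  define p q where "p = 3 * Re \<omega> + Im \<omega>" and "q = Re \<omega> + 4 * Im \<omega>"
  have pq: "0 \<le> p" "0 \<le> q" "3 * S \<le> p" using assms by (auto simp: p_def q_def stokes_cone_def)
  have R: "Re \<omega> = (4 * p - q) / 11" "Im \<omega> = (3 * q - p) / 11" by (simp_all add: p_def q_def)
  have "(cmod \<omega>)\<^sup>2 = (17 * p\<^sup>2 + 10 * q\<^sup>2 - 14 * (p * q)) / 121"
    unfolding cmod_power2 R by (simp add: power2_eq_square field_simps)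
  also have "\<dots> \<le> 4 * (9 * p\<^sup>2 + 4 * q\<^sup>2 + 12 * (p * q)) / 121"
    by (rule divide_right_mono)
      (use mult_nonneg_nonneg[OF pq(1,2)] zero_le_power2[of p] zero_le_power2[of q] in \<open>simp, argo\<close>)
  also have "\<dots> = (2 * (Re \<omega> + Im \<omega>))\<^sup>2"
    unfolding R by (simp add: power2_eq_square field_simps)
  finally have "cmod \<omega> \<le> 2 * (Re \<omega> + Im \<omega>)"
    by (rule power2_le_imp_le) (use pq R in simp)
  then show "cmod \<omega> / 2 \<le> Re \<omega> + Im \<omega>" by simp
  have "p \<le> 4 * cmod \<omega>"
    using complex_Re_le_cmod[of \<omega>] abs_Im_le_cmod[of \<omega>] unfolding p_def by linarith
  then show "3 * S / 4 \<le> cmod \<omega>" using pq by simp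
qed

text \<open>The variable \<open>z\<close> is chosen so that \<open>P(z) z'\<^sup>2 = b\<^sup>2\<close> is nearly 1, and \<open>\<zeta>\<close> is a
  primitive of \<open>b\<close>. As a function of \<open>\<zeta>\<close>, the product of \<open>w\<close> and \<open>y = (dz/d\<zeta>)\<^sup>-\<^sup>1\<^sup>/\<^sup>2\<close> satisfies
  \<open>v'' + (1 + \<epsilon>) v = 0\<close> with \<open>\<epsilon> = - y'' / y\<close>. Since \<open>\<bar>y\<bar>\<^sup>2\<close> is comparable with \<open>\<bar>\<xi>\<bar>\<^sup>p\<close>, it varies by a bounded factor on discs of radius
  proportional to \<open>\<bar>\<zeta>\<bar>\<close>, and Cauchy's inequality gives \<open>\<epsilon> = O(\<bar>\<zeta>\<bar>\<^sup>-\<^sup>2)\<close>. So \<open>wkb_cone\<close> applies.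
  The function \<open>g\<close> parametrizes the curve on which \<open>\<zeta>\<close> is real.\<close>

lemma wkb_half_plane:
  fixes P w1 w2 z z' b :: "complex \<Rightarrow> complex" and p \<kappa> :: real
  assumes S0: "0 < S0"
    and z: "\<And>\<xi>. \<xi> \<in> tilted_half_plane S0 \<Longrightarrow> (z has_field_derivative z' \<xi>) (at \<xi>)"
    and z': "z' holomorphic_on tilted_half_plane S0"
      "\<And>\<xi>. \<xi> \<in> tilted_half_plane S0 \<Longrightarrow> cmod (z' \<xi>) = \<kappa> * cmod \<xi> powr (- p)"
    and p: "0 \<le> p" "p \<le> 1" "0 < \<kappa>"
    and b: "b holomorphic_on tilted_half_plane S0"
      "\<And>\<xi>. \<xi> \<in> tilted_half_plane S0 \<Longrightarrow> (b \<xi>)\<^sup>2 = P (z \<xi>) * (z' \<xi>)\<^sup>2"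
      "\<And>\<delta>. 0 < \<delta> \<Longrightarrow> \<exists>S\<ge>S0. \<forall>\<xi>\<in>tilted_half_plane S. cmod (b \<xi> - 1) \<le> \<delta>"
    and w: "w1 holomorphic_on UNIV" "w2 holomorphic_on UNIV"
      "\<And>z. deriv (deriv w1) z = - P z * w1 z" "\<And>z. deriv (deriv w2) z = - P z * w2 z"
      "\<And>z. w1 z * deriv w2 z - w2 z * deriv w1 z = c" "c \<noteq> 0"
  obtains \<zeta> g S1 S2 A B where "S0 \<le> S1" "0 < S2" "0 < A" "0 < B"
    "\<And>\<xi>. \<xi> \<in> tilted_half_plane S1 \<Longrightarrow> \<zeta> \<xi> \<in> stokes_cone S2 \<Longrightarrow>
      A * exp (2 * \<bar>Im (\<zeta> \<xi>)\<bar>) \<le> cmod \<xi> powr p * ((cmod (w1 (z \<xi>)))\<^sup>2 + (cmod (w2 (z \<xi>)))\<^sup>2) \<and>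
      cmod \<xi> powr p * ((cmod (w1 (z \<xi>)))\<^sup>2 + (cmod (w2 (z \<xi>)))\<^sup>2) \<le> B * exp (2 * \<bar>Im (\<zeta> \<xi>)\<bar>)"
    "\<And>\<delta>. 0 < \<delta> \<Longrightarrow> \<exists>C. \<exists>S\<ge>S1. \<forall>\<xi>\<in>tilted_half_plane S. cmod (\<zeta> \<xi> - \<xi>) \<le> \<delta> * cmod \<xi> + C"
    "continuous_on {S2..} g"
    "\<And>t. S2 \<le> t \<Longrightarrow> g t \<in> tilted_half_plane S1 \<and> \<zeta> (g t) = of_real t \<and> cmod (g t - of_real t) \<le> t / 10"
proof -
  obtain S1 T0 \<zeta> G where S1: "S0 \<le> S1" "0 < S1" and T0: "0 < T0"
    and b1: "\<And>\<xi>. \<xi> \<in> tilted_half_plane S1 \<Longrightarrow> cmod (b \<xi> - 1) \<le> 1/100"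
    and d\<zeta>: "\<And>\<xi>. \<xi> \<in> tilted_half_plane S1 \<Longrightarrow> (\<zeta> has_field_derivative b \<xi>) (at \<xi>)"
    and growth: "\<And>\<delta>. 0 < \<delta> \<Longrightarrow> \<exists>C. \<exists>S\<ge>S1. \<forall>\<xi>\<in>tilted_half_plane S. cmod (\<zeta> \<xi> - \<xi>) \<le> \<delta> * cmod \<xi> + C"
    and op: "open (\<zeta> ` tilted_half_plane S1)" and holG: "G holomorphic_on (\<zeta> ` tilted_half_plane S1)"
    and G: "\<And>\<xi>. \<xi> \<in> tilted_half_plane S1 \<Longrightarrow> G (\<zeta> \<xi>) = \<xi>"
    and dG: "\<And>\<xi>. \<xi> \<in> tilted_half_plane S1 \<Longrightarrow> (G has_field_derivative 1 / b \<xi>) (at (\<zeta> \<xi>))"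
    and cover: "\<And>\<omega> \<omega>'. cmod \<omega> / 2 \<le> Re \<omega> + Im \<omega> \<Longrightarrow> T0 \<le> cmod \<omega> \<Longrightarrow> \<omega>' \<in> cball \<omega> (cmod \<omega> / 20) \<Longrightarrow>
        \<omega>' \<in> \<zeta> ` tilted_half_plane S1 \<and> G \<omega>' \<in> cball \<omega> (cmod \<omega> / 10)"
    by (rule near_identity_coordinate[OF b(1,3)]) blast+
  let ?H = "tilted_half_plane S1"
  define O' where "O' = \<zeta> ` ?H"
  have sub: "?H \<subseteq> tilted_half_plane S0" by (rule tilted_half_plane_mono[OF S1(1)])
  have bnz: "b \<xi> \<noteq> 0" "99/100 \<le> cmod (b \<xi>)" "cmod (b \<xi>) \<le> 101/100" if "\<xi> \<in> ?H" for \<xi>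
    using b1[OF that] norm_triangle_ineq2[of 1 "b \<xi>"] norm_triangle_ineq2[of "b \<xi>" 1]
    by (auto simp: norm_minus_commute)
  have Hnz: "\<xi> \<noteq> 0" if "\<xi> \<in> ?H" for \<xi> using that S1 by (auto simp: tilted_half_plane_def)
  have z'nz: "z' \<xi> \<noteq> 0" if "\<xi> \<in> ?H" for \<xi>
    using z'(2)[of \<xi>] sub that Hnz[OF that] p by auto
  have "(\<lambda>\<xi>. b \<xi> / z' \<xi>) holomorphic_on ?H"
    using sub z'nz by (intro holomorphic_on_divide holomorphic_on_subset[OF b(1)] holomorphic_on_subset[OF z'(1)]) auto
  then obtain q where q: "q holomorphic_on ?H" "\<And>\<xi>. \<xi> \<in> ?H \<Longrightarrow> b \<xi> / z' \<xi> = (q \<xi>)\<^sup>2"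
    using contractible_imp_holomorphic_sqrt[of "\<lambda>\<xi>. b \<xi> / z' \<xi>" ?H]
      convex_imp_contractible[OF convex_tilted_half_plane[of S1]] bnz z'nz by (metis divide_eq_0_iff)
  define Z where "Z = z \<circ> G"
  define y where "y = q \<circ> G"
  have GO: "G \<omega> \<in> ?H" "\<zeta> (G \<omega>) = \<omega>" if "\<omega> \<in> O'" for \<omega> using that G by (auto simp: O'_def)
  have dG': "(G has_field_derivative 1 / b (G \<omega>)) (at \<omega>)" if "\<omega> \<in> O'" for \<omega>
    using dG[OF GO(1)[OF that]] GO(2)[OF that] by simp
  have dZ: "(Z has_field_derivative z' (G \<omega>) / b (G \<omega>)) (at \<omega>)" if "\<omega> \<in> O'" for \<omega>
    using DERIV_chain[OF z[of "G \<omega>"] dG'[OF that]] GO(1)[OF that] sub by (auto simp: Z_def)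
  define Z' where "Z' \<omega> = z' (G \<omega>) / b (G \<omega>)" for \<omega>
  have opO: "open O'" and holGO: "G holomorphic_on O'" using op holG by (auto simp: O'_def)
  have GsubO: "G ` O' \<subseteq> ?H" using GO by auto
  have hol_y: "y holomorphic_on O'"
    unfolding y_def by (rule holomorphic_on_compose_gen[OF holGO q(1) GsubO])
  have holZ: "Z holomorphic_on O'" using dZ opO by (auto simp: holomorphic_on_open)
  have yZ: "(y \<omega>)\<^sup>2 * Z' \<omega> = 1" if "\<omega> \<in> O'" for \<omega>
    using q(2)[OF GO(1)[OF that], symmetric] bnz[OF GO(1)[OF that]] z'nz[OF GO(1)[OF that]]
    by (simp add: y_def Z'_def)
  have ynz: "y \<omega> \<noteq> 0" if "\<omega> \<in> O'" for \<omega> using yZ[OF that] by auto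
  have PZ: "P (Z \<omega>) * (Z' \<omega>)\<^sup>2 = 1" if "\<omega> \<in> O'" for \<omega>
    using b(2)[of "G \<omega>"] sub GO(1)[OF that] bnz[OF GO(1)[OF that]]
    by (auto simp: Z_def Z'_def power_divide)
  \<comment> \<open>The factor \<open>y\<close> removes the first-order term.\<close>
  define V where "V w \<omega> = w (Z \<omega>) * y \<omega>" for w \<omega>
  define V' where "V' w \<omega> = deriv w (Z \<omega>) * Z' \<omega> * y \<omega> + w (Z \<omega>) * deriv y \<omega>" for w \<omega>
  define \<epsilon> where "\<epsilon> \<omega> = - deriv (deriv y) \<omega> / y \<omega>" for \<omega>
  have dy: "(y has_field_derivative deriv y \<omega>) (at \<omega>)" "(deriv y has_field_derivative deriv (deriv y) \<omega>) (at \<omega>)"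
    if "\<omega> \<in> O'" for \<omega>
    using holomorphic_derivI[OF hol_y opO that] holomorphic_derivI[OF holomorphic_deriv[OF hol_y opO] opO that] by auto
  have "Z' holomorphic_on O'"
  proof -
    have "Z' = (\<lambda>\<xi>. z' \<xi> / b \<xi>) \<circ> G" by (auto simp: Z'_def)
    moreover have "(\<lambda>\<xi>. z' \<xi> / b \<xi>) holomorphic_on ?H"
      using sub bnz by (intro holomorphic_on_divide holomorphic_on_subset[OF b(1)] holomorphic_on_subset[OF z'(1)]) auto
    ultimately show ?thesis using holomorphic_on_compose_gen[OF holGO _ GsubO] by metis
  qed
  then have dZ': "(Z' has_field_derivative deriv Z' \<omega>) (at \<omega>)" if "\<omega> \<in> O'" for \<omega>
    by (rule holomorphic_derivI[OF _ opO that])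
  have cross: "2 * deriv y \<omega> * Z' \<omega> + y \<omega> * deriv Z' \<omega> = 0" if "\<omega> \<in> O'" for \<omega>
  proof -
    have "((\<lambda>\<omega>. (y \<omega>)\<^sup>2 * Z' \<omega>) has_field_derivative 2 * y \<omega> * deriv y \<omega> * Z' \<omega> + deriv Z' \<omega> * (y \<omega>)\<^sup>2) (at \<omega>)"
      by (rule derivative_eq_intros dy dZ' that refl)+ simp
    moreover have "((\<lambda>\<omega>. (y \<omega>)\<^sup>2 * Z' \<omega>) has_field_derivative 0) (at \<omega>)"
      by (rule has_field_derivative_transform_within_open[OF DERIV_const[of 1] opO that]) (simp add: yZ)
    ultimately have "2 * y \<omega> * deriv y \<omega> * Z' \<omega> + deriv Z' \<omega> * (y \<omega>)\<^sup>2 = 0" by (rule DERIV_unique)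
    then have "y \<omega> * (2 * deriv y \<omega> * Z' \<omega> + y \<omega> * deriv Z' \<omega>) = 0" by (simp add: power2_eq_square algebra_simps)
    then show ?thesis using ynz[OF that] by simp
  qed
  have dV: "(V w has_field_derivative V' w \<omega>) (at \<omega>)"
    and dV': "(V' w has_field_derivative - (1 + \<epsilon> \<omega>) * V w \<omega>) (at \<omega>)"
    if "\<omega> \<in> O'" and hw: "w holomorphic_on UNIV" and ode: "\<And>z. deriv (deriv w) z = - P z * w z" for w \<omega>
  proof -
    have dw: "(w has_field_derivative deriv w x) (at x)" "(deriv w has_field_derivative - P x * w x) (at x)" for x
      using holomorphic_derivI[OF hw open_UNIV] holomorphic_derivI[OF holomorphic_deriv[OF hw open_UNIV] open_UNIV] ode
      by auto
    note dZ1 = dZ[OF that(1), folded Z'_def]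
    have dwZ: "((\<lambda>\<omega>. w (Z \<omega>)) has_field_derivative deriv w (Z \<omega>) * Z' \<omega>) (at \<omega>)"
      "((\<lambda>\<omega>. deriv w (Z \<omega>)) has_field_derivative - P (Z \<omega>) * w (Z \<omega>) * Z' \<omega>) (at \<omega>)"
      by (rule DERIV_chain2[OF dw(1) dZ1] DERIV_chain2[OF dw(2) dZ1])+
    show "(V w has_field_derivative V' w \<omega>) (at \<omega>)" unfolding V_def V'_def
      by (rule derivative_eq_intros dwZ dy that refl)+ simp
    have "(V' w has_field_derivative
        (- P (Z \<omega>) * w (Z \<omega>) * Z' \<omega> * Z' \<omega> + deriv Z' \<omega> * deriv w (Z \<omega>)) * y \<omega> + deriv y \<omega> * (deriv w (Z \<omega>) * Z' \<omega>)
        + (deriv w (Z \<omega>) * Z' \<omega> * deriv y \<omega> + deriv (deriv y) \<omega> * w (Z \<omega>))) (at \<omega>)"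
      unfolding V'_def by (intro DERIV_add DERIV_mult dwZ dy dZ' that)
    moreover have "(- P (Z \<omega>) * w (Z \<omega>) * Z' \<omega> * Z' \<omega> + deriv Z' \<omega> * deriv w (Z \<omega>)) * y \<omega> + deriv y \<omega> * (deriv w (Z \<omega>) * Z' \<omega>)
        + (deriv w (Z \<omega>) * Z' \<omega> * deriv y \<omega> + deriv (deriv y) \<omega> * w (Z \<omega>)) =
        - (P (Z \<omega>) * (Z' \<omega>)\<^sup>2) * w (Z \<omega>) * y \<omega> + deriv w (Z \<omega>) * (2 * deriv y \<omega> * Z' \<omega> + y \<omega> * deriv Z' \<omega>)
        + deriv (deriv y) \<omega> * w (Z \<omega>)"
      by (simp add: power2_eq_square algebra_simps)
    moreover have "\<dots> = - (1 + \<epsilon> \<omega>) * V w \<omega>"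
      unfolding PZ[OF that(1)] cross[OF that(1)] using ynz[OF that(1)]
      by (simp add: V_def \<epsilon>_def algebra_simps)
    ultimately show "(V' w has_field_derivative - (1 + \<epsilon> \<omega>) * V w \<omega>) (at \<omega>)" by (simp only:)
  qed
  have normy: "(cmod (y (\<zeta> \<xi>)))\<^sup>2 = cmod (b \<xi>) * cmod \<xi> powr p / \<kappa>" if "\<xi> \<in> ?H" for \<xi>
  proof -
    have "(cmod (y (\<zeta> \<xi>)))\<^sup>2 = cmod (b \<xi> / z' \<xi>)"
      using q(2)[OF that] G[OF that] by (simp add: y_def norm_power)
    also have "\<dots> = cmod (b \<xi>) * cmod \<xi> powr p / \<kappa>"
      using z'(2)[of \<xi>] sub that p(3) by (auto simp: norm_divide powr_minus field_simps)
    finally show ?thesis .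
  qed
  \<comment> \<open>Cauchy's inequality on radius \<open>\<bar>\<omega>\<bar> / 20\<close> with \<open>\<bar>y\<bar>\<close> at most doubled gives \<open>2! \<cdot> 2 \<cdot> 20\<^sup>2\<close>; the summand 160 in \<open>S2\<close> is \<open>\<surd>(16 D)\<close>.\<close>
  define D where "D = (1600::real)"
  define S2 where "S2 = 2 * T0 + 160"
  have S2: "0 < S2" "T0 \<le> 3 * S2 / 4" using T0 by (auto simp: S2_def)
  have coneO: "\<omega> \<in> O'" "cmod \<omega> / 2 \<le> Re \<omega> + Im \<omega>" "T0 \<le> cmod \<omega>" if "\<omega> \<in> stokes_cone S2" for \<omega>
    using stokes_cone_sum_ge[OF that] S2 cover[of \<omega> \<omega>] by (auto simp: O'_def)
  have eps: "cmod (\<epsilon> \<omega>) \<le> D / (cmod \<omega>)\<^sup>2" if "\<omega> \<in> stokes_cone S2" for \<omega>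
  proof -
    note c = coneO[OF that]
    define r where "r = cmod \<omega> / 20"
    have \<omega>: "0 < cmod \<omega>" using c T0 by linarith
    have cb: "\<omega>' \<in> O' \<and> G \<omega>' \<in> cball \<omega> (cmod \<omega> / 10)" if "\<omega>' \<in> cball \<omega> r" for \<omega>'
      using cover[OF c(2,3)] that by (auto simp: r_def O'_def)
    have nG: "9/10 * cmod \<omega> \<le> cmod (G \<omega>') \<and> cmod (G \<omega>') \<le> 11/10 * cmod \<omega>" if "\<omega>' \<in> cball \<omega> r" for \<omega>'
      using cb[OF that] norm_triangle_ineq2[of \<omega> "G \<omega>'"] norm_triangle_ineq2[of "G \<omega>'" \<omega>]
      by (auto simp: dist_norm norm_minus_commute)
    have yb: "cmod (y \<omega>') \<le> 2 * cmod (y \<omega>)" if w': "\<omega>' \<in> cball \<omega> r" for \<omega>'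
    proof (rule power2_le_imp_le)
      have w: "\<omega> \<in> cball \<omega> r" using \<omega> by (simp add: r_def)
      have eq: "(cmod (y x))\<^sup>2 = cmod (b (G x)) * cmod (G x) powr p / \<kappa>" if "x \<in> cball \<omega> r" for x
        using normy[of "G x"] GO[of x] cb[OF that] by auto
      have "cmod (G \<omega>') powr p \<le> (2 * cmod (G \<omega>)) powr p"
        using nG[OF w'] nG[OF w] p \<omega> by (intro powr_mono2) auto
      also have "\<dots> = 2 powr p * cmod (G \<omega>) powr p" by (rule powr_mult)
      also have "\<dots> \<le> 2 * cmod (G \<omega>) powr p"
        using p powr_mono[of p 1 2] by (intro mult_right_mono) auto
      finally have 1: "cmod (G \<omega>') powr p \<le> 2 * cmod (G \<omega>) powr p" .
      have 2: "cmod (b (G \<omega>')) \<le> 2 * cmod (b (G \<omega>))"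
        using bnz(3)[OF GO(1)[of \<omega>']] bnz(2)[OF GO(1)[of \<omega>]] cb[OF w'] cb[OF w] by auto
      have "cmod (b (G \<omega>')) * cmod (G \<omega>') powr p \<le> (2 * cmod (b (G \<omega>))) * (2 * cmod (G \<omega>) powr p)"
        by (rule mult_mono[OF 2 1]) auto
      then show "(cmod (y \<omega>'))\<^sup>2 \<le> (2 * cmod (y \<omega>))\<^sup>2"
        unfolding power_mult_distrib eq[OF w'] eq[OF w] using p(3) by (simp add: field_simps)
    qed simp
    have "cmod ((deriv ^^ 2) y \<omega>) \<le> fact 2 * (2 * cmod (y \<omega>)) / r ^ 2"
    proof (rule Cauchy_inequality)
      have "cball \<omega> r \<subseteq> O'" using cb by auto
      then show "y holomorphic_on ball \<omega> r" "continuous_on (cball \<omega> r) y"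
        using hol_y by (auto intro!: holomorphic_on_imp_continuous_on elim!: holomorphic_on_subset)
      show "0 < r" using \<omega> by (simp add: r_def)
      show "cmod (y x) \<le> 2 * cmod (y \<omega>)" if "cmod (\<omega> - x) = r" for x
        using that by (intro yb) (simp add: dist_norm)
    qed
    then have "cmod (deriv (deriv y) \<omega>) \<le> 4 * cmod (y \<omega>) / r\<^sup>2" by (simp add: numeral_2_eq_2)
    then have "cmod (deriv (deriv y) \<omega>) \<le> D * cmod (y \<omega>) / (cmod \<omega>)\<^sup>2"
      by (simp add: r_def D_def power_divide)
    then show ?thesis using ynz[OF c(1)] by (simp add: \<epsilon>_def norm_divide field_simps)
  qed
  have wr: "V w1 \<omega> * V' w2 \<omega> - V w2 \<omega> * V' w1 \<omega> = c" if "\<omega> \<in> stokes_cone S2" for \<omega>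
  proof -
    have "V w1 \<omega> * V' w2 \<omega> - V w2 \<omega> * V' w1 \<omega> =
       (w1 (Z \<omega>) * deriv w2 (Z \<omega>) - w2 (Z \<omega>) * deriv w1 (Z \<omega>)) * ((y \<omega>)\<^sup>2 * Z' \<omega>)"
      by (simp add: V_def V'_def power2_eq_square algebra_simps)
    then show ?thesis using w(5) yZ[OF coneO(1)[OF that]] by simp
  qed
  have "16 * D \<le> S2\<^sup>2"
  proof -
    have "160\<^sup>2 \<le> S2\<^sup>2" using T0 by (intro power_mono) (auto simp: S2_def)
    then show ?thesis by (simp add: D_def)
  qed
  from wkb_cone[OF S2(1) this dV[OF coneO(1) w(1,3)] dV'[OF coneO(1) w(1,3)]
      dV[OF coneO(1) w(2,4)] dV'[OF coneO(1) w(2,4)] eps wr w(6)]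
  obtain A B where AB: "0 < A" "0 < B" and VV: "\<And>\<omega>. \<omega> \<in> stokes_cone S2 \<Longrightarrow>
     A * exp (2 * \<bar>Im \<omega>\<bar>) \<le> (cmod (V w1 \<omega>))\<^sup>2 + (cmod (V w2 \<omega>))\<^sup>2 \<and>
     (cmod (V w1 \<omega>))\<^sup>2 + (cmod (V w2 \<omega>))\<^sup>2 \<le> B * exp (2 * \<bar>Im \<omega>\<bar>)" by blast
  show ?thesis
  proof (rule that[of S1 S2 "A * \<kappa> * (100/101)" "B * \<kappa> * (100/99)" \<zeta> "\<lambda>t. G (of_real t)"])
    fix \<xi> assume \<xi>: "\<xi> \<in> ?H" "\<zeta> \<xi> \<in> stokes_cone S2"
    define h where "h = cmod \<xi> powr p * ((cmod (w1 (z \<xi>)))\<^sup>2 + (cmod (w2 (z \<xi>)))\<^sup>2)"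
    have h: "0 \<le> h" by (simp add: h_def)
    have "(cmod (V w1 (\<zeta> \<xi>)))\<^sup>2 + (cmod (V w2 (\<zeta> \<xi>)))\<^sup>2 = cmod (b \<xi>) / \<kappa> * h"
      using G[OF \<xi>(1)] by (simp add: V_def norm_mult power_mult_distrib normy[OF \<xi>(1)] Z_def h_def algebra_simps)
    then have *: "A * exp (2 * \<bar>Im (\<zeta> \<xi>)\<bar>) \<le> cmod (b \<xi>) / \<kappa> * h" "cmod (b \<xi>) / \<kappa> * h \<le> B * exp (2 * \<bar>Im (\<zeta> \<xi>)\<bar>)"
      using VV[OF \<xi>(2)] by auto
    have "cmod (b \<xi>) / \<kappa> * h \<le> 101/100 / \<kappa> * h"
      using bnz[OF \<xi>(1)] p(3) h by (intro mult_right_mono divide_right_mono) auto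
    with *(1) have 1: "A * exp (2 * \<bar>Im (\<zeta> \<xi>)\<bar>) \<le> 101/100 / \<kappa> * h" by simp
    have "99/100 / \<kappa> * h \<le> cmod (b \<xi>) / \<kappa> * h"
      using bnz[OF \<xi>(1)] p(3) h by (intro mult_right_mono divide_right_mono) auto
    with *(2) have 2: "99/100 / \<kappa> * h \<le> B * exp (2 * \<bar>Im (\<zeta> \<xi>)\<bar>)" by simp
    show "A * \<kappa> * (100/101) * exp (2 * \<bar>Im (\<zeta> \<xi>)\<bar>) \<le> h \<and> h \<le> B * \<kappa> * (100/99) * exp (2 * \<bar>Im (\<zeta> \<xi>)\<bar>)"
      using 1 2 p(3) by (simp add: field_simps)
  next
    have real_cone: "of_real t \<in> stokes_cone S2" if "S2 \<le> t" for t
      using that S2 by (simp add: stokes_cone_def)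
    have "continuous_on O' G" using holGO by (rule holomorphic_on_imp_continuous_on)
    then show "continuous_on {S2..} (\<lambda>t. G (of_real t))"
      by (rule continuous_on_compose2[OF _ continuous_on_of_real[OF continuous_on_id]])
        (use coneO(1)[OF real_cone] in auto)
    fix t assume t: "S2 \<le> t"
    note c = coneO[OF real_cone[OF t]]
    have "0 < t" using t S2 by simp
    then show "G (of_real t) \<in> ?H \<and> \<zeta> (G (of_real t)) = of_real t \<and> cmod (G (of_real t) - of_real t) \<le> t / 10"
      using GO[OF c(1)] cover[OF c(2,3), of "of_real t"] by (auto simp: dist_norm norm_minus_commute)
  qed (use S1 S2 AB p growth in auto)
qed

section \<open>Solutions with a polynomial potential\<close>

lemma Ln_polar: "0 < \<rho> \<Longrightarrow> \<bar>\<phi>\<bar> < pi \<Longrightarrow> Ln (of_real \<rho> * cis \<phi>) = Complex (ln \<rho>) \<phi>"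
  by (rule Ln_unique) (auto simp: exp_eq_polar)

lemma cos_plus_sin_ge_1:
  assumes "0 \<le> \<phi>" "\<phi> \<le> pi / 2" shows "0 \<le> cos \<phi>" "0 \<le> sin \<phi>" "1 \<le> cos \<phi> + sin \<phi>"
proof -
  show c: "0 \<le> cos \<phi>" using assms by (intro cos_ge_zero) auto
  show s: "0 \<le> sin \<phi>" using assms by (intro sin_ge_zero) auto
  have "1\<^sup>2 \<le> (cos \<phi> + sin \<phi>)\<^sup>2" using c s sin_cos_squared_add[of \<phi>] by (simp add: power2_sum)
  then show "1 \<le> cos \<phi> + sin \<phi>" by (rule power2_le_imp_le) (use c s in auto)
qed

lemma eventually_affine_ln_le:
  assumes "0 < (\<eta>::real)" shows "eventually (\<lambda>\<rho>. K + ln \<rho> \<le> \<eta> * \<rho>) at_top"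
proof -
  have "((\<lambda>\<rho>. K / \<rho> + ln \<rho> / \<rho>) \<longlongrightarrow> 0 + 0) at_top"
    by (intro tendsto_add ln_x_over_x_tendsto_0 tendsto_divide_0[OF tendsto_const] filterlim_at_top_imp_at_infinity filterlim_ident)
  then have "eventually (\<lambda>\<rho>. K / \<rho> + ln \<rho> / \<rho> < \<eta>) at_top"
    using assms by (auto dest: order_tendstoD)
  then show ?thesis using eventually_gt_at_top[of 0]
    by eventually_elim (simp add: field_simps)
qed

lemma filterlim_powr_at_top:
  assumes "0 < (p::real)" shows "filterlim (\<lambda>x::real. x powr p) at_top at_top"
  unfolding filterlim_at_top
proof
  fix Z :: real
  have "eventually (\<lambda>x. (\<bar>Z\<bar> + 1) powr (1 / p) \<le> x) at_top" by (rule eventually_ge_at_top)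
  then show "eventually (\<lambda>x. Z \<le> x powr p) at_top"
  proof eventually_elim
    case (elim x)
    then have "((\<bar>Z\<bar> + 1) powr (1 / p)) powr p \<le> x powr p" using assms by (intro powr_mono2) auto
    then show ?case using assms by (simp add: powr_powr)
  qed
qed

text \<open>The condition on \<open>l\<close> and \<open>\<theta>\<close> says that the substitution \<open>z = l e\<^sup>\<i>\<^sup>\<theta> \<xi>\<^sup>1\<^sup>/\<^sup>m\<close> turns the leading
  term of \<open>P(z) z'\<^sup>2\<close> into 1, so \<open>wkb_half_plane\<close> applies. The closed first quadrant of the
  \<open>\<xi>\<close>-plane is the sector of opening \<open>\<pi> / (2 m)\<close> to the left of the direction \<open>\<theta>\<close>, and there \<open>Im \<zeta>\<close> is
  \<open>\<rho> sin \<phi> + o(\<rho>)\<close>. The curve is the one on which \<open>\<zeta>\<close> is real.\<close>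

lemma wkb_polynomial_sector:
  fixes P :: "complex poly" and w1 w2 :: "complex \<Rightarrow> complex" and l \<theta> m :: real
  assumes P: "P \<noteq> 0" and m: "2 * m = real (degree P) + 2"
    and l: "0 < l" "(of_real l * cis \<theta>) ^ (degree P + 2) * lead_coeff P = (of_real m)\<^sup>2"
    and w: "w1 holomorphic_on UNIV" "w2 holomorphic_on UNIV"
      "\<And>z. deriv (deriv w1) z = - poly P z * w1 z" "\<And>z. deriv (deriv w2) z = - poly P z * w2 z"
      "\<And>z. w1 z * deriv w2 z - w2 z * deriv w1 z = c" "c \<noteq> 0"
  defines "L \<equiv> \<lambda>z. ln ((cmod (w1 z))\<^sup>2 + (cmod (w2 z))\<^sup>2)"
    and "zz \<equiv> \<lambda>\<rho> \<phi>. of_real (l * \<rho> powr (1 / m)) * cis (\<theta> + \<phi> / m)"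
  shows "\<exists>R>0. \<exists>C. \<forall>\<rho>\<ge>R. \<forall>\<phi>\<in>{0..pi/2}. - L (zz \<rho> \<phi>) \<le> degree P / 2 * ln (cmod (zz \<rho> \<phi>)) + C"
    and "\<And>\<eta>. 0 < \<eta> \<Longrightarrow> \<exists>R>0. \<forall>\<rho>\<ge>R. \<forall>\<phi>\<in>{0..pi/2}. \<bar>L (zz \<rho> \<phi>) - 2 * \<rho> * sin \<phi>\<bar> \<le> \<eta> * \<rho>"
    and "\<exists>\<gamma> C. curve_to_infinity \<gamma> \<and> asymptotic_direction \<gamma> \<theta> \<and>
           (\<forall>t\<ge>0. \<bar>L (\<gamma> t) + degree P / 2 * ln (cmod (\<gamma> t))\<bar> \<le> C)"
proof -
  define d a lam where "d = degree P" and "a = lead_coeff P" and "lam = of_real l * cis \<theta>"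
  have m1: "1 \<le> m" and a: "a \<noteq> 0" using m P by (auto simp: a_def)
  have lam: "lam \<noteq> 0" "cmod lam = l" "lam ^ (d + 2) * a = (of_real m)\<^sup>2"
    using l by (auto simp: lam_def norm_mult d_def a_def)
  define z where "z \<xi> = lam * exp (Ln \<xi> / of_real m)" for \<xi>
  define z' where "z' \<xi> = z \<xi> / (of_real m * \<xi>)" for \<xi>
  define Q where "Q x = poly P x / (a * x ^ d)" for x
  define b where "b \<xi> = csqrt (Q (z \<xi>))" for \<xi>
  define p where "p = 1 - 1 / m"
  have Hn: "\<xi> \<noteq> 0" "\<xi> \<notin> \<real>\<^sub>\<le>\<^sub>0" if "\<xi> \<in> tilted_half_plane S" "0 \<le> S" for \<xi> S
    using that by (auto simp: tilted_half_plane_def complex_nonpos_Reals_iff)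
  have Hnorm: "S / 2 < cmod \<xi>" if "\<xi> \<in> tilted_half_plane S" for \<xi> S
    using that complex_Re_le_cmod[of \<xi>] abs_Im_le_cmod[of \<xi>] by (auto simp: tilted_half_plane_def)
  have zn: "cmod (z \<xi>) = l * cmod \<xi> powr (1 / m)" if "\<xi> \<noteq> 0" for \<xi>
    using that lam(2) by (simp add: z_def norm_mult powr_def)
  have zpow: "z \<xi> ^ (d + 2) * a = (of_real m)\<^sup>2 * \<xi>\<^sup>2" if "\<xi> \<noteq> 0" for \<xi>
  proof -
    have dm: "of_nat (d + 2) = 2 * complex_of_real m"
      using m by (metis d_def of_real_of_nat_eq of_real_mult of_real_numeral of_nat_add of_nat_numeral)
    have "exp (Ln \<xi> / of_real m) ^ (d + 2) = exp (of_nat (d + 2) * (Ln \<xi> / of_real m))"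
      by (rule exp_of_nat_mult[symmetric])
    also have "\<dots> = exp (2 * Ln \<xi>)" using m1 unfolding dm by simp
    also have "\<dots> = \<xi>\<^sup>2" using that by (simp add: exp_double)
    finally have "exp (Ln \<xi> / of_real m) ^ (d + 2) = \<xi>\<^sup>2" .
    then show ?thesis using lam(3) unfolding z_def power_mult_distrib by (simp add: mult_ac)
  qed
  have bsq: "(b \<xi>)\<^sup>2 = poly P (z \<xi>) * (z' \<xi>)\<^sup>2" if "\<xi> \<noteq> 0" for \<xi>
  proof -
    have znz: "z \<xi> \<noteq> 0" using lam by (simp add: z_def)
    have "(z' \<xi>)\<^sup>2 = (z \<xi>)\<^sup>2 / (z \<xi> ^ (d + 2) * a)"
      unfolding zpow[OF that] by (simp add: z'_def power_divide power_mult_distrib)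
    also have "\<dots> = 1 / (a * z \<xi> ^ d)" using znz a by (simp add: power_add power2_eq_square)
    finally show ?thesis by (simp add: b_def Q_def)
  qed
  have Qlim: "(Q \<longlongrightarrow> 1) at_infinity"
  proof -
    have "((\<lambda>x. poly P x / x ^ d / a) \<longlongrightarrow> a / a) at_infinity"
      unfolding d_def a_def by (intro tendsto_divide poly_divide_tendsto_aux tendsto_const) (use P in simp)
    then show ?thesis using a by (simp add: Q_def[abs_def] mult.commute)
  qed
  have blim: "\<exists>S\<ge>S'. \<forall>\<xi>\<in>tilted_half_plane S. cmod (csqrt (Q (z \<xi>)) - 1) \<le> \<delta> \<and> cmod (Q (z \<xi>) - 1) < 1"
    if "0 < \<delta>" for \<delta> S'
  proof -
    have "((\<lambda>x. csqrt (Q x)) \<longlongrightarrow> csqrt 1) at_infinity"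
      by (rule continuous_within_tendsto_compose'[OF _ _ Qlim, of UNIV csqrt]) (auto intro!: continuous_at_csqrt)
    then have "eventually (\<lambda>x. dist (csqrt (Q x)) (csqrt 1) < \<delta>) at_infinity" using that by (rule tendstoD)
    moreover have "eventually (\<lambda>x. dist (Q x) 1 < 1) at_infinity" by (rule tendstoD[OF Qlim]) simp
    ultimately have "eventually (\<lambda>x. dist (csqrt (Q x)) (csqrt 1) < \<delta> \<and> dist (Q x) 1 < 1) at_infinity"
      by eventually_elim auto
    then obtain R where R: "\<And>x. R \<le> cmod x \<Longrightarrow> cmod (csqrt (Q x) - 1) < \<delta> \<and> cmod (Q x - 1) < 1"
      by (auto simp: eventually_at_infinity dist_norm)
    define S where "S = max S' (2 * ((\<bar>R\<bar> + 1) / l) powr m)"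
    have "R \<le> cmod (z \<xi>)" if "\<xi> \<in> tilted_half_plane S" for \<xi>
    proof -
      have "((\<bar>R\<bar> + 1) / l) powr m \<le> S / 2" by (simp add: S_def)
      then have "((\<bar>R\<bar> + 1) / l) powr m \<le> cmod \<xi>" using Hnorm[OF that] by simp
      then have "(((\<bar>R\<bar> + 1) / l) powr m) powr (1 / m) \<le> cmod \<xi> powr (1 / m)"
        using m1 by (intro powr_mono2) auto
      moreover have "(((\<bar>R\<bar> + 1) / l) powr m) powr (1 / m) = (\<bar>R\<bar> + 1) / l"
        using m1 l by (simp add: powr_powr)
      ultimately have "\<bar>R\<bar> + 1 \<le> l * cmod \<xi> powr (1 / m)" using l(1) by (simp add: pos_divide_le_eq mult.commute)
      moreover have "\<xi> \<noteq> 0" by (rule Hn(1)[OF that]) (simp add: S_def le_max_iff_disj)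
      ultimately show ?thesis using zn[of \<xi>] by simp
    qed
    then show ?thesis using R by (intro exI[of _ S]) (auto simp: S_def intro: less_imp_le)
  qed
  obtain S0 where S0: "1 \<le> S0" "\<And>\<xi>. \<xi> \<in> tilted_half_plane S0 \<Longrightarrow> cmod (Q (z \<xi>) - 1) < 1"
    using blim[of 1 1] by auto
  note Hn0 = Hn[of _ S0]
  have dz: "(z has_field_derivative z' \<xi>) (at \<xi>)" if "\<xi> \<in> tilted_half_plane S0" for \<xi>
    unfolding z_def z'_def using Hn0[OF that] S0 m1
    by (auto intro!: derivative_eq_intros simp: field_simps)
  have holz: "z holomorphic_on tilted_half_plane S0"
    using dz open_tilted_half_plane by (auto simp: holomorphic_on_open)
  have holz': "z' holomorphic_on tilted_half_plane S0"
    unfolding z'_def using Hn0 S0 m1 by (intro holomorphic_intros holz) auto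
  have nz': "cmod (z' \<xi>) = l / m * cmod \<xi> powr (- p)" if "\<xi> \<in> tilted_half_plane S0" for \<xi>
  proof -
    have "\<xi> \<noteq> 0" using Hn0[OF that] S0 by simp
    then have "cmod \<xi> powr (- p) = cmod \<xi> powr (1 / m) / cmod \<xi>"
      by (simp add: p_def powr_diff)
    then show ?thesis using zn[OF \<open>\<xi> \<noteq> 0\<close>] m1 by (simp add: z'_def norm_divide norm_mult)
  qed
  have p: "0 \<le> p" "p \<le> 1" "m * p = d / 2" using m1 m by (auto simp: p_def d_def field_simps)
  have holb: "b holomorphic_on tilted_half_plane S0"
    unfolding b_def
  proof (rule holomorphic_on_csqrt')
    show "(\<lambda>\<xi>. Q (z \<xi>)) holomorphic_on tilted_half_plane S0"
      unfolding Q_def using lam a by (intro holomorphic_intros holz) (auto simp: z_def)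
    show "Q (z \<xi>) \<notin> \<real>\<^sub>\<le>\<^sub>0" if "\<xi> \<in> tilted_half_plane S0" for \<xi>
      using S0(2)[OF that] abs_Re_le_cmod[of "Q (z \<xi>) - 1"] by (auto simp: complex_nonpos_Reals_iff)
  qed
  have blim': "\<exists>S\<ge>S0. \<forall>\<xi>\<in>tilted_half_plane S. cmod (b \<xi> - 1) \<le> \<delta>" if "0 < \<delta>" for \<delta>
    using blim[OF that, of S0] by (auto simp: b_def)
  have S0pos: "0 < S0" and lm: "0 < l / m" using S0 l m1 by auto
  have bsq': "(b \<xi>)\<^sup>2 = poly P (z \<xi>) * (z' \<xi>)\<^sup>2" if "\<xi> \<in> tilted_half_plane S0" for \<xi>
    using bsq[of \<xi>] Hn0[OF that] S0 by simp
  define h where "h x = (cmod (w1 x))\<^sup>2 + (cmod (w2 x))\<^sup>2" for x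
  obtain \<zeta> g S1 S2 A B where S12: "S0 \<le> S1" "0 < S2" and AB: "0 < A" "0 < B"
    and est: "\<And>\<xi>. \<xi> \<in> tilted_half_plane S1 \<Longrightarrow> \<zeta> \<xi> \<in> stokes_cone S2 \<Longrightarrow>
      A * exp (2 * \<bar>Im (\<zeta> \<xi>)\<bar>) \<le> cmod \<xi> powr p * h (z \<xi>) \<and>
      cmod \<xi> powr p * h (z \<xi>) \<le> B * exp (2 * \<bar>Im (\<zeta> \<xi>)\<bar>)"
    and growth: "\<And>\<delta>. 0 < \<delta> \<Longrightarrow> \<exists>C. \<exists>S\<ge>S1. \<forall>\<xi>\<in>tilted_half_plane S. cmod (\<zeta> \<xi> - \<xi>) \<le> \<delta> * cmod \<xi> + C"
    and contg: "continuous_on {S2..} g"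
    and g: "\<And>t. S2 \<le> t \<Longrightarrow> g t \<in> tilted_half_plane S1 \<and> \<zeta> (g t) = of_real t \<and> cmod (g t - of_real t) \<le> t / 10"
    unfolding h_def
    by (rule wkb_half_plane[OF S0pos dz holz' nz' p(1,2) lm holb bsq' blim' w]) blast+
  have est': "\<bar>L (z \<xi>) - (2 * \<bar>Im (\<zeta> \<xi>)\<bar> - d / 2 * (ln (cmod (z \<xi>)) - ln l))\<bar> \<le> \<bar>ln A\<bar> + \<bar>ln B\<bar>"
    if \<xi>: "\<xi> \<in> tilted_half_plane S1" "\<zeta> \<xi> \<in> stokes_cone S2" for \<xi>
  proof -
    have nz: "\<xi> \<noteq> 0" using Hn[OF \<xi>(1)] S12 S0 by simp
    have e: "A * exp (2 * \<bar>Im (\<zeta> \<xi>)\<bar>) \<le> cmod \<xi> powr p * h (z \<xi>)"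
      "cmod \<xi> powr p * h (z \<xi>) \<le> B * exp (2 * \<bar>Im (\<zeta> \<xi>)\<bar>)" using est[OF \<xi>] by auto
    have "0 < cmod \<xi> powr p * h (z \<xi>)" using AB(1) e(1) by (smt (verit) exp_gt_zero mult_pos_pos)
    then have hpos: "0 < h (z \<xi>)" using nz by (simp add: zero_less_mult_iff)
    have ln_eq: "ln (cmod \<xi> powr p * h (z \<xi>)) = p * ln (cmod \<xi>) + L (z \<xi>)"
      using hpos nz by (simp add: ln_mult ln_powr L_def flip: h_def)
    have "ln (A * exp (2 * \<bar>Im (\<zeta> \<xi>)\<bar>)) \<le> ln (cmod \<xi> powr p * h (z \<xi>))"
      "ln (cmod \<xi> powr p * h (z \<xi>)) \<le> ln (B * exp (2 * \<bar>Im (\<zeta> \<xi>)\<bar>))"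
      using e AB hpos nz by (auto intro!: ln_mono)
    then have *: "ln A + 2 * \<bar>Im (\<zeta> \<xi>)\<bar> \<le> p * ln (cmod \<xi>) + L (z \<xi>)"
      "p * ln (cmod \<xi>) + L (z \<xi>) \<le> ln B + 2 * \<bar>Im (\<zeta> \<xi>)\<bar>"
      using AB unfolding ln_eq by (auto simp: ln_mult)
    have "ln (cmod (z \<xi>)) = ln l + ln (cmod \<xi>) / m" using zn[OF nz] l nz by (simp add: ln_mult ln_powr)
    then have "ln (cmod \<xi>) = m * (ln (cmod (z \<xi>)) - ln l)" using m1 by simp
    then have "p * ln (cmod \<xi>) = m * p * (ln (cmod (z \<xi>)) - ln l)" by simp
    then have "p * ln (cmod \<xi>) = d / 2 * (ln (cmod (z \<xi>)) - ln l)" unfolding p(3) .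
    then show ?thesis using * by linarith
  qed
  \<comment> \<open>The closed quarter plane lies well inside the region where the estimate holds.\<close>
  have zz: "zz \<rho> \<phi> = z (of_real \<rho> * cis \<phi>)" if "0 < \<rho>" "\<phi> \<in> {0..pi/2}" for \<rho> \<phi>
  proof -
    have "\<bar>\<phi>\<bar> < pi" using that pi_gt_zero unfolding atLeastAtMost_iff by linarith
    then have "z (of_real \<rho> * cis \<phi>) = lam * exp (Complex (ln \<rho>) \<phi> / of_real m)"
      unfolding z_def using that by (simp add: Ln_polar)
    also have "Complex (ln \<rho>) \<phi> / of_real m = Complex (ln \<rho> / m) (\<phi> / m)"
      by (simp add: complex_eq_iff)
    also have "exp \<dots> = of_real (\<rho> powr (1 / m)) * cis (\<phi> / m)"
      using that by (simp add: exp_eq_polar powr_def)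
    finally show ?thesis by (simp add: zz_def lam_def cis_mult[symmetric] mult_ac)
  qed
  have quarter: "of_real \<rho> * cis \<phi> \<in> tilted_half_plane S" if "S < \<rho>" "0 < \<rho>" "\<phi> \<in> {0..pi/2}" for S \<rho> \<phi>
  proof -
    have "\<rho> * 1 \<le> \<rho> * (cos \<phi> + sin \<phi>)" using that cos_plus_sin_ge_1[of \<phi>] by (intro mult_left_mono) auto
    then show ?thesis using that by (simp add: tilted_half_plane_def distrib_left)
  qed
  obtain C1 S3 where S3: "S1 \<le> S3" and C1: "\<And>\<xi>. \<xi> \<in> tilted_half_plane S3 \<Longrightarrow> cmod (\<zeta> \<xi> - \<xi>) \<le> 1/100 * cmod \<xi> + C1"
    using growth[of "1/100"] by auto
  \<comment> \<open>Beyond this radius \<open>\<zeta> \<xi>\<close> is within \<open>\<rho> / 50\<close> of \<open>\<xi>\<close>, which the slopes of the cone tolerate.\<close>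
  define R0 where "R0 = 1 + \<bar>S3\<bar> + 100 * \<bar>C1\<bar> + 4 * S2"
  have R0: "0 < R0" "S3 < R0" "S1 < R0" using S12 S3 by (auto simp: R0_def)
  have in_cone: "\<zeta> (of_real \<rho> * cis \<phi>) \<in> stokes_cone S2" "of_real \<rho> * cis \<phi> \<in> tilted_half_plane S1"
    if \<rho>: "R0 \<le> \<rho>" and \<phi>: "\<phi> \<in> {0..pi/2}" for \<rho> \<phi>
  proof -
    let ?\<xi> = "of_real \<rho> * cis \<phi>"
    have \<rho>pos: "0 < \<rho>" using \<rho> R0 by simp
    show H1: "?\<xi> \<in> tilted_half_plane S1" using quarter \<rho> R0 \<rho>pos \<phi> by simp
    have "?\<xi> \<in> tilted_half_plane S3" using quarter \<rho> R0 \<rho>pos \<phi> by simp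
    from C1[OF this] have "cmod (\<zeta> ?\<xi> - ?\<xi>) \<le> 1/100 * \<rho> + C1" using \<rho>pos by (simp add: norm_mult)
    also have "\<dots> \<le> \<rho> / 50" using \<rho> S12 by (simp add: R0_def)
    finally have D: "cmod (\<zeta> ?\<xi> - ?\<xi>) \<le> \<rho> / 50" .
    have "\<bar>Re (\<zeta> ?\<xi> - ?\<xi>)\<bar> \<le> \<rho> / 50" "\<bar>Im (\<zeta> ?\<xi> - ?\<xi>)\<bar> \<le> \<rho> / 50"
      using D abs_Re_le_cmod[of "\<zeta> ?\<xi> - ?\<xi>"] abs_Im_le_cmod[of "\<zeta> ?\<xi> - ?\<xi>"] by linarith+
    moreover have Re_rho: "Re ?\<xi> = \<rho> * cos \<phi>" and Im_rho: "Im ?\<xi> = \<rho> * sin \<phi>" by simp_all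
    ultimately have ri: "\<rho> * cos \<phi> - \<rho> / 50 \<le> Re (\<zeta> ?\<xi>)" "\<rho> * sin \<phi> - \<rho> / 50 \<le> Im (\<zeta> ?\<xi>)"
      unfolding minus_complex.simps Re_rho Im_rho by linarith+
    have c: "0 \<le> \<rho> * cos \<phi>" "0 \<le> \<rho> * sin \<phi>" "\<rho> \<le> \<rho> * cos \<phi> + \<rho> * sin \<phi>"
      using cos_plus_sin_ge_1[of \<phi>] \<phi> \<rho>pos by (auto simp flip: distrib_left)
    have "4 * S2 \<le> \<rho>" using \<rho> S12 by (simp add: R0_def)
    then show "\<zeta> ?\<xi> \<in> stokes_cone S2"
      using ri c \<rho>pos unfolding stokes_cone_def by auto
  qed
  define K where "K = \<bar>ln A\<bar> + \<bar>ln B\<bar>"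
  have est2: "\<bar>L (zz \<rho> \<phi>) - (2 * \<bar>Im (\<zeta> (of_real \<rho> * cis \<phi>))\<bar> - d / 2 * (ln (cmod (zz \<rho> \<phi>)) - ln l))\<bar> \<le> K"
    if "R0 \<le> \<rho>" "\<phi> \<in> {0..pi/2}" for \<rho> \<phi>
    using est'[OF in_cone(2)[OF that] in_cone(1)[OF that]] that R0 by (simp add: zz K_def)
  show "\<exists>R>0. \<exists>C. \<forall>\<rho>\<ge>R. \<forall>\<phi>\<in>{0..pi/2}. - L (zz \<rho> \<phi>) \<le> degree P / 2 * ln (cmod (zz \<rho> \<phi>)) + C"
  proof (rule exI[of _ R0], rule conjI[OF R0(1)], rule exI[of _ "K - d / 2 * ln l"], intro allI impI ballI)
    fix \<rho> \<phi> :: real assume "R0 \<le> \<rho>" "\<phi> \<in> {0..pi/2}"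
    from est2[OF this] show "- L (zz \<rho> \<phi>) \<le> degree P / 2 * ln (cmod (zz \<rho> \<phi>)) + (K - d / 2 * ln l)"
      unfolding d_def right_diff_distrib by linarith
  qed
  show "\<exists>R>0. \<forall>\<rho>\<ge>R. \<forall>\<phi>\<in>{0..pi/2}. \<bar>L (zz \<rho> \<phi>) - 2 * \<rho> * sin \<phi>\<bar> \<le> \<eta> * \<rho>" if \<eta>: "0 < \<eta>" for \<eta>
  proof -
    obtain C S where S: "S1 \<le> S" and C: "\<And>\<xi>. \<xi> \<in> tilted_half_plane S \<Longrightarrow> cmod (\<zeta> \<xi> - \<xi>) \<le> \<eta> / 4 * cmod \<xi> + C"
      using growth[of "\<eta> / 4"] \<eta> by auto
    have "eventually (\<lambda>\<rho>. (K + 2 * C) + ln \<rho> \<le> \<eta> / 2 * \<rho>) at_top"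
      using \<eta> by (intro eventually_affine_ln_le) simp
    then obtain R where R: "\<And>\<rho>. R \<le> \<rho> \<Longrightarrow> (K + 2 * C) + ln \<rho> \<le> \<eta> / 2 * \<rho>"
      by (auto simp: eventually_at_top_linorder)
    define R' where "R' = 1 + max R (max R0 S)"
    have R': "R \<le> R'" "R0 \<le> R'" "S < R'" "1 \<le> R'" using R0 by (auto simp: R'_def)
    show ?thesis
    proof (intro exI[of _ R'] conjI allI impI ballI)
      show "0 < R'" using R' by simp
      fix \<rho> \<phi> :: real assume \<rho>: "R' \<le> \<rho>" and \<phi>: "\<phi> \<in> {0..pi/2}"
      let ?\<xi> = "of_real \<rho> * cis \<phi>"
      have \<rho>1: "1 \<le> \<rho>" "R0 \<le> \<rho>" using R' \<rho> by auto
      have "?\<xi> \<in> tilted_half_plane S" using \<rho> R' \<phi> by (intro quarter) auto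
      from C[OF this] have "cmod (\<zeta> ?\<xi> - ?\<xi>) \<le> \<eta> / 4 * \<rho> + C" using \<rho>1 by (simp add: norm_mult)
      then have I: "\<bar>Im (\<zeta> ?\<xi>) - \<rho> * sin \<phi>\<bar> \<le> \<eta> / 4 * \<rho> + C"
        using abs_Im_le_cmod[of "\<zeta> ?\<xi> - ?\<xi>"] by simp
      have s: "0 \<le> \<rho> * sin \<phi>" using cos_plus_sin_ge_1[of \<phi>] \<phi> \<rho>1 by auto
      have "ln (cmod (zz \<rho> \<phi>)) = ln l + ln \<rho> / m"
        using \<rho>1 l m1 by (simp add: zz_def norm_mult ln_mult ln_powr)
      then have "d / 2 * (ln (cmod (zz \<rho> \<phi>)) - ln l) = m * p * (ln \<rho> / m)" by (simp add: p(3))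
      also have "\<dots> = p * ln \<rho>" using m1 by simp
      finally have e: "d / 2 * (ln (cmod (zz \<rho> \<phi>)) - ln l) = p * ln \<rho>" .
      have "0 \<le> p * ln \<rho>" "p * ln \<rho> \<le> 1 * ln \<rho>"
        using p \<rho>1 by (simp, intro mult_right_mono, auto)
      moreover have "\<bar>\<bar>Im (\<zeta> ?\<xi>)\<bar> - \<rho> * sin \<phi>\<bar> \<le> \<eta> / 4 * \<rho> + C"
        using I s by linarith
      ultimately have "\<bar>L (zz \<rho> \<phi>) - 2 * (\<rho> * sin \<phi>)\<bar> \<le> K + 2 * (\<eta> / 4 * \<rho> + C) + ln \<rho>"
        using est2[OF \<rho>1(2) \<phi>] unfolding e abs_le_iff by argo
      also have "\<dots> \<le> \<eta> * \<rho>" using R[of \<rho>] R' \<rho> by simp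
      finally show "\<bar>L (zz \<rho> \<phi>) - 2 * \<rho> * sin \<phi>\<bar> \<le> \<eta> * \<rho>" by (simp add: mult.assoc)
    qed
  qed
  define \<gamma> where "\<gamma> t = z (g (S2 + t))" for t
  have gH: "g (S2 + t) \<in> tilted_half_plane S0" "g (S2 + t) \<in> tilted_half_plane S1" "g (S2 + t) \<noteq> 0"
     "g (S2 + t) \<notin> \<real>\<^sub>\<le>\<^sub>0" if "0 \<le> t" for t
  proof -
    show 1: "g (S2 + t) \<in> tilted_half_plane S1" using g[of "S2 + t"] that by simp
    then show "g (S2 + t) \<in> tilted_half_plane S0" using tilted_half_plane_mono[OF S12(1)] by auto
    show "g (S2 + t) \<noteq> 0" "g (S2 + t) \<notin> \<real>\<^sub>\<le>\<^sub>0" using Hn[OF 1] S12 S0 by auto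
  qed
  have cont\<gamma>: "continuous_on {0..} \<gamma>"
  proof -
    have "continuous_on {0..} (\<lambda>t. g (S2 + t))"
      by (rule continuous_on_compose2[OF contg]) (auto intro!: continuous_intros)
    then show ?thesis unfolding \<gamma>_def
      by (rule continuous_on_compose2[OF holomorphic_on_imp_continuous_on[OF holz]]) (use gH in auto)
  qed
  have g_lim: "((\<lambda>t. g (S2 + t) / of_real (S2 + t)) \<longlongrightarrow> 1) at_top"
  proof (rule tendstoI)
    fix e :: real assume e: "0 < e"
    obtain C S where S: "S1 \<le> S" and C: "\<And>\<xi>. \<xi> \<in> tilted_half_plane S \<Longrightarrow> cmod (\<zeta> \<xi> - \<xi>) \<le> e / 4 * cmod \<xi> + C"
      using growth[of "e / 4"] e by auto
    have "eventually (\<lambda>t. max 1 (max (2 * S) (4 * \<bar>C\<bar> / e)) \<le> t) at_top" by (rule eventually_ge_at_top)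
    then show "eventually (\<lambda>t. dist (g (S2 + t) / of_real (S2 + t)) 1 < e) at_top"
    proof eventually_elim
      case (elim t)
      define s where "s = S2 + t"
      have s: "1 \<le> s" "2 * S < s" "4 * \<bar>C\<bar> / e \<le> s" "S2 \<le> s" using elim S12 by (auto simp: s_def)
      have gs: "\<zeta> (g s) = of_real s" "cmod (g s - of_real s) \<le> s / 10" using g[OF s(4)] by auto
      have "\<bar>Re (g s - of_real s)\<bar> \<le> s / 10" "\<bar>Im (g s - of_real s)\<bar> \<le> s / 10"
        using gs(2) abs_Re_le_cmod[of "g s - of_real s"] abs_Im_le_cmod[of "g s - of_real s"] by linarith+
      then have "s - s / 10 \<le> Re (g s)" "- (s / 10) \<le> Im (g s)"
        unfolding minus_complex.simps Re_complex_of_real Im_complex_of_real by linarith+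
      then have "g s \<in> tilted_half_plane S" using s unfolding tilted_half_plane_def by simp
      from C[OF this] have "cmod (of_real s - g s) \<le> e / 4 * cmod (g s) + C" by (simp add: gs)
      moreover have "cmod (g s) \<le> 2 * s"
        using norm_triangle_ineq[of "of_real s" "g s - of_real s"] gs(2) s(1) by simp
      then have "e / 4 * cmod (g s) \<le> e / 4 * (2 * s)" using e by (intro mult_left_mono) auto
      moreover have "C \<le> e * s / 4" using s(3) e by (simp add: field_simps)
      moreover have "0 < e * s" using e s by simp
      ultimately have "cmod (of_real s - g s) < e * s" by linarith
      moreover have "g s / of_real s - 1 = (g s - of_real s) / of_real s" using s by (simp add: field_simps)
      ultimately show ?case
        unfolding s_def[symmetric] using s by (simp add: dist_norm norm_divide norm_minus_commute field_simps)
    qed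
  qed
  have gamma_inf: "filterlim \<gamma> at_infinity at_top"
  proof -
    have "filterlim (\<lambda>t. cmod (\<gamma> t)) at_top at_top"
    proof (rule filterlim_at_top_mono)
      show "filterlim (\<lambda>t. l * (t / 2) powr (1 / m)) at_top at_top"
      proof (rule filterlim_tendsto_pos_mult_at_top[OF tendsto_const l(1)])
        have "filterlim (\<lambda>t::real. t / 2) at_top at_top"
          using filterlim_tendsto_pos_mult_at_top[OF tendsto_const[of "1/2"] _ filterlim_ident] by simp
        then show "filterlim (\<lambda>t::real. (t / 2) powr (1 / m)) at_top at_top"
          using m1 by (intro filterlim_compose[OF filterlim_powr_at_top]) auto
      qed
      show "eventually (\<lambda>t. l * (t / 2) powr (1 / m) \<le> cmod (\<gamma> t)) at_top"
        using eventually_ge_at_top[of 0]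
      proof eventually_elim
        case (elim t)
        have "t / 2 \<le> cmod (g (S2 + t))"
          using g[of "S2 + t"] elim S12 norm_triangle_ineq2[of "of_real (S2 + t)" "g (S2 + t)"]
          by (simp add: norm_minus_commute flip: of_real_add)
        then show ?case using elim m1 l unfolding \<gamma>_def zn[OF gH(3)[OF elim]]
          by (intro mult_left_mono powr_mono2) auto
      qed
    qed
    then show ?thesis by (simp add: filterlim_at_infinity_conv_norm_at_top)
  qed
  have "asymptotic_direction \<gamma> \<theta>"
    unfolding asymptotic_direction_def
  proof (intro exI[of _ "\<lambda>t. \<theta> + Im (Ln (g (S2 + t))) / m"] conjI)
    show "eventually (\<lambda>t. \<gamma> t = of_real (cmod (\<gamma> t)) * cis (\<theta> + Im (Ln (g (S2 + t))) / m)) at_top"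
      using eventually_ge_at_top[of 0]
    proof eventually_elim
      case (elim t)
      let ?\<xi> = "g (S2 + t)"
      have nz: "?\<xi> \<noteq> 0" by (rule gH[OF elim])
      have "exp (Ln ?\<xi> / of_real m) = of_real (exp (ln (cmod ?\<xi>) / m)) * cis (Im (Ln ?\<xi>) / m)"
        using nz by (simp add: exp_eq_polar)
      also have "exp (ln (cmod ?\<xi>) / m) = cmod ?\<xi> powr (1 / m)" using nz by (simp add: powr_def)
      finally show ?case using zn[OF nz]
        by (simp add: \<gamma>_def z_def lam_def cis_mult[symmetric] mult_ac)
    qed
    have "((\<lambda>t. Ln (g (S2 + t) / of_real (S2 + t))) \<longlongrightarrow> Ln 1) at_top"
      by (rule tendsto_Ln[OF g_lim]) auto
    then have "((\<lambda>t. Im (Ln (g (S2 + t) / of_real (S2 + t)))) \<longlongrightarrow> 0) at_top"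
      using tendsto_Im by fastforce
    moreover have "eventually (\<lambda>t. Im (Ln (g (S2 + t) / of_real (S2 + t))) = Im (Ln (g (S2 + t)))) at_top"
      using eventually_ge_at_top[of 0]
    proof eventually_elim
      case (elim t)
      have s: "0 < S2 + t" using elim S12 by simp
      have "Ln (of_real (1 / (S2 + t)) * g (S2 + t)) = Ln (of_real (1 / (S2 + t))) + Ln (g (S2 + t))"
        using s gH(3)[OF elim] by (intro Ln_times_of_real) auto
      moreover have "Ln (of_real (1 / (S2 + t))) = complex_of_real (ln (1 / (S2 + t)))"
        using s by (intro Ln_of_real) auto
      ultimately have "Ln (of_real (1 / (S2 + t)) * g (S2 + t)) = complex_of_real (ln (1 / (S2 + t))) + Ln (g (S2 + t))"
        by simp
      then show ?case by simp
    qed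
    ultimately have "((\<lambda>t. Im (Ln (g (S2 + t)))) \<longlongrightarrow> 0) at_top"
      by (simp cong: filterlim_cong)
    then have "((\<lambda>t. \<theta> + Im (Ln (g (S2 + t))) / m) \<longlongrightarrow> \<theta> + 0 / m) at_top"
      using m1 by (intro tendsto_intros) auto
    then show "((\<lambda>t. \<theta> + Im (Ln (g (S2 + t))) / m) \<longlongrightarrow> \<theta>) at_top" by simp
  qed
  moreover have "\<forall>t\<ge>0. \<bar>L (\<gamma> t) + degree P / 2 * ln (cmod (\<gamma> t))\<bar> \<le> K + \<bar>d / 2 * ln l\<bar>"
  proof (intro allI impI)
    fix t :: real assume t: "0 \<le> t"
    have "\<zeta> (g (S2 + t)) = of_real (S2 + t)" using g[of "S2 + t"] t by simp
    moreover have "of_real (S2 + t) \<in> stokes_cone S2" using t S12 by (simp add: stokes_cone_def)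
    ultimately have "\<bar>L (\<gamma> t) - (0 - d / 2 * (ln (cmod (\<gamma> t)) - ln l))\<bar> \<le> K"
      using est'[OF gH(2)[OF t]] by (simp add: \<gamma>_def K_def)
    then show "\<bar>L (\<gamma> t) + degree P / 2 * ln (cmod (\<gamma> t))\<bar> \<le> K + \<bar>d / 2 * ln l\<bar>"
      unfolding d_def right_diff_distrib by linarith
  qed
  ultimately show "\<exists>\<gamma> C. curve_to_infinity \<gamma> \<and> asymptotic_direction \<gamma> \<theta> \<and>
           (\<forall>t\<ge>0. \<bar>L (\<gamma> t) + degree P / 2 * ln (cmod (\<gamma> t))\<bar> \<le> C)"
    using cont\<gamma> gamma_inf unfolding curve_to_infinity_def by blast
qed

lemma deriv_cnj_conjugate:
  assumes "f holomorphic_on UNIV"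
  shows "(\<lambda>z. cnj (f (cnj z))) holomorphic_on UNIV" "deriv (\<lambda>z. cnj (f (cnj z))) z = cnj (deriv f (cnj z))"
proof -
  have *: "((\<lambda>z. cnj (f (cnj z))) has_field_derivative cnj (deriv f (cnj z))) (at z)" for z
    using has_field_derivative_cnj_cnj[of f "deriv f (cnj z)" z] holomorphic_derivI[OF assms open_UNIV]
    by (simp add: o_def)
  show "(\<lambda>z. cnj (f (cnj z))) holomorphic_on UNIV" using * by (auto simp: holomorphic_on_open)
  show "deriv (\<lambda>z. cnj (f (cnj z))) z = cnj (deriv f (cnj z))" using * by (rule DERIV_imp_deriv)
qed

text \<open>The sector to the right of a critical direction is the mirror image of the one to the left for the
  conjugate equation, whose solutions are \<open>z \<mapsto> cnj (w (cnj z))\<close>.\<close>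

lemma wkb_polynomial_sector_signed:
  fixes P :: "complex poly" and w1 w2 :: "complex \<Rightarrow> complex" and l \<theta> m s :: real
  assumes P: "P \<noteq> 0" and m: "2 * m = real (degree P) + 2"
    and l: "0 < l" "(of_real l * cis \<theta>) ^ (degree P + 2) * lead_coeff P = (of_real m)\<^sup>2"
    and w: "w1 holomorphic_on UNIV" "w2 holomorphic_on UNIV"
      "\<And>z. deriv (deriv w1) z = - poly P z * w1 z" "\<And>z. deriv (deriv w2) z = - poly P z * w2 z"
      "\<And>z. w1 z * deriv w2 z - w2 z * deriv w1 z = c" "c \<noteq> 0"
    and s: "s \<in> {1, - 1}"
  defines "L \<equiv> \<lambda>z. ln ((cmod (w1 z))\<^sup>2 + (cmod (w2 z))\<^sup>2)"
    and "zz \<equiv> \<lambda>\<rho> \<phi>. of_real (l * \<rho> powr (1 / m)) * cis (\<theta> + s * \<phi> / m)"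
  shows "\<exists>R>0. \<exists>C. \<forall>\<rho>\<ge>R. \<forall>\<phi>\<in>{0..pi/2}. - L (zz \<rho> \<phi>) \<le> degree P / 2 * ln (cmod (zz \<rho> \<phi>)) + C" (is ?A)
    and "\<And>\<eta>. 0 < \<eta> \<Longrightarrow> \<exists>R>0. \<forall>\<rho>\<ge>R. \<forall>\<phi>\<in>{0..pi/2}. \<bar>L (zz \<rho> \<phi>) - 2 * \<rho> * sin \<phi>\<bar> \<le> \<eta> * \<rho>" (is "PROP ?B")
proof -
  have "?A \<and> (\<forall>\<eta>>0. \<exists>R>0. \<forall>\<rho>\<ge>R. \<forall>\<phi>\<in>{0..pi/2}. \<bar>L (zz \<rho> \<phi>) - 2 * \<rho> * sin \<phi>\<bar> \<le> \<eta> * \<rho>)"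
  proof (cases "s = 1")
    case True
    show ?thesis
      using wkb_polynomial_sector(1,2)[OF P m l w] True by (simp add: L_def zz_def)
  next
    case False
    then have s1: "s = - 1" using s by simp
    define P' where "P' = map_poly cnj P"
    define v1 where "v1 z = cnj (w1 (cnj z))" for z
    define v2 where "v2 z = cnj (w2 (cnj z))" for z
    have P': "P' \<noteq> 0" "degree P' = degree P" "lead_coeff P' = cnj (lead_coeff P)"
      using P by (simp_all add: P'_def degree_map_poly map_poly_eq_0_iff coeff_map_poly)
    have l': "(of_real l * cis (- \<theta>)) ^ (degree P' + 2) * lead_coeff P' = (of_real m)\<^sup>2"
    proof -
      have "(of_real l * cis (- \<theta>)) ^ (degree P' + 2) * lead_coeff P' =
         cnj ((of_real l * cis \<theta>) ^ (degree P + 2) * lead_coeff P)"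
        using P'(3) by (simp add: P'(2) cis_cnj)
      then show ?thesis unfolding l(2) by simp
    qed
    have v: "v1 holomorphic_on UNIV" "v2 holomorphic_on UNIV"
      unfolding v1_def v2_def by (intro deriv_cnj_conjugate w)+
    have dv: "deriv v1 = (\<lambda>z. cnj (deriv w1 (cnj z)))" "deriv v2 = (\<lambda>z. cnj (deriv w2 (cnj z)))"
      unfolding v1_def v2_def using deriv_cnj_conjugate(2)[OF w(1)] deriv_cnj_conjugate(2)[OF w(2)] by auto
    have ddv: "deriv (deriv v1) z = - poly P' z * v1 z" "deriv (deriv v2) z = - poly P' z * v2 z" for z
      unfolding dv using deriv_cnj_conjugate(2)[OF holomorphic_deriv[OF w(1) open_UNIV]]
         deriv_cnj_conjugate(2)[OF holomorphic_deriv[OF w(2) open_UNIV]]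
      by (simp_all add: w(3,4) P'_def poly_map_poly_cnj v1_def v2_def)
    have wr: "v1 z * deriv v2 z - v2 z * deriv v1 z = cnj c" for z
      using w(5)[of "cnj z", symmetric] by (simp add: dv v1_def v2_def)
    have zz': "cnj (zz \<rho> \<phi>) = of_real (l * \<rho> powr (1 / m)) * cis (- \<theta> + \<phi> / m)" for \<rho> \<phi>
      by (simp add: zz_def s1 cis_cnj)
    have LL: "ln ((cmod (v1 (cnj z)))\<^sup>2 + (cmod (v2 (cnj z)))\<^sup>2) = L z" for z
      by (simp add: L_def v1_def v2_def)
    have m': "2 * m = real (degree P') + 2" using m P' by simp
    have c: "cnj c \<noteq> 0" using w by simp
    show ?thesis
      using wkb_polynomial_sector(1,2)[OF P'(1) m' l(1) l' v ddv wr c]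
      unfolding zz'[symmetric] LL P'(2) by simp
  qed
  then show ?A "PROP ?B" by auto
qed

text \<open>The critical directions are \<open>\<theta>0 + \<pi> j / m\<close>, and there are \<open>2 m = deg P + 2\<close> of them modulo
  \<open>2 \<pi>\<close>. The sectors of opening \<open>\<pi> / (2 m)\<close> on both sides of them cover the plane, and all constants can be taken as
  maxima over these finitely many sectors.\<close>

lemma wkb_polynomial_plane:
  fixes P :: "complex poly" and w1 w2 :: "complex \<Rightarrow> complex" and m :: real
  assumes P: "P \<noteq> 0" and m: "2 * m = real (degree P) + 2"
    and w: "w1 holomorphic_on UNIV" "w2 holomorphic_on UNIV"
      "\<And>z. deriv (deriv w1) z = - poly P z * w1 z" "\<And>z. deriv (deriv w2) z = - poly P z * w2 z"
      "\<And>z. w1 z * deriv w2 z - w2 z * deriv w1 z = c" "c \<noteq> 0"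
  defines "L \<equiv> \<lambda>z. ln ((cmod (w1 z))\<^sup>2 + (cmod (w2 z))\<^sup>2)"
  obtains \<kappa> \<theta>0 R C :: real where "0 < \<kappa>"
    "\<And>z. R \<le> cmod z \<Longrightarrow> - L z \<le> degree P / 2 * ln (cmod z) + C"
    "\<And>\<eta>. 0 < \<eta> \<Longrightarrow> \<exists>R. \<forall>r\<ge>R. \<forall>\<theta>. \<bar>L (of_real r * cis \<theta>) - \<kappa> * r powr m * \<bar>sin (m * (\<theta> - \<theta>0))\<bar>\<bar> \<le> \<eta> * r powr m"
    "\<And>\<theta>. sin (m * (\<theta> - \<theta>0)) = 0 \<Longrightarrow> \<exists>\<gamma> C. curve_to_infinity \<gamma> \<and> asymptotic_direction \<gamma> \<theta> \<and>
           (\<forall>t\<ge>0. \<bar>L (\<gamma> t) + degree P / 2 * ln (cmod (\<gamma> t))\<bar> \<le> C)"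
proof -
  define d a where "d = degree P" and "a = lead_coeff P"
  have m1: "1 \<le> m" and a: "a \<noteq> 0" using m P by (auto simp: a_def)
  have d2: "real (d + 2) = 2 * m" using m by (simp add: d_def)
  define l where "l = (m\<^sup>2 / cmod a) powr (1 / (2 * m))"
  define \<theta>0 where "\<theta>0 = - Arg a / (2 * m)"
  have l: "0 < l" using a m1 by (simp add: l_def)
  have lpow: "l ^ (d + 2) * cmod a = m\<^sup>2"
  proof -
    have "l ^ (d + 2) = l powr (2 * m)" using powr_realpow[OF l, of "d + 2"] unfolding d2 by simp
    also have "\<dots> = m\<^sup>2 / cmod a" using a m1 by (simp add: l_def powr_powr)
    finally show ?thesis using a by simp
  qed
  have turn: "(of_real l * cis \<theta>) ^ (degree P + 2) * lead_coeff P = (of_real m)\<^sup>2"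
    if "m * (\<theta> - \<theta>0) = pi * of_int j" for \<theta> j
  proof -
    have "2 * m * \<theta> = 2 * pi * of_int j + 2 * m * \<theta>0" using that by (simp add: algebra_simps)
    then have "real (d + 2) * \<theta> = 2 * pi * of_int j - Arg a"
      using m1 unfolding d2 by (simp add: \<theta>0_def)
    moreover have "cis \<theta> ^ (d + 2) = cis (real (d + 2) * \<theta>)" by (rule Complex.DeMoivre)
    ultimately have "cis \<theta> ^ (d + 2) = cis (2 * pi * of_int j - Arg a)" by simp
    also have "\<dots> = cis (- Arg a)"
      using cis_mult[of "2 * pi * of_int j" "- Arg a"] by (simp add: cis_multiple_2pi)
    finally have 1: "(of_real l * cis \<theta>) ^ (d + 2) * a = of_real (l ^ (d + 2)) * (cis (- Arg a) * a)"
      by (simp add: power_mult_distrib)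
    have "cis (- Arg a) * a = cis (- Arg a) * (of_real (cmod a) * cis (Arg a))"
      using rcis_cmod_Arg[of a] by (simp add: rcis_def)
    also have "\<dots> = of_real (cmod a)" by (simp add: mult.left_commute[of "cis _"] cis_mult)
    finally have "cis (- Arg a) * a = of_real (cmod a)" .
    with 1 have "(of_real l * cis \<theta>) ^ (d + 2) * a = of_real (l ^ (d + 2) * cmod a)" by simp
    also have "\<dots> = (of_real m)\<^sup>2" unfolding lpow by simp
    finally show ?thesis by (simp add: d_def a_def)
  qed
  define J where "J = {0..<int (d + 2)} \<times> {1::real, -1}"
  define \<theta>j where "\<theta>j j = \<theta>0 + pi * of_int j / m" for j :: int
  define zz where "zz j s \<rho> \<phi> = of_real (l * \<rho> powr (1 / m)) * cis (\<theta>j j + s * \<phi> / m)" for j s \<rho> \<phi>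
  have finJ: "finite J" "J \<noteq> {}" by (auto simp: J_def)
  have tj: "m * (\<theta>j j - \<theta>0) = pi * of_int j" for j using m1 by (simp add: \<theta>j_def)
  \<comment> \<open>Every point lies in one of finitely many half-sectors bounded by a critical ray.\<close>
  have cover: "\<exists>(j, s)\<in>J. \<exists>\<phi>\<in>{0..pi/2}. of_real r * cis \<theta> = zz j s ((r / l) powr m) \<phi> \<and> \<bar>sin (m * (\<theta> - \<theta>0))\<bar> = sin \<phi>"
    if r: "0 < r" for r \<theta>
  proof -
    define k where "k = round (m * (\<theta> - \<theta>0) / pi)"
    define \<psi> where "\<psi> = m * (\<theta> - \<theta>0) - pi * of_int k"
    define s where "s = (if 0 \<le> \<psi> then 1 else - 1 :: real)"
    define j where "j = k mod int (d + 2)"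
    have "\<bar>of_int k - m * (\<theta> - \<theta>0) / pi\<bar> \<le> 1/2" unfolding k_def by (rule of_int_round_abs_le)
    then have "pi * \<bar>of_int k - m * (\<theta> - \<theta>0) / pi\<bar> \<le> pi * (1/2)" by (intro mult_left_mono) auto
    then have "\<bar>pi * (of_int k - m * (\<theta> - \<theta>0) / pi)\<bar> \<le> pi / 2" by (simp add: abs_mult)
    moreover have "pi * (of_int k - m * (\<theta> - \<theta>0) / pi) = - \<psi>"
    proof -
      have "pi * (x - X / pi) = pi * x - X" for x X by (simp add: right_diff_distrib)
      then show ?thesis by (simp add: \<psi>_def)
    qed
    ultimately have \<psi>: "\<bar>\<psi>\<bar> \<le> pi / 2" by simp
    have s\<psi>: "s * \<bar>\<psi>\<bar> = \<psi>" by (simp add: s_def)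
    have sgn: "cis (pi * of_int k) = 1 \<or> cis (pi * of_int k) = -1"
      by (cases "even k") (auto elim!: evenE oddE simp: distrib_left cis_mult[symmetric] cis_multiple_2pi mult.assoc[symmetric] mult.commute[of pi 2])
    have "sin (m * (\<theta> - \<theta>0)) = Im (cis (pi * of_int k) * cis \<psi>)" by (simp add: cis_mult \<psi>_def)
    then have "\<bar>sin (m * (\<theta> - \<theta>0))\<bar> = \<bar>sin \<psi>\<bar>" using sgn by auto
    also have "\<dots> = sin \<bar>\<psi>\<bar>"
      using \<psi> sin_ge_zero[of \<psi>] sin_ge_zero[of "- \<psi>"] by (cases "0 \<le> \<psi>") auto
    finally have 1: "\<bar>sin (m * (\<theta> - \<theta>0))\<bar> = sin \<bar>\<psi>\<bar>" .
    obtain q where q: "k = j + int (d + 2) * q" unfolding j_def by (metis mod_mult_div_eq)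
    have "\<theta> = \<theta>0 + pi * of_int k / m + s * \<bar>\<psi>\<bar> / m"
    proof -
      have "m * (\<theta> - \<theta>0) = pi * of_int k + \<psi>" by (simp add: \<psi>_def)
      then have "\<theta> - \<theta>0 = (pi * of_int k + \<psi>) / m" using m1 by (simp add: eq_divide_eq mult.commute)
      then show ?thesis unfolding s\<psi> by (simp add: add_divide_distrib)
    qed
    also have "real_of_int k = of_int j + 2 * m * of_int q" unfolding q using d2 by simp
    finally have "\<theta> = \<theta>j j + s * \<bar>\<psi>\<bar> / m + 2 * pi * of_int q" using m1 by (simp add: \<theta>j_def field_simps)
    then have "cis \<theta> = cis (\<theta>j j + s * \<bar>\<psi>\<bar> / m)" by (simp add: cis_mult[symmetric] cis_multiple_2pi)
    moreover have "l * ((r / l) powr m) powr (1 / m) = r" using r l m1 by (simp add: powr_powr)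
    ultimately have "of_real r * cis \<theta> = zz j s ((r / l) powr m) \<bar>\<psi>\<bar>" by (simp add: zz_def)
    moreover have "(j, s) \<in> J" by (auto simp: J_def j_def s_def)
    ultimately show ?thesis using 1 \<psi> by (intro bexI[of _ "(j, s)"]) auto
  qed
  have sec: "\<exists>R>0. \<exists>C. \<forall>\<rho>\<ge>R. \<forall>\<phi>\<in>{0..pi/2}. - L (zz j s \<rho> \<phi>) \<le> degree P / 2 * ln (cmod (zz j s \<rho> \<phi>)) + C"
    "0 < \<eta> \<Longrightarrow> \<exists>R>0. \<forall>\<rho>\<ge>R. \<forall>\<phi>\<in>{0..pi/2}. \<bar>L (zz j s \<rho> \<phi>) - 2 * \<rho> * sin \<phi>\<bar> \<le> \<eta> * \<rho>"
    if "(j, s) \<in> J" for j s \<eta>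
    using wkb_polynomial_sector_signed(1)[OF P m l turn[OF tj] w, of s j]
      wkb_polynomial_sector_signed(2)[OF P m l turn[OF tj] w, of s \<eta> j] that
    unfolding L_def zz_def J_def by blast+
  have "\<forall>x\<in>J. \<exists>R C. \<forall>\<rho>\<ge>R. \<forall>\<phi>\<in>{0..pi/2}. - L (zz (fst x) (snd x) \<rho> \<phi>) \<le> degree P / 2 * ln (cmod (zz (fst x) (snd x) \<rho> \<phi>)) + C"
    using sec(1) by (metis prod.collapse)
  then obtain Rf Cf where RC: "\<And>x \<rho> \<phi>. x \<in> J \<Longrightarrow> Rf x \<le> \<rho> \<Longrightarrow> \<phi> \<in> {0..pi/2} \<Longrightarrow>
      - L (zz (fst x) (snd x) \<rho> \<phi>) \<le> degree P / 2 * ln (cmod (zz (fst x) (snd x) \<rho> \<phi>)) + Cf x"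
    by metis
  define R where "R = 1 + Max (Rf ` J)"
  define C where "C = Max (Cf ` J)"
  define R1 where "R1 = 1 + l * \<bar>R\<bar> powr (1 / m)"
  have Rpow: "R \<le> (r / l) powr m \<and> 0 < r" if "1 + l * \<bar>R\<bar> powr (1 / m) \<le> r" for r R
  proof -
    have r: "0 < r" using that l by (smt (verit) mult_nonneg_nonneg powr_ge_zero)
    have "\<bar>R\<bar> powr (1 / m) \<le> r / l" using that l by (simp add: field_simps)
    then have "(\<bar>R\<bar> powr (1 / m)) powr m \<le> (r / l) powr m" using m1 by (intro powr_mono2) auto
    moreover have "(\<bar>R\<bar> powr (1 / m)) powr m = \<bar>R\<bar>" using m1 by (simp add: powr_powr)
    ultimately show ?thesis using r by simp
  qed
  show ?thesis
  proof (rule that[of "2 / l powr m" R1 C \<theta>0])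
    show "0 < 2 / l powr m" using l by simp
    fix z assume z: "R1 \<le> cmod z"
    have z0: "0 < cmod z" and zR: "R \<le> (cmod z / l) powr m" using Rpow[OF z[unfolded R1_def]] by auto
    have "z = of_real (cmod z) * cis (Arg z)" using rcis_cmod_Arg[of z] by (simp add: rcis_def)
    with cover[OF z0, of "Arg z"] obtain j s \<phi> where x: "(j, s) \<in> J" "\<phi> \<in> {0..pi/2}" "z = zz j s ((cmod z / l) powr m) \<phi>"
      by auto
    have "Rf (j, s) \<le> Max (Rf ` J)" "Cf (j, s) \<le> C" unfolding C_def using finJ x(1) by (intro Max_ge; auto)+
    then have "Rf (j, s) \<le> (cmod z / l) powr m" using zR by (simp add: R_def)
    from RC[OF x(1) this x(2)] show "- L z \<le> degree P / 2 * ln (cmod z) + C"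
      using \<open>Cf (j, s) \<le> C\<close> x(3) by simp
  next
    fix \<eta> :: real assume \<eta>: "0 < \<eta>"
    define \<eta>' where "\<eta>' = \<eta> * l powr m"
    have \<eta>': "0 < \<eta>'" using \<eta> l by (simp add: \<eta>'_def)
    have "\<forall>x\<in>J. \<exists>R. \<forall>\<rho>\<ge>R. \<forall>\<phi>\<in>{0..pi/2}. \<bar>L (zz (fst x) (snd x) \<rho> \<phi>) - 2 * \<rho> * sin \<phi>\<bar> \<le> \<eta>' * \<rho>"
      using sec(2)[OF _ \<eta>'] by (metis prod.collapse)
    then obtain Rg where Rg: "\<And>x \<rho> \<phi>. x \<in> J \<Longrightarrow> Rg x \<le> \<rho> \<Longrightarrow> \<phi> \<in> {0..pi/2} \<Longrightarrow>
        \<bar>L (zz (fst x) (snd x) \<rho> \<phi>) - 2 * \<rho> * sin \<phi>\<bar> \<le> \<eta>' * \<rho>" by metis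
    define R' where "R' = 1 + l * \<bar>Max (Rg ` J)\<bar> powr (1 / m)"
    show "\<exists>R. \<forall>r\<ge>R. \<forall>\<theta>. \<bar>L (of_real r * cis \<theta>) - 2 / l powr m * r powr m * \<bar>sin (m * (\<theta> - \<theta>0))\<bar>\<bar> \<le> \<eta> * r powr m"
    proof (intro exI[of _ R'] allI impI)
      fix r \<theta> :: real assume r: "R' \<le> r"
      have r0: "0 < r" and rR: "Max (Rg ` J) \<le> (r / l) powr m" using Rpow[OF r[unfolded R'_def]] by auto
      obtain j s \<phi> where x: "(j, s) \<in> J" "\<phi> \<in> {0..pi/2}" "of_real r * cis \<theta> = zz j s ((r / l) powr m) \<phi>"
         "\<bar>sin (m * (\<theta> - \<theta>0))\<bar> = sin \<phi>" using cover[OF r0, of \<theta>] by auto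
      have "Rg (j, s) \<le> Max (Rg ` J)" using finJ x(1) by (intro Max_ge) auto
      then have "Rg (j, s) \<le> (r / l) powr m" using rR by simp
      from Rg[OF x(1) this x(2)] have "\<bar>L (of_real r * cis \<theta>) - 2 * (r / l) powr m * sin \<phi>\<bar> \<le> \<eta>' * (r / l) powr m"
        by (simp add: x(3))
      moreover have "(r / l) powr m = r powr m / l powr m" using r0 l by (simp add: powr_divide)
      ultimately show "\<bar>L (of_real r * cis \<theta>) - 2 / l powr m * r powr m * \<bar>sin (m * (\<theta> - \<theta>0))\<bar>\<bar> \<le> \<eta> * r powr m"
        unfolding x(4) using l by (simp add: \<eta>'_def)
    qed
  next
    fix \<theta> assume "sin (m * (\<theta> - \<theta>0)) = 0"
    then obtain j where j: "m * (\<theta> - \<theta>0) = of_int j * pi" unfolding sin_zero_iff_int2 by blast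
    have "m * (\<theta> - \<theta>0) = pi * of_int j" using j by (simp add: mult.commute)
    from wkb_polynomial_sector(3)[OF P m l turn[OF this] w]
    show "\<exists>\<gamma> C. curve_to_infinity \<gamma> \<and> asymptotic_direction \<gamma> \<theta> \<and>
           (\<forall>t\<ge>0. \<bar>L (\<gamma> t) + degree P / 2 * ln (cmod (\<gamma> t))\<bar> \<le> C)"
      by (simp add: L_def)
  qed
qed

section \<open>Jets of solutions\<close>

text \<open>The second-order information about a solution in complex form: \<open>g = u\<^bsub>z\<^esub>\<close>, and the two parts of the derivative of
  \<open>g\<close> say \<open>u\<^bsub>zz\<^esub> = T + (u\<^bsub>z\<^esub>)\<^sup>2\<close> and \<open>4 u\<^bsub>z z'\<^esub> = - e\<^sup>2\<^sup>u\<close>, which is the Liouville equation. It is relative to a set because a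
  developing map is first compared with the solution on a small disc.\<close>

definition liouville_jet ::
  "(complex \<Rightarrow> real) \<Rightarrow> (complex \<Rightarrow> complex) \<Rightarrow> (complex \<Rightarrow> complex) \<Rightarrow> complex set \<Rightarrow> bool" where
  "liouville_jet u g T S \<longleftrightarrow> (\<forall>z\<in>S.
     (u has_derivative (\<lambda>h. 2 * Re (g z * h))) (at z) \<and>
     (g has_derivative (\<lambda>h. (T z + (g z)\<^sup>2) * h - of_real (exp (2 * u z)) / 4 * cnj h)) (at z))"

definition norm_square_pair :: "(complex \<Rightarrow> complex) \<Rightarrow> (complex \<Rightarrow> complex) \<Rightarrow> complex \<Rightarrow> real" where
  "norm_square_pair w1 w2 z = (cmod (w1 z))\<^sup>2 + (cmod (w2 z))\<^sup>2"

lemma norm_square_pair_pos: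
  assumes "deriv w1 z * w2 z - w1 z * deriv w2 z = 1"
  shows "0 < norm_square_pair w1 w2 z"
  using assms by (auto simp: norm_square_pair_def sum_power2_gt_zero_iff)

text \<open>With \<open>H = \<bar>w1\<bar>\<^sup>2 + \<bar>w2\<bar>\<^sup>2\<close>, \<open>A = H\<^bsub>z\<^esub>\<close> and \<open>B = \<bar>w1'\<bar>\<^sup>2 + \<bar>w2'\<bar>\<^sup>2\<close>, Lagrange's identity says that
  \<open>\<bar>A\<bar>\<^sup>2 - B H\<close> is minus the squared modulus of the Wronskian. This is what turns the mixed derivative of
  \<open>ln H\<close> into \<open>1 / H\<^sup>2\<close>.\<close>

lemma liouville_jet_norm_square_pair:
  assumes "open S" and w: "w1 holomorphic_on S" "w2 holomorphic_on S"
    and ode: "\<And>z. z \<in> S \<Longrightarrow> deriv (deriv w1) z = - T z * w1 z" "\<And>z. z \<in> S \<Longrightarrow> deriv (deriv w2) z = - T z * w2 z"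
    and wr: "\<And>z. z \<in> S \<Longrightarrow> deriv w1 z * w2 z - w1 z * deriv w2 z = 1"
  shows "liouville_jet (\<lambda>z. ln 2 - ln (norm_square_pair w1 w2 z))
     (\<lambda>z. - (deriv w1 z * cnj (w1 z) + deriv w2 z * cnj (w2 z)) / of_real (norm_square_pair w1 w2 z)) T S"
  unfolding liouville_jet_def
proof (intro ballI conjI)
  fix z assume z: "z \<in> S"
  define A where "A z = deriv w1 z * cnj (w1 z) + deriv w2 z * cnj (w2 z)" for z
  define H where "H z = w1 z * cnj (w1 z) + w2 z * cnj (w2 z)" for z
  have Hh: "of_real (norm_square_pair w1 w2 z) = H z" for z
    by (simp add: norm_square_pair_def H_def complex_norm_square del: of_real_power)
  have hH: "norm_square_pair w1 w2 z = Re (H z)" for z using Hh[of z] by (metis Re_complex_of_real)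
  have "H z \<noteq> 0" using norm_square_pair_pos[OF wr[OF z]] Hh[of z] by auto
  have dw: "(w1 has_derivative (\<lambda>h. deriv w1 z * h)) (at z)" "(w2 has_derivative (\<lambda>h. deriv w2 z * h)) (at z)"
    using holomorphic_derivI[OF w(1) \<open>open S\<close> z] holomorphic_derivI[OF w(2) \<open>open S\<close> z]
    by (simp_all add: has_field_derivative_def)
  have ddw: "(deriv w1 has_derivative (\<lambda>h. - T z * w1 z * h)) (at z)" "(deriv w2 has_derivative (\<lambda>h. - T z * w2 z * h)) (at z)"
    using holomorphic_derivI[OF holomorphic_deriv[OF w(1) \<open>open S\<close>] \<open>open S\<close> z]
      holomorphic_derivI[OF holomorphic_deriv[OF w(2) \<open>open S\<close>] \<open>open S\<close> z]
    unfolding has_field_derivative_def ode[OF z] by blast+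
  have dc: "((\<lambda>z. cnj (w1 z)) has_derivative (\<lambda>h. cnj (deriv w1 z * h))) (at z)"
    "((\<lambda>z. cnj (w2 z)) has_derivative (\<lambda>h. cnj (deriv w2 z * h))) (at z)"
    by (rule bounded_linear.has_derivative[OF bounded_linear_cnj] dw)+
  have dH: "(H has_derivative (\<lambda>h. A z * h + cnj (A z * h))) (at z)"
  proof -
    have "(H has_derivative (\<lambda>h. (w1 z * cnj (deriv w1 z * h) + deriv w1 z * h * cnj (w1 z)) +
        (w2 z * cnj (deriv w2 z * h) + deriv w2 z * h * cnj (w2 z)))) (at z)"
      unfolding H_def by (intro has_derivative_add has_derivative_mult dw dc)
    then show ?thesis by (rule back_subst) (auto simp: A_def algebra_simps)
  qed
  define B where "B = deriv w1 z * cnj (deriv w1 z) + deriv w2 z * cnj (deriv w2 z)"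
  have dA: "(A has_derivative (\<lambda>h. - T z * H z * h + B * cnj h)) (at z)"
  proof -
    have "(A has_derivative (\<lambda>h. (deriv w1 z * cnj (deriv w1 z * h) + (- T z * w1 z * h) * cnj (w1 z)) +
        (deriv w2 z * cnj (deriv w2 z * h) + (- T z * w2 z * h) * cnj (w2 z)))) (at z)"
      unfolding A_def by (intro has_derivative_add has_derivative_mult ddw dc)
    then show ?thesis by (rule back_subst) (auto simp: B_def H_def algebra_simps)
  qed
  have lagrange: "A z * cnj (A z) - B * H z = - 1"
  proof -
    have "A z * cnj (A z) - B * H z =
       - ((deriv w1 z * w2 z - w1 z * deriv w2 z) * cnj (deriv w1 z * w2 z - w1 z * deriv w2 z))"
      by (simp add: A_def B_def H_def algebra_simps)
    then show ?thesis by (simp add: wr[OF z])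
  qed
  have h: "norm_square_pair w1 w2 z = Re (H z)" "0 < Re (H z)"
    using norm_square_pair_pos[OF wr[OF z]] hH[of z] by simp_all
  have dRe: "((\<lambda>z. Re (H z)) has_derivative (\<lambda>h. Re (A z * h + cnj (A z * h)))) (at z)"
    by (rule bounded_linear.has_derivative[OF bounded_linear_Re dH])
  have "((\<lambda>z. ln 2 - ln (Re (H z))) has_derivative (\<lambda>x. 0 - Re (A z * x + cnj (A z * x)) * inverse (Re (H z)))) (at z)"
    by (intro has_derivative_diff has_derivative_const has_derivative_ln dRe h)
  moreover have "0 - Re (A z * x + cnj (A z * x)) * inverse (Re (H z)) = 2 * Re (- A z / of_real (Re (H z)) * x)" for x
  proof -
    have "- A z / of_real (Re (H z)) * x = of_real (inverse (Re (H z))) * (- (A z * x))"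
      by (simp add: divide_inverse)
    then have "Re (- A z / of_real (Re (H z)) * x) = inverse (Re (H z)) * (- Re (A z * x))"
      by (simp only: Re_complex_of_real times_complex.simps Im_complex_of_real) simp
    moreover have "Re (X + cnj X) = 2 * Re X" for X by simp
    moreover have "0 - 2 * R * i = 2 * (i * - R)" for R i :: real by simp
    ultimately show ?thesis by metis
  qed
  ultimately show "((\<lambda>z. ln 2 - ln (norm_square_pair w1 w2 z)) has_derivative
          (\<lambda>h. 2 * Re (- (deriv w1 z * cnj (w1 z) + deriv w2 z * cnj (w2 z)) / of_real (norm_square_pair w1 w2 z) * h))) (at z)"
    by (simp add: hH A_def)
  have "((\<lambda>z. - A z / H z) has_derivative (\<lambda>h. - (- A z) * (inverse (H z) * (A z * h + cnj (A z * h)) * inverse (H z))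
      + - (- T z * H z * h + B * cnj h) / H z)) (at z)"
    by (intro has_derivative_divide has_derivative_minus dA dH \<open>H z \<noteq> 0\<close>)
  moreover have "- (- A z) * (inverse (H z) * (A z * h + cnj (A z * h)) * inverse (H z)) + - (- T z * H z * h + B * cnj h) / H z
     = (T z + (- A z / H z)\<^sup>2) * h - 1 / (H z)\<^sup>2 * cnj h" for h
  proof -
    have "- (- A z) * (inverse (H z) * (A z * h + cnj (A z * h)) * inverse (H z)) + - (- T z * H z * h + B * cnj h) / H z
      = (T z + (A z / H z)\<^sup>2) * h + (A z * cnj (A z) - B * H z) / (H z)\<^sup>2 * cnj h"
      using \<open>H z \<noteq> 0\<close> by (simp add: field_simps power2_eq_square)
    then show ?thesis unfolding lagrange by (simp add: power_divide)
  qed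
  ultimately have "((\<lambda>z. - A z / H z) has_derivative (\<lambda>h. (T z + (- A z / H z)\<^sup>2) * h - 1 / (H z)\<^sup>2 * cnj h)) (at z)" by simp
  moreover have "of_real (exp (2 * (ln 2 - ln (norm_square_pair w1 w2 z)))) / 4 = 1 / (H z)\<^sup>2"
  proof -
    have "exp (2 * (ln 2 - ln (Re (H z)))) = (exp (ln 2 - ln (Re (H z))))\<^sup>2" by (rule exp_double)
    also have "\<dots> = (2 / Re (H z))\<^sup>2" using h by (simp add: exp_diff)
    finally show ?thesis using Hh[of z] by (simp add: hH power_divide)
  qed
  ultimately show "((\<lambda>z. - (deriv w1 z * cnj (w1 z) + deriv w2 z * cnj (w2 z)) / of_real (norm_square_pair w1 w2 z)) has_derivative
          (\<lambda>h. (T z + (- (deriv w1 z * cnj (w1 z) + deriv w2 z * cnj (w2 z)) / of_real (norm_square_pair w1 w2 z))\<^sup>2) * h -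
                of_real (exp (2 * (ln 2 - ln (norm_square_pair w1 w2 z)))) / 4 * cnj h)) (at z)"
    by (simp add: Hh A_def)
qed

lemma liouville_jet_unique:
  assumes "open S" "z \<in> S" and j: "liouville_jet u g T S" "liouville_jet v k T' S" and eq: "\<And>z. z \<in> S \<Longrightarrow> u z = v z"
  shows "g z = k z" "T z = T' z"
proof -
  have gk: "g z = k z" if z: "z \<in> S" for z
  proof -
    have 1: "(u has_derivative (\<lambda>h. 2 * Re (g z * h))) (at z)" using j z by (auto simp: liouville_jet_def)
    have "(v has_derivative (\<lambda>h. 2 * Re (k z * h))) (at z)" using j z by (auto simp: liouville_jet_def)
    then have "(u has_derivative (\<lambda>h. 2 * Re (k z * h))) (at z)"
      by (rule has_derivative_transform_within_open[OF _ \<open>open S\<close> z]) (simp add: eq)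
    with 1 have "(\<lambda>h. 2 * Re (g z * h)) = (\<lambda>h. 2 * Re (k z * h))" by (rule has_derivative_unique)
    from fun_cong[OF this, of 1] fun_cong[OF this, of \<i>] show ?thesis by (simp add: complex_eq_iff)
  qed
  show "g z = k z" using gk assms by simp
  let ?E = "of_real (exp (2 * u z)) / 4 :: complex"
  have 1: "(g has_derivative (\<lambda>h. (T z + (g z)\<^sup>2) * h - ?E * cnj h)) (at z)" using j assms by (auto simp: liouville_jet_def)
  have "(k has_derivative (\<lambda>h. (T' z + (g z)\<^sup>2) * h - ?E * cnj h)) (at z)"
    using j assms gk[OF \<open>z \<in> S\<close>] eq[OF \<open>z \<in> S\<close>] by (auto simp: liouville_jet_def)
  then have "(g has_derivative (\<lambda>h. (T' z + (g z)\<^sup>2) * h - ?E * cnj h)) (at z)"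
    by (rule has_derivative_transform_within_open[OF _ \<open>open S\<close> \<open>z \<in> S\<close>]) (simp add: gk)
  with 1 have "(\<lambda>h. (T z + (g z)\<^sup>2) * h - ?E * cnj h) = (\<lambda>h. (T' z + (g z)\<^sup>2) * h - ?E * cnj h)" by (rule has_derivative_unique)
  from fun_cong[OF this, of 1] show "T z = T' z" by simp
qed

lemma has_derivative_partial:
  assumes "(u has_derivative D) (at z)"
  shows "((\<lambda>t::real. u (z + t *\<^sub>R b)) has_real_derivative D b) (at 0)" "partial_deriv b u z = D b"
proof -
  interpret bounded_linear D using assms by (rule has_derivative_bounded_linear)
  have "((\<lambda>t::real. z + t *\<^sub>R b) has_derivative (\<lambda>t. t *\<^sub>R b)) (at 0)"
    by (auto intro!: derivative_eq_intros)
  then have "((\<lambda>t::real. u (z + t *\<^sub>R b)) has_derivative (\<lambda>t. D (t *\<^sub>R b))) (at 0)"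
    using diff_chain_at[of "\<lambda>t::real. z + t *\<^sub>R b" "\<lambda>t. t *\<^sub>R b" 0 u D] assms by (simp add: o_def)
  then show "((\<lambda>t::real. u (z + t *\<^sub>R b)) has_real_derivative D b) (at 0)"
    by (simp add: has_field_derivative_def scaleR mult.commute[of _ "D b"])
  then show "partial_deriv b u z = D b" unfolding partial_deriv_def by (rule DERIV_imp_deriv)
qed

lemma C1_planeI:
  assumes "\<And>z. (u has_derivative (\<lambda>h. Re (p z * h))) (at z)" "continuous_on UNIV p"
  shows "C1_plane u" "partial_deriv b u = (\<lambda>z. Re (p z * b))"
proof -
  show pd: "partial_deriv b u = (\<lambda>z. Re (p z * b))" for b
    using has_derivative_partial(2)[OF assms(1)] by auto
  have "(\<lambda>t::real. u (z + t *\<^sub>R b)) field_differentiable (at 0)" for b z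
    using has_derivative_partial(1)[OF assms(1)] by (auto simp: field_differentiable_def)
  moreover have "continuous_on UNIV (partial_deriv b u)" for b
    unfolding pd by (intro continuous_intros assms)
  ultimately show "C1_plane u" by (auto simp: C1_plane_def)
qed

lemma liouville_solution_if_jet:
  assumes j: "liouville_jet u g T UNIV" and T: "continuous_on UNIV T"
  shows "liouville_solution u"
proof -
  define E where "E z = complex_of_real (exp (2 * u z)) / 4" for z
  have du: "(u has_derivative (\<lambda>h. Re (2 * g z * h))) (at z)" for z
  proof -
    have "(\<lambda>h. Re (2 * g z * h)) = (\<lambda>h. 2 * Re (g z * h))" by auto
    moreover have "(u has_derivative (\<lambda>h. 2 * Re (g z * h))) (at z)" using j unfolding liouville_jet_def by blast
    ultimately show ?thesis by (simp only:)
  qed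
  have dg: "(g has_derivative (\<lambda>h. (T z + (g z)\<^sup>2) * h - E z * cnj h)) (at z)" for z
    using j by (auto simp: liouville_jet_def E_def)
  have cg: "continuous_on UNIV g" using dg by (meson continuous_at_imp_continuous_on has_derivative_continuous)
  have cu: "continuous_on UNIV u" using du by (meson continuous_at_imp_continuous_on has_derivative_continuous)
  have c2g: "continuous_on UNIV (\<lambda>z. 2 * g z)" by (intro continuous_intros cg)
  note u1 = C1_planeI[OF du c2g]
  define q where "q b z = 2 * (T z + (g z)\<^sup>2) * b - 2 * E z * cnj b" for b z
  have d2: "((\<lambda>z. Re (2 * g z * b)) has_derivative (\<lambda>h. Re (q b z * h))) (at z)" if b: "b \<in> Basis" for b z
  proof -
    have "((\<lambda>z. Re (2 * g z * b)) has_derivative (\<lambda>h. Re (2 * ((T z + (g z)\<^sup>2) * h - E z * cnj h) * b))) (at z)"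
      by (intro bounded_linear.has_derivative[OF bounded_linear_Re] has_derivative_mult_left has_derivative_mult_right dg)
    moreover have "Re (2 * ((T z + (g z)\<^sup>2) * h - E z * cnj h) * b) = Re (q b z * h)" for h
    proof -
      have "Re (E z * cnj h * b) = Re (E z * cnj b * h)" by (simp add: E_def algebra_simps)
      moreover have "Re (2 * ((T z + (g z)\<^sup>2) * h - E z * cnj h) * b) = 2 * (Re ((T z + (g z)\<^sup>2) * b * h) - Re (E z * cnj h * b))"
        by (simp add: algebra_simps)
      moreover have "Re (q b z * h) = 2 * (Re ((T z + (g z)\<^sup>2) * b * h) - Re (E z * cnj b * h))"
        by (simp add: q_def algebra_simps)
      ultimately show ?thesis by simp
    qed
    ultimately show ?thesis by simp
  qed
  have cq: "continuous_on UNIV (q b)" for b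
    unfolding q_def E_def by (intro continuous_intros T cg cu) auto
  have C2: "C2_plane u"
    unfolding C2_plane_def u1(2) using u1(1) C1_planeI(1)[OF d2 cq] by blast
  have pd2: "partial_deriv b (partial_deriv b u) z = Re (q b z * b)" if "b \<in> Basis" for b z
    unfolding u1(2) C1_planeI(2)[OF d2[OF that] cq] ..
  have "laplacian u z = Re (q 1 z * 1) + Re (q \<i> z * \<i>)" for z
    using pd2[of 1 z] pd2[of \<i> z] by (simp add: laplacian_def Basis_complex_def)
  also have "Re (q 1 z * 1) + Re (q \<i> z * \<i>) = - exp (2 * u z)" for z
    by (simp add: q_def E_def algebra_simps)
  finally show ?thesis using C2 by (simp add: liouville_solution_def)
qed

lemma exp_diff_le:
  assumes "x \<le> M" "y \<le> (M::real)" shows "\<bar>exp x - exp y\<bar> \<le> exp M * \<bar>x - y\<bar>"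
proof -
  have "exp x - exp y \<le> exp M * (x - y)" if "y \<le> x" "x \<le> M" for x y :: real
  proof -
    have "1 + (y - x) \<le> exp (y - x)" by (rule exp_ge_add_one_self)
    then have "1 - exp (y - x) \<le> x - y" by linarith
    then have "exp x * (1 - exp (y - x)) \<le> exp x * (x - y)" by (rule mult_left_mono) simp
    moreover have "exp x * (x - y) \<le> exp M * (x - y)" using that by (intro mult_right_mono) auto
    moreover have "exp x * (1 - exp (y - x)) = exp x - exp y" by (simp add: right_diff_distrib flip: exp_add)
    ultimately show ?thesis by linarith
  qed
  from this[of x y] this[of y x] show ?thesis using assms by (cases "y \<le> x") auto
qed

text \<open>Along a ray, \<open>(u, g)\<close> solves a first-order system whose right-hand side is Lipschitz on bounded sets,
  so two jets with the same initial data agree by Gronwall's inequality for the squared distance \<open>E\<close>.\<close>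

lemma liouville_jet_determined_at_0:
  assumes j: "liouville_jet u g T UNIV" "liouville_jet v k T UNIV" and eq: "u 0 = v 0" "g 0 = k 0"
  shows "u z = v z"
proof -
  define p q r s where "p t = u (of_real t * z)" and "q t = g (of_real t * z)"
    and "r t = v (of_real t * z)" and "s t = k (of_real t * z)" for t :: real
  have l: "((\<lambda>t::real. of_real t * z) has_derivative (\<lambda>t. of_real t * z)) (at t)" for t
    by (auto intro!: derivative_eq_intros)
  have du: "((\<lambda>t. u (of_real t * z)) has_real_derivative 2 * Re (g (of_real t * z) * z)) (at t)"
    if "liouville_jet u g T UNIV" for u g t
  proof -
    have "(u has_derivative (\<lambda>h. 2 * Re (g (of_real t * z) * h))) (at (of_real t * z))" using that by (auto simp: liouville_jet_def)
    from diff_chain_at[OF l[of t] this]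
    have "((\<lambda>t. u (of_real t * z)) has_derivative (\<lambda>x. 2 * Re (g (of_real t * z) * (of_real x * z)))) (at t)" by (simp add: o_def)
    moreover have "2 * Re (g (of_real t * z) * (of_real x * z)) = 2 * Re (g (of_real t * z) * z) * x" for x
      by (simp add: algebra_simps)
    ultimately show ?thesis by (simp add: has_field_derivative_def)
  qed
  define F where "F g u t = (T (of_real t * z) + (g (of_real t * z))\<^sup>2) * z - of_real (exp (2 * u (of_real t * z))) / 4 * cnj z" for g u t
  have dg: "((\<lambda>t. g (of_real t * z)) has_vector_derivative F g u t) (at t)"
    if "liouville_jet u g T UNIV" for u g t
  proof -
    have "(g has_derivative (\<lambda>h. (T (of_real t * z) + (g (of_real t * z))\<^sup>2) * h - of_real (exp (2 * u (of_real t * z))) / 4 * cnj h)) (at (of_real t * z))"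
      using that by (auto simp: liouville_jet_def)
    from diff_chain_at[OF l[of t] this]
    have "((\<lambda>t. g (of_real t * z)) has_derivative (\<lambda>x. (T (of_real t * z) + (g (of_real t * z))\<^sup>2) * (of_real x * z)
        - of_real (exp (2 * u (of_real t * z))) / 4 * cnj (of_real x * z))) (at t)" by (simp add: o_def)
    moreover have "(T (of_real t * z) + (g (of_real t * z))\<^sup>2) * (of_real x * z)
        - of_real (exp (2 * u (of_real t * z))) / 4 * cnj (of_real x * z) = x *\<^sub>R F g u t" for x
      by (simp add: F_def scaleR_conv_of_real algebra_simps)
    ultimately show ?thesis by (simp add: has_vector_derivative_def)
  qed
  have dp: "(p has_real_derivative 2 * Re (q t * z)) (at t)" "(r has_real_derivative 2 * Re (s t * z)) (at t)" for t
    unfolding p_def q_def r_def s_def by (rule du j)+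
  have dq: "(q has_vector_derivative F g u t) (at t)" "(s has_vector_derivative F k v t) (at t)" for t
    unfolding q_def s_def by (rule dg j)+
  have cont: "continuous_on {0..1} p" "continuous_on {0..1} r" "continuous_on {0..1} q" "continuous_on {0..1} s"
    by (rule continuous_at_imp_continuous_on, blast intro: DERIV_isCont[OF dp(1)] DERIV_isCont[OF dp(2)]
        has_vector_derivative_continuous[OF dq(1)] has_vector_derivative_continuous[OF dq(2)])+
  have "bounded (p ` {0..1} \<union> r ` {0..1})" "bounded (q ` {0..1} \<union> s ` {0..1})"
    by (auto intro!: compact_imp_bounded compact_continuous_image cont)
  then obtain M0 M1 where M0: "\<And>x. x \<in> p ` {0..1} \<union> r ` {0..1} \<Longrightarrow> \<bar>x\<bar> \<le> M0"
    and M1: "\<And>x. x \<in> q ` {0..1} \<union> s ` {0..1} \<Longrightarrow> cmod x \<le> M1" unfolding bounded_iff real_norm_def by metis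
  define a b where "a t = p t - r t" and "b t = q t - s t" for t
  define K where "K = 2 * cmod z + 2 * (cmod z * (2 * M1)) + cmod z * exp (2 * M0)"
  define E where "E t = (a t)\<^sup>2 + (cmod (b t))\<^sup>2" for t
  have da: "(a has_real_derivative 2 * Re (b t * z)) (at t)" for t
  proof -
    have "(a has_real_derivative 2 * Re (q t * z) - 2 * Re (s t * z)) (at t)" unfolding a_def by (intro DERIV_diff dp)
    then show ?thesis by (simp add: b_def algebra_simps)
  qed
  have db: "(b has_vector_derivative F g u t - F k v t) (at t)" for t
    unfolding b_def by (intro has_vector_derivative_diff dq)
  have dE: "(E has_real_derivative 2 * a t * (2 * Re (b t * z)) + 2 * inner (b t) (F g u t - F k v t)) (at t)" for t
  proof -
    have "((\<lambda>t. (cmod (b t))\<^sup>2) has_real_derivative 2 * inner (b t) (F g u t - F k v t)) (at t)"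
      using bounded_bilinear.has_vector_derivative[OF bounded_bilinear_inner db db, of t]
      by (simp add: dot_square_norm inner_commute has_real_derivative_iff_has_vector_derivative)
    then have "((\<lambda>t. a t * a t + (cmod (b t))\<^sup>2) has_real_derivative
        (2 * Re (b t * z) * a t + 2 * Re (b t * z) * a t) + 2 * inner (b t) (F g u t - F k v t)) (at t)"
      by (intro DERIV_add DERIV_mult da)
    then show ?thesis unfolding E_def power2_eq_square by (simp add: algebra_simps)
  qed
  have "2 * a t * (2 * Re (b t * z)) + 2 * inner (b t) (F g u t - F k v t) \<le> K * E t" if t: "t \<in> {0..1}" for t
  proof -
    have "F g u t - F k v t = (q t + s t) * b t * z - of_real (exp (2 * p t) - exp (2 * r t)) / 4 * cnj z"
      by (simp add: F_def b_def q_def s_def p_def r_def algebra_simps power2_eq_square diff_divide_distrib)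
    then have "cmod (F g u t - F k v t) \<le> cmod ((q t + s t) * b t * z) + cmod (of_real (exp (2 * p t) - exp (2 * r t)) / 4 * cnj z)"
      by (simp only: norm_triangle_ineq4)
    also have "\<dots> \<le> 2 * M1 * cmod (b t) * cmod z + (exp (2 * M0) * (2 * \<bar>a t\<bar>)) / 4 * cmod z"
    proof (rule add_mono)
      have "cmod (q t + s t) \<le> 2 * M1"
        using M1[of "q t"] M1[of "s t"] t norm_triangle_ineq[of "q t" "s t"] by auto
      then show "cmod ((q t + s t) * b t * z) \<le> 2 * M1 * cmod (b t) * cmod z"
        unfolding norm_mult by (intro mult_right_mono) auto
      have "\<bar>exp (2 * p t) - exp (2 * r t)\<bar> \<le> exp (2 * M0) * \<bar>2 * p t - 2 * r t\<bar>"
        using M0[of "p t"] M0[of "r t"] t by (intro exp_diff_le) (auto simp: abs_le_iff)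
      also have "\<bar>2 * p t - 2 * r t\<bar> = 2 * \<bar>a t\<bar>" unfolding a_def right_diff_distrib[symmetric] abs_mult by simp
      finally show "cmod (of_real (exp (2 * p t) - exp (2 * r t)) / 4 * cnj z) \<le> (exp (2 * M0) * (2 * \<bar>a t\<bar>)) / 4 * cmod z"
        unfolding norm_mult norm_divide norm_of_real complex_mod_cnj norm_numeral
        by (intro mult_right_mono divide_right_mono) auto
    qed
    finally have Fd: "cmod (F g u t - F k v t) \<le> 2 * M1 * cmod (b t) * cmod z + (exp (2 * M0) * (2 * \<bar>a t\<bar>)) / 4 * cmod z" .
    have "inner (b t) (F g u t - F k v t) \<le> cmod (b t) * cmod (F g u t - F k v t)" by (rule norm_cauchy_schwarz)
    also have "\<dots> \<le> cmod (b t) * (2 * M1 * cmod (b t) * cmod z + (exp (2 * M0) * (2 * \<bar>a t\<bar>)) / 4 * cmod z)"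
      by (rule mult_left_mono[OF Fd]) simp
    also have "\<dots> = 2 * M1 * cmod z * (cmod (b t))\<^sup>2 + exp (2 * M0) * cmod z / 2 * (\<bar>a t\<bar> * cmod (b t))"
      by (simp add: power2_eq_square algebra_simps)
    finally have 1: "inner (b t) (F g u t - F k v t) \<le> 2 * M1 * cmod z * (cmod (b t))\<^sup>2 + exp (2 * M0) * cmod z / 2 * (\<bar>a t\<bar> * cmod (b t))" .
    have "a t * Re (b t * z) \<le> \<bar>a t\<bar> * cmod (b t * z)"
    proof -
      have "a t * Re (b t * z) \<le> \<bar>a t\<bar> * \<bar>Re (b t * z)\<bar>" unfolding abs_mult[symmetric] by (rule abs_ge_self)
      also have "\<dots> \<le> \<bar>a t\<bar> * cmod (b t * z)" by (intro mult_left_mono abs_Re_le_cmod) auto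
      finally show ?thesis .
    qed
    then have 2: "a t * Re (b t * z) \<le> cmod z * (\<bar>a t\<bar> * cmod (b t))" by (simp add: norm_mult mult_ac)
    have ab: "2 * (\<bar>a t\<bar> * cmod (b t)) \<le> E t" using sum_squares_bound[of "\<bar>a t\<bar>" "cmod (b t)"] by (simp add: E_def)
    have bE: "(cmod (b t))\<^sup>2 \<le> E t" by (simp add: E_def)
    have M1p: "0 \<le> M1" using M1[of "q t"] t norm_ge_zero[of "q t"] by (meson UnI1 imageI order_trans)
    have E0: "0 \<le> E t" by (simp add: E_def)
    have "2 * M1 * cmod z * (cmod (b t))\<^sup>2 \<le> 2 * M1 * cmod z * E t"
      using M1p by (intro mult_left_mono bE) auto
    moreover have "exp (2 * M0) * cmod z / 4 * (2 * (\<bar>a t\<bar> * cmod (b t))) \<le> exp (2 * M0) * cmod z / 4 * E t"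
      by (intro mult_left_mono ab) auto
    moreover have "cmod z * (2 * (\<bar>a t\<bar> * cmod (b t))) \<le> cmod z * E t"
      by (intro mult_left_mono ab) auto
    moreover have "0 \<le> exp (2 * M0) * cmod z * E t" using E0 by simp
    ultimately show ?thesis using 1 2 unfolding K_def by (simp add: algebra_simps)
  qed
  note bound = this
  have "E 1 * exp (- K * 1) \<le> E 0 * exp (- K * 0)"
  proof (rule DERIV_nonpos_imp_nonincreasing[where f = "\<lambda>t. E t * exp (- K * t)"])
    fix t :: real assume t: "0 \<le> t" "t \<le> 1"
    let ?e = "2 * a t * (2 * Re (b t * z)) + 2 * inner (b t) (F g u t - F k v t)"
    have "((\<lambda>t. exp (- K * t)) has_real_derivative - K * exp (- K * t)) (at t)"
      by (auto intro!: derivative_eq_intros)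
    from DERIV_mult[OF dE this]
    have "((\<lambda>t. E t * exp (- K * t)) has_real_derivative ?e * exp (- K * t) + - K * exp (- K * t) * E t) (at t)" .
    moreover have "?e * exp (- K * t) + - K * exp (- K * t) * E t = (?e - K * E t) * exp (- K * t)" by (simp add: algebra_simps)
    moreover have "(?e - K * E t) * exp (- K * t) \<le> 0"
      using bound[of t] t by (intro mult_nonpos_nonneg) auto
    ultimately show "\<exists>y. ((\<lambda>t. E t * exp (- K * t)) has_real_derivative y) (at t) \<and> y \<le> 0" by metis
  qed simp
  moreover have "E 0 = 0" using eq by (simp add: E_def a_def b_def p_def q_def r_def s_def)
  ultimately have "E 1 \<le> 0" by (simp add: mult_le_0_iff)
  then have "a 1 = 0" by (simp add: E_def sum_power2_le_zero_iff)
  then show ?thesis by (simp add: a_def p_def r_def)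
qed

lemma C1_plane_has_derivative:
  assumes "C1_plane v"
  shows "(v has_derivative (\<lambda>h. partial_deriv 1 v z * Re h + partial_deriv \<i> v z * Im h)) (at z)"
proof -
  let ?p = "partial_deriv 1 v" and ?q = "partial_deriv \<i> v"
  have cont: "continuous_on UNIV ?q" using assms by (auto simp: C1_plane_def Basis_complex_def)
  have d: "((\<lambda>t::real. v (z + t *\<^sub>R b)) has_real_derivative partial_deriv b v z) (at 0)" if "b \<in> {1, \<i>}" for b z
    using assms that unfolding C1_plane_def Basis_complex_def partial_deriv_def DERIV_deriv_iff_field_differentiable
    by blast
  define f where "f x y = v (Complex x y)" for x y
  have fx: "((\<lambda>x. f x y) has_derivative (\<lambda>t. ?p (Complex x y) * t)) (at x)" for x y
  proof -
    have "(((\<lambda>t. v (Complex x y + t *\<^sub>R 1)) \<circ> (\<lambda>s. s - x)) has_real_derivative ?p (Complex x y) * 1) (at x)"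
      by (rule DERIV_chain) (use d[of 1 "Complex x y"] in \<open>auto intro!: derivative_eq_intros\<close>)
    moreover have "(\<lambda>t. v (Complex x y + t *\<^sub>R 1)) \<circ> (\<lambda>s. s - x) = (\<lambda>x. f x y)"
      by (auto simp: f_def fun_eq_iff complex_eq_iff intro!: arg_cong[of _ _ v])
    ultimately show ?thesis by (simp add: has_field_derivative_def)
  qed
  define fy where "fy x y = blinfun_scaleR_left (?q (Complex x y))" for x y
  have fy: "((\<lambda>y. f x y) has_derivative blinfun_apply (fy x y)) (at y)" for x y
  proof -
    have "(((\<lambda>t. v (Complex x y + t *\<^sub>R \<i>)) \<circ> (\<lambda>s. s - y)) has_real_derivative ?q (Complex x y) * 1) (at y)"
      by (rule DERIV_chain) (use d[of \<i> "Complex x y"] in \<open>auto intro!: derivative_eq_intros\<close>)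
    moreover have "(\<lambda>t. v (Complex x y + t *\<^sub>R \<i>)) \<circ> (\<lambda>s. s - y) = (\<lambda>y. f x y)"
      by (auto simp: f_def fun_eq_iff complex_eq_iff intro!: arg_cong[of _ _ v])
    ultimately have "((\<lambda>y. f x y) has_derivative (\<lambda>t. ?q (Complex x y) * t)) (at y)"
      by (simp add: has_field_derivative_def)
    moreover have "blinfun_apply (fy x y) = (\<lambda>t. ?q (Complex x y) * t)"
      by (simp add: fy_def fun_eq_iff)
    ultimately show ?thesis by simp
  qed
  have "continuous_on UNIV (\<lambda>(x, y). fy x y)"
    unfolding fy_def case_prod_unfold
    by (intro bounded_linear.continuous_on[OF bounded_linear_blinfun_scaleR_left] continuous_on_compose2[OF cont])
      (auto intro!: continuous_intros)
  then have fyc: "continuous (at (x, y) within UNIV \<times> UNIV) (\<lambda>(x, y). fy x y)" for x y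
    by (simp add: continuous_on_eq_continuous_at)
  have "((\<lambda>(x, y). f x y) has_derivative (\<lambda>(tx, ty). ?p (Complex (Re z) (Im z)) * tx + fy (Re z) (Im z) ty)) (at (Re z, Im z) within UNIV \<times> UNIV)"
    by (rule has_derivative_partialsI[OF fx fy fyc]) auto
  then have "((\<lambda>(x, y). f x y) has_derivative (\<lambda>(tx, ty). ?p z * tx + ?q z * ty)) (at (Re z, Im z))"
    by (simp add: fy_def mult.commute)
  note dF = this
  have dRI: "((\<lambda>z. (Re z, Im z)) has_derivative (\<lambda>z. (Re z, Im z))) (at z)"
    by (intro has_derivative_Pair bounded_linear.has_derivative[OF bounded_linear_Re] bounded_linear.has_derivative[OF bounded_linear_Im]
        has_derivative_ident)
  have "((\<lambda>(x, y). f x y) \<circ> (\<lambda>z. (Re z, Im z)) has_derivative (\<lambda>(tx, ty). ?p z * tx + ?q z * ty) \<circ> (\<lambda>z. (Re z, Im z))) (at z)"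
    by (rule diff_chain_at[OF dRI]) (use dF in simp)
  moreover have "(\<lambda>(x, y). f x y) \<circ> (\<lambda>z. (Re z, Im z)) = v" by (auto simp: f_def)
  ultimately show ?thesis by (simp add: o_def)
qed

text \<open>Second differences over a small square, expanded by the mean value theorem in the two
  possible orders.\<close>

lemma mixed_partials_eq:
  assumes "C1_plane v" "C1_plane (partial_deriv 1 v)" "C1_plane (partial_deriv \<i> v)"
  shows "partial_deriv \<i> (partial_deriv 1 v) z = partial_deriv 1 (partial_deriv \<i> v) z"
proof -
  have d: "((\<lambda>t::real. v (a + of_real t * b)) has_real_derivative partial_deriv b v (a + of_real t * b)) (at t)"
    if v: "C1_plane v" and b: "b \<in> {1, \<i>}" for v a b t
  proof -
    have "((\<lambda>t::real. a + of_real t * b) has_derivative (\<lambda>t. of_real t * b)) (at t)"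
      by (auto intro!: derivative_eq_intros)
    from diff_chain_at[OF this C1_plane_has_derivative[OF v]]
    have "((\<lambda>t. v (a + of_real t * b)) has_derivative (\<lambda>h. partial_deriv 1 v (a + of_real t * b) * Re (of_real h * b)
        + partial_deriv \<i> v (a + of_real t * b) * Im (of_real h * b))) (at t)" by (simp add: o_def)
    then show ?thesis using b by (auto simp: has_field_derivative_def)
  qed
  have second: "\<exists>s t. 0 < s \<and> s < h \<and> 0 < t \<and> t < h \<and>
      v (z + of_real h * b + of_real h * b') - v (z + of_real h * b) - v (z + of_real h * b') + v z
      = h * h * partial_deriv b' (partial_deriv b v) (z + of_real s * b + of_real t * b')"
    if h: "0 < h" and b: "b \<in> {1, \<i>}" "b' \<in> {1, \<i>}" for h b b'
  proof -
    let ?p = "partial_deriv b v"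
    have C: "C1_plane ?p" using b assms by auto
    define \<phi> where "\<phi> s = v (z + of_real h * b' + of_real s * b) - v (z + of_real s * b)" for s
    have "(\<phi> has_real_derivative ?p (z + of_real h * b' + of_real s * b) - ?p (z + of_real s * b)) (at s)" for s
      unfolding \<phi>_def by (intro DERIV_diff d assms b)
    from MVT2[OF h this] obtain s where s: "0 < s" "s < h"
      "\<phi> h - \<phi> 0 = (h - 0) * (?p (z + of_real h * b' + of_real s * b) - ?p (z + of_real s * b))" by auto
    from MVT2[OF h d[OF C b(2)], of "z + of_real s * b"] obtain t where t: "0 < t" "t < h"
      "?p (z + of_real s * b + of_real h * b') - ?p (z + of_real s * b) = h * partial_deriv b' ?p (z + of_real s * b + of_real t * b')"
      by auto
    have "v (z + of_real h * b + of_real h * b') - v (z + of_real h * b) - v (z + of_real h * b') + v z = \<phi> h - \<phi> 0"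
      by (simp add: \<phi>_def add_ac)
    also have "\<dots> = h * h * partial_deriv b' ?p (z + of_real s * b + of_real t * b')"
      using s(3) t(3) by (simp add: add_ac)
    finally show ?thesis using s t by blast
  qed
  define A where "A = partial_deriv \<i> (partial_deriv 1 v)"
  define B where "B = partial_deriv 1 (partial_deriv \<i> v)"
  have contA: "isCont A z" and contB: "isCont B z"
    using assms(2,3) by (auto simp: C1_plane_def Basis_complex_def A_def B_def continuous_on_eq_continuous_at)
  have "\<bar>A z - B z\<bar> \<le> e" if e: "0 < e" for e
  proof -
    from contA e obtain d1 where d1: "0 < d1" "\<And>x. dist x z < d1 \<Longrightarrow> dist (A x) (A z) < e / 2"
      unfolding continuous_at_eps_delta by (metis half_gt_zero)
    from contB e obtain d2 where d2: "0 < d2" "\<And>x. dist x z < d2 \<Longrightarrow> dist (B x) (B z) < e / 2"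
      unfolding continuous_at_eps_delta by (metis half_gt_zero)
    define h where "h = min d1 d2 / 3"
    have h: "0 < h" "2 * h < d1" "2 * h < d2" using d1 d2 by (auto simp: h_def)
    obtain s t where 1: "0 < s" "s < h" "0 < t" "t < h"
      "v (z + of_real h * 1 + of_real h * \<i>) - v (z + of_real h * 1) - v (z + of_real h * \<i>) + v z = h * h * A (z + of_real s * 1 + of_real t * \<i>)"
      using second[OF h(1), of 1 \<i>] by (auto simp: A_def)
    obtain s' t' where 2: "0 < s'" "s' < h" "0 < t'" "t' < h"
      "v (z + of_real h * \<i> + of_real h * 1) - v (z + of_real h * \<i>) - v (z + of_real h * 1) + v z = h * h * B (z + of_real s' * \<i> + of_real t' * 1)"
      using second[OF h(1), of \<i> 1] by (auto simp: B_def)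
    have "z + of_real h * 1 + of_real h * \<i> = z + of_real h * \<i> + of_real h * 1" by simp
    then have "h * h * A (z + of_real s * 1 + of_real t * \<i>) = h * h * B (z + of_real s' * \<i> + of_real t' * 1)"
      using 1(5) 2(5) by (smt (verit))
    then have AB: "A (z + of_real s * 1 + of_real t * \<i>) = B (z + of_real s' * \<i> + of_real t' * 1)" using h by simp
    have "dist (z + of_real s * 1 + of_real t * \<i>) z \<le> s + t"
      using 1 norm_triangle_ineq[of "of_real s" "of_real t * \<i>"] by (simp add: dist_norm norm_mult)
    then have "dist (A (z + of_real s * 1 + of_real t * \<i>)) (A z) < e / 2" using 1 h by (intro d1) auto
    moreover have "dist (z + of_real s' * \<i> + of_real t' * 1) z \<le> s' + t'"
      using 2 norm_triangle_ineq[of "of_real s' * \<i>" "of_real t'"] by (simp add: dist_norm norm_mult)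
    then have "dist (B (z + of_real s' * \<i> + of_real t' * 1)) (B z) < e / 2" using 2 h by (intro d2) auto
    ultimately show ?thesis unfolding AB dist_real_def by linarith
  qed
  then have "\<bar>A z - B z\<bar> \<le> 0" by (rule field_le_epsilon[of _ 0, simplified])
  then show ?thesis by (simp add: A_def B_def)
qed

text \<open>\<open>g = u\<^bsub>z\<^esub>\<close> and \<open>T = u\<^bsub>zz\<^esub> - (u\<^bsub>z\<^esub>)\<^sup>2\<close>, written with real partial derivatives. The
  symmetry of the mixed partial derivatives is needed for the derivative of \<open>g\<close> to split into these two parts.\<close>

lemma liouville_solution_jet:
  assumes "liouville_solution u"
  obtains g T where "liouville_jet u g T UNIV" "continuous_on UNIV T"
proof -
  let ?p = "partial_deriv 1 u" and ?q = "partial_deriv \<i> u"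
  have C: "C1_plane u" "C1_plane ?p" "C1_plane ?q"
    using assms by (auto simp: liouville_solution_def C2_plane_def Basis_complex_def)
  define p1 p2 q1 q2 where "p1 = partial_deriv 1 ?p" and "p2 = partial_deriv \<i> ?p"
    and "q1 = partial_deriv 1 ?q" and "q2 = partial_deriv \<i> ?q"
  have p2q1: "p2 z = q1 z" for z unfolding p2_def q1_def by (rule mixed_partials_eq[OF C])
  have lap: "p1 z + q2 z = - exp (2 * u z)" for z
  proof -
    have "- laplacian u z = exp (2 * u z)" using assms by (auto simp: liouville_solution_def)
    moreover have "laplacian u z = p1 z + q2 z" by (simp add: laplacian_def Basis_complex_def p1_def q2_def)
    ultimately show ?thesis by simp
  qed
  have cont: "continuous_on UNIV p1" "continuous_on UNIV p2" "continuous_on UNIV q2" "continuous_on UNIV ?p" "continuous_on UNIV ?q"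
    using C by (auto simp: C1_plane_def Basis_complex_def p1_def p2_def q2_def)
  have du: "(u has_derivative (\<lambda>h. ?p z * Re h + ?q z * Im h)) (at z)" for z
    by (rule C1_plane_has_derivative[OF C(1)])
  have dp: "(?p has_derivative (\<lambda>h. p1 z * Re h + p2 z * Im h)) (at z)" for z
    unfolding p1_def p2_def by (rule C1_plane_has_derivative[OF C(2)])
  have dq: "(?q has_derivative (\<lambda>h. q1 z * Re h + q2 z * Im h)) (at z)" for z
    unfolding q1_def q2_def by (rule C1_plane_has_derivative[OF C(3)])
  define g where "g z = Complex (?p z / 2) (- ?q z / 2)" for z
  define T where "T z = Complex ((p1 z - q2 z) / 4) (- p2 z / 2) - (g z)\<^sup>2" for z
  have g_eq: "g z = of_real (?p z / 2) + of_real (- ?q z / 2) * \<i>" for z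
    by (simp add: g_def complex_eq_iff)
  have "continuous_on UNIV g" unfolding g_eq[abs_def] by (intro continuous_intros cont) auto
  moreover have "T = (\<lambda>z. of_real ((p1 z - q2 z) / 4) + of_real (- p2 z / 2) * \<i> - (g z)\<^sup>2)"
    by (auto simp: T_def complex_eq_iff)
  ultimately have "continuous_on UNIV T" by (auto intro!: continuous_intros cont)
  moreover have "liouville_jet u g T UNIV"
    unfolding liouville_jet_def
  proof (intro ballI conjI)
    fix z
    have "?p z * Re h + ?q z * Im h = 2 * Re (g z * h)" for h by (simp add: g_def)
    then show "(u has_derivative (\<lambda>h. 2 * Re (g z * h))) (at z)" using du[of z] by simp
    have "(g has_derivative (\<lambda>h. of_real ((p1 z * Re h + p2 z * Im h) / 2) + of_real (- (q1 z * Re h + q2 z * Im h) / 2) * \<i>)) (at z)"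
      unfolding g_eq[abs_def]
      by (intro has_derivative_add has_derivative_mult_left has_derivative_of_real
          bounded_linear.has_derivative[OF bounded_linear_divide] has_derivative_minus dp dq)
    moreover have "of_real ((p1 z * Re h + p2 z * Im h) / 2) + of_real (- (q1 z * Re h + q2 z * Im h) / 2) * \<i>
        = (T z + (g z)\<^sup>2) * h - of_real (exp (2 * u z)) / 4 * cnj h" for h
    proof -
      have e: "exp (2 * u z) = - (p1 z + q2 z)" using lap[of z] by simp
      have "(T z + (g z)\<^sup>2) * h - of_real (- (p1 z + q2 z)) / 4 * cnj h
         = Complex ((p1 z * Re h + p2 z * Im h) / 2) (- (p2 z * Re h + q2 z * Im h) / 2)"
        unfolding T_def by (simp add: complex_eq_iff field_simps)
      then show ?thesis unfolding e p2q1[symmetric] by (simp add: complex_eq_iff)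
    qed
    ultimately show "(g has_derivative (\<lambda>h. (T z + (g z)\<^sup>2) * h - of_real (exp (2 * u z)) / 4 * cnj h)) (at z)"
      by simp
  qed
  ultimately show ?thesis using that by blast
qed

text \<open>Formally the conjugate derivative of \<open>T\<close> vanishes because of the equation, but that would take a third
  derivative of \<open>u\<close>. Instead, the 1-form \<open>\<omega> = - g\<^sup>2 dz + E dz'\<close> with \<open>E = e\<^sup>2\<^sup>u / 4\<close> and \<open>dz'\<close> the conjugate of \<open>dz\<close> is closed,
  and its coefficients are differentiable. It has a primitive \<open>\<Omega>\<close>
  by Poincare's lemma, and \<open>d(g + \<Omega>) = T dz\<close>. So \<open>T\<close> is the complex derivative of the entire function \<open>g + \<Omega>\<close>.\<close>

lemma liouville_jet_holomorphic:
  assumes j: "liouville_jet u g T UNIV" and cT: "continuous_on UNIV T"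
  shows "T holomorphic_on UNIV"
proof -
  define E where "E z = complex_of_real (exp (2 * u z)) / 4" for z
  have du: "(u has_derivative (\<lambda>h. 2 * Re (g z * h))) (at z)"
    and dg: "(g has_derivative (\<lambda>h. (T z + (g z)\<^sup>2) * h - E z * cnj h)) (at z)" for z
    using j by (auto simp: liouville_jet_def E_def)
  have cu: "continuous_on UNIV u" and cg: "continuous_on UNIV g"
    using du dg by (meson continuous_at_imp_continuous_on has_derivative_continuous)+
  have cE: "continuous_on UNIV E" unfolding E_def by (intro continuous_intros cu) auto
  have dE: "(E has_derivative (\<lambda>h. E z * of_real (4 * Re (g z * h)))) (at z)" for z
  proof -
    have dexp: "((\<lambda>x. exp (2 * u x)) has_derivative (\<lambda>x. exp (2 * u z) * (2 * (2 * Re (g z * x))))) (at z)"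
      using has_derivative_exp[OF has_derivative_mult_right[OF du[of z], of 2]] by (simp add: mult_ac)
    have "(E has_derivative (\<lambda>h. of_real (exp (2 * u z) * (2 * (2 * Re (g z * h)))) / 4)) (at z)"
      unfolding E_def
      by (intro bounded_linear.has_derivative[OF bounded_linear_divide] has_derivative_of_real dexp)
    then show ?thesis by (rule back_subst) (auto simp: E_def)
  qed
  \<comment> \<open>\<open>D z k h\<close> is the derivative of \<open>\<omega> z h\<close> in the direction \<open>k\<close>; its symmetry says that \<open>\<omega>\<close> is closed.\<close>
  define \<omega> where "\<omega> z h = - (g z)\<^sup>2 * h + E z * cnj h" for z h
  define D where "D z k h = - 2 * g z * ((T z + (g z)\<^sup>2) * k - E z * cnj k) * h + E z * of_real (4 * Re (g z * k)) * cnj h" for z k h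
  have d\<omega>: "((\<lambda>z. \<omega> z h) has_derivative (\<lambda>k. D z k h)) (at z)" for z h
  proof -
    have "((\<lambda>z. \<omega> z h) has_derivative (\<lambda>k. - (2 * ((T z + (g z)\<^sup>2) * k - E z * cnj k) * g z ^ (2 - 1)) * h + E z * of_real (4 * Re (g z * k)) * cnj h)) (at z)"
      unfolding \<omega>_def
      by (intro has_derivative_add has_derivative_mult_left has_derivative_minus dE)
        (use has_derivative_power[OF dg[of z], of 2] in \<open>simp add: mult_ac\<close>)
    moreover have "- (2 * ((T z + (g z)\<^sup>2) * k - E z * cnj k) * g z ^ (2 - 1)) * h + E z * of_real (4 * Re (g z * k)) * cnj h = D z k h" for k
      unfolding D_def by (simp only: diff_numeral_special power_one_right mult_ac mult_minus_left mult_minus_right) simp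
    ultimately show ?thesis by (simp only:)
  qed
  have sym: "D z k h = D z h k" for z k h
  proof -
    have "of_real (4 * Re (g z * x)) = 2 * (g z * x + cnj (g z * x))" for x by (simp add: complex_eq_iff)
    then show ?thesis unfolding D_def by (simp add: algebra_simps)
  qed
  have c\<omega>: "continuous_on S (\<lambda>x. \<omega> (f x) (k x))"
    if f: "continuous_on S f" and k: "continuous_on S k" for S and f k :: "'x::topological_space \<Rightarrow> complex"
    unfolding \<omega>_def
    by (intro continuous_intros k continuous_on_compose2[OF cg f] continuous_on_compose2[OF cE f]; simp)
  have cD: "continuous_on S (\<lambda>x. D (f x) (k x) (l x))"
    if f: "continuous_on S f" and k: "continuous_on S k" and l: "continuous_on S l"
    for S and f k l :: "'x::topological_space \<Rightarrow> complex"
    unfolding D_def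
    by (intro continuous_intros k l continuous_on_compose2[OF cg f] continuous_on_compose2[OF cE f] continuous_on_compose2[OF cT f]; simp)
  \<comment> \<open>Poincare's primitive, the integral along the segment from 0; closedness makes the integrand of its derivative exact.\<close>
  define \<Omega> where "\<Omega> z = integral {0..1} (\<lambda>t::real. \<omega> (of_real t * z) z)" for z
  have dir: "((\<lambda>s::real. \<Omega> (z + s *\<^sub>R b)) has_vector_derivative \<omega> z b) (at 0)" for z b
  proof -
    define y where "y s = z + s *\<^sub>R b" for s :: real
    define F where "F s t = \<omega> (of_real t * y s) (y s)" for s t :: real
    define F' where "F' s t = \<omega> (of_real t * y s) b + of_real t * D (of_real t * y s) (y s) b" for s t :: real
    have cy: "continuous_on S y" for S unfolding y_def by (intro continuous_intros)
    have "((\<lambda>s. integral (cbox 0 1) (F s)) has_vector_derivative integral (cbox 0 1) (F' 0)) (at 0 within UNIV)"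
    proof (rule leibniz_rule_vector_derivative)
      fix s t :: real
      have dy: "((\<lambda>s. of_real t * y s) has_derivative (\<lambda>r. of_real t * (r *\<^sub>R b))) (at s)" "(y has_derivative (\<lambda>r. r *\<^sub>R b)) (at s)"
        unfolding y_def by (auto intro!: derivative_eq_intros)
      have dgy: "((\<lambda>s. \<omega> (of_real t * y s) h) has_derivative (\<lambda>r. D (of_real t * y s) (of_real t * (r *\<^sub>R b)) h)) (at s)" for h
        using diff_chain_at[OF dy(1) d\<omega>[of h]] by (simp add: o_def)
      have lin: "\<omega> z h = \<omega> z 1 * of_real (Re h) + \<omega> z \<i> * of_real (Im h)" for z h
        by (simp add: \<omega>_def complex_eq_iff algebra_simps)
      have linD: "D z k h = D z k 1 * of_real (Re h) + D z k \<i> * of_real (Im h)" for z k h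
        by (simp add: D_def complex_eq_iff algebra_simps)
      have linD2: "D z (of_real t * (r *\<^sub>R k)) h = r *\<^sub>R (of_real t * D z k h)" for z k h and r t :: real
        by (simp add: D_def scaleR_conv_of_real algebra_simps)
      have lin2: "\<omega> z (r *\<^sub>R h) = r *\<^sub>R \<omega> z h" for z h and r :: real
        by (simp add: \<omega>_def scaleR_conv_of_real algebra_simps)
      have "((\<lambda>s. \<omega> (of_real t * y s) 1 * of_real (Re (y s)) + \<omega> (of_real t * y s) \<i> * of_real (Im (y s)))
        has_derivative (\<lambda>r. (\<omega> (of_real t * y s) 1 * of_real (Re (r *\<^sub>R b)) + D (of_real t * y s) (of_real t * (r *\<^sub>R b)) 1 * of_real (Re (y s)))
          + (\<omega> (of_real t * y s) \<i> * of_real (Im (r *\<^sub>R b)) + D (of_real t * y s) (of_real t * (r *\<^sub>R b)) \<i> * of_real (Im (y s))))) (at s)"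
        by (intro has_derivative_add has_derivative_mult dgy has_derivative_of_real bounded_linear.has_derivative[OF bounded_linear_Re]
            bounded_linear.has_derivative[OF bounded_linear_Im] dy)
      then have "(((\<lambda>s. F s t)) has_derivative (\<lambda>r. \<omega> (of_real t * y s) (r *\<^sub>R b) + D (of_real t * y s) (of_real t * (r *\<^sub>R b)) (y s))) (at s)"
        unfolding F_def lin[of _ "y _"] lin[of _ "_ *\<^sub>R b"] linD[of _ _ "y s"] by (simp add: add_ac)
      moreover have "\<omega> (of_real t * y s) (r *\<^sub>R b) + D (of_real t * y s) (of_real t * (r *\<^sub>R b)) (y s) = r *\<^sub>R F' s t" for r
        unfolding F'_def lin2 linD2 sym[of _ b] by (simp add: scaleR_add_right)
      ultimately show "((\<lambda>s. F s t) has_vector_derivative F' s t) (at s within UNIV)"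
        by (simp add: has_vector_derivative_def)
    next
      fix s :: real
      show "F s integrable_on cbox 0 1"
        unfolding F_def by (rule integrable_continuous, rule c\<omega>) (intro continuous_intros)+
    next
      show "continuous_on (UNIV \<times> cbox 0 1) (\<lambda>(s, t). F' s t)"
        unfolding F'_def case_prod_unfold
        by (intro continuous_intros c\<omega> cD continuous_on_compose2[OF cy[of UNIV]]) auto
    qed auto
    moreover have "integral (cbox 0 1) (F' 0) = \<omega> z b"
    proof -
      have "(F' 0 has_integral of_real 1 * \<omega> (of_real 1 * z) b - of_real 0 * \<omega> (of_real 0 * z) b) {0..1}"
      proof (rule fundamental_theorem_of_calculus)
        fix t :: real
        have dl: "((\<lambda>t::real. of_real t * z) has_derivative (\<lambda>r. of_real r * z)) (at t within {0..1})"
          by (auto intro!: derivative_eq_intros)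
        have "((\<lambda>t. \<omega> (of_real t * z) b) has_derivative (\<lambda>r. D (of_real t * z) (of_real r * z) b)) (at t within {0..1})"
          using diff_chain_within[OF dl has_derivative_at_withinI[OF d\<omega>[of b]]] by (simp add: o_def)
        then have "((\<lambda>t. of_real t * \<omega> (of_real t * z) b) has_derivative
            (\<lambda>r. of_real t * D (of_real t * z) (of_real r * z) b + of_real r * \<omega> (of_real t * z) b)) (at t within {0..1})"
          by (intro has_derivative_mult) (auto intro!: derivative_eq_intros)
        moreover have "of_real t * D (of_real t * z) (of_real r * z) b + of_real r * \<omega> (of_real t * z) b = r *\<^sub>R F' 0 t" for r
          by (simp add: F'_def y_def D_def scaleR_conv_of_real algebra_simps)
        ultimately show "((\<lambda>t. of_real t * \<omega> (of_real t * z) b) has_vector_derivative F' 0 t) (at t within {0..1})"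
          by (simp add: has_vector_derivative_def)
      qed simp
      then show ?thesis by (simp add: integral_unique)
    qed
    ultimately show ?thesis by (simp add: \<Omega>_def F_def[abs_def] y_def)
  qed
  have part: "(\<Omega> has_derivative \<omega> z) (at z)" for z
  proof -
    have c: "C1_plane (\<lambda>z. Re (\<Omega> z)) \<and> C1_plane (\<lambda>z. Im (\<Omega> z)) \<and> (\<forall>b z. partial_deriv b (\<lambda>z. Re (\<Omega> z)) z = Re (\<omega> z b) \<and>
        partial_deriv b (\<lambda>z. Im (\<Omega> z)) z = Im (\<omega> z b))"
    proof -
      have dR: "((\<lambda>t. Re (\<Omega> (z + t *\<^sub>R b))) has_real_derivative Re (\<omega> z b)) (at 0)" for z b
        using bounded_linear.has_vector_derivative[OF bounded_linear_Re dir[of z b]]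
        by (simp add: has_real_derivative_iff_has_vector_derivative)
      have dI: "((\<lambda>t. Im (\<Omega> (z + t *\<^sub>R b))) has_real_derivative Im (\<omega> z b)) (at 0)" for z b
        using bounded_linear.has_vector_derivative[OF bounded_linear_Im dir[of z b]]
        by (simp add: has_real_derivative_iff_has_vector_derivative)
      have p: "partial_deriv b (\<lambda>z. Re (\<Omega> z)) = (\<lambda>z. Re (\<omega> z b))" "partial_deriv b (\<lambda>z. Im (\<Omega> z)) = (\<lambda>z. Im (\<omega> z b))" for b
        unfolding partial_deriv_def using DERIV_imp_deriv[OF dR] DERIV_imp_deriv[OF dI] by auto
      show ?thesis
      proof -
        have "(\<lambda>t::real. Re (\<Omega> (z + t *\<^sub>R b))) field_differentiable (at 0)" "(\<lambda>t::real. Im (\<Omega> (z + t *\<^sub>R b))) field_differentiable (at 0)" for z b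
          using dR[of z b] dI[of z b] unfolding field_differentiable_def by blast+
        moreover have "continuous_on UNIV (\<lambda>z. \<omega> z b)" for b by (intro c\<omega> continuous_intros)
        then have "continuous_on UNIV (\<lambda>z. Re (\<omega> z b))" "continuous_on UNIV (\<lambda>z. Im (\<omega> z b))" for b
          by (auto intro!: continuous_intros)
        ultimately show ?thesis unfolding C1_plane_def p by blast
      qed
    qed
    have "((\<lambda>z. of_real (Re (\<Omega> z)) + \<i> * of_real (Im (\<Omega> z))) has_derivative
        (\<lambda>h. of_real (Re (\<omega> z 1) * Re h + Re (\<omega> z \<i>) * Im h) + \<i> * of_real (Im (\<omega> z 1) * Re h + Im (\<omega> z \<i>) * Im h))) (at z)"
      using C1_plane_has_derivative[of "\<lambda>z. Re (\<Omega> z)" z] C1_plane_has_derivative[of "\<lambda>z. Im (\<Omega> z)" z] c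
      by (intro has_derivative_add has_derivative_of_real has_derivative_mult_right) auto
    moreover have "(\<lambda>z. of_real (Re (\<Omega> z)) + \<i> * of_real (Im (\<Omega> z))) = \<Omega>"
      by (simp add: fun_eq_iff complex_eq_iff)
    moreover have "of_real (Re (\<omega> z 1) * Re h + Re (\<omega> z \<i>) * Im h) + \<i> * of_real (Im (\<omega> z 1) * Re h + Im (\<omega> z \<i>) * Im h) = \<omega> z h" for h
    proof -
      have "\<omega> z h = \<omega> z 1 * of_real (Re h) + \<omega> z \<i> * of_real (Im h)"
        by (simp add: \<omega>_def complex_eq_iff algebra_simps)
      then show ?thesis by (simp add: complex_eq_iff)
    qed
    ultimately show ?thesis by (simp only:)
  qed
  have "((\<lambda>z. g z + \<Omega> z) has_field_derivative T z) (at z)" for z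
  proof -
    have "((\<lambda>z. g z + \<Omega> z) has_derivative (\<lambda>h. ((T z + (g z)\<^sup>2) * h - E z * cnj h) + \<omega> z h)) (at z)"
      by (intro has_derivative_add dg part)
    moreover have "(\<lambda>h. ((T z + (g z)\<^sup>2) * h - E z * cnj h) + \<omega> z h) = (*) (T z)"
      by (auto simp: \<omega>_def algebra_simps)
    ultimately show ?thesis by (simp add: has_field_derivative_def)
  qed
  then have "(\<lambda>z. g z + \<Omega> z) holomorphic_on UNIV" "deriv (\<lambda>z. g z + \<Omega> z) = T"
    by (auto simp: holomorphic_on_open intro!: DERIV_imp_deriv)
  then show ?thesis using holomorphic_deriv[OF _ open_UNIV] by metis
qed

section \<open>Linear equations with an entire coefficient\<close>

text \<open>The Taylor coefficients at 0 of the solution of \<open>w'' + T w = 0\<close> with \<open>w 0 = a\<close> and \<open>w' 0 = b\<close>, where \<open>c\<close> are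
  the Taylor coefficients of \<open>T\<close>.\<close>

fun ode_coeff :: "(nat \<Rightarrow> complex) \<Rightarrow> complex \<Rightarrow> complex \<Rightarrow> nat \<Rightarrow> complex" where
  "ode_coeff c a b 0 = a"
| "ode_coeff c a b (Suc 0) = b"
| "ode_coeff c a b (Suc (Suc n)) =
     - (\<Sum>k\<in>{..n}. c k * ode_coeff c a b (n - k)) / (of_nat (n + 2) * of_nat (n + 1))"

text \<open>Since \<open>\<bar>c n\<bar> R\<^sup>n\<close> decays geometrically, the convolution in the recursion is at most a constant times the maximum of
  the earlier terms, and from some index on the divisor \<open>(n + 2) (n + 1)\<close> outweighs this constant.\<close>

lemma ode_coeff_bounded:
  assumes c: "fps_conv_radius (Abs_fps c) = \<infinity>" and R: "0 < R"
  shows "\<exists>M. \<forall>n. cmod (ode_coeff c a b n) * R ^ n \<le> M"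
proof -
  let ?a = "ode_coeff c a b"
  have "summable (\<lambda>n. c n * (of_real (2 * R)) ^ n)"
    using summable_fps[of "of_real (2 * R)" "Abs_fps c"] c by simp
  then have "bounded (range (\<lambda>n. c n * (of_real (2 * R)) ^ n))"
    by (rule convergent_imp_bounded[OF summable_LIMSEQ_zero])
  then obtain C where C: "\<And>n. cmod (c n * (of_real (2 * R)) ^ n) \<le> C" unfolding bounded_iff by auto
  have C0: "0 \<le> C" using C[of 0] norm_ge_zero order_trans by blast
  have cR: "cmod (c n) * R ^ n \<le> C * (1/2) ^ n" for n
    using C[of n] R by (simp add: norm_mult norm_power power_mult_distrib power_divide field_simps)
  obtain N0 :: nat where N0: "2 * C * R\<^sup>2 \<le> real N0" using real_arch_simple by blast
  define M where "M = Max ((\<lambda>j. cmod (?a j) * R ^ j) ` {..N0 + 1})"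
  have M: "cmod (?a j) * R ^ j \<le> M" if "j \<le> N0 + 1" for j
    unfolding M_def using that by (intro Max_ge) auto
  have M0: "0 \<le> M" using M[of 0] by (smt (verit) le0 mult_nonneg_nonneg norm_ge_zero power_0)
  have "cmod (?a n) * R ^ n \<le> M" for n
  proof (induction n rule: less_induct)
    case (less n)
    show ?case
    proof (cases "n \<le> N0 + 1")
      case False
      then obtain k where k: "n = Suc (Suc k)" "N0 \<le> k" by (metis Suc_eq_plus1 add_leE le_Suc_eq not_less_eq_eq old.nat.exhaust zero_le)
      have "cmod (?a n) * R ^ n = cmod (\<Sum>j\<in>{..k}. c j * ?a (k - j)) * R ^ k * (R\<^sup>2 / (real (k + 2) * real (k + 1)))"
      proof -
        have "cmod (of_nat (k + 2) * of_nat (k + 1)) = real (k + 2) * real (k + 1)"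
          unfolding norm_mult norm_of_nat ..
        then show ?thesis
          by (simp only: k ode_coeff.simps norm_divide norm_minus_cancel) (simp add: power2_eq_square field_simps)
      qed
      also have "\<dots> \<le> (2 * C * M) * (R\<^sup>2 / (real (k + 2) * real (k + 1)))"
      proof (rule mult_right_mono)
        have "cmod (\<Sum>j\<in>{..k}. c j * ?a (k - j)) * R ^ k \<le> (\<Sum>j\<in>{..k}. cmod (c j * ?a (k - j))) * R ^ k"
          using R by (intro mult_right_mono norm_sum) auto
        also have "\<dots> = (\<Sum>j\<in>{..k}. (cmod (c j) * R ^ j) * (cmod (?a (k - j)) * R ^ (k - j)))"
          unfolding sum_distrib_right
        proof (intro sum.cong refl)
          fix j assume "j \<in> {..k}"
          then have "R ^ k = R ^ j * R ^ (k - j)" by (simp flip: power_add)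
          then show "cmod (c j * ?a (k - j)) * R ^ k = (cmod (c j) * R ^ j) * (cmod (?a (k - j)) * R ^ (k - j))"
            by (simp add: norm_mult)
        qed
        also have "\<dots> \<le> (\<Sum>j\<in>{..k}. (C * (1/2) ^ j) * M)"
        proof (rule sum_mono)
          fix j assume "j \<in> {..k}"
          have le: "cmod (?a (k - j)) * R ^ (k - j) \<le> M" by (rule less) (simp add: k)
          show "(cmod (c j) * R ^ j) * (cmod (?a (k - j)) * R ^ (k - j)) \<le> (C * (1/2) ^ j) * M"
            by (rule mult_mono[OF cR le]) (use R C0 in simp_all)
        qed
        also have "\<dots> = C * M * (\<Sum>j\<in>{..k}. (1/2) ^ j)" by (simp add: sum_distrib_left mult_ac)
        also have "\<dots> \<le> C * M * 2"
        proof (rule mult_left_mono)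
          have "(\<Sum>j\<in>{..k}. (1/2::real) ^ j) = 2 - (1/2) ^ k"
            by (induction k) (simp_all add: field_simps)
          then show "(\<Sum>j\<in>{..k}. (1/2::real) ^ j) \<le> 2" by simp
        qed (use C0 M0 in simp)
        finally show "cmod (\<Sum>j\<in>{..k}. c j * ?a (k - j)) * R ^ k \<le> 2 * C * M" by simp
      qed simp
      also have "\<dots> = M * (2 * C * R\<^sup>2 / (real (k + 2) * real (k + 1)))" by simp
      also have "\<dots> \<le> M * 1"
      proof (rule mult_left_mono[OF _ M0])
        have "2 * C * R\<^sup>2 \<le> real (k + 2) * 1" using N0 k by simp
        also have "\<dots> \<le> real (k + 2) * real (k + 1)" by (intro mult_left_mono) auto
        finally show "2 * C * R\<^sup>2 / (real (k + 2) * real (k + 1)) \<le> 1" by (simp add: divide_le_eq_1 add_pos_pos)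
      qed
      finally show ?thesis by simp
    qed (use M in auto)
  qed
  then show ?thesis by blast
qed

lemma entire_linear_ode_solution:
  assumes T: "T holomorphic_on UNIV"
  obtains w where "w holomorphic_on UNIV" "w 0 = a" "deriv w 0 = b" "\<And>z. deriv (deriv w) z = - T z * w z"
proof -
  define C where "C = fps_expansion T 0"
  define c where "c = fps_nth C"
  have radC: "fps_conv_radius C = \<infinity>"
    using conv_radius_fps_expansion[of T 0 \<infinity>] T by (simp add: C_def eball_inf)
  have evalC: "eval_fps C z = T z" for z
    using eval_fps_expansion'[of T 0 \<infinity> z] T by (simp add: C_def eball_inf)
  have Cc: "C = Abs_fps c" by (simp add: c_def fps_nth_inverse)
  define W where "W = Abs_fps (ode_coeff c a b)"
  have radW: "fps_conv_radius W = \<infinity>"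
  proof -
    have "ereal r \<le> fps_conv_radius W" if r: "0 < r" for r
    proof -
      obtain M where M: "\<And>n. cmod (ode_coeff c a b n) * (2 * r) ^ n \<le> M"
        using ode_coeff_bounded[of c "2 * r" a b] radC r unfolding Cc by (auto simp del: power_mult_distrib)
      have "summable (\<lambda>n. fps_nth W n * of_real r ^ n)"
      proof (rule summable_comparison_test')
        show "summable (\<lambda>n. M * (1/2) ^ n)" by (intro summable_mult summable_geometric) simp
        show "norm (fps_nth W n * of_real r ^ n) \<le> M * (1/2) ^ n" for n
          using M[of n] r by (simp add: W_def norm_mult norm_power power_mult_distrib power_divide field_simps)
      qed
      then have "ereal (norm (of_real r :: complex)) \<le> conv_radius (fps_nth W)" by (rule conv_radius_geI)
      then show ?thesis using r by (simp add: fps_conv_radius_def)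
    qed
    from this[of "max 1 _"] have "ereal (max 1 x) \<le> fps_conv_radius W" for x by simp
    then show ?thesis by (metis ereal_less_eq(3) ereal_top max.cobounded2 order_trans)
  qed
  have radW': "fps_conv_radius (fps_deriv W) = \<infinity>" "fps_conv_radius (fps_deriv (fps_deriv W)) = \<infinity>"
    using fps_conv_radius_deriv[of W] fps_conv_radius_deriv[of "fps_deriv W"] radW by auto
  have ode: "fps_deriv (fps_deriv W) = - (C * W)"
  proof (rule fps_ext)
    fix n
    have "fps_nth (fps_deriv (fps_deriv W)) n = of_nat (n + 1) * (of_nat (n + 2) * ode_coeff c a b (Suc (Suc n)))"
      by (simp add: W_def)
    also have "\<dots> = - (\<Sum>k\<in>{..n}. c k * ode_coeff c a b (n - k))"
    proof -
      have "(of_nat (n + 1) :: complex) \<noteq> 0" "(of_nat (n + 2) :: complex) \<noteq> 0" by (simp_all del: of_nat_add of_nat_Suc)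
      then show ?thesis by (simp del: of_nat_add of_nat_Suc)
    qed
    also have "\<dots> = fps_nth (- (C * W)) n" by (simp add: fps_mult_nth W_def c_def atMost_atLeast0)
    finally show "fps_nth (fps_deriv (fps_deriv W)) n = fps_nth (- (C * W)) n" .
  qed
  have d1: "(eval_fps W has_field_derivative eval_fps (fps_deriv W) z) (at z)" for z
    by (rule has_field_derivative_eval_fps) (simp add: radW)
  have d2: "(eval_fps (fps_deriv W) has_field_derivative eval_fps (fps_deriv (fps_deriv W)) z) (at z)" for z
    by (rule has_field_derivative_eval_fps) (simp add: radW')
  have D1: "deriv (eval_fps W) = eval_fps (fps_deriv W)" using d1 by (auto intro!: DERIV_imp_deriv)
  have "deriv (deriv (eval_fps W)) z = eval_fps (- (C * W)) z" for z
    unfolding D1 ode[symmetric] by (rule DERIV_imp_deriv[OF d2])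
  also have "eval_fps (- (C * W)) z = - T z * eval_fps W z" for z
  proof -
    have "ereal (norm z) < fps_conv_radius (C * W)"
      using fps_conv_radius_mult[of C W] by (auto simp: radC radW)
    then have "eval_fps (- (C * W)) z = - eval_fps (C * W) z" by (rule eval_fps_minus)
    also have "eval_fps (C * W) z = eval_fps C z * eval_fps W z" by (rule eval_fps_mult) (simp_all add: radC radW)
    finally show ?thesis by (simp add: evalC)
  qed
  finally have "deriv (deriv (eval_fps W)) z = - T z * eval_fps W z" for z .
  moreover have "eval_fps W holomorphic_on UNIV" using d1 by (auto simp: holomorphic_on_open)
  moreover have "eval_fps W 0 = a" "deriv (eval_fps W) 0 = b" unfolding D1 eval_fps_at_0 by (simp_all add: W_def)
  ultimately show ?thesis using that by blast
qed

section \<open>Lower bounds from circle means\<close>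

text \<open>The Laplacian of \<open>V\<close> is \<open>- 4 \<beta>\<close>. For the circle mean \<open>M(r)\<close>, Green's formula reads
  \<open>(r M'(r))' = - 4 r S(r)\<close> with \<open>S(r)\<close> the circle mean of \<open>\<beta>\<close>. Integrating twice from 0 gives both bounds.\<close>

lemma circle_mean_bounds:
  fixes V :: "complex \<Rightarrow> real" and G \<alpha> :: "complex \<Rightarrow> complex" and \<beta> :: "complex \<Rightarrow> real"
  assumes dV: "\<And>z. z \<in> ball 0 2 \<Longrightarrow> (V has_derivative (\<lambda>h. 2 * Re (G z * h))) (at z)"
    and dG: "\<And>z. z \<in> ball 0 2 \<Longrightarrow> (G has_derivative (\<lambda>h. \<alpha> z * h - of_real (\<beta> z) * cnj h)) (at z)"
    and cont: "continuous_on (ball 0 2) \<alpha>" "continuous_on (ball 0 2) \<beta>"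
    and \<beta>: "\<And>z. z \<in> cball 0 1 \<Longrightarrow> 0 \<le> \<beta> z \<and> \<beta> z \<le> B"
  shows "integral {0..2 * pi} (\<lambda>t. V (cis t)) \<le> 2 * pi * V 0"
    and "2 * pi * V 0 - 2 * pi * B \<le> integral {0..2 * pi} (\<lambda>t. V (cis t))"
proof -
  have cV: "continuous_on (ball 0 2) V" and cG: "continuous_on (ball 0 2) G"
    using dV dG by (meson continuous_at_imp_continuous_on has_derivative_continuous)+
  have inb: "of_real r * cis t \<in> ball 0 2" if "r \<in> {0..1}" for r t
    using that by (simp add: norm_mult)
  define M where "M r = integral (cbox 0 (2 * pi)) (\<lambda>t. V (of_real r * cis t))" for r
  define K where "K r = integral (cbox 0 (2 * pi)) (\<lambda>t. 2 * Re (G (of_real r * cis t) * cis t))" for r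
  define N where "N r = integral (cbox 0 (2 * pi)) (\<lambda>t. 2 * Re (G (of_real r * cis t) * (of_real r * cis t)))" for r
  define S where "S r = integral (cbox 0 (2 * pi)) (\<lambda>t. \<beta> (of_real r * cis t))" for r
  have ccis: "continuous_on A (\<lambda>x. of_real (fst x) * cis (snd x))" for A :: "(real \<times> real) set"
    by (intro continuous_intros)
  have ccis1: "continuous_on A (\<lambda>t. of_real r * cis t)" for A :: "real set" and r
    by (intro continuous_intros)
  have NK: "N r = r * K r" for r
  proof -
    have "2 * Re (G (of_real r * cis t) * (of_real r * cis t)) = r * (2 * Re (G (of_real r * cis t) * cis t))" for t
      by (simp add: algebra_simps)
    then show ?thesis by (simp only: N_def K_def integral_mult_right)
  qed
  have dray: "((\<lambda>r. of_real r * cis t) has_derivative (\<lambda>h. of_real h * cis t)) (at r within A)" for r t A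
    by (auto intro!: derivative_eq_intros)
  have dM: "(M has_vector_derivative K r) (at r within {0..1})" if "r \<in> {0..1}" for r
    unfolding M_def K_def
  proof (rule leibniz_rule_vector_derivative)
    fix r t :: real assume r: "r \<in> {0..1}"
    have "((\<lambda>r. V (of_real r * cis t)) has_derivative (\<lambda>h. 2 * Re (G (of_real r * cis t) * (of_real h * cis t)))) (at r within {0..1})"
      using diff_chain_within[OF dray has_derivative_at_withinI[OF dV[OF inb[OF r]]]] by (simp add: o_def)
    moreover have "2 * Re (G (of_real r * cis t) * (of_real h * cis t)) = h *\<^sub>R (2 * Re (G (of_real r * cis t) * cis t))" for h
      by (simp add: algebra_simps)
    ultimately show "((\<lambda>r. V (of_real r * cis t)) has_vector_derivative 2 * Re (G (of_real r * cis t) * cis t)) (at r within {0..1})"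
      unfolding has_vector_derivative_def by (simp only:)
  next
    fix r :: real assume r: "r \<in> {0..1}"
    show "(\<lambda>t. V (of_real r * cis t)) integrable_on cbox 0 (2 * pi)"
      by (intro integrable_continuous continuous_on_compose2[OF cV ccis1]) (use inb[OF r] in auto)
  next
    show "continuous_on ({0..1} \<times> cbox 0 (2 * pi)) (\<lambda>(r, t). 2 * Re (G (of_real r * cis t) * cis t))"
      unfolding case_prod_unfold
      by (intro continuous_intros continuous_on_compose2[OF cG ccis]) (use inb in auto)
  qed (use that in auto)
  have dN: "(N has_vector_derivative - 4 * r * S r) (at r within {0..1})" if r: "r \<in> {0..1}" for r
  proof -
    define n where "n r t = 2 * Re (\<alpha> (of_real r * cis t) * cis t * (of_real r * cis t)
        - of_real (\<beta> (of_real r * cis t)) * of_real r + G (of_real r * cis t) * cis t)" for r t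
    have "(N has_vector_derivative integral (cbox 0 (2 * pi)) (n r)) (at r within {0..1})"
      unfolding N_def
    proof (rule leibniz_rule_vector_derivative)
      fix r t :: real assume r: "r \<in> {0..1}"
      let ?z = "of_real r * cis t"
      have 1: "((\<lambda>r. G (of_real r * cis t)) has_derivative (\<lambda>h. \<alpha> ?z * (of_real h * cis t) - of_real (\<beta> ?z) * cnj (of_real h * cis t))) (at r within {0..1})"
        using diff_chain_within[OF dray has_derivative_at_withinI[OF dG[OF inb[OF r]]]] by (simp add: o_def)
      have "((\<lambda>r. 2 * Re (G (of_real r * cis t) * (of_real r * cis t))) has_derivative
         (\<lambda>h. 2 * Re (G ?z * (of_real h * cis t) + (\<alpha> ?z * (of_real h * cis t) - of_real (\<beta> ?z) * cnj (of_real h * cis t)) * ?z))) (at r within {0..1})"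
        by (intro has_derivative_mult_right bounded_linear.has_derivative[OF bounded_linear_Re] has_derivative_mult 1 dray)
      moreover have "2 * Re (G ?z * (of_real h * cis t) + (\<alpha> ?z * (of_real h * cis t) - of_real (\<beta> ?z) * cnj (of_real h * cis t)) * ?z) = h *\<^sub>R n r t" for h
      proof -
        have "cnj (cis t) * cis t = 1" by (simp add: cis_cnj cis_mult)
        then have "G ?z * (of_real h * cis t) + (\<alpha> ?z * (of_real h * cis t) - of_real (\<beta> ?z) * cnj (of_real h * cis t)) * ?z =
           of_real h * (\<alpha> ?z * cis t * ?z - of_real (\<beta> ?z) * of_real r + G ?z * cis t)" (is "?L = _")
          by (simp add: algebra_simps)
        moreover have "Re (of_real h * X) = h * Re X" for X by simp
        ultimately have "Re ?L = h * Re (\<alpha> ?z * cis t * ?z - of_real (\<beta> ?z) * of_real r + G ?z * cis t)"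
          by (simp only:)
        then show ?thesis by (simp only: n_def real_scaleR_def mult.left_commute)
      qed
      ultimately show "((\<lambda>r. 2 * Re (G (of_real r * cis t) * (of_real r * cis t))) has_vector_derivative n r t) (at r within {0..1})"
        unfolding has_vector_derivative_def by (simp only:)
    next
      fix r :: real assume r: "r \<in> {0..1}"
      show "(\<lambda>t. 2 * Re (G (of_real r * cis t) * (of_real r * cis t))) integrable_on cbox 0 (2 * pi)"
        by (intro integrable_continuous continuous_intros continuous_on_compose2[OF cG ccis1]) (use inb[OF r] in auto)
    next
      show "continuous_on ({0..1} \<times> cbox 0 (2 * pi)) (\<lambda>(r, t). n r t)"
        unfolding case_prod_unfold n_def
        by (intro continuous_intros continuous_on_compose2[OF cG ccis] continuous_on_compose2[OF cont(1) ccis]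
            continuous_on_compose2[OF cont(2) ccis]) (use inb in auto)
    qed (use r in auto)
    moreover have "integral (cbox 0 (2 * pi)) (n r) = - 4 * r * S r"
    proof -
      \<comment> \<open>Up to \<open>- 4 r \<beta>\<close> the integrand is an angular derivative, which integrates to zero over the circle.\<close>
      define k where "k t = 2 * Im (G (of_real r * cis t) * cis t)" for t
      have "((\<lambda>t. n r t + 4 * r * \<beta> (of_real r * cis t)) has_integral k (2 * pi) - k 0) {0..2 * pi}"
      proof (rule fundamental_theorem_of_calculus)
        fix t :: real
        let ?z = "of_real r * cis t"
        have dcis: "(cis has_derivative (\<lambda>h. of_real h * (\<i> * cis t))) (at t within {0..2 * pi})"
          using has_derivative_cis[OF has_derivative_ident, of t "{0..2 * pi}"] by (simp add: scaleR_conv_of_real)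
        have dz: "((\<lambda>t. of_real r * cis t) has_derivative (\<lambda>h. of_real r * (of_real h * (\<i> * cis t)))) (at t within {0..2 * pi})"
          by (rule has_derivative_mult_right[OF dcis])
        have 1: "((\<lambda>t. G (of_real r * cis t)) has_derivative (\<lambda>h. \<alpha> ?z * (of_real r * (of_real h * (\<i> * cis t))) - of_real (\<beta> ?z) * cnj (of_real r * (of_real h * (\<i> * cis t))))) (at t within {0..2 * pi})"
          using diff_chain_within[OF dz has_derivative_at_withinI[OF dG[OF inb[OF r]]]] by (simp add: o_def)
        have "(k has_derivative
         (\<lambda>h. 2 * Im (G ?z * (of_real h * (\<i> * cis t)) + (\<alpha> ?z * (of_real r * (of_real h * (\<i> * cis t))) - of_real (\<beta> ?z) * cnj (of_real r * (of_real h * (\<i> * cis t)))) * cis t))) (at t within {0..2 * pi})"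
          unfolding k_def
          by (intro has_derivative_mult_right bounded_linear.has_derivative[OF bounded_linear_Im] has_derivative_mult 1 dcis)
        moreover have "2 * Im (G ?z * (of_real h * (\<i> * cis t)) + (\<alpha> ?z * (of_real r * (of_real h * (\<i> * cis t))) - of_real (\<beta> ?z) * cnj (of_real r * (of_real h * (\<i> * cis t)))) * cis t)
           = h *\<^sub>R (n r t + 4 * r * \<beta> ?z)" for h
        proof -
          let ?X = "\<alpha> ?z * cis t * ?z + of_real (\<beta> ?z) * of_real r + G ?z * cis t"
          have "cnj (cis t) * cis t = 1" by (simp add: cis_cnj cis_mult)
          then have "G ?z * (of_real h * (\<i> * cis t)) + (\<alpha> ?z * (of_real r * (of_real h * (\<i> * cis t))) - of_real (\<beta> ?z) * cnj (of_real r * (of_real h * (\<i> * cis t)))) * cis t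
            = of_real h * (\<i> * ?X)" (is "?L = _")
            by (simp add: algebra_simps)
          moreover have "Im (of_real h * (\<i> * X)) = h * Re X" for X by simp
          ultimately have "Im ?L = h * Re ?X" by (simp only:)
          moreover have "n r t + 4 * r * \<beta> ?z = 2 * Re ?X" by (simp add: n_def)
          ultimately show ?thesis by (simp only: real_scaleR_def mult.left_commute)
        qed
        ultimately show "(k has_vector_derivative n r t + 4 * r * \<beta> ?z) (at t within {0..2 * pi})"
          unfolding has_vector_derivative_def by (simp only:)
      qed simp
      moreover have "k (2 * pi) = k 0" by (simp add: k_def)
      ultimately have 1: "((\<lambda>t. n r t + 4 * r * \<beta> (of_real r * cis t)) has_integral 0) {0..2 * pi}" by simp
      have "continuous_on {0..2 * pi} (\<lambda>t. \<beta> (of_real r * cis t))"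
        by (intro continuous_on_compose2[OF cont(2) ccis1]) (use inb[OF r] in auto)
      then have "((\<lambda>t. \<beta> (of_real r * cis t)) has_integral S r) {0..2 * pi}"
        by (simp add: S_def integrable_continuous_real integrable_integral)
      from has_integral_diff[OF 1 has_integral_mult_right[OF this, of "4 * r"]]
      show ?thesis by (simp add: integral_unique)
    qed
    ultimately show ?thesis by simp
  qed
  have Sb: "0 \<le> S r" "S r \<le> 2 * pi * B" if r: "r \<in> {0..1}" for r
  proof -
    have "continuous_on {0..2 * pi} (\<lambda>t. \<beta> (of_real r * cis t))"
      by (intro continuous_on_compose2[OF cont(2) ccis1]) (use inb[OF r] in auto)
    then have i: "(\<lambda>t. \<beta> (of_real r * cis t)) integrable_on {0..2 * pi}" by (rule integrable_continuous_real)
    have in1: "of_real r * cis t \<in> cball 0 1" for t using r by (simp add: norm_mult)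
    show "0 \<le> S r" unfolding S_def cbox_interval using \<beta>[OF in1] by (intro integral_nonneg i) auto
    have "S r \<le> integral {0..2 * pi} (\<lambda>t. B)"
      unfolding S_def cbox_interval using \<beta>[OF in1] by (intro integral_le i) auto
    then show "S r \<le> 2 * pi * B" by simp
  qed
  have dN': "(N has_real_derivative - 4 * r * S r) (at r within {0..1})" if "r \<in> {0..1}" for r
    using dN[OF that] by (simp add: has_real_derivative_iff_has_vector_derivative)
  have dM': "(M has_real_derivative K r) (at r within {0..1})" if "r \<in> {0..1}" for r
    using dM[OF that] by (simp add: has_real_derivative_iff_has_vector_derivative)
  have N0: "N 0 = 0" by (simp add: N_def)
  have cN: "continuous_on {0..1} N" using dN' by (rule DERIV_continuous_on)
  have cM: "continuous_on {0..1} M" using dM' by (rule DERIV_continuous_on)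
  have Nle: "N r \<le> 0" and Nge: "- 4 * pi * B * r\<^sup>2 \<le> N r" if r: "r \<in> {0..1}" for r
  proof -
    have "N r \<le> N 0"
    proof (rule DERIV_nonpos_imp_decreasing_open[where f = N])
      fix x assume x: "0 < x" "x < r"
      then have x': "x \<in> {0..1}" "x < 1" using r by auto
      have "(N has_real_derivative - 4 * x * S x) (at x)" using dN'[OF x'(1)] at_within_Icc_at[OF x(1) x'(2)] by simp
      moreover have "- 4 * x * S x \<le> 0" using Sb[OF x'(1)] x by simp
      ultimately show "\<exists>y. (N has_real_derivative y) (at x) \<and> y \<le> 0" by blast
    qed (use r cN in \<open>auto elim: continuous_on_subset\<close>)
    then show "N r \<le> 0" by (simp add: N0)
    have "N 0 + 4 * pi * B * 0\<^sup>2 \<le> N r + 4 * pi * B * r\<^sup>2"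
    proof (rule DERIV_nonneg_imp_increasing_open[where f = "\<lambda>r. N r + 4 * pi * B * r\<^sup>2"])
      fix x assume x: "0 < x" "x < r"
      then have x': "x \<in> {0..1}" "x < 1" using r by auto
      have "(N has_real_derivative - 4 * x * S x) (at x)" using dN'[OF x'(1)] at_within_Icc_at[OF x(1) x'(2)] by simp
      then have "((\<lambda>r. N r + 4 * pi * B * r\<^sup>2) has_real_derivative - 4 * x * S x + 4 * pi * B * (2 * x)) (at x)"
        by (auto intro!: derivative_eq_intros)
      moreover have "4 * x * S x \<le> 4 * x * (2 * pi * B)" using Sb[OF x'(1)] x by (intro mult_left_mono) auto
      then have "0 \<le> - 4 * x * S x + 4 * pi * B * (2 * x)" by (simp add: algebra_simps)
      ultimately show "\<exists>y. ((\<lambda>r. N r + 4 * pi * B * r\<^sup>2) has_real_derivative y) (at x) \<and> 0 \<le> y" by blast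
    next
      have "continuous_on {0..r} N" using r by (intro continuous_on_subset[OF cN]) auto
      then show "continuous_on {0..r} (\<lambda>r. N r + 4 * pi * B * r\<^sup>2)" by (intro continuous_intros)
    qed (use r in auto)
    then show "- 4 * pi * B * r\<^sup>2 \<le> N r" by (simp add: N0)
  qed
  have "M 1 \<le> M 0"
  proof (rule DERIV_nonpos_imp_decreasing_open[where f = M])
    fix x :: real assume x: "0 < x" "x < 1"
    have "(M has_real_derivative K x) (at x)" using dM'[of x] at_within_Icc_at[OF x] x by simp
    moreover have "K x \<le> 0" using Nle[of x] NK[of x] x by (simp add: mult_le_0_iff)
    ultimately show "\<exists>y. (M has_real_derivative y) (at x) \<and> y \<le> 0" by blast
  qed (use cM in auto)
  moreover have "M 0 + 2 * pi * B * 0\<^sup>2 \<le> M 1 + 2 * pi * B * 1\<^sup>2"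
  proof (rule DERIV_nonneg_imp_increasing_open[where f = "\<lambda>r. M r + 2 * pi * B * r\<^sup>2"])
    fix x :: real assume x: "0 < x" "x < 1"
    have "(M has_real_derivative K x) (at x)" using dM'[of x] at_within_Icc_at[OF x] x by simp
    then have "((\<lambda>r. M r + 2 * pi * B * r\<^sup>2) has_real_derivative K x + 2 * pi * B * (2 * x)) (at x)"
      by (auto intro!: derivative_eq_intros)
    moreover have "0 \<le> x * (K x + 2 * pi * B * (2 * x))"
      using Nge[of x] x unfolding NK[of x] by (simp add: power2_eq_square algebra_simps)
    then have "0 \<le> K x + 2 * pi * B * (2 * x)" using x by (simp add: zero_le_mult_iff)
    ultimately show "\<exists>y. ((\<lambda>r. M r + 2 * pi * B * r\<^sup>2) has_real_derivative y) (at x) \<and> 0 \<le> y" by blast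
  qed (use cM in \<open>auto intro!: continuous_intros\<close>)
  moreover have "M 0 = 2 * pi * V 0" by (simp add: M_def)
  moreover have "M 1 = integral {0..2 * pi} (\<lambda>t. V (cis t))" by (simp add: M_def)
  ultimately show "integral {0..2 * pi} (\<lambda>t. V (cis t)) \<le> 2 * pi * V 0"
    and "2 * pi * V 0 - 2 * pi * B \<le> integral {0..2 * pi} (\<lambda>t. V (cis t))" by auto
qed

text \<open>Composition with a holomorphic map multiplies the Laplacian by the squared modulus of its
  derivative, so \<open>circle_mean_bounds\<close> applies to \<open>u \<circ> \<phi>\<close>.\<close>

lemma liouville_jet_circle_mean:
  assumes j: "liouville_jet u g T UNIV" and cT: "continuous_on UNIV T"
    and \<phi>: "\<phi> holomorphic_on ball 0 2"
    and B: "\<And>z. z \<in> cball 0 1 \<Longrightarrow> exp (2 * u (\<phi> z)) / 4 * (cmod (deriv \<phi> z))\<^sup>2 \<le> B"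
  shows "integral {0..2 * pi} (\<lambda>t. u (\<phi> (cis t))) \<le> 2 * pi * u (\<phi> 0)"
    and "2 * pi * u (\<phi> 0) - 2 * pi * B \<le> integral {0..2 * pi} (\<lambda>t. u (\<phi> (cis t)))"
proof -
  define E where "E z = exp (2 * u z) / 4" for z
  define \<alpha> where "\<alpha> z = (T (\<phi> z) + (g (\<phi> z))\<^sup>2) * (deriv \<phi> z)\<^sup>2 + g (\<phi> z) * deriv (deriv \<phi>) z" for z
  define \<beta> where "\<beta> z = E (\<phi> z) * (cmod (deriv \<phi> z))\<^sup>2" for z
  have du: "(u has_derivative (\<lambda>h. 2 * Re (g z * h))) (at z)"
    and dg: "(g has_derivative (\<lambda>h. (T z + (g z)\<^sup>2) * h - of_real (E z) * cnj h)) (at z)" for z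
    using j by (auto simp: liouville_jet_def E_def)
  have cu: "continuous_on UNIV u" and cg: "continuous_on UNIV g"
    using du dg by (meson continuous_at_imp_continuous_on has_derivative_continuous)+
  have hol': "deriv \<phi> holomorphic_on ball 0 2" "deriv (deriv \<phi>) holomorphic_on ball 0 2"
    by (intro holomorphic_deriv \<phi> open_ball)+
  note c\<phi> = holomorphic_on_imp_continuous_on[OF \<phi>] holomorphic_on_imp_continuous_on[OF hol'(1)] holomorphic_on_imp_continuous_on[OF hol'(2)]
  have d\<phi>: "(\<phi> has_derivative (\<lambda>h. deriv \<phi> z * h)) (at z)" "(deriv \<phi> has_derivative (\<lambda>h. deriv (deriv \<phi>) z * h)) (at z)"
    if "z \<in> ball 0 2" for z
    using holomorphic_derivI[OF \<phi> open_ball that] holomorphic_derivI[OF hol'(1) open_ball that]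
    by (simp_all add: has_field_derivative_def)
  have 1: "((\<lambda>z. u (\<phi> z)) has_derivative (\<lambda>h. 2 * Re (g (\<phi> z) * deriv \<phi> z * h))) (at z)" if "z \<in> ball 0 2" for z
    using diff_chain_at[OF d\<phi>(1)[OF that] du] by (simp add: o_def mult.assoc)
  have 2: "((\<lambda>z. g (\<phi> z) * deriv \<phi> z) has_derivative (\<lambda>h. \<alpha> z * h - of_real (\<beta> z) * cnj h)) (at z)" if "z \<in> ball 0 2" for z
  proof -
    have "((\<lambda>z. g (\<phi> z)) has_derivative (\<lambda>h. (T (\<phi> z) + (g (\<phi> z))\<^sup>2) * (deriv \<phi> z * h) - of_real (E (\<phi> z)) * cnj (deriv \<phi> z * h))) (at z)"
      using diff_chain_at[OF d\<phi>(1)[OF that] dg] by (simp add: o_def)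
    from has_derivative_mult[OF this d\<phi>(2)[OF that]]
    have "((\<lambda>z. g (\<phi> z) * deriv \<phi> z) has_derivative (\<lambda>h. g (\<phi> z) * (deriv (deriv \<phi>) z * h) +
        ((T (\<phi> z) + (g (\<phi> z))\<^sup>2) * (deriv \<phi> z * h) - of_real (E (\<phi> z)) * cnj (deriv \<phi> z * h)) * deriv \<phi> z)) (at z)" .
    moreover have "g (\<phi> z) * (deriv (deriv \<phi>) z * h) +
        ((T (\<phi> z) + (g (\<phi> z))\<^sup>2) * (deriv \<phi> z * h) - of_real (E (\<phi> z)) * cnj (deriv \<phi> z * h)) * deriv \<phi> z
        = \<alpha> z * h - of_real (\<beta> z) * cnj h" for h
    proof -
      have "of_real (\<beta> z) = of_real (E (\<phi> z)) * (deriv \<phi> z * cnj (deriv \<phi> z))"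
        by (simp add: \<beta>_def complex_norm_square del: of_real_power)
      then show ?thesis by (simp add: \<alpha>_def power2_eq_square algebra_simps)
    qed
    ultimately show ?thesis by (simp only:)
  qed
  have c: "continuous_on (ball 0 2) \<alpha>" "continuous_on (ball 0 2) \<beta>"
    unfolding \<alpha>_def \<beta>_def E_def
    by (intro continuous_intros c\<phi> continuous_on_compose2[OF cT c\<phi>(1)] continuous_on_compose2[OF cg c\<phi>(1)]
        continuous_on_compose2[OF cu c\<phi>(1)]; simp)+
  have b: "0 \<le> \<beta> z \<and> \<beta> z \<le> B" if "z \<in> cball 0 1" for z
    using B[OF that] by (simp add: \<beta>_def E_def)
  from circle_mean_bounds[OF 1 2 c b]
  show "integral {0..2 * pi} (\<lambda>t. u (\<phi> (cis t))) \<le> 2 * pi * u (\<phi> 0)"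
    and "2 * pi * u (\<phi> 0) - 2 * pi * B \<le> integral {0..2 * pi} (\<lambda>t. u (\<phi> (cis t)))" by simp_all
qed

text \<open>A continuous choice of the angle of the boundary values of the disc automorphism
  \<open>\<omega> \<mapsto> (\<omega> + a) / (1 + a \<omega>)\<close>. At \<open>e\<^sup>\<i>\<^sup>t\<close> this is \<open>e\<^sup>\<i>\<^sup>t\<close> times the quotient of \<open>1 + a e\<^sup>-\<^sup>\<i>\<^sup>t\<close> by its own
  conjugate, whence twice an argument.\<close>

definition moebius_angle :: "real \<Rightarrow> real \<Rightarrow> real" where
  "moebius_angle a t = t + 2 * Im (Ln (1 + of_real a * cis (- t)))"

lemma cis_moebius_angle:
  assumes "0 \<le> a" "a \<le> 1/2"
  shows "(cis t + of_real a) / (1 + of_real a * cis t) = cis (moebius_angle a t)"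
proof -
  define x where "x = of_real a * cis (- t)"
  have nx: "cmod x \<le> 1/2" using assms by (simp add: x_def norm_mult)
  have nz: "1 + x \<noteq> 0"
  proof -
    have "1 + x = 0 \<Longrightarrow> cmod x = 1" by (simp add: add_eq_0_iff)
    then show ?thesis using nx by auto
  qed
  have "cis t + of_real a = cis t * (1 + x)" by (simp add: x_def distrib_left cis_mult mult.left_commute)
  moreover have "1 + of_real a * cis t = cnj (1 + x)" by (simp add: x_def cis_cnj)
  ultimately have "(cis t + of_real a) / (1 + of_real a * cis t) = cis t * ((1 + x) / cnj (1 + x))" by simp
  also have "(1 + x) / cnj (1 + x) = cis (2 * Im (Ln (1 + x)))"
  proof -
    have "1 + x = exp (Ln (1 + x))" using nz by simp
    then have "(1 + x) / cnj (1 + x) = exp (Ln (1 + x)) / exp (cnj (Ln (1 + x)))" by (metis exp_cnj)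
    also have "\<dots> = exp (Ln (1 + x) - cnj (Ln (1 + x)))" by (simp add: exp_diff)
    also have "Ln (1 + x) - cnj (Ln (1 + x)) = \<i> * of_real (2 * Im (Ln (1 + x)))" by (simp add: complex_eq_iff)
    finally show ?thesis by (simp add: cis_conv_exp)
  qed
  finally show ?thesis by (simp add: moebius_angle_def x_def cis_mult)
qed

lemma moebius_angle_deriv:
  assumes "0 \<le> a" "a \<le> 1/2"
  shows "\<exists>D. (moebius_angle a has_real_derivative D) (at t within S) \<and> 1/3 \<le> D"
proof -
  define x where "x = of_real a * cis (- t)"
  have nx: "cmod x \<le> 1/2" using assms by (simp add: x_def norm_mult)
  have Rx: "- (1/2) \<le> Re x" using nx abs_Re_le_cmod[of x] by linarith
  have nz: "1 + x \<notin> \<real>\<^sub>\<le>\<^sub>0" using Rx by (auto simp: complex_nonpos_Reals_iff)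
  have "((\<lambda>t. of_real a * cis (- t)) has_vector_derivative - \<i> * x) (at t within S)"
    unfolding x_def has_vector_derivative_def
    by (auto intro!: derivative_eq_intros simp: scaleR_conv_of_real)
  then have "((\<lambda>t. 1 + of_real a * cis (- t)) has_vector_derivative - \<i> * x) (at t within S)"
    using has_vector_derivative_add[OF has_vector_derivative_const[of 1]] by fastforce
  from field_vector_diff_chain_within[OF this, of Ln "inverse (1 + x)"]
  have "((Ln \<circ> (\<lambda>t. 1 + of_real a * cis (- t))) has_vector_derivative - \<i> * x * inverse (1 + x)) (at t within S)"
    using has_field_derivative_Ln[OF nz] by (simp add: x_def has_field_derivative_at_within)
  from bounded_linear.has_vector_derivative[OF bounded_linear_Im this]
  have "((\<lambda>t. Im (Ln (1 + of_real a * cis (- t)))) has_real_derivative Im (- \<i> * x * inverse (1 + x))) (at t within S)"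
    by (simp add: has_real_derivative_iff_has_vector_derivative o_def)
  then have d: "(moebius_angle a has_real_derivative 1 + 2 * Im (- \<i> * x * inverse (1 + x))) (at t within S)"
    unfolding moebius_angle_def by (intro DERIV_add DERIV_ident DERIV_cmult)
  have nz': "1 + x \<noteq> 0" using nz by auto
  have "- \<i> * x * inverse (1 + x) = - \<i> * (1 - inverse (1 + x))" using nz' by (simp add: field_simps)
  moreover have "Im (- \<i> * (1 - X)) = Re X - 1" for X by simp
  ultimately have I: "Im (- \<i> * x * inverse (1 + x)) = Re (inverse (1 + x)) - 1" by (simp only:)
  have "2/3 \<le> Re (inverse (1 + x))"
  proof -
    have "Re (inverse (1 + x)) = (1 + Re x) / (cmod (1 + x))\<^sup>2"
      by (simp add: inverse_complex.simps cmod_power2)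
    moreover have "(cmod (1 + x))\<^sup>2 = 1 + 2 * Re x + (cmod x)\<^sup>2"
      unfolding cmod_power2 by (simp add: power2_eq_square algebra_simps)
    moreover have "(cmod x)\<^sup>2 \<le> (1/2)\<^sup>2" using nx by (intro power_mono) auto
    moreover have "0 < (cmod (1 + x))\<^sup>2" using nz' by simp
    moreover have "Re x \<le> 1/2" using nx abs_Re_le_cmod[of x] by linarith
    ultimately show ?thesis by (simp add: pos_le_divide_eq power2_eq_square)
  qed
  then have "1/3 \<le> 1 + 2 * Im (- \<i> * x * inverse (1 + x))"
  proof -
    have "1/3 \<le> 1 + 2 * (y - 1)" if "2/3 \<le> y" for y :: real using that by simp
    then show ?thesis unfolding I using \<open>2/3 \<le> Re (inverse (1 + x))\<close> by blast
  qed
  with d show ?thesis by blast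
qed

text \<open>Harnack's inequality in boundary form: the Poisson kernel of the point \<open>a\<close> is the derivative of the inverse
  of \<open>moebius_angle a\<close>, which is at most 3 for \<open>a \<le> 1/2\<close>.\<close>

lemma moebius_angle_integral_le:
  fixes q :: "real \<Rightarrow> real"
  assumes a: "0 \<le> a" "a \<le> 1/2" and q: "continuous_on {0..2 * pi} q" "\<And>t. t \<in> {0..2 * pi} \<Longrightarrow> 0 \<le> q t"
  shows "integral {0..2 * pi} (\<lambda>t. q (moebius_angle a t)) \<le> 3 * integral {0..2 * pi} q"
proof -
  let ?g = "moebius_angle a"
  obtain g' where g': "\<And>t. (?g has_real_derivative g' t) (at t within {0..2 * pi})" "\<And>t. 1/3 \<le> g' t"
    using moebius_angle_deriv[OF a, of _ "{0..2 * pi}"] by metis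
  have ends: "?g 0 = 0" "?g (2 * pi) = 2 * pi"
  proof -
    have "1 + complex_of_real a = of_real (1 + a)" by simp
    then have "Im (Ln (1 + complex_of_real a)) = 0" using a Ln_of_real[of "1 + a"] by (metis Im_complex_of_real add_pos_nonneg zero_less_one)
    then show "?g 0 = 0" "?g (2 * pi) = 2 * pi" by (simp_all add: moebius_angle_def flip: cis_inverse)
  qed
  have mono: "?g s \<le> ?g t" if "s \<le> t" for s t
  proof (rule DERIV_nonneg_imp_nondecreasing[OF that])
    fix x
    obtain D where "(?g has_real_derivative D) (at x)" "1/3 \<le> D" using moebius_angle_deriv[OF a, of x UNIV] by auto
    then show "\<exists>y. (?g has_real_derivative y) (at x) \<and> 0 \<le> y" by (intro exI[of _ D]) auto
  qed
  have im: "?g ` {0..2 * pi} \<subseteq> {0..2 * pi}"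
    using mono[of 0] mono[of _ "2 * pi"] ends by (auto simp: image_subset_iff)
  have cg: "continuous_on {0..2 * pi} ?g" using g'(1) by (rule DERIV_continuous_on)
  have I: "((\<lambda>t. g' t *\<^sub>R q (?g t)) has_integral integral {0..2 * pi} q) {0..2 * pi}"
    using has_integral_substitution[OF _ _ im q(1) g'(1)] ends by simp
  have qg: "0 \<le> q (?g t)" if "t \<in> {0..2 * pi}" for t using q(2) im that by blast
  have "integral {0..2 * pi} (\<lambda>t. q (?g t)) \<le> integral {0..2 * pi} (\<lambda>t. 3 * (g' t *\<^sub>R q (?g t)))"
  proof (rule integral_le)
    show "(\<lambda>t. q (?g t)) integrable_on {0..2 * pi}"
      by (intro integrable_continuous_real continuous_on_compose2[OF q(1) cg im])
    show "(\<lambda>t. 3 * (g' t *\<^sub>R q (?g t))) integrable_on {0..2 * pi}"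
      using has_integral_integrable[OF has_integral_mult_right[OF I, of 3]] .
    show "q (?g t) \<le> 3 * (g' t *\<^sub>R q (?g t))" if "t \<in> {0..2 * pi}" for t
      using mult_right_mono[OF g'(2)[of t] qg[OF that]] by simp
  qed
  also have "\<dots> = 3 * integral {0..2 * pi} q"
    using has_integral_mult_right[OF I, of 3] by (rule integral_unique)
  finally show ?thesis .
qed

text \<open>A solution is superharmonic, and its Laplacian is at most polynomially negative when \<open>e\<^sup>u\<close> is
  polynomially bounded. Hence its means over circles around the origin cannot drop faster than a polynomial, and Harnack's
  inequality transports this from the circle of radius \<open>R = 2 \<bar>z\<bar> + 1\<close> to the point \<open>z\<close>, which lies at
  relative distance \<open>a \<le> 1/2\<close> from the centre.\<close>

lemma liouville_jet_polynomial_lower_bound: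
  assumes j: "liouville_jet u g T UNIV" and cT: "continuous_on UNIV T"
    and K: "0 < K" "\<And>z. exp (u z) \<le> K * (1 + cmod z) ^ n"
  obtains \<Lambda> where "0 \<le> \<Lambda>" "\<And>z. - u z \<le> \<Lambda> * (1 + cmod z) ^ (2 * n + 2)"
proof -
  define \<Lambda> where "\<Lambda> = 2 * \<bar>ln K\<bar> + 4 * real n + 3 * \<bar>u 0\<bar> + 3 * K\<^sup>2 * 4 ^ n"
  have cu: "continuous_on UNIV u"
    using j unfolding liouville_jet_def by (meson UNIV_I continuous_at_imp_continuous_on has_derivative_continuous)
  have "- u z \<le> \<Lambda> * (1 + cmod z) ^ (2 * n + 2)" for z
  proof -
    define R where "R = 2 * cmod z + 1"
    define \<eta> where "\<eta> = (if z = 0 then 1 else z / of_real (cmod z))"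
    define a where "a = cmod z / R"
    have R: "1 \<le> R" by (simp add: R_def)
    have \<eta>: "cmod \<eta> = 1" "of_real (cmod z) * \<eta> = z" by (auto simp: \<eta>_def norm_divide)
    have Rpos: "0 < R" using R by simp
    have a: "0 \<le> a" "a \<le> 1/2"
      unfolding a_def pos_divide_le_eq[OF Rpos] using R by (auto simp: R_def)
    \<comment> \<open>Both maps send the unit disc onto the disc of radius \<open>R\<close>; the centre goes to \<open>z\<close> under \<open>\<psi>\<close> and to 0 under \<open>\<phi>\<close>.\<close>
    define \<psi> where "\<psi> \<omega> = of_real R * \<eta> * ((\<omega> + of_real a) / (1 + of_real a * \<omega>))" for \<omega> :: complex
    define \<phi> where "\<phi> \<omega> = of_real R * \<eta> * \<omega>" for \<omega>
    have den: "1 + of_real a * \<omega> \<noteq> 0" if "\<omega> \<in> ball 0 2" for \<omega> :: complex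
    proof
      assume "1 + of_real a * \<omega> = 0"
      then have "of_real a * \<omega> = - 1" by (simp add: add_eq_0_iff)
      then have "a * cmod \<omega> = 1" using a by (metis norm_minus_cancel norm_mult norm_of_real norm_one abs_of_nonneg)
      moreover have "a * cmod \<omega> \<le> 1/2 * cmod \<omega>" using a by (intro mult_right_mono) auto
      ultimately show False using that by simp
    qed
    have hol\<psi>: "\<psi> holomorphic_on ball 0 2" unfolding \<psi>_def using den by (intro holomorphic_intros) auto
    have hol\<phi>: "\<phi> holomorphic_on ball 0 2" unfolding \<phi>_def by (intro holomorphic_intros)
    have \<psi>0: "\<psi> 0 = z" using R \<eta> by (simp add: \<psi>_def a_def mult_ac)
    have \<psi>cis: "\<psi> (cis t) = of_real R * \<eta> * cis (moebius_angle a t)" for t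
      by (simp add: \<psi>_def cis_moebius_angle[OF a])
    have d\<phi>: "deriv \<phi> \<omega> = of_real R * \<eta>" for \<omega>
      unfolding \<phi>_def by (rule DERIV_imp_deriv) (auto intro!: derivative_eq_intros)
    define U where "U = ln K + n * ln (1 + R)"
    have uU: "u x \<le> U" "exp (u x) \<le> K * (1 + R) ^ n" if "cmod x \<le> R" for x
    proof -
      have "exp (u x) \<le> K * (1 + cmod x) ^ n" by (rule K)
      also have "\<dots> \<le> K * (1 + R) ^ n" using that K R by (intro mult_left_mono power_mono) auto
      finally show 1: "exp (u x) \<le> K * (1 + R) ^ n" .
      then have "ln (exp (u x)) \<le> ln (K * (1 + R) ^ n)" using K R by (intro ln_mono) auto
      then show "u x \<le> U" using K R by (simp add: U_def ln_mult ln_realpow)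
    qed
    define B where "B = (K * (1 + R) ^ n)\<^sup>2 / 4 * R\<^sup>2"
    have "exp (2 * u (\<phi> \<omega>)) / 4 * (cmod (deriv \<phi> \<omega>))\<^sup>2 \<le> B" if "\<omega> \<in> cball 0 1" for \<omega>
    proof -
      have "cmod (\<phi> \<omega>) = R * cmod \<omega>" using \<eta> R by (simp add: \<phi>_def norm_mult)
      also have "\<dots> \<le> R" using that R by (intro mult_left_le) auto
      finally have "exp (u (\<phi> \<omega>)) \<le> K * (1 + R) ^ n" by (rule uU(2))
      then have "(exp (u (\<phi> \<omega>)))\<^sup>2 \<le> (K * (1 + R) ^ n)\<^sup>2" by (intro power_mono) auto
      moreover have "cmod (deriv \<phi> \<omega>) = R" using \<eta> R by (simp add: d\<phi> norm_mult)
      ultimately show ?thesis unfolding B_def exp_double by (simp add: mult_right_mono divide_right_mono)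
    qed
    from liouville_jet_circle_mean(2)[OF j cT hol\<phi> this]
    have low: "2 * pi * u 0 - 2 * pi * B \<le> integral {0..2 * pi} (\<lambda>t. u (\<phi> (cis t)))" by (simp add: \<phi>_def)
    have cont\<psi>: "continuous_on (ball 0 2) (\<lambda>\<omega>. exp (2 * u (\<psi> \<omega>)) / 4 * (cmod (deriv \<psi> \<omega>))\<^sup>2)"
      by (intro continuous_intros continuous_on_compose2[OF cu holomorphic_on_imp_continuous_on[OF hol\<psi>]]
          holomorphic_on_imp_continuous_on holomorphic_deriv hol\<psi>) auto
    have "bounded ((\<lambda>\<omega>. exp (2 * u (\<psi> \<omega>)) / 4 * (cmod (deriv \<psi> \<omega>))\<^sup>2) ` cball 0 1)"
      by (intro compact_imp_bounded compact_continuous_image continuous_on_subset[OF cont\<psi>]) auto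
    then obtain B' where "\<And>\<omega>. \<omega> \<in> cball 0 1 \<Longrightarrow> exp (2 * u (\<psi> \<omega>)) / 4 * (cmod (deriv \<psi> \<omega>))\<^sup>2 \<le> B'"
      unfolding bounded_iff real_norm_def by (meson abs_le_D1 imageI)
    from liouville_jet_circle_mean(1)[OF j cT hol\<psi> this]
    have up: "integral {0..2 * pi} (\<lambda>t. u (\<psi> (cis t))) \<le> 2 * pi * u z" by (simp add: \<psi>0)
    \<comment> \<open>\<open>U - u\<close> is nonnegative on the disc, as Harnack's inequality requires.\<close>
    define q where "q t = U - u (of_real R * \<eta> * cis t)" for t
    have cq: "continuous_on S q" for S
      unfolding q_def by (intro continuous_intros continuous_on_compose2[OF cu]) auto
    have qpos: "0 \<le> q t" for t using uU(1)[of "of_real R * \<eta> * cis t"] \<eta> R by (simp add: q_def norm_mult)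
    have cang: "continuous_on S (moebius_angle a)" for S
      using moebius_angle_deriv[OF a, of _ S] by (meson DERIV_continuous continuous_on_eq_continuous_within)
    have cu1: "continuous_on S (\<lambda>t. u (of_real R * \<eta> * cis t))" for S
      by (intro continuous_on_compose2[OF cu] continuous_intros) auto
    have cu2: "continuous_on S (\<lambda>t. u (of_real R * \<eta> * cis (moebius_angle a t)))" for S
      by (intro continuous_on_compose2[OF cu1[of UNIV] cang]) auto
    have "2 * pi * (U - u z) \<le> integral {0..2 * pi} (\<lambda>t. q (moebius_angle a t))"
    proof -
      have "integral {0..2 * pi} (\<lambda>t. q (moebius_angle a t)) =
          integral {0..2 * pi} (\<lambda>t. U) - integral {0..2 * pi} (\<lambda>t. u (\<psi> (cis t)))"
        unfolding q_def \<psi>cis by (intro integral_diff integrable_continuous_real continuous_intros cu2)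
      then show ?thesis using up by (simp add: algebra_simps)
    qed
    also have "\<dots> \<le> 3 * integral {0..2 * pi} q"
      by (rule moebius_angle_integral_le[OF a cq qpos])
    also have "integral {0..2 * pi} q \<le> 2 * pi * (U - u 0 + B)"
    proof -
      have "integral {0..2 * pi} q =
          integral {0..2 * pi} (\<lambda>t. U) - integral {0..2 * pi} (\<lambda>t. u (\<phi> (cis t)))"
        unfolding q_def \<phi>_def by (intro integral_diff integrable_continuous_real continuous_intros cu1)
      then show ?thesis using low by (simp add: algebra_simps)
    qed
    finally have "2 * pi * (U - u z) \<le> 2 * pi * (3 * (U - u 0 + B))" by simp
    then have "U - u z \<le> 3 * (U - u 0 + B)" by (rule mult_left_le_imp_le) simp
    then have 1: "- u z \<le> 2 * U + 3 * \<bar>u 0\<bar> + 3 * B" by simp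
    define X where "X = 1 + cmod z"
    have X: "1 \<le> X" "1 + R = 2 * X" "R \<le> 2 * X" by (simp_all add: X_def R_def)
    define Y where "Y = X ^ (2 * n + 2)"
    have Y: "1 \<le> Y" "X \<le> Y"
      unfolding Y_def using X by (auto simp del: power_Suc power_Suc2 power_add_numeral2 add_2_eq_Suc' intro!: self_le_power one_le_power)
    have "ln (1 + R) \<le> 2 * X" using X ln_le_minus_one[of "1 + R"] by simp
    then have "ln (1 + R) \<le> 2 * Y" using Y by linarith
    then have "real n * ln (1 + R) \<le> real n * (2 * Y)" by (intro mult_left_mono) auto
    moreover have "ln K \<le> \<bar>ln K\<bar> * Y" using Y by (smt (verit) mult_le_cancel_left1)
    ultimately have U: "U \<le> \<bar>ln K\<bar> * Y + 2 * real n * Y" by (simp add: U_def)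
    have "B \<le> (K * (2 * X) ^ n)\<^sup>2 / 4 * (2 * X)\<^sup>2"
      unfolding B_def X(2) using X R by (intro mult_left_mono power_mono) auto
    also have "\<dots> = K\<^sup>2 * 4 ^ n * Y"
      by (simp add: Y_def power_mult_distrib power_add power_mult power2_eq_square mult_ac power_even_eq)
         (simp add: power_mult_distrib[symmetric] mult_ac)
    finally have B: "B \<le> K\<^sup>2 * 4 ^ n * Y" .
    have u0: "\<bar>u 0\<bar> \<le> \<bar>u 0\<bar> * Y" using Y by (simp add: mult_le_cancel_left1)
    have "- u z \<le> 2 * (\<bar>ln K\<bar> * Y + 2 * real n * Y) + 3 * (\<bar>u 0\<bar> * Y) + 3 * (K\<^sup>2 * 4 ^ n * Y)"
    proof -
      have "2 * U + 3 * \<bar>u 0\<bar> + 3 * B \<le> 2 * (\<bar>ln K\<bar> * Y + 2 * real n * Y) + 3 * (\<bar>u 0\<bar> * Y) + 3 * (K\<^sup>2 * 4 ^ n * Y)"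
        by (intro add_mono mult_left_mono U B u0) auto
      with 1 show ?thesis by (rule order_trans)
    qed
    also have "\<dots> = \<Lambda> * Y" by (simp add: \<Lambda>_def algebra_simps)
    finally show ?thesis by (simp add: Y_def X_def)
  qed
  moreover have "0 \<le> \<Lambda>" by (simp add: \<Lambda>_def)
  ultimately show ?thesis using that by blast
qed

section \<open>Polynomial growth forces a polynomial potential\<close>

lemma has_derivative_cmod_power2:
  assumes "(v has_field_derivative v') (at x)"
  shows "((\<lambda>x. (cmod (v x))\<^sup>2) has_derivative (\<lambda>k. 2 * Re (cnj (v x) * v' * k))) (at x)"
proof -
  have d: "(v has_derivative (\<lambda>k. v' * k)) (at x)" using assms by (simp add: has_field_derivative_def)
  have "((\<lambda>x. Re (v x * cnj (v x))) has_derivative (\<lambda>k. Re (v x * cnj (v' * k) + v' * k * cnj (v x)))) (at x)"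
    by (intro bounded_linear.has_derivative[OF bounded_linear_Re] has_derivative_mult d
        bounded_linear.has_derivative[OF bounded_linear_cnj])
  moreover have "Re (v x * cnj (v' * k) + v' * k * cnj (v x)) = 2 * Re (cnj (v x) * v' * k)" for k
    by (simp add: algebra_simps)
  moreover have "Re (v x * cnj (v x)) = (cmod (v x))\<^sup>2" for x
    unfolding complex_norm_square[symmetric] by (simp del: of_real_power)
  ultimately show ?thesis by (simp only:)
qed

text \<open>The function \<open>exp (G / B)\<close> has modulus between \<open>1 / e\<close> and \<open>e\<close>, so Cauchy's inequality for it bounds its
  logarithmic derivative \<open>G' / B\<close>, without any bound on the imaginary part of \<open>G\<close>.\<close>

lemma deriv_bound_of_log_bound:
  assumes G: "G holomorphic_on ball z0 \<rho>" and \<rho>: "0 < \<rho>" and B: "0 < B"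
    and R: "\<And>z. z \<in> ball z0 \<rho> \<Longrightarrow> \<bar>Re (G z)\<bar> \<le> B"
  shows "cmod (deriv G z0) \<le> 3 * B * exp 2 / \<rho>" "cmod (deriv (deriv G) z0) \<le> 9 * B * exp 2 / \<rho>\<^sup>2"
proof -
  define k where "k z = exp (G z / of_real B)" for z
  have holk: "k holomorphic_on ball z0 \<rho>" unfolding k_def using B by (intro holomorphic_intros G) auto
  have nk: "exp (- 1) \<le> cmod (k z)" "cmod (k z) \<le> exp 1" if "z \<in> ball z0 \<rho>" for z
  proof -
    have "- 1 \<le> Re (G z) / B" "Re (G z) / B \<le> 1" using R[OF that] B by (auto simp: field_simps abs_le_iff)
    then show "exp (- 1) \<le> cmod (k z)" "cmod (k z) \<le> exp 1" by (simp_all add: k_def)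
  qed
  have dG: "cmod (deriv G z) \<le> 3 * B * exp 2 / \<rho>" if z: "z \<in> cball z0 (\<rho> / 3)" for z
  proof -
    have sub: "cball z (\<rho> / 3) \<subseteq> ball z0 \<rho>"
    proof
      fix y assume "y \<in> cball z (\<rho> / 3)"
      then have "dist z0 y \<le> \<rho> / 3 + \<rho> / 3" using z dist_triangle[of z0 y z] by simp
      then show "y \<in> ball z0 \<rho>" using \<rho> by simp
    qed
    have zin: "z \<in> ball z0 \<rho>" using subsetD[OF sub, of z] \<rho> by simp
    have "cmod ((deriv ^^ 1) k z) \<le> fact 1 * exp 1 / (\<rho> / 3) ^ 1"
    proof (rule Cauchy_inequality)
      show "k holomorphic_on ball z (\<rho> / 3)" using holk sub by (meson ball_subset_cball holomorphic_on_subset order_trans)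
      show "continuous_on (cball z (\<rho> / 3)) k" using holk sub by (meson continuous_on_subset holomorphic_on_imp_continuous_on)
      show "cmod (k x) \<le> exp 1" if "cmod (z - x) = \<rho> / 3" for x
        using that sub by (intro nk) (auto simp: dist_norm subset_iff)
    qed (use \<rho> in auto)
    then have dk: "cmod (deriv k z) \<le> 3 * exp 1 / \<rho>" by (simp add: field_simps)
    have "(G has_field_derivative deriv G z) (at z)" by (rule holomorphic_derivI[OF G open_ball zin])
    then have "(k has_field_derivative k z * (deriv G z / of_real B)) (at z)"
      unfolding k_def using B by (auto intro!: derivative_eq_intros)
    then have "deriv k z = k z * (deriv G z / of_real B)" by (rule DERIV_imp_deriv)
    then have "cmod (k z) * cmod (deriv G z) / B \<le> 3 * exp 1 / \<rho>" using dk B by (simp add: norm_mult norm_divide)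
    moreover have "exp (- 1) * cmod (deriv G z) / B \<le> cmod (k z) * cmod (deriv G z) / B"
      using nk[OF zin] B by (intro divide_right_mono mult_right_mono) auto
    ultimately have "exp (- 1) * cmod (deriv G z) / B \<le> 3 * exp 1 / \<rho>" by linarith
    then have "exp 1 * (exp (- 1) * cmod (deriv G z) / B) \<le> exp 1 * (3 * exp 1 / \<rho>)" by (intro mult_left_mono) auto
    moreover have "exp 1 * (exp (- 1) * cmod (deriv G z) / B) = cmod (deriv G z) / B"
      by (simp add: mult.assoc[symmetric] exp_minus)
    moreover have "exp 1 * (3 * exp 1 / \<rho>) = 3 * exp 2 / \<rho>" using exp_double[of "1::real"] by (simp add: power2_eq_square)
    ultimately have "cmod (deriv G z) / B \<le> 3 * exp 2 / \<rho>" by (simp only:)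
    then show ?thesis using B by (simp add: field_simps)
  qed
  show "cmod (deriv G z0) \<le> 3 * B * exp 2 / \<rho>" using \<rho> by (intro dG) auto
  have hol': "deriv G holomorphic_on ball z0 \<rho>" by (intro holomorphic_deriv G open_ball)
  have "cmod ((deriv ^^ 1) (deriv G) z0) \<le> fact 1 * (3 * B * exp 2 / \<rho>) / (\<rho> / 3) ^ 1"
  proof (rule Cauchy_inequality)
    have sub: "cball z0 (\<rho> / 3) \<subseteq> ball z0 \<rho>" using \<rho> by auto
    show "deriv G holomorphic_on ball z0 (\<rho> / 3)" using hol' sub by (meson ball_subset_cball holomorphic_on_subset order_trans)
    show "continuous_on (cball z0 (\<rho> / 3)) (deriv G)" using hol' sub by (meson continuous_on_subset holomorphic_on_imp_continuous_on)
    show "cmod (deriv G x) \<le> 3 * B * exp 2 / \<rho>" if "cmod (z0 - x) = \<rho> / 3" for x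
      using that by (intro dG) (simp add: dist_norm)
  qed (use \<rho> in auto)
  then show "cmod (deriv (deriv G) z0) \<le> 9 * B * exp 2 / \<rho>\<^sup>2" by (simp add: power2_eq_square)
qed

text \<open>The quotient \<open>w1 / w2\<close> moves on the Riemann sphere with speed \<open>1 / (\<bar>w1\<bar>\<^sup>2 + \<bar>w2\<bar>\<^sup>2)\<close>. If it is rotated to 0 at
  \<open>z0\<close>, it stays in the hemisphere around 0 over the disc of radius \<open>\<rho>\<close>. There the denominator \<open>v2\<close> carries at least half of the
  sum of squares, has a logarithm \<open>G\<close> with bounded real part, and \<open>T = - v2'' / v2 = - G'' - G'\<^sup>2\<close>.\<close>

lemma potential_local_bound:
  assumes w: "w1 holomorphic_on UNIV" "w2 holomorphic_on UNIV"
    and ode: "\<And>z. deriv (deriv w1) z = - T z * w1 z" "\<And>z. deriv (deriv w2) z = - T z * w2 z"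
    and wr: "\<And>z. deriv w1 z * w2 z - w1 z * deriv w2 z = 1"
    and \<rho>: "0 < \<rho>" and B: "0 < B"
    and h: "\<And>z. z \<in> ball z0 \<rho> \<Longrightarrow> 1 / norm_square_pair w1 w2 z \<le> 1 / (2 * \<rho>)"
    and lnh: "\<And>z. z \<in> ball z0 \<rho> \<Longrightarrow> \<bar>ln (norm_square_pair w1 w2 z)\<bar> + 1 \<le> B"
  shows "cmod (T z0) \<le> 9 * B * exp 2 / \<rho>\<^sup>2 + (3 * B * exp 2 / \<rho>)\<^sup>2"
proof -
  let ?h = "norm_square_pair w1 w2"
  have hpos: "0 < ?h z" for z by (rule norm_square_pair_pos[OF wr])
  define s where "s = sqrt (?h z0)"
  have s: "0 < s" "s\<^sup>2 = ?h z0" using hpos[of z0] by (simp_all add: s_def)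
  define a b where "a = w1 z0 / of_real s" and "b = w2 z0 / of_real s"
  have ab: "a * cnj a + b * cnj b = 1"
  proof -
    have "a * cnj a + b * cnj b = of_real ((cmod a)\<^sup>2 + (cmod b)\<^sup>2)" by (simp add: complex_norm_square del: of_real_power)
    also have "(cmod a)\<^sup>2 + (cmod b)\<^sup>2 = ?h z0 / s\<^sup>2"
      using s(1) by (simp add: a_def b_def norm_divide power_divide norm_square_pair_def add_divide_distrib)
    finally show ?thesis using s hpos[of z0] by simp
  qed
  \<comment> \<open>A unitary change of the pair makes the first function vanish at \<open>z0\<close>.\<close>
  define v1 where "v1 z = b * w1 z - a * w2 z" for z
  define v2 where "v2 z = cnj a * w1 z + cnj b * w2 z" for z
  have hv: "(cmod (v1 z))\<^sup>2 + (cmod (v2 z))\<^sup>2 = ?h z" for z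
  proof -
    have "complex_of_real ((cmod (v1 z))\<^sup>2 + (cmod (v2 z))\<^sup>2) = v1 z * cnj (v1 z) + v2 z * cnj (v2 z)"
      by (simp add: complex_norm_square del: of_real_power)
    also have "\<dots> = (a * cnj a + b * cnj b) * (w1 z * cnj (w1 z) + w2 z * cnj (w2 z))"
      by (simp add: v1_def v2_def algebra_simps)
    also have "\<dots> = of_real (?h z)" unfolding ab by (simp add: norm_square_pair_def complex_norm_square del: of_real_power)
    finally show ?thesis by (simp only: of_real_eq_iff)
  qed
  have dw: "(w1 has_field_derivative deriv w1 z) (at z)" "(w2 has_field_derivative deriv w2 z) (at z)"
    "(deriv w1 has_field_derivative - T z * w1 z) (at z)" "(deriv w2 has_field_derivative - T z * w2 z) (at z)" for z
    using holomorphic_derivI[OF w(1) open_UNIV] holomorphic_derivI[OF w(2) open_UNIV]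
      holomorphic_derivI[OF holomorphic_deriv[OF w(1) open_UNIV] open_UNIV]
      holomorphic_derivI[OF holomorphic_deriv[OF w(2) open_UNIV] open_UNIV] ode by auto
  define v1' where "v1' z = b * deriv w1 z - a * deriv w2 z" for z
  define v2' where "v2' z = cnj a * deriv w1 z + cnj b * deriv w2 z" for z
  have dv: "(v1 has_field_derivative v1' z) (at z)" "(v2 has_field_derivative v2' z) (at z)"
    "(v2' has_field_derivative - T z * v2 z) (at z)" for z
  proof -
    show "(v1 has_field_derivative v1' z) (at z)" unfolding v1_def v1'_def by (intro DERIV_diff DERIV_cmult dw)
    show "(v2 has_field_derivative v2' z) (at z)" unfolding v2_def v2'_def by (intro DERIV_add DERIV_cmult dw)
    have "(v2' has_field_derivative cnj a * (- T z * w1 z) + cnj b * (- T z * w2 z)) (at z)"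
      unfolding v2'_def by (intro DERIV_add DERIV_cmult dw)
    then show "(v2' has_field_derivative - T z * v2 z) (at z)" by (simp add: v2_def algebra_simps)
  qed
  have wrv: "v1' z * v2 z - v1 z * v2' z = 1" for z
  proof -
    have "v1' z * v2 z - v1 z * v2' z = (a * cnj a + b * cnj b) * (deriv w1 z * w2 z - w1 z * deriv w2 z)"
      by (simp add: v1_def v2_def v1'_def v2'_def algebra_simps)
    then show ?thesis by (simp add: ab wr)
  qed
  have v10: "v1 z0 = 0" by (simp add: v1_def a_def b_def)
  \<comment> \<open>\<open>\<bar>v1\<bar>\<^sup>2 / h\<close> vanishes at \<open>z0\<close> and has gradient at most \<open>1 / h\<close>, because the Wronskian is 1.\<close>
  have "(cmod (v1 z))\<^sup>2 / ?h z \<le> 1/2" if z: "z \<in> ball z0 \<rho>" for z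
  proof -
    have "norm ((cmod (v1 z))\<^sup>2 / ?h z - (cmod (v1 z0))\<^sup>2 / ?h z0) \<le> 1 / (2 * \<rho>) * norm (z - z0)"
    proof (rule differentiable_bound[OF convex_ball])
      fix x assume x: "x \<in> ball z0 \<rho>"
      let ?p = "\<lambda>k. 2 * Re (cnj (v1 x) * v1' x * k)" and ?q = "\<lambda>k. 2 * Re (cnj (v2 x) * v2' x * k)"
      have dh: "((\<lambda>x. ?h x) has_derivative (\<lambda>k. ?p k + ?q k)) (at x)"
        using has_derivative_add[OF has_derivative_cmod_power2[OF dv(1)] has_derivative_cmod_power2[OF dv(2)]]
        by (simp only: hv)
      have "((\<lambda>x. (cmod (v1 x))\<^sup>2 / ?h x) has_derivative
          (\<lambda>k. (?p k * ?h x - (cmod (v1 x))\<^sup>2 * (?p k + ?q k)) / (?h x * ?h x))) (at x)"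
        using hpos[of x] by (intro has_derivative_divide' has_derivative_cmod_power2 dv dh) auto
      moreover have "?p k * ?h x - (cmod (v1 x))\<^sup>2 * (?p k + ?q k) = 2 * Re (cnj (v1 x) * cnj (v2 x) * k)" for k
      proof -
        have eq: "v1' x * v2 x - v1 x * v2' x = 1" by (rule wrv)
        have "?p k * ?h x - (cmod (v1 x))\<^sup>2 * (?p k + ?q k) = ?p k * (cmod (v2 x))\<^sup>2 - (cmod (v1 x))\<^sup>2 * ?q k"
          unfolding hv[symmetric] by (simp only: algebra_simps)
        also have "?p k * (cmod (v2 x))\<^sup>2 = 2 * Re (of_real ((cmod (v2 x))\<^sup>2) * (cnj (v1 x) * v1' x * k))" by simp
        also have "(cmod (v1 x))\<^sup>2 * ?q k = 2 * Re (of_real ((cmod (v1 x))\<^sup>2) * (cnj (v2 x) * v2' x * k))" by simp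
        also have "2 * Re (of_real ((cmod (v2 x))\<^sup>2) * (cnj (v1 x) * v1' x * k)) - 2 * Re (of_real ((cmod (v1 x))\<^sup>2) * (cnj (v2 x) * v2' x * k))
          = 2 * Re (cnj (v1 x) * cnj (v2 x) * (v1' x * v2 x - v1 x * v2' x) * k)"
        proof -
          have "of_real ((cmod (v2 x))\<^sup>2) * (cnj (v1 x) * v1' x * k) - of_real ((cmod (v1 x))\<^sup>2) * (cnj (v2 x) * v2' x * k)
             = cnj (v1 x) * cnj (v2 x) * (v1' x * v2 x - v1 x * v2' x) * k"
            unfolding complex_norm_square by (simp add: algebra_simps)
          then show ?thesis by (simp only: right_diff_distrib[symmetric] minus_complex.simps[symmetric])
        qed
        finally show ?thesis unfolding eq by simp
      qed
      ultimately have "((\<lambda>x. (cmod (v1 x))\<^sup>2 / ?h x) has_derivative (\<lambda>k. 2 * Re (cnj (v1 x) * cnj (v2 x) * k) / (?h x * ?h x))) (at x)"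
        by (simp only:)
      then show "((\<lambda>x. (cmod (v1 x))\<^sup>2 / ?h x) has_derivative (\<lambda>k. 2 * Re (cnj (v1 x) * cnj (v2 x) * k) / (?h x * ?h x))) (at x within ball z0 \<rho>)"
        by (rule has_derivative_at_withinI)
      show "onorm (\<lambda>k. 2 * Re (cnj (v1 x) * cnj (v2 x) * k) / (?h x * ?h x)) \<le> 1 / (2 * \<rho>)"
      proof (rule onorm_le)
        fix k
        have "\<bar>2 * Re (cnj (v1 x) * cnj (v2 x) * k)\<bar> \<le> 2 * (cmod (v1 x) * cmod (v2 x) * cmod k)"
          using abs_Re_le_cmod[of "cnj (v1 x) * cnj (v2 x) * k"] by (simp add: norm_mult abs_mult)
        also have "\<dots> = (2 * cmod (v1 x) * cmod (v2 x)) * cmod k" by simp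
        also have "\<dots> \<le> ?h x * cmod k"
          using sum_squares_bound[of "cmod (v1 x)" "cmod (v2 x)"] by (intro mult_right_mono) (auto simp: hv)
        finally have "\<bar>2 * Re (cnj (v1 x) * cnj (v2 x) * k)\<bar> / (?h x * ?h x) \<le> ?h x * cmod k / (?h x * ?h x)"
          using hpos[of x] by (intro divide_right_mono) auto
        also have "\<dots> = 1 / ?h x * cmod k" using hpos[of x] by simp
        also have "\<dots> \<le> 1 / (2 * \<rho>) * cmod k" by (intro mult_right_mono h x) auto
        finally show "norm (2 * Re (cnj (v1 x) * cnj (v2 x) * k) / (?h x * ?h x)) \<le> 1 / (2 * \<rho>) * norm k"
          using hpos[of x] by simp
      qed
    qed (use z \<rho> in auto)
    also have "\<dots> \<le> 1 / (2 * \<rho>) * \<rho>" using z \<rho> by (intro mult_left_mono) (auto simp: dist_norm norm_minus_commute)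
    finally show ?thesis using \<rho> hpos[of z] by (simp add: v10)
  qed
  then have v2big: "?h z / 2 \<le> (cmod (v2 z))\<^sup>2" "(cmod (v2 z))\<^sup>2 \<le> ?h z" if "z \<in> ball z0 \<rho>" for z
    using hv[of z] hpos[of z] that by (auto simp: divide_le_eq)
       (smt (verit, best) zero_le_power2 field_sum_of_halves)+
  have v2nz: "v2 z \<noteq> 0" if "z \<in> ball z0 \<rho>" for z using v2big(1)[OF that] hpos[of z] by auto
  have holv2: "v2 holomorphic_on ball z0 \<rho>" using dv(2) by (auto simp: holomorphic_on_open)
  obtain G where G: "G holomorphic_on ball z0 \<rho>" "\<And>z. z \<in> ball z0 \<rho> \<Longrightarrow> v2 z = exp (G z)"
    using contractible_imp_holomorphic_log[OF holv2 convex_imp_contractible[OF convex_ball]] v2nz by metis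
  have ReG: "\<bar>Re (G z)\<bar> \<le> B" if z: "z \<in> ball z0 \<rho>" for z
  proof -
    have "ln ((cmod (v2 z))\<^sup>2) = 2 * Re (G z)" using G(2)[OF z] by (simp add: ln_realpow)
    moreover have "ln (?h z / 2) \<le> ln ((cmod (v2 z))\<^sup>2)" "ln ((cmod (v2 z))\<^sup>2) \<le> ln (?h z)"
      using v2big[OF z] hpos[of z] v2nz[OF z] by (auto intro!: ln_mono)
    moreover have "ln (?h z / 2) = ln (?h z) - ln 2" using hpos[of z] by (simp add: ln_div)
    moreover have "ln 2 \<le> (1::real)" using ln_le_minus_one[of "2::real"] by simp
    ultimately show ?thesis using lnh[OF z] by linarith
  qed
  have z0: "z0 \<in> ball z0 \<rho>" using \<rho> by simp
  note bd = deriv_bound_of_log_bound[OF G(1) \<rho> B ReG]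
  have v2'G: "v2' z = deriv G z * v2 z" if z: "z \<in> ball z0 \<rho>" for z
  proof -
    have "((\<lambda>z. exp (G z)) has_field_derivative exp (G z) * deriv G z) (at z)"
      by (rule DERIV_fun_exp[OF holomorphic_derivI[OF G(1) open_ball z]])
    then have "(v2 has_field_derivative exp (G z) * deriv G z) (at z)"
      by (rule has_field_derivative_transform_within_open[OF _ open_ball z]) (simp add: G(2))
    then show ?thesis using DERIV_unique[OF dv(2)] G(2)[OF z] by (metis mult.commute)
  qed
  have "((\<lambda>z. deriv G z * v2 z) has_field_derivative deriv (deriv G) z0 * v2 z0 + v2' z0 * deriv G z0) (at z0)"
    by (rule DERIV_mult[OF holomorphic_derivI[OF holomorphic_deriv[OF G(1) open_ball] open_ball z0] dv(2)])
  then have "(v2' has_field_derivative deriv (deriv G) z0 * v2 z0 + v2' z0 * deriv G z0) (at z0)"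
    by (rule has_field_derivative_transform_within_open[OF _ open_ball z0]) (simp add: v2'G)
  then have "- T z0 * v2 z0 = deriv (deriv G) z0 * v2 z0 + v2' z0 * deriv G z0" using DERIV_unique[OF dv(3)] by metis
  then have "- T z0 * v2 z0 = (deriv (deriv G) z0 + (deriv G z0)\<^sup>2) * v2 z0"
    unfolding v2'G[OF z0] by (simp add: power2_eq_square algebra_simps)
  then have "T z0 = - (deriv (deriv G) z0 + (deriv G z0)\<^sup>2)" using v2nz[OF z0] by (metis add.inverse_inverse mult_right_cancel)
  then have "cmod (T z0) \<le> cmod (deriv (deriv G) z0) + (cmod (deriv G z0))\<^sup>2"
    using norm_triangle_ineq[of "deriv (deriv G) z0" "(deriv G z0)\<^sup>2"] by (simp only: norm_power norm_minus_cancel)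
  also have "\<dots> \<le> 9 * B * exp 2 / \<rho>\<^sup>2 + (3 * B * exp 2 / \<rho>)\<^sup>2"
    using bd by (intro add_mono power_mono) auto
  finally show ?thesis .
qed

lemma polynomially_bounded_entire_imp_poly:
  assumes F: "F holomorphic_on UNIV" and "\<And>z. A \<le> norm z \<Longrightarrow> norm (F z) \<le> B * norm z ^ n"
  obtains Q where "F = poly Q"
proof -
  have "F z = (\<Sum>i\<le>n. (deriv ^^ i) F 0 / fact i * z ^ i)" for z by (rule Liouville_polynomial[OF assms])
  then have "F = poly (\<Sum>i\<le>n. monom ((deriv ^^ i) F 0 / fact i) i)"
    by (auto simp: poly_sum poly_monom)
  then show ?thesis using that by blast
qed

text \<open>\<open>potential_local_bound\<close> applies at every \<open>z0\<close> with \<open>\<rho>\<close> an inverse power of \<open>2 + \<bar>z0\<bar>\<close>: the growth hypothesis is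
  the lower bound for \<open>\<bar>w1\<bar>\<^sup>2 + \<bar>w2\<bar>\<^sup>2\<close>, and \<open>liouville_jet_polynomial_lower_bound\<close> is the upper bound for its logarithm.\<close>

lemma potential_polynomial:
  assumes w: "w1 holomorphic_on UNIV" "w2 holomorphic_on UNIV" and T: "T holomorphic_on UNIV"
    and ode: "\<And>z. deriv (deriv w1) z = - T z * w1 z" "\<And>z. deriv (deriv w2) z = - T z * w2 z"
    and wr: "\<And>z. deriv w1 z * w2 z - w1 z * deriv w2 z = 1"
    and K: "\<And>z. exp (ln 2 - ln (norm_square_pair w1 w2 z)) \<le> K * (1 + cmod z) ^ n" "1 \<le> K"
  obtains P where "\<And>z. T z = poly P z"
proof -
  let ?h = "norm_square_pair w1 w2"
  define u where "u z = ln 2 - ln (?h z)" for z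
  have hpos: "0 < ?h z" for z by (rule norm_square_pair_pos[OF wr])
  have jet: "liouville_jet u (\<lambda>z. - (deriv w1 z * cnj (w1 z) + deriv w2 z * cnj (w2 z)) / of_real (?h z)) T UNIV"
    unfolding u_def by (rule liouville_jet_norm_square_pair) (use w ode wr in auto)
  have Ku: "exp (u z) \<le> K * (1 + cmod z) ^ n" for z using K(1) by (simp add: u_def)
  have Kpos: "0 < K" using K(2) by simp
  obtain \<Lambda> where \<Lambda>: "0 \<le> \<Lambda>" "\<And>z. - u z \<le> \<Lambda> * (1 + cmod z) ^ (2 * n + 2)"
    using liouville_jet_polynomial_lower_bound[OF jet holomorphic_on_imp_continuous_on[OF T] Kpos Ku] by blast
  define M c where "M = 2 * n + 2" and "c = \<Lambda> + ln K + real n + 2"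
  have c: "2 \<le> c" using \<Lambda>(1) K(2) by (simp add: c_def)
  define C where "C = 9 * c * exp 2 * K\<^sup>2 + (3 * c * exp 2 * K)\<^sup>2"
  have bound: "cmod (T z0) \<le> C * (2 + cmod z0) ^ (2 * M + 2 * n)" for z0
  proof -
    define X where "X = 2 + cmod z0"
    have X: "1 \<le> X" by (simp add: X_def)
    have Xn: "1 \<le> X ^ n" "1 \<le> X ^ M" "X \<le> X ^ M" using X by (auto simp: M_def one_le_power intro: self_le_power simp del: power_Suc add_2_eq_Suc')
    define \<rho> where "\<rho> = 1 / (K * X ^ n)"
    have "1 * 1 \<le> K * X ^ n" using Xn K(2) by (intro mult_mono) auto
    then have \<rho>: "0 < \<rho>" "\<rho> \<le> 1" by (auto simp: \<rho>_def)
    have near: "1 + cmod z \<le> X" if "z \<in> ball z0 \<rho>" for z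
      using that \<rho> norm_triangle_ineq2[of z z0] by (simp add: X_def dist_norm norm_minus_commute)
    define B where "B = c * X ^ M"
    have B: "0 < B" using c Xn by (simp add: B_def)
    have "cmod (T z0) \<le> 9 * B * exp 2 / \<rho>\<^sup>2 + (3 * B * exp 2 / \<rho>)\<^sup>2"
    proof (rule potential_local_bound[OF w ode wr \<rho>(1) B])
      fix z assume z: "z \<in> ball z0 \<rho>"
      have pw: "(1 + cmod z) ^ k \<le> X ^ k" for k using near[OF z] by (intro power_mono) auto
      have eu: "exp (u z) = 2 / ?h z" using hpos[of z] by (simp add: u_def exp_diff)
      have ule: "exp (u z) \<le> K * X ^ n" using Ku[of z] pw[of n] Kpos by (meson mult_left_mono order_trans less_imp_le)
      then show "1 / ?h z \<le> 1 / (2 * \<rho>)" unfolding eu by (simp add: \<rho>_def)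
      have "u z \<le> ln (K * X ^ n)" using ule Kpos X by (subst ln_ge_iff) auto
      also have "\<dots> = ln K + n * ln X" using Kpos X by (simp add: ln_mult ln_realpow)
      also have "\<dots> \<le> ln K * X ^ M + n * X ^ M"
      proof (rule add_mono)
        show "ln K \<le> ln K * X ^ M" using Xn K(2) by (simp add: mult_le_cancel_left1)
        have "ln X \<le> X ^ M" using ln_le_minus_one[of X] X Xn by simp
        then show "n * ln X \<le> n * X ^ M" by (intro mult_left_mono) auto
      qed
      finally have up: "u z \<le> ln K * X ^ M + n * X ^ M" .
      have "- u z \<le> \<Lambda> * X ^ M" using \<Lambda>(2)[of z] pw[of M] \<Lambda>(1) unfolding M_def by (meson mult_left_mono order_trans)
      moreover have "0 \<le> \<Lambda> * X ^ M" "0 \<le> ln K * X ^ M + n * X ^ M" using \<Lambda>(1) K(2) Xn by auto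
      ultimately have "\<bar>u z\<bar> \<le> \<Lambda> * X ^ M + (ln K * X ^ M + n * X ^ M)" using up by linarith
      moreover have "\<bar>ln (?h z)\<bar> \<le> 1 + \<bar>u z\<bar>"
        using ln_le_minus_one[of "2::real"] ln_ge_zero[of "2::real"] unfolding u_def by linarith
      ultimately have "\<bar>ln (?h z)\<bar> + 1 \<le> (\<Lambda> * X ^ M + (ln K * X ^ M + n * X ^ M)) + 2 * X ^ M" using Xn by linarith
      also have "\<dots> = B" by (simp add: B_def c_def algebra_simps)
      finally show "\<bar>ln (?h z)\<bar> + 1 \<le> B" .
    qed
    also have "\<dots> = 9 * c * exp 2 * K\<^sup>2 * (X ^ M * (X ^ n)\<^sup>2) + (3 * c * exp 2 * K)\<^sup>2 * ((X ^ M)\<^sup>2 * (X ^ n)\<^sup>2)"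
      by (simp add: \<rho>_def B_def power_mult_distrib power_divide)
    also have "\<dots> \<le> 9 * c * exp 2 * K\<^sup>2 * ((X ^ M)\<^sup>2 * (X ^ n)\<^sup>2) + (3 * c * exp 2 * K)\<^sup>2 * ((X ^ M)\<^sup>2 * (X ^ n)\<^sup>2)"
    proof (intro add_mono mult_left_mono mult_right_mono)
      show "X ^ M \<le> (X ^ M)\<^sup>2" using Xn(2) by (intro self_le_power) auto
    qed (use c Kpos in auto)
    also have "\<dots> = C * ((X ^ M)\<^sup>2 * (X ^ n)\<^sup>2)" by (simp add: C_def distrib_right)
    also have "(X ^ M)\<^sup>2 * (X ^ n)\<^sup>2 = X ^ (2 * M + 2 * n)" by (simp add: power_add power_mult[symmetric] mult.commute)
    finally show ?thesis by (simp add: X_def)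
  qed
  have C0: "0 \<le> C" using c Kpos by (simp add: C_def)
  define k where "k = 2 * M + 2 * n"
  have "cmod (T z) \<le> C * 2 ^ k * cmod z ^ k" if "2 \<le> cmod z" for z
  proof -
    have "(2 + cmod z) ^ k \<le> (2 * cmod z) ^ k" using that by (intro power_mono) auto
    then have "C * (2 + cmod z) ^ k \<le> C * (2 * cmod z) ^ k" using C0 by (rule mult_left_mono)
    with bound[of z] show ?thesis by (simp add: k_def power_mult_distrib mult.assoc)
  qed
  note growth = this
  obtain P where "T = poly P" by (rule polynomially_bounded_entire_imp_poly[OF T growth])
  then show ?thesis using that by simp
qed

section \<open>Representation of solutions and their asymptotics\<close>

definition normalized_pair ::
  "(complex \<Rightarrow> complex) \<Rightarrow> (complex \<Rightarrow> complex) \<Rightarrow> (complex \<Rightarrow> complex) \<Rightarrow> complex set \<Rightarrow> bool" where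
  "normalized_pair T w1 w2 S \<longleftrightarrow> w1 holomorphic_on S \<and> w2 holomorphic_on S \<and>
     (\<forall>z\<in>S. deriv (deriv w1) z = - T z * w1 z \<and> deriv (deriv w2) z = - T z * w2 z \<and>
        deriv w1 z * w2 z - w1 z * deriv w2 z = 1)"

text \<open>For a pair with Wronskian 1, the quotient \<open>f = w1 / w2\<close> has \<open>f' = 1 / w2\<^sup>2\<close>, so this is Liouville's
  expression \<open>ln (2 \<bar>f'\<bar> / (1 + \<bar>f\<bar>\<^sup>2))\<close>, free of poles.\<close>

definition pair_potential :: "(complex \<Rightarrow> complex) \<Rightarrow> (complex \<Rightarrow> complex) \<Rightarrow> complex \<Rightarrow> real" where
  "pair_potential w1 w2 z = ln 2 - ln (norm_square_pair w1 w2 z)"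

lemma normalized_pair_jet:
  assumes "open S" "normalized_pair T w1 w2 S"
  obtains g where "liouville_jet (pair_potential w1 w2) g T S"
proof -
  have "pair_potential w1 w2 = (\<lambda>z. ln 2 - ln (norm_square_pair w1 w2 z))" by (simp add: pair_potential_def fun_eq_iff)
  then show ?thesis
    using liouville_jet_norm_square_pair[OF assms(1), of w1 w2 T] assms(2) that
    unfolding normalized_pair_def by simp
qed

lemma wronskian_constant:
  assumes S: "open S" "connected S" and v: "v holomorphic_on S" "w holomorphic_on S"
    and ode: "\<And>z. z \<in> S \<Longrightarrow> deriv (deriv v) z = - T z * v z" "\<And>z. z \<in> S \<Longrightarrow> deriv (deriv w) z = - T z * w z"
  shows "\<exists>c. \<forall>z\<in>S. deriv v z * w z - v z * deriv w z = c"
proof -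
  have "((\<lambda>z. deriv v z * w z - v z * deriv w z) has_field_derivative 0) (at z)" if z: "z \<in> S" for z
  proof -
    have d: "(v has_field_derivative deriv v z) (at z)" "(w has_field_derivative deriv w z) (at z)"
      "(deriv v has_field_derivative - T z * v z) (at z)" "(deriv w has_field_derivative - T z * w z) (at z)"
      using holomorphic_derivI[OF v(1) S(1) z] holomorphic_derivI[OF v(2) S(1) z]
        holomorphic_derivI[OF holomorphic_deriv[OF v(1) S(1)] S(1) z]
        holomorphic_derivI[OF holomorphic_deriv[OF v(2) S(1)] S(1) z] ode[OF z] by auto
    have "((\<lambda>z. deriv v z * w z - v z * deriv w z) has_field_derivative
      (- T z * v z * w z + deriv w z * deriv v z) - (deriv v z * deriv w z + - T z * w z * v z)) (at z)"
      by (intro DERIV_diff DERIV_mult d)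
    then show ?thesis by (simp add: algebra_simps)
  qed
  then have "(\<lambda>z. deriv v z * w z - v z * deriv w z) constant_on S"
    using S by (intro has_field_derivative_0_imp_constant_on) auto
  then show ?thesis by (auto simp: constant_on_def)
qed

lemma normalized_pair_exists:
  assumes T: "T holomorphic_on UNIV" and init: "a' * b - a * b' = 1"
  obtains w1 w2 where "normalized_pair T w1 w2 UNIV" "w1 0 = a" "deriv w1 0 = a'" "w2 0 = b" "deriv w2 0 = b'"
proof -
  obtain w1 where w1: "w1 holomorphic_on UNIV" "w1 0 = a" "deriv w1 0 = a'" "\<And>z. deriv (deriv w1) z = - T z * w1 z"
    using entire_linear_ode_solution[OF T] by blast
  obtain w2 where w2: "w2 holomorphic_on UNIV" "w2 0 = b" "deriv w2 0 = b'" "\<And>z. deriv (deriv w2) z = - T z * w2 z"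
    using entire_linear_ode_solution[OF T] by blast
  obtain c where c: "\<And>z. deriv w1 z * w2 z - w1 z * deriv w2 z = c"
    using wronskian_constant[OF open_UNIV connected_UNIV w1(1) w2(1) w1(4) w2(4)] by auto
  have "c = 1" using c[of 0] init w1 w2 by simp
  then have "normalized_pair T w1 w2 UNIV" using w1 w2 c by (simp add: normalized_pair_def)
  then show ?thesis using that w1 w2 by blast
qed

lemma normalized_pair_solution:
  assumes "T holomorphic_on UNIV" "normalized_pair T w1 w2 UNIV"
  shows "liouville_solution (pair_potential w1 w2)"
  using normalized_pair_jet[OF open_UNIV assms(2)] liouville_solution_if_jet
    holomorphic_on_imp_continuous_on[OF assms(1)] by metis

text \<open>Every value and every gradient at the origin is realized by a normalized pair for the potential of \<open>u\<close>, and
  \<open>liouville_jet_determined_at_0\<close> identifies the two solutions.\<close>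

lemma liouville_solution_representation:
  assumes "liouville_solution u"
  obtains T w1 w2 where "T holomorphic_on UNIV" "normalized_pair T w1 w2 UNIV" "u = pair_potential w1 w2"
proof -
  obtain g T where j: "liouville_jet u g T UNIV" and cT: "continuous_on UNIV T"
    using liouville_solution_jet[OF assms] by blast
  have T: "T holomorphic_on UNIV" by (rule liouville_jet_holomorphic[OF j cT])
  \<comment> \<open>Initial values chosen so that the new solution has the same value and gradient at the origin.\<close>
  define b where "b = complex_of_real (sqrt 2 * exp (- u 0 / 2))"
  have b: "b \<noteq> 0" "cnj b = b" by (simp_all add: b_def)
  have b2: "(cmod b)\<^sup>2 = 2 * exp (- u 0)"
    by (simp add: b_def norm_mult power_mult_distrib flip: exp_double)
  have init: "1 / b * b - 0 * (- b * g 0) = 1" using b by simp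
  obtain w1 w2 where w: "normalized_pair T w1 w2 UNIV" "w1 0 = 0" "deriv w1 0 = 1 / b" "w2 0 = b" "deriv w2 0 = - b * g 0"
    using normalized_pair_exists[OF T init] by blast
  define k where "k z = - (deriv w1 z * cnj (w1 z) + deriv w2 z * cnj (w2 z)) / of_real (norm_square_pair w1 w2 z)" for z
  have jw: "liouville_jet (pair_potential w1 w2) k T UNIV"
    using liouville_jet_norm_square_pair[OF open_UNIV, of w1 w2 T] w(1)
    unfolding normalized_pair_def k_def pair_potential_def[abs_def] by simp
  have h0: "norm_square_pair w1 w2 0 = (cmod b)\<^sup>2" using w by (simp add: norm_square_pair_def)
  have "u 0 = pair_potential w1 w2 0" by (simp add: pair_potential_def h0 b2 ln_mult)
  moreover have "g 0 = k 0"
  proof -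
    have "k 0 = b * g 0 * cnj b / of_real ((cmod b)\<^sup>2)" using w unfolding k_def h0 by simp
    also have "\<dots> = g 0 * (b * cnj b) / (b * cnj b)" unfolding complex_norm_square by (simp add: mult_ac)
    finally show ?thesis using b by simp
  qed
  ultimately have "u z = pair_potential w1 w2 z" for z by (rule liouville_jet_determined_at_0[OF j jw])
  then have "u = pair_potential w1 w2" by auto
  then show ?thesis using that T w(1) by blast
qed

lemma Limsup_at_infinity_ge_along:
  fixes f :: "complex \<Rightarrow> real"
  assumes \<gamma>: "filterlim \<gamma> at_infinity at_top" and lim: "((\<lambda>t::real. f (\<gamma> t)) \<longlongrightarrow> k) at_top"
  shows "ereal k \<le> Limsup at_infinity (\<lambda>z. ereal (f z))"
  unfolding Limsup_def
proof (rule INF_greatest)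
  fix P :: "complex \<Rightarrow> bool" assume "P \<in> {P. eventually P at_infinity}"
  then have "eventually (\<lambda>t. P (\<gamma> t)) at_top" using \<gamma> by (auto simp: filterlim_iff)
  then have "eventually (\<lambda>t. ereal (f (\<gamma> t)) \<le> Sup ((\<lambda>z. ereal (f z)) ` {z. P z})) at_top"
    by eventually_elim (auto intro: SUP_upper)
  moreover have "((\<lambda>t. ereal (f (\<gamma> t))) \<longlongrightarrow> ereal k) at_top" using lim by simp
  ultimately show "ereal k \<le> Sup ((\<lambda>z. ereal (f z)) ` {z. P z})"
    by (intro tendsto_upperbound) auto
qed

lemma filterlim_ln_norm_at_infinity: "filterlim (\<lambda>z::complex. ln (norm z)) at_top at_infinity"
  by (rule filterlim_compose[OF ln_at_top filterlim_norm_at_top])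

text \<open>A reformulation of \<open>wkb_polynomial_plane\<close>. Its one-sided bound holds outside a disc and gives the upper bound for
  the limit superior; a curve in a critical direction shows that the bound is attained.\<close>

lemma polynomial_potential_asymptotics:
  fixes P :: "complex poly"
  assumes P: "P \<noteq> 0" and w: "normalized_pair (poly P) w1 w2 UNIV"
  defines "u \<equiv> pair_potential w1 w2" and "k \<equiv> real (degree P) / 2"
  shows "u \<in> N k"
    and "\<exists>c \<theta>0 :: real. c > 0 \<and>
           uniform_limit UNIV
             (\<lambda>r \<theta>. (u (complex_of_real r * cis \<theta>)
                       - (- c * r powr (k + 1) * \<bar>sin ((k + 1) * (\<theta> - \<theta>0))\<bar>)) / r powr (k + 1))
             (\<lambda>\<theta>. 0) at_top \<and>
           (\<forall>\<theta>. sin ((k + 1) * (\<theta> - \<theta>0)) = 0 \<longrightarrow>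
              (\<exists>\<gamma>. curve_to_infinity \<gamma> \<and> asymptotic_direction \<gamma> \<theta> \<and>
                   ((\<lambda>t. u (\<gamma> t) / ln (norm (\<gamma> t))) \<longlongrightarrow> k) at_top))"
proof -
  have w': "w1 holomorphic_on UNIV" "w2 holomorphic_on UNIV"
      "\<And>z. deriv (deriv w1) z = - poly P z * w1 z" "\<And>z. deriv (deriv w2) z = - poly P z * w2 z"
      "\<And>z. w1 z * deriv w2 z - w2 z * deriv w1 z = - 1" "- 1 \<noteq> (0::complex)"
  proof -
    show "w1 z * deriv w2 z - w2 z * deriv w1 z = - 1" for z
    proof -
      have "deriv w1 z * w2 z - w1 z * deriv w2 z = 1" using w by (simp add: normalized_pair_def)
      then show ?thesis by (simp add: algebra_simps)
    qed
  qed (use w in \<open>auto simp: normalized_pair_def\<close>)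
  define m where "m = k + 1"
  have m: "2 * m = real (degree P) + 2" "1 \<le> m" by (simp_all add: m_def k_def)
  define L where "L z = ln ((cmod (w1 z))\<^sup>2 + (cmod (w2 z))\<^sup>2)" for z
  have uL: "u z = ln 2 - L z" for z by (simp add: u_def pair_potential_def norm_square_pair_def L_def)
  obtain \<kappa> \<theta>0 R C where \<kappa>: "0 < \<kappa>" and up: "\<And>z. R \<le> cmod z \<Longrightarrow> - L z \<le> degree P / 2 * ln (cmod z) + C"
    and asy: "\<And>\<eta>. 0 < \<eta> \<Longrightarrow> \<exists>R. \<forall>r\<ge>R. \<forall>\<theta>. \<bar>L (of_real r * cis \<theta>) - \<kappa> * r powr m * \<bar>sin (m * (\<theta> - \<theta>0))\<bar>\<bar> \<le> \<eta> * r powr m"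
    and curve: "\<And>\<theta>. sin (m * (\<theta> - \<theta>0)) = 0 \<Longrightarrow> \<exists>\<gamma> C. curve_to_infinity \<gamma> \<and> asymptotic_direction \<gamma> \<theta> \<and>
           (\<forall>t\<ge>0. \<bar>L (\<gamma> t) + degree P / 2 * ln (cmod (\<gamma> t))\<bar> \<le> C)"
    unfolding L_def by (rule wkb_polynomial_plane[OF P m(1) w']) blast
  have curve': "\<exists>\<gamma>. curve_to_infinity \<gamma> \<and> asymptotic_direction \<gamma> \<theta> \<and>
                   ((\<lambda>t. u (\<gamma> t) / ln (norm (\<gamma> t))) \<longlongrightarrow> k) at_top" if \<theta>: "sin (m * (\<theta> - \<theta>0)) = 0" for \<theta>
  proof -
    obtain \<gamma> C where \<gamma>: "curve_to_infinity \<gamma>" "asymptotic_direction \<gamma> \<theta>"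
      "\<And>t. 0 \<le> t \<Longrightarrow> \<bar>L (\<gamma> t) + k * ln (cmod (\<gamma> t))\<bar> \<le> C" using curve[OF \<theta>] by (auto simp: k_def)
    have ln: "filterlim (\<lambda>t. ln (cmod (\<gamma> t))) at_top at_top"
      by (rule filterlim_compose[OF filterlim_ln_norm_at_infinity]) (use \<gamma>(1) in \<open>simp add: curve_to_infinity_def\<close>)
    have "((\<lambda>t. u (\<gamma> t) / ln (norm (\<gamma> t)) - k) \<longlongrightarrow> 0) at_top"
    proof (rule tendsto_rabs_zero_cancel, rule tendsto_sandwich[where f = "\<lambda>_. 0"])
      show "eventually (\<lambda>t. \<bar>u (\<gamma> t) / ln (norm (\<gamma> t)) - k\<bar> \<le> (ln 2 + C) / ln (norm (\<gamma> t))) at_top"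
        using eventually_ge_at_top[of 0] filterlim_at_top_dense[THEN iffD1, OF ln, rule_format, of 0]
      proof eventually_elim
        case (elim t)
        have "u (\<gamma> t) / ln (norm (\<gamma> t)) - k = (ln 2 - (L (\<gamma> t) + k * ln (cmod (\<gamma> t)))) / ln (norm (\<gamma> t))"
          using elim by (simp add: uL field_simps)
        moreover have "\<bar>ln 2 - (L (\<gamma> t) + k * ln (cmod (\<gamma> t)))\<bar> \<le> ln 2 + C"
          using \<gamma>(3)[OF elim(1)] ln_ge_zero[of "2::real"] by linarith
        ultimately show ?case using elim by (simp add: abs_divide divide_right_mono)
      qed
      show "((\<lambda>t. (ln 2 + C) / ln (norm (\<gamma> t))) \<longlongrightarrow> 0) at_top"
        by (intro tendsto_divide_0[OF tendsto_const] filterlim_at_top_imp_at_infinity ln)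
    qed auto
    from LIM_zero_cancel[OF this] \<gamma>(1,2) show ?thesis by blast
  qed
  have "liouville_solution u"
    unfolding u_def by (rule normalized_pair_solution[OF _ w]) (intro holomorphic_intros)
  moreover have "Limsup at_infinity (\<lambda>z. ereal (u z / ln (norm z))) = ereal k"
  proof (rule antisym)
    obtain \<gamma> where "curve_to_infinity \<gamma>" "((\<lambda>t. u (\<gamma> t) / ln (norm (\<gamma> t))) \<longlongrightarrow> k) at_top"
      using curve'[of \<theta>0] by auto
    then show "ereal k \<le> Limsup at_infinity (\<lambda>z. ereal (u z / ln (norm z)))"
      by (intro Limsup_at_infinity_ge_along) (auto simp: curve_to_infinity_def)
    have lim: "((\<lambda>z. k + (ln 2 + C) / ln (norm (z::complex))) \<longlongrightarrow> k + 0) at_infinity"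
      by (intro tendsto_add tendsto_const tendsto_divide_0[OF tendsto_const] filterlim_at_top_imp_at_infinity
          filterlim_ln_norm_at_infinity)
    have "eventually (\<lambda>z::complex. R \<le> norm z) at_infinity"
      using filterlim_at_top[THEN iffD1, OF filterlim_norm_at_top] by blast
    moreover have "eventually (\<lambda>z::complex. 0 < ln (norm z)) at_infinity"
      using filterlim_at_top_dense[THEN iffD1, OF filterlim_ln_norm_at_infinity] by blast
    ultimately have "eventually (\<lambda>z. ereal (u z / ln (norm z)) \<le> ereal (k + (ln 2 + C) / ln (norm z))) at_infinity"
    proof eventually_elim
      case (elim z)
      have "u z \<le> k * ln (cmod z) + (ln 2 + C)" using up[OF elim(1)] by (simp add: uL k_def)
      then have "u z / ln (cmod z) \<le> (k * ln (cmod z) + (ln 2 + C)) / ln (cmod z)" using elim by (intro divide_right_mono) auto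
      then show ?case using elim by (simp add: add_divide_distrib)
    qed
    then have "Limsup at_infinity (\<lambda>z. ereal (u z / ln (norm z))) \<le> Limsup at_infinity (\<lambda>z. ereal (k + (ln 2 + C) / ln (norm (z::complex))))"
      by (rule Limsup_mono)
    also have "\<dots> = ereal k" using lim_imp_Limsup[OF trivial_limit_at_infinity tendsto_ereal[OF lim]] by simp
    finally show "Limsup at_infinity (\<lambda>z. ereal (u z / ln (norm z))) \<le> ereal k" .
  qed
  ultimately show "u \<in> N k" by (simp add: N_def)
  have unif: "uniform_limit UNIV
             (\<lambda>r \<theta>. (u (complex_of_real r * cis \<theta>) - (- \<kappa> * r powr m * \<bar>sin (m * (\<theta> - \<theta>0))\<bar>)) / r powr m)
             (\<lambda>\<theta>. 0) at_top"
  proof (rule uniform_limitI)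
    fix e :: real assume e: "0 < e"
    obtain R where R: "\<And>r \<theta>. R \<le> r \<Longrightarrow> \<bar>L (of_real r * cis \<theta>) - \<kappa> * r powr m * \<bar>sin (m * (\<theta> - \<theta>0))\<bar>\<bar> \<le> e / 2 * r powr m"
      using asy[of "e / 2"] e by auto
    have "eventually (\<lambda>r. max R (max 1 (2 / e)) < r) at_top" by (rule eventually_gt_at_top)
    then show "eventually (\<lambda>r. \<forall>\<theta>\<in>UNIV. dist ((u (complex_of_real r * cis \<theta>) - (- \<kappa> * r powr m * \<bar>sin (m * (\<theta> - \<theta>0))\<bar>)) / r powr m) 0 < e) at_top"
    proof eventually_elim
      case (elim r)
      have r: "R \<le> r" "1 < r" "2 / e < r" using elim by auto
      have rp: "r \<le> r powr m" using powr_mono[of 1 m r] m(2) r by simp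
      have "2 / e < r powr m" using r rp by linarith
      then have big: "1 < e / 2 * r powr m" using e by (simp add: field_simps)
      show ?case
      proof
        fix \<theta>
        let ?x = "u (complex_of_real r * cis \<theta>) - (- \<kappa> * r powr m * \<bar>sin (m * (\<theta> - \<theta>0))\<bar>)"
        have "\<bar>?x\<bar> \<le> ln 2 + \<bar>L (of_real r * cis \<theta>) - \<kappa> * r powr m * \<bar>sin (m * (\<theta> - \<theta>0))\<bar>\<bar>"
        proof -
          have "?x = ln 2 - (L (of_real r * cis \<theta>) - \<kappa> * r powr m * \<bar>sin (m * (\<theta> - \<theta>0))\<bar>)" by (simp add: uL)
          also have "\<bar>\<dots>\<bar> \<le> \<bar>ln 2\<bar> + \<bar>L (of_real r * cis \<theta>) - \<kappa> * r powr m * \<bar>sin (m * (\<theta> - \<theta>0))\<bar>\<bar>"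
            by (rule abs_triangle_ineq4)
          finally show ?thesis by simp
        qed
        also have "\<dots> \<le> 1 + e / 2 * r powr m"
          using R[OF r(1), of \<theta>] ln_le_minus_one[of "2::real"] by simp
        also have "\<dots> < e * r powr m" using big by simp
        finally have "\<bar>?x\<bar> / r powr m < e" using r by (simp add: pos_divide_less_eq)
        then show "dist (?x / r powr m) 0 < e" using r by (simp add: dist_real_def abs_divide)
      qed
    qed
  qed
  show "\<exists>c \<theta>0 :: real. c > 0 \<and>
           uniform_limit UNIV
             (\<lambda>r \<theta>. (u (complex_of_real r * cis \<theta>)
                       - (- c * r powr (k + 1) * \<bar>sin ((k + 1) * (\<theta> - \<theta>0))\<bar>)) / r powr (k + 1))
             (\<lambda>\<theta>. 0) at_top \<and>
           (\<forall>\<theta>. sin ((k + 1) * (\<theta> - \<theta>0)) = 0 \<longrightarrow>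
              (\<exists>\<gamma>. curve_to_infinity \<gamma> \<and> asymptotic_direction \<gamma> \<theta> \<and>
                   ((\<lambda>t. u (\<gamma> t) / ln (norm (\<gamma> t))) \<longlongrightarrow> k) at_top))"
    using \<kappa> unif curve' unfolding m_def by blast
qed

lemma normalized_pair_affine:
  assumes "normalized_pair (\<lambda>_. 0) w1 w2 UNIV"
  obtains a b c d where "a * d - b * c = 1" "w1 = (\<lambda>z. a * z + b)" "w2 = (\<lambda>z. c * z + d)"
proof -
  have affine: "\<exists>a b. \<forall>z. w z = a * z + b" if w: "w holomorphic_on UNIV" and dd: "\<And>z. deriv (deriv w) z = 0" for w
  proof -
    have "(deriv w has_field_derivative 0) (at z)" for z
      using holomorphic_derivI[OF holomorphic_deriv[OF w open_UNIV] open_UNIV] dd by (metis UNIV_I)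
    then obtain a where a: "\<And>z. deriv w z = a"
      using has_field_derivative_0_imp_constant_on[of UNIV "deriv w"] by (auto simp: constant_on_def)
    have "((\<lambda>z. w z - a * z) has_field_derivative deriv w z - a) (at z)" for z
      using holomorphic_derivI[OF w open_UNIV, of z UNIV] by (auto intro!: derivative_eq_intros)
    then have "((\<lambda>z. w z - a * z) has_field_derivative 0) (at z)" for z by (simp add: a)
    then obtain b where "\<And>z. w z - a * z = b"
      using has_field_derivative_0_imp_constant_on[of UNIV "\<lambda>z. w z - a * z"] by (auto simp: constant_on_def)
    then show ?thesis by (metis add.commute diff_add_cancel)
  qed
  obtain a b where 1: "\<And>z. w1 z = a * z + b" using affine[of w1] assms by (auto simp: normalized_pair_def)
  obtain c d where 2: "\<And>z. w2 z = c * z + d" using affine[of w2] assms by (auto simp: normalized_pair_def)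
  have "deriv w1 0 = a" "deriv w2 0 = c"
    by (rule DERIV_imp_deriv; subst 1[abs_def] 2[abs_def]; auto intro!: derivative_eq_intros)+
  moreover have "deriv w1 0 * w2 0 - w1 0 * deriv w2 0 = 1" using assms by (simp add: normalized_pair_def)
  ultimately have "a * d - b * c = 1" by (simp add: 1 2)
  then show ?thesis using that 1 2 by presburger
qed

text \<open>The sum of squares of two affine functions with Wronskian 1 is asymptotic to a positive multiple of \<open>\<bar>z\<bar>\<^sup>2\<close>.\<close>

lemma zero_potential_in_N:
  assumes w: "normalized_pair (\<lambda>_. 0) w1 w2 UNIV"
  shows "pair_potential w1 w2 \<in> N (-2)"
proof -
  obtain a b c d where ac: "a * d - b * c = 1" "w1 = (\<lambda>z. a * z + b)" "w2 = (\<lambda>z. c * z + d)"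
    by (rule normalized_pair_affine[OF w]) blast
  have abcd: "a * d - b * c = 1" "\<And>z. w1 z = a * z + b" "\<And>z. w2 z = c * z + d" using ac by simp_all
  let ?h = "norm_square_pair w1 w2"
  define s where "s = (cmod a)\<^sup>2 + (cmod c)\<^sup>2"
  have s: "0 < s" using abcd(1) by (auto simp: s_def sum_power2_gt_zero_iff)
  have lin: "((\<lambda>z. (\<alpha> * z + \<beta>) / z) \<longlongrightarrow> \<alpha>) at_infinity" for \<alpha> \<beta> :: complex
  proof -
    have "((\<lambda>z. \<alpha> + \<beta> / z) \<longlongrightarrow> \<alpha> + 0) at_infinity"
      by (intro tendsto_add tendsto_const tendsto_divide_0[OF tendsto_const] filterlim_ident)
    moreover have "eventually (\<lambda>z::complex. z \<noteq> 0) at_infinity"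
      using eventually_not_equal_at_infinity by blast
    then have "eventually (\<lambda>z. \<alpha> + \<beta> / z = (\<alpha> * z + \<beta>) / z) at_infinity"
      by eventually_elim (simp add: field_simps)
    ultimately show ?thesis using Lim_transform_eventually by fastforce
  qed
  have "((\<lambda>z. (cmod ((a * z + b) / z))\<^sup>2 + (cmod ((c * z + d) / z))\<^sup>2) \<longlongrightarrow> s) at_infinity"
    unfolding s_def by (intro tendsto_intros lin)
  then have "((\<lambda>z. ln ((cmod ((a * z + b) / z))\<^sup>2 + (cmod ((c * z + d) / z))\<^sup>2)) \<longlongrightarrow> ln s) at_infinity"
    using s by (intro tendsto_ln) auto
  then have "((\<lambda>z. ln 2 - ln ((cmod ((a * z + b) / z))\<^sup>2 + (cmod ((c * z + d) / z))\<^sup>2)) \<longlongrightarrow> ln 2 - ln s) at_infinity"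
    by (intro tendsto_diff tendsto_const)
  then have "((\<lambda>z. (ln 2 - ln ((cmod ((a * z + b) / z))\<^sup>2 + (cmod ((c * z + d) / z))\<^sup>2)) / ln (norm z) - 2) \<longlongrightarrow> 0 - 2) at_infinity"
    by (intro tendsto_diff tendsto_const tendsto_divide_0 filterlim_at_top_imp_at_infinity filterlim_ln_norm_at_infinity)
  moreover have "eventually (\<lambda>z::complex. 0 < ln (norm z)) at_infinity"
    using filterlim_at_top_dense[THEN iffD1, OF filterlim_ln_norm_at_infinity] by blast
  then have "eventually (\<lambda>z. (ln 2 - ln ((cmod ((a * z + b) / z))\<^sup>2 + (cmod ((c * z + d) / z))\<^sup>2)) / ln (norm z) - 2
       = pair_potential w1 w2 z / ln (norm z)) at_infinity"
  proof eventually_elim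
    case (elim z)
    have z: "z \<noteq> 0" using elim by auto
    have h: "0 < ?h z" using w by (intro norm_square_pair_pos) (simp add: normalized_pair_def)
    have "(cmod ((a * z + b) / z))\<^sup>2 + (cmod ((c * z + d) / z))\<^sup>2 = ?h z / (cmod z)\<^sup>2"
      unfolding norm_square_pair_def abcd norm_divide power_divide by (rule add_divide_distrib[symmetric])
    also have "ln \<dots> = ln (?h z) - 2 * ln (cmod z)" using h z by (simp add: ln_div ln_realpow)
    finally show ?case using elim by (simp add: pair_potential_def field_simps)
  qed
  ultimately have "((\<lambda>z. pair_potential w1 w2 z / ln (norm z)) \<longlongrightarrow> - 2) at_infinity"
    using Lim_transform_eventually by fastforce
  then have "Limsup at_infinity (\<lambda>z. ereal (pair_potential w1 w2 z / ln (norm z))) = ereal (- 2)"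
    by (intro lim_imp_Limsup tendsto_ereal trivial_limit_at_infinity)
  moreover have "liouville_solution (pair_potential w1 w2)" by (rule normalized_pair_solution[OF _ w]) simp
  ultimately show ?thesis by (simp add: N_def)
qed

text \<open>A finite limit superior bounds \<open>e\<^sup>u\<close> by a power, so \<open>T\<close> is a polynomial by \<open>potential_polynomial\<close>. The
  value of \<open>k\<close> is then forced, since the limit superior has been computed for every polynomial potential.\<close>

lemma potential_of_N:
  assumes u: "pair_potential w1 w2 \<in> N k" and T: "T holomorphic_on UNIV" and w: "normalized_pair T w1 w2 UNIV"
  shows "(T = (\<lambda>_. 0) \<and> k = - 2) \<or> (\<exists>P. P \<noteq> 0 \<and> T = poly P \<and> k = real (degree P) / 2)"
proof -
  let ?u = "pair_potential w1 w2"
  have lim: "Limsup at_infinity (\<lambda>z. ereal (?u z / ln (norm z))) = ereal k" using u by (simp add: N_def)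
  obtain n :: nat where n: "k + 1 \<le> real n" using real_arch_simple by blast
  have "eventually (\<lambda>z. ereal (?u z / ln (norm z)) < ereal (k + 1)) at_infinity"
    by (rule Limsup_lessD) (simp add: lim)
  moreover have "eventually (\<lambda>z::complex. 0 < ln (norm z)) at_infinity"
    using filterlim_at_top_dense[THEN iffD1, OF filterlim_ln_norm_at_infinity] by blast
  ultimately have "eventually (\<lambda>z. exp (?u z) \<le> (1 + cmod z) ^ n) at_infinity"
  proof eventually_elim
    case (elim z)
    have z1: "0 < cmod z" using elim by (metis ln_0 norm_le_zero_iff norm_zero not_le order_less_irrefl)
    have "?u z < (k + 1) * ln (norm z)" using elim by (simp add: pos_divide_less_eq)
    also have "\<dots> \<le> n * ln (norm z)" using n elim by (intro mult_right_mono) auto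
    also have "\<dots> = ln (norm z ^ n)" using z1 by (simp add: ln_realpow)
    finally have "exp (?u z) \<le> norm z ^ n" using z1 by (metis exp_le_cancel_iff exp_ln less_imp_le zero_less_power)
    also have "\<dots> \<le> (1 + cmod z) ^ n" by (intro power_mono) auto
    finally show ?case .
  qed
  then obtain R where R: "\<And>z. R \<le> cmod z \<Longrightarrow> exp (?u z) \<le> (1 + cmod z) ^ n" by (auto simp: eventually_at_infinity)
  obtain g where "liouville_jet ?u g T UNIV" using normalized_pair_jet[OF open_UNIV w] by blast
  then have cu: "continuous_on UNIV ?u"
    unfolding liouville_jet_def by (meson UNIV_I continuous_at_imp_continuous_on has_derivative_continuous)
  have "bounded ((\<lambda>z. exp (?u z)) ` cball 0 R)"
    by (intro compact_imp_bounded compact_continuous_image continuous_intros continuous_on_subset[OF cu]) auto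
  then obtain K0 where K0: "\<And>z. z \<in> cball 0 R \<Longrightarrow> exp (?u z) \<le> K0"
    unfolding bounded_iff real_norm_def by (meson abs_le_D1 imageI)
  define K where "K = max 1 K0"
  have K: "exp (ln 2 - ln (norm_square_pair w1 w2 z)) \<le> K * (1 + cmod z) ^ n" for z
  proof (cases "R \<le> cmod z")
    case True
    have "1 * (1 + cmod z) ^ n \<le> K * (1 + cmod z) ^ n" by (intro mult_right_mono) (auto simp: K_def)
    then show ?thesis using R[OF True] by (simp add: pair_potential_def)
  next
    case False
    then have "exp (?u z) \<le> K * 1" using K0[of z] by (simp add: K_def)
    also have "\<dots> \<le> K * (1 + cmod z) ^ n" by (intro mult_left_mono one_le_power) (auto simp: K_def)
    finally show ?thesis by (simp add: pair_potential_def)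
  qed
  obtain P where P: "\<And>z. T z = poly P z"
    by (rule potential_polynomial[of w1 w2 T K n]) (use w T K in \<open>auto simp: normalized_pair_def K_def\<close>)
  have TP: "T = poly P" using P by auto
  have uniq: "k' = k" if "?u \<in> N k'" for k' using that lim by (simp add: N_def)
  show ?thesis
  proof (cases "P = 0")
    case True
    then have T0: "T = (\<lambda>_. 0)" using P by auto
    then have "- 2 = k" using uniq zero_potential_in_N w by blast
    then show ?thesis using T0 by simp
  next
    case False
    have "real (degree P) / 2 = k" using uniq polynomial_potential_asymptotics(1)[OF False] w TP by blast
    then show ?thesis using False TP by blast
  qed
qed

section \<open>Developing maps\<close>

text \<open>With \<open>y = f'\<^sup>-\<^sup>1\<^sup>/\<^sup>2\<close>, which exists on a disc, the pair \<open>(f y, y)\<close> has Wronskian 1. Differentiating the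
  Wronskian shows that both members satisfy the equation with the potential \<open>- y'' / y\<close>.\<close>

lemma developing_map_local_pair:
  assumes f: "f holomorphic_on ball z0 r" and dm: "developing_map f u"
  obtains S v1 v2 where "normalized_pair S v1 v2 (ball z0 r)" "\<And>z. z \<in> ball z0 r \<Longrightarrow> v2 z \<noteq> 0"
    "\<And>z. z \<in> ball z0 r \<Longrightarrow> v1 z = f z * v2 z" "\<And>z. z \<in> ball z0 r \<Longrightarrow> u z = pair_potential v1 v2 z"
proof -
  let ?B = "ball z0 r"
  have np: "\<not> is_pole f z" if "z \<in> ?B" for z using not_is_pole_holomorphic[OF open_ball that f] .
  have df: "deriv f z \<noteq> 0" and uf: "u z = ln (2 * norm (deriv f z) / (1 + (norm (f z))\<^sup>2))" if "z \<in> ?B" for z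
    using dm np[OF that] unfolding developing_map_def locally_univalent_meromorphic_def Let_def by metis+
  have hol': "deriv f holomorphic_on ?B" by (intro holomorphic_deriv f open_ball)
  have "(\<lambda>z. inverse (deriv f z)) holomorphic_on ?B" by (rule holomorphic_on_inverse[OF hol' df])
  then obtain y where y: "y holomorphic_on ?B" "\<And>z. z \<in> ?B \<Longrightarrow> inverse (deriv f z) = (y z)\<^sup>2"
    using contractible_imp_holomorphic_sqrt[of "\<lambda>z. inverse (deriv f z)" ?B] convex_imp_contractible[OF convex_ball] df
    by (metis inverse_nonzero_iff_nonzero)
  have ynz: "y z \<noteq> 0" if "z \<in> ?B" for z using y(2)[OF that] df[OF that] by auto
  have yf: "deriv f z * (y z)\<^sup>2 = 1" if "z \<in> ?B" for z using y(2)[OF that, symmetric] df[OF that] by simp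
  define v1 where "v1 z = f z * y z" for z
  have hv1: "v1 holomorphic_on ?B" unfolding v1_def by (intro holomorphic_intros f y)
  have d: "(f has_field_derivative deriv f z) (at z)" "(y has_field_derivative deriv y z) (at z)" if "z \<in> ?B" for z
    by (rule holomorphic_derivI[OF f open_ball that] holomorphic_derivI[OF y(1) open_ball that])+
  have dv1: "deriv v1 z = deriv f z * y z + deriv y z * f z" if "z \<in> ?B" for z
    unfolding v1_def by (rule DERIV_imp_deriv[OF DERIV_mult[OF d[OF that]]])
  have wr: "deriv v1 z * y z - v1 z * deriv y z = 1" if "z \<in> ?B" for z
    using yf[OF that] by (simp add: dv1[OF that] v1_def power2_eq_square algebra_simps)
  have dd: "(v1 has_field_derivative deriv v1 z) (at z)" "(deriv v1 has_field_derivative deriv (deriv v1) z) (at z)"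
    "(deriv y has_field_derivative deriv (deriv y) z) (at z)" if "z \<in> ?B" for z
    using holomorphic_derivI[OF hv1 open_ball that] holomorphic_derivI[OF holomorphic_deriv[OF hv1 open_ball] open_ball that]
      holomorphic_derivI[OF holomorphic_deriv[OF y(1) open_ball] open_ball that] by auto
  have cross: "deriv (deriv v1) z * y z = v1 z * deriv (deriv y) z" if z: "z \<in> ?B" for z
  proof -
    have "((\<lambda>z. deriv v1 z * y z - v1 z * deriv y z) has_field_derivative
        (deriv (deriv v1) z * y z + deriv y z * deriv v1 z) - (deriv v1 z * deriv y z + deriv (deriv y) z * v1 z)) (at z)"
      by (intro DERIV_diff DERIV_mult dd d z)
    moreover have "((\<lambda>z. deriv v1 z * y z - v1 z * deriv y z) has_field_derivative 0) (at z)"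
      by (rule has_field_derivative_transform_within_open[OF DERIV_const[of 1] open_ball z]) (simp add: wr)
    ultimately have "(deriv (deriv v1) z * y z + deriv y z * deriv v1 z) - (deriv v1 z * deriv y z + deriv (deriv y) z * v1 z) = 0"
      by (rule DERIV_unique)
    then show ?thesis by (simp add: algebra_simps)
  qed
  define S where "S z = - deriv (deriv y) z / y z" for z
  have "normalized_pair S v1 y ?B"
    unfolding normalized_pair_def
  proof (intro conjI ballI hv1 y(1) wr)
    fix z assume z: "z \<in> ?B"
    show "deriv (deriv v1) z = - S z * v1 z" using cross[OF z] ynz[OF z] by (simp add: S_def field_simps)
    show "deriv (deriv y) z = - S z * y z" using ynz[OF z] by (simp add: S_def)
  qed
  moreover have "u z = pair_potential v1 y z" if z: "z \<in> ?B" for z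
  proof -
    have "(cmod (y z))\<^sup>2 = 1 / cmod (deriv f z)" using y(2)[OF z] by (metis norm_inverse norm_power inverse_eq_divide)
    then have "norm_square_pair v1 y z = (1 + (cmod (f z))\<^sup>2) / cmod (deriv f z)"
      by (simp add: norm_square_pair_def v1_def norm_mult power_mult_distrib add_divide_distrib)
    moreover have "0 < 1 + (cmod (f z))\<^sup>2" by (simp add: add_pos_nonneg)
    ultimately show ?thesis using df[OF z] by (simp add: uf[OF z] pair_potential_def ln_div ln_mult)
  qed
  ultimately show ?thesis using that ynz by (auto simp: v1_def)
qed

lemma developing_map_analytic_somewhere:
  assumes dm: "developing_map f u" and "open O'" "O' \<noteq> {}"
  obtains z0 r where "0 < r" "ball z0 r \<subseteq> O'" "f holomorphic_on ball z0 r"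
proof -
  have nm: "f nicely_meromorphic_on UNIV"
    using dm by (auto simp: developing_map_def locally_univalent_meromorphic_def)
  then have "f meromorphic_on UNIV" by (auto simp: nicely_meromorphic_on_def)
  then have ev: "eventually (\<lambda>z. f analytic_on {z}) (cosparse UNIV)" by (rule meromorphic_on_imp_analytic_cosparse)
  obtain x where x: "x \<in> O'" using assms by auto
  have "eventually (\<lambda>z. f analytic_on {z}) (at x)" using ev by (simp add: eventually_cosparse_open_eq)
  moreover have "eventually (\<lambda>z. z \<in> O') (at x)" using x assms eventually_at_in_open' by blast
  ultimately have "eventually (\<lambda>z. f analytic_on {z} \<and> z \<in> O') (at x)" by (rule eventually_conj)
  then obtain z0 where z0: "f analytic_on {z0}" "z0 \<in> O'"
    using eventually_happens'[OF at_neq_bot] by blast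
  obtain r1 where r1: "0 < r1" "f holomorphic_on ball z0 r1" using z0(1) by (auto simp: analytic_at_ball)
  obtain r2 where r2: "0 < r2" "ball z0 r2 \<subseteq> O'" using z0(2) \<open>open O'\<close> by (auto simp: open_contains_ball)
  show ?thesis
    by (rule that[of "min r1 r2" z0]) (use r1 r2 in \<open>auto elim: holomorphic_on_subset\<close>)
qed

text \<open>Near a point where \<open>f\<close> is holomorphic it is the quotient of a local normalized pair. This pair represents the same
  \<open>u\<close>, so it belongs to the potential \<open>T\<close> and consists of linear combinations of \<open>w1\<close> and \<open>w2\<close>, which are entire.\<close>

lemma developing_map_quotient:
  assumes dm: "developing_map f u" and w: "normalized_pair T w1 w2 UNIV" and u: "u = pair_potential w1 w2"
  obtains V1 V2 where "normalized_pair T V1 V2 UNIV" "is_quotient f V1 V2"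
proof -
  obtain z0 r where r: "0 < r" and f: "f holomorphic_on ball z0 r"
    using developing_map_analytic_somewhere[OF dm open_UNIV UNIV_not_empty] by blast
  let ?B = "ball z0 r"
  obtain S v1 v2 where v: "normalized_pair S v1 v2 ?B" and v2: "\<And>z. z \<in> ?B \<Longrightarrow> v2 z \<noteq> 0"
    and v1: "\<And>z. z \<in> ?B \<Longrightarrow> v1 z = f z * v2 z" and uv: "\<And>z. z \<in> ?B \<Longrightarrow> u z = pair_potential v1 v2 z"
    by (rule developing_map_local_pair[OF f dm]) blast
  have wB: "normalized_pair T w1 w2 ?B" using w by (auto simp: normalized_pair_def elim: holomorphic_on_subset)
  obtain g g' where j: "liouville_jet (pair_potential v1 v2) g S ?B" "liouville_jet (pair_potential w1 w2) g' T ?B"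
    using normalized_pair_jet[OF open_ball v] normalized_pair_jet[OF open_ball wB] by metis
  have ST: "S z = T z" if "z \<in> ?B" for z
    by (rule liouville_jet_unique(2)[OF open_ball that j]) (use uv u in auto)
  have comb: "\<exists>a b. \<forall>z\<in>?B. v z = a * w1 z + b * w2 z"
    if v: "v holomorphic_on ?B" and ode: "\<And>z. z \<in> ?B \<Longrightarrow> deriv (deriv v) z = - T z * v z" for v
  proof -
    have ow: "w1 holomorphic_on ?B" "w2 holomorphic_on ?B"
      "\<And>z. z \<in> ?B \<Longrightarrow> deriv (deriv w1) z = - T z * w1 z" "\<And>z. z \<in> ?B \<Longrightarrow> deriv (deriv w2) z = - T z * w2 z"
      "\<And>z. z \<in> ?B \<Longrightarrow> deriv w1 z * w2 z - w1 z * deriv w2 z = 1"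
      using wB by (auto simp: normalized_pair_def)
    obtain a where a: "\<And>z. z \<in> ?B \<Longrightarrow> deriv v z * w2 z - v z * deriv w2 z = a"
      using wronskian_constant[OF open_ball connected_ball v ow(2) ode ow(4)] by blast
    obtain b where b: "\<And>z. z \<in> ?B \<Longrightarrow> deriv v z * w1 z - v z * deriv w1 z = b"
      using wronskian_constant[OF open_ball connected_ball v ow(1) ode ow(3)] by blast
    \<comment> \<open>Cramer's rule: the coefficients are Wronskians of \<open>v\<close> with \<open>w2\<close> and with \<open>w1\<close>, hence constant.\<close>
    have "v z = a * w1 z + (- b) * w2 z" if z: "z \<in> ?B" for z
    proof -
      have "a * w1 z + (- b) * w2 z = v z * (deriv w1 z * w2 z - w1 z * deriv w2 z)"
        unfolding a[OF z, symmetric] b[OF z, symmetric] by (simp add: algebra_simps)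
      then show ?thesis using ow(5)[OF z] by simp
    qed
    then show ?thesis by blast
  qed
  obtain a1 b1 where 1: "\<And>z. z \<in> ?B \<Longrightarrow> v1 z = a1 * w1 z + b1 * w2 z"
    using comb[of v1] v ST unfolding normalized_pair_def by metis
  obtain a2 b2 where 2: "\<And>z. z \<in> ?B \<Longrightarrow> v2 z = a2 * w1 z + b2 * w2 z"
    using comb[of v2] v ST unfolding normalized_pair_def by metis
  define V1 V2 where "V1 z = a1 * w1 z + b1 * w2 z" and "V2 z = a2 * w1 z + b2 * w2 z" for z
  have hw: "w1 holomorphic_on UNIV" "w2 holomorphic_on UNIV" using w by (auto simp: normalized_pair_def)
  have hV: "V1 holomorphic_on UNIV" "V2 holomorphic_on UNIV"
    unfolding V1_def V2_def by (intro holomorphic_intros hw)+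
  have lin: "deriv (\<lambda>z. a * w1 z + b * w2 z) = (\<lambda>z. a * deriv w1 z + b * deriv w2 z)"
    "deriv (\<lambda>z. a * deriv w1 z + b * deriv w2 z) z = - T z * (a * w1 z + b * w2 z)" for a b z
  proof -
    have d: "(w1 has_field_derivative deriv w1 z) (at z)" "(w2 has_field_derivative deriv w2 z) (at z)"
      "(deriv w1 has_field_derivative - T z * w1 z) (at z)" "(deriv w2 has_field_derivative - T z * w2 z) (at z)" for z
      using holomorphic_derivI[OF hw(1) open_UNIV] holomorphic_derivI[OF hw(2) open_UNIV]
        holomorphic_derivI[OF holomorphic_deriv[OF hw(1) open_UNIV] open_UNIV]
        holomorphic_derivI[OF holomorphic_deriv[OF hw(2) open_UNIV] open_UNIV] w by (auto simp: normalized_pair_def)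
    show "deriv (\<lambda>z. a * w1 z + b * w2 z) = (\<lambda>z. a * deriv w1 z + b * deriv w2 z)"
      by (rule ext, rule DERIV_imp_deriv, intro DERIV_add DERIV_cmult d)
    have "((\<lambda>z. a * deriv w1 z + b * deriv w2 z) has_field_derivative a * (- T z * w1 z) + b * (- T z * w2 z)) (at z)"
      by (intro DERIV_add DERIV_cmult d)
    then show "deriv (\<lambda>z. a * deriv w1 z + b * deriv w2 z) z = - T z * (a * w1 z + b * w2 z)"
      using DERIV_imp_deriv by (force simp: algebra_simps)
  qed
  have odeV: "deriv (deriv V1) z = - T z * V1 z" "deriv (deriv V2) z = - T z * V2 z" for z
    unfolding V1_def V2_def lin by simp_all
  obtain c where c: "\<And>z. deriv V1 z * V2 z - V1 z * deriv V2 z = c"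
    using wronskian_constant[OF open_UNIV connected_UNIV hV odeV] by auto
  have z0: "z0 \<in> ?B" using r by simp
  have vV: "v1 z = V1 z" "v2 z = V2 z" if "z \<in> ?B" for z using 1 2 that by (auto simp: V1_def V2_def)
  have hv: "v1 holomorphic_on ?B" "v2 holomorphic_on ?B" using v by (auto simp: normalized_pair_def)
  have "deriv v1 z0 = deriv V1 z0" "deriv v2 z0 = deriv V2 z0"
    by (rule complex_derivative_transform_within_open[OF hv(1) holomorphic_on_subset[OF hV(1)] open_ball z0 vV(1)]
        complex_derivative_transform_within_open[OF hv(2) holomorphic_on_subset[OF hV(2)] open_ball z0 vV(2)]; simp)+
  then have "c = 1" using c[of z0] v z0 vV[OF z0] unfolding normalized_pair_def by metis
  then have V: "normalized_pair T V1 V2 UNIV" using hV odeV c by (simp add: normalized_pair_def)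
  \<comment> \<open>The identity \<open>f V2 = V1\<close> spreads from the ball to the whole plane.\<close>
  have nm: "f nicely_meromorphic_on UNIV" and m: "f meromorphic_on UNIV"
    using dm by (auto simp: developing_map_def locally_univalent_meromorphic_def nicely_meromorphic_on_def)
  define F where "F z = f z * V2 z - V1 z" for z
  have "F meromorphic_on UNIV" unfolding F_def
    using hV by (intro meromorphic_intros m analytic_on_imp_meromorphic_on) (simp_all add: analytic_on_open)
  then consider "\<forall>\<^sub>\<approx>z\<in>UNIV. F z = 0" | "\<forall>\<^sub>\<approx>z\<in>UNIV. F z \<noteq> 0"
    using meromorphic_imp_constant_or_avoid[of F UNIV 0] by auto
  then have F0: "eventually (\<lambda>z. F z = 0) (at z)" for z
  proof cases
    case 1 then show ?thesis by (simp add: eventually_cosparse_open_eq)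
  next
    case 2
    then have "eventually (\<lambda>z. F z \<noteq> 0) (at z0)" by (simp add: eventually_cosparse_open_eq)
    moreover have "eventually (\<lambda>z. z \<in> ?B) (at z0)" using z0 eventually_at_in_open' by blast
    ultimately have "eventually (\<lambda>z. False) (at z0)"
      by eventually_elim (use v1 vV in \<open>auto simp: F_def\<close>)
    then show ?thesis by simp
  qed
  have "f z = V1 z / V2 z" if nz: "V2 z \<noteq> 0" for z
  proof -
    have cV: "isCont V1 z" "isCont V2 z"
      using hV by (auto simp: holomorphic_on_imp_continuous_on continuous_on_eq_continuous_at intro: holomorphic_on_imp_continuous_on[THEN continuous_on_interior])
    have "(\<lambda>x. V1 x / V2 x) \<midarrow>z\<rightarrow> V1 z / V2 z"
      using cV nz by (intro tendsto_divide) (auto simp: isCont_def)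
    moreover have "eventually (\<lambda>x. V2 x \<noteq> 0) (at z)"
      using cV(2) nz by (auto simp: isCont_def intro: tendsto_imp_eventually_ne)
    then have "eventually (\<lambda>x. V1 x / V2 x = f x) (at z)"
      using F0[of z] by eventually_elim (simp add: F_def field_simps)
    ultimately have lim: "f \<midarrow>z\<rightarrow> V1 z / V2 z" by (rule Lim_transform_eventually)
    have "(is_pole f z \<and> f z = 0) \<or> f \<midarrow>z\<rightarrow> f z" using nm by (auto simp: nicely_meromorphic_on_def)
    moreover have "\<not> is_pole f z"
      unfolding is_pole_def using lim not_tendsto_and_filterlim_at_infinity[OF trivial_limit_at] by blast
    ultimately have "f \<midarrow>z\<rightarrow> f z" by blast
    with lim show ?thesis using LIM_unique by blast
  qed
  then have "is_quotient f V1 V2" by (simp add: is_quotient_def)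
  then show ?thesis using that V by blast
qed

text \<open>The potential can be recovered from the quotient (it is half of the Schwarzian derivative). Here this appears as
  follows: dividing \<open>w1\<close>, \<open>w2\<close> by a square root of their Wronskian gives a normalized pair that represents \<open>u\<close> on a disc,
  and the potential of \<open>u\<close> is unique.\<close>

lemma potential_eq_of_quotient:
  assumes dm: "developing_map f u" and W: "normalized_pair T W1 W2 UNIV" and u: "u = pair_potential W1 W2"
    and T: "T holomorphic_on UNIV" and S: "S holomorphic_on UNIV"
    and w: "w1 holomorphic_on UNIV" "w2 holomorphic_on UNIV"
      "\<And>z. deriv (deriv w1) z = - S z * w1 z" "\<And>z. deriv (deriv w2) z = - S z * w2 z"
    and q: "is_quotient f w1 w2" and nz: "w2 x \<noteq> 0"
  shows "T = S"
proof -
  have "open {z. w2 z \<noteq> 0}"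
    using holomorphic_on_imp_continuous_on[OF w(2)] by (intro open_Collect_neq continuous_on_const)
  moreover have "{z. w2 z \<noteq> 0} \<noteq> {}" using nz by auto
  ultimately obtain z0 r where r: "0 < r" "ball z0 r \<subseteq> {z. w2 z \<noteq> 0}" by (metis all_not_in_conv openE)
  let ?B = "ball z0 r"
  have w2nz: "w2 z \<noteq> 0" if "z \<in> ?B" for z using r that by auto
  have fq: "f z = w1 z / w2 z" if "z \<in> ?B" for z using q w2nz[OF that] by (auto simp: is_quotient_def)
  have "(\<lambda>z. w1 z / w2 z) holomorphic_on ?B"
    using w2nz by (intro holomorphic_on_divide) (auto intro: holomorphic_on_subset[OF w(1)] holomorphic_on_subset[OF w(2)])
  then have f: "f holomorphic_on ?B" by (rule holomorphic_transform) (simp add: fq)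
  obtain c where c: "\<And>z. deriv w1 z * w2 z - w1 z * deriv w2 z = c"
    using wronskian_constant[OF open_UNIV connected_UNIV w] by auto
  have df: "deriv f z = c / (w2 z)\<^sup>2" if z: "z \<in> ?B" for z
  proof -
    have "((\<lambda>z. w1 z / w2 z) has_field_derivative (deriv w1 z * w2 z - w1 z * deriv w2 z) / (w2 z * w2 z)) (at z)"
      using w2nz[OF z] holomorphic_derivI[OF w(1) open_UNIV] holomorphic_derivI[OF w(2) open_UNIV]
      by (intro DERIV_divide) auto
    then have "(f has_field_derivative c / (w2 z)\<^sup>2) (at z)"
      unfolding c power2_eq_square
      by (rule has_field_derivative_transform_within_open[OF _ open_ball z]) (simp add: fq)
    then show ?thesis by (rule DERIV_imp_deriv)
  qed
  have z0: "z0 \<in> ?B" using r by simp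
  have fu: "deriv f z \<noteq> 0" "u z = ln (2 * norm (deriv f z) / (1 + (norm (f z))\<^sup>2))" if "z \<in> ?B" for z
    using dm not_is_pole_holomorphic[OF open_ball that f]
    unfolding developing_map_def locally_univalent_meromorphic_def Let_def by metis+
  have c0: "c \<noteq> 0" using fu(1)[OF z0] df[OF z0] by auto
  define s where "s = csqrt c"
  have s: "s \<noteq> 0" "s * s = c" using c0 power2_csqrt[of c] by (auto simp: s_def power2_eq_square)
  define v1 v2 where "v1 z = w1 z / s" and "v2 z = w2 z / s" for z
  have dv: "deriv v1 = (\<lambda>z. deriv w1 z / s)" "deriv v2 = (\<lambda>z. deriv w2 z / s)"
    unfolding v1_def v2_def using holomorphic_derivI[OF w(1) open_UNIV] holomorphic_derivI[OF w(2) open_UNIV]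
    by (auto intro!: DERIV_imp_deriv DERIV_cdivide)
  have ddv: "deriv (deriv v1) z = deriv (deriv w1) z / s" "deriv (deriv v2) z = deriv (deriv w2) z / s" for z
    unfolding dv using holomorphic_derivI[OF holomorphic_deriv[OF w(1) open_UNIV] open_UNIV]
      holomorphic_derivI[OF holomorphic_deriv[OF w(2) open_UNIV] open_UNIV]
    by (auto intro!: DERIV_imp_deriv DERIV_cdivide)
  have hv: "v1 holomorphic_on UNIV" "v2 holomorphic_on UNIV"
    unfolding v1_def v2_def using s by (intro holomorphic_intros w; simp)+
  have wrv: "deriv v1 z * v2 z - v1 z * deriv v2 z = 1" for z
  proof -
    have "deriv v1 z * v2 z - v1 z * deriv v2 z = (deriv w1 z * w2 z - w1 z * deriv w2 z) / (s * s)"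
      by (simp add: dv v1_def v2_def diff_divide_distrib)
    then show ?thesis using c0 by (simp add: c s)
  qed
  have v: "normalized_pair S v1 v2 ?B"
    using hv wrv w by (auto simp: normalized_pair_def ddv v1_def v2_def elim: holomorphic_on_subset)
  have uv: "u z = pair_potential v1 v2 z" if z: "z \<in> ?B" for z
  proof -
    have cs: "(cmod s)\<^sup>2 = cmod c" using s by (metis norm_mult power2_eq_square)
    have "norm_square_pair v1 v2 z = ((cmod (w1 z))\<^sup>2 + (cmod (w2 z))\<^sup>2) / cmod c"
      by (simp add: norm_square_pair_def v1_def v2_def norm_divide power_divide cs add_divide_distrib)
    moreover have "2 * norm (deriv f z) / (1 + (norm (f z))\<^sup>2) = 2 * cmod c / ((cmod (w1 z))\<^sup>2 + (cmod (w2 z))\<^sup>2)"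
      using w2nz[OF z] by (simp add: df[OF z] fq[OF z] norm_divide norm_power power_divide field_simps)
    moreover have "0 < (cmod (w1 z))\<^sup>2 + (cmod (w2 z))\<^sup>2" using w2nz[OF z] by (simp add: sum_power2_gt_zero_iff)
    moreover have "ln (2 * x / h) = ln 2 - ln (h / x)" if "0 < x" "0 < h" for x h :: real
      using that by (simp add: ln_div ln_mult)
    ultimately show ?thesis using c0 unfolding fu(2)[OF z] pair_potential_def by simp
  qed
  have WB: "normalized_pair T W1 W2 ?B" using W by (auto simp: normalized_pair_def elim: holomorphic_on_subset)
  obtain g g' where j: "liouville_jet (pair_potential W1 W2) g T ?B" "liouville_jet (pair_potential v1 v2) g' S ?B"
    using normalized_pair_jet[OF open_ball v] normalized_pair_jet[OF open_ball WB] by metis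
  have TS: "T z = S z" if "z \<in> ?B" for z
    by (rule liouville_jet_unique(2)[OF open_ball that j]) (use uv u in auto)
  have "T z = S z" for z
    by (rule analytic_continuation_open[of ?B UNIV T S]) (use r T S TS in auto)
  then show ?thesis by auto
qed

lemma poly_upper_bound:
  fixes q :: "complex poly"
  obtains C n where "0 \<le> C" "\<And>z. 1 \<le> norm z \<Longrightarrow> norm (poly q z) \<le> C * norm z ^ n"
proof -
  have "norm (poly q z) \<le> (\<Sum>i\<le>degree q. norm (coeff q i)) * norm z ^ degree q" if z: "1 \<le> norm z" for z
  proof -
    have "norm (poly q z) \<le> (\<Sum>i\<le>degree q. norm (coeff q i * z ^ i))"
      unfolding poly_altdef by (rule norm_sum)
    also have "\<dots> \<le> (\<Sum>i\<le>degree q. norm (coeff q i) * norm z ^ degree q)"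
      unfolding norm_mult norm_power using z by (intro sum_mono mult_left_mono power_increasing) auto
    finally show ?thesis by (simp add: sum_distrib_right)
  qed
  then show ?thesis by (intro that[of "\<Sum>i\<le>degree q. norm (coeff q i)" "degree q"] sum_nonneg) auto
qed

lemma poly_lower_bound:
  fixes q :: "complex poly"
  assumes "q \<noteq> 0"
  obtains \<epsilon> R where "0 < \<epsilon>" "\<And>z. R \<le> norm z \<Longrightarrow> \<epsilon> \<le> norm (poly q z)"
proof (cases "degree q = 0")
  case True
  then obtain c where "q = [:c:]" by (metis degree_eq_zeroE)
  with assms that[of "norm c"] show ?thesis by auto
next
  case False
  then have "filterlim (poly q) at_infinity at_infinity" by (intro filterlim_poly_at_infinity) auto
  then have "eventually (\<lambda>z. 1 \<le> norm (poly q z)) at_infinity"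
    using filterlim_at_infinity[of 0 "poly q"] by auto
  then obtain R where "\<And>z. R \<le> norm z \<Longrightarrow> 1 \<le> norm (poly q z)" by (auto simp: eventually_at_infinity)
  then show ?thesis using that[of 1] by auto
qed

text \<open>If \<open>V1 / V2 = p / q\<close>, differentiating gives \<open>1 / V2\<^sup>2 = (p' q - p q') / q\<^sup>2\<close>. So \<open>V2\<close> grows at most like a power
  and is a polynomial, and \<open>T = - V2'' / V2\<close> tends to 0 at infinity.\<close>

lemma rational_quotient_potential_zero:
  assumes V: "normalized_pair T V1 V2 UNIV" and T: "T holomorphic_on UNIV" and q: "is_quotient f V1 V2"
    and rat: "rational_function f"
  shows "T = (\<lambda>_. 0)"
proof -
  obtain p q where pq: "q \<noteq> 0" "\<And>z. poly q z \<noteq> 0 \<Longrightarrow> f z = poly p z / poly q z"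
    using rat by (auto simp: rational_function_def)
  have hV: "V1 holomorphic_on UNIV" "V2 holomorphic_on UNIV" using V by (auto simp: normalized_pair_def)
  have wr: "deriv V1 z * V2 z - V1 z * deriv V2 z = 1" for z using V by (auto simp: normalized_pair_def)
  have ode: "deriv (deriv V2) z = - T z * V2 z" for z using V by (auto simp: normalized_pair_def)
  have V2nz: "\<exists>z. V2 z \<noteq> 0"
  proof (rule ccontr)
    assume "\<not> ?thesis"
    then have "V2 = (\<lambda>_. 0)" by auto
    then show False using wr[of 0] by simp
  qed
  define E where "E z = poly p z * V2 z - poly q z * V1 z" for z
  have hE: "E holomorphic_on UNIV" unfolding E_def by (intro holomorphic_intros hV)
  have E0: "E z = 0" for z
  proof -
    obtain x where x: "V2 x \<noteq> 0" using V2nz by auto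
    have "open {z. V2 z \<noteq> 0}"
      using holomorphic_on_imp_continuous_on[OF hV(2)] by (intro open_Collect_neq continuous_on_const)
    moreover have "x \<in> {z. V2 z \<noteq> 0}" using x by simp
    ultimately obtain r where r: "0 < r" "ball x r \<subseteq> {z. V2 z \<noteq> 0}" by (metis openE)
    have fin: "finite {z. poly q z = 0}" using pq(1) by (rule poly_roots_finite)
    have op: "open (ball x r - {z. poly q z = 0})" by (intro open_Diff finite_imp_closed fin open_ball)
    have ne: "ball x r - {z. poly q z = 0} \<noteq> {}"
    proof
      assume "ball x r - {z. poly q z = 0} = {}"
      then have "finite (ball x r)" using fin finite_subset by (metis Diff_eq_empty_iff)
      then show False using r(1) by (metis ball_eq_empty finite_imp_not_open not_le open_ball)
    qed
    have "E y = 0" if "y \<in> ball x r - {z. poly q z = 0}" for y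
    proof -
      have "V2 y \<noteq> 0" "poly q y \<noteq> 0" using that r by auto
      then have "V1 y / V2 y = poly p y / poly q y" using pq(2)[of y] q by (auto simp: is_quotient_def)
      then show ?thesis using \<open>V2 y \<noteq> 0\<close> \<open>poly q y \<noteq> 0\<close> by (simp add: E_def field_simps)
    qed
    then show "E z = 0"
      using analytic_continuation_open[OF op open_UNIV ne connected_UNIV subset_UNIV hE holomorphic_on_const[of 0], of z] by simp
  qed
  define R where "R = pderiv p * q - p * pderiv q"
  have key: "(V2 z)\<^sup>2 * poly R z = (poly q z)\<^sup>2" for z
  proof -
    have dV: "(V1 has_field_derivative deriv V1 z) (at z)" "(V2 has_field_derivative deriv V2 z) (at z)"
      using holomorphic_derivI[OF hV(1) open_UNIV] holomorphic_derivI[OF hV(2) open_UNIV] by auto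
    have "(E has_field_derivative (poly (pderiv p) z * V2 z + deriv V2 z * poly p z) - (poly (pderiv q) z * V1 z + deriv V1 z * poly q z)) (at z)"
      unfolding E_def by (intro DERIV_diff DERIV_mult poly_DERIV dV)
    moreover have "E = (\<lambda>_. 0)" using E0 by auto
    ultimately have d: "(poly (pderiv p) z * V2 z + deriv V2 z * poly p z) - (poly (pderiv q) z * V1 z + deriv V1 z * poly q z) = 0"
      using DERIV_unique[OF _ DERIV_const] by metis
    have e: "poly p z * V2 z = poly q z * V1 z" using E0[of z] by (simp add: E_def)
    have "(V2 z)\<^sup>2 * poly R z - (poly q z)\<^sup>2 * (deriv V1 z * V2 z - V1 z * deriv V2 z) =
       ((poly (pderiv p) z * V2 z + deriv V2 z * poly p z) - (poly (pderiv q) z * V1 z + deriv V1 z * poly q z)) * (poly q z * V2 z)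
       + (poly q z * V1 z - poly p z * V2 z) * (V2 z * poly (pderiv q) z + poly q z * deriv V2 z)"
      by (simp add: R_def power2_eq_square algebra_simps)
    also have "\<dots> = 0" unfolding d e by simp
    finally show ?thesis by (simp add: wr)
  qed
  have "R \<noteq> 0"
  proof
    assume "R = 0"
    then have "\<forall>z. poly q z = 0" using key by simp
    then show False using pq(1) poly_all_0_iff_0 by blast
  qed
  then obtain \<epsilon> A where \<epsilon>: "0 < \<epsilon>" "\<And>z. A \<le> norm z \<Longrightarrow> \<epsilon> \<le> norm (poly R z)" by (rule poly_lower_bound) blast
  obtain C n where C: "0 \<le> C" "\<And>z. 1 \<le> norm z \<Longrightarrow> norm (poly q z) \<le> C * norm z ^ n" by (rule poly_upper_bound) blast
  have "norm (V2 z) \<le> (C / sqrt \<epsilon>) * norm z ^ n" if z: "max A 1 \<le> norm z" for z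
  proof (rule power2_le_imp_le)
    have "(norm (V2 z))\<^sup>2 * \<epsilon> \<le> (norm (V2 z))\<^sup>2 * norm (poly R z)" using \<epsilon>(2)[of z] z by (intro mult_left_mono) auto
    also have "\<dots> = (norm (poly q z))\<^sup>2" using key[of z] by (metis norm_mult norm_power)
    also have "\<dots> \<le> (C * norm z ^ n)\<^sup>2" using C(2)[of z] z by (intro power_mono) auto
    finally show "(norm (V2 z))\<^sup>2 \<le> (C / sqrt \<epsilon> * norm z ^ n)\<^sup>2"
      using \<epsilon>(1) by (simp add: power_mult_distrib power_divide field_simps)
    show "0 \<le> C / sqrt \<epsilon> * norm z ^ n" using C \<epsilon> by simp
  qed
  then obtain Q where Q: "V2 = poly Q" using polynomially_bounded_entire_imp_poly[OF hV(2)] by blast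
  have Qnz: "Q \<noteq> 0" using V2nz Q by auto
  have dQ: "deriv (poly p) = poly (pderiv p)" for p :: "complex poly"
    by (rule ext, rule DERIV_imp_deriv, rule poly_DERIV)
  have TQ: "T z * poly Q z = - poly (pderiv (pderiv Q)) z" for z
    using ode[of z] unfolding Q dQ by simp
  obtain \<epsilon>' A' where \<epsilon>': "0 < \<epsilon>'" "\<And>z. A' \<le> norm z \<Longrightarrow> \<epsilon>' \<le> norm (poly Q z)" by (rule poly_lower_bound[OF Qnz]) blast
  have ev: "eventually (\<lambda>z. - (poly (pderiv (pderiv Q)) z / poly Q z) = T z) at_infinity"
    unfolding eventually_at_infinity
  proof (intro exI[of _ A'] allI impI)
    fix z :: complex assume "A' \<le> norm z"
    then have "poly Q z \<noteq> 0" using \<epsilon>'(2)[of z] \<epsilon>'(1) by auto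
    then show "- (poly (pderiv (pderiv Q)) z / poly Q z) = T z" using TQ[of z] by (simp add: field_simps)
  qed
  have "((\<lambda>z. poly (pderiv (pderiv Q)) z / poly Q z) \<longlongrightarrow> 0) at_infinity"
  proof (cases "degree Q = 0")
    case True
    then have "pderiv Q = 0" by (simp add: pderiv_eq_0_iff)
    then show ?thesis by simp
  next
    case False
    then show ?thesis by (intro poly_divide_tendsto_0_at_infinity) (simp add: degree_pderiv)
  qed
  then have "((\<lambda>z. - (poly (pderiv (pderiv Q)) z / poly Q z)) \<longlongrightarrow> - 0) at_infinity" by (rule tendsto_minus)
  then have "(T \<longlongrightarrow> 0) at_infinity" using Lim_transform_eventually[OF _ ev] by simp
  then show ?thesis using Liouville_weak_0[OF T] by auto
qed

lemma normalized_pair_lin_indep: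
  assumes "normalized_pair T w1 w2 UNIV"
  shows "lin_indep_pair w1 w2"
  unfolding lin_indep_pair_def
proof (intro allI impI)
  fix a b assume 0: "\<forall>z. a * w1 z + b * w2 z = 0"
  have hw: "w1 holomorphic_on UNIV" "w2 holomorphic_on UNIV" and wr: "deriv w1 0 * w2 0 - w1 0 * deriv w2 0 = 1"
    using assms by (auto simp: normalized_pair_def)
  have "((\<lambda>z. a * w1 z + b * w2 z) has_field_derivative a * deriv w1 0 + b * deriv w2 0) (at 0)"
    using holomorphic_derivI[OF hw(1) open_UNIV] holomorphic_derivI[OF hw(2) open_UNIV] by (intro DERIV_add DERIV_cmult) auto
  moreover have "(\<lambda>z. a * w1 z + b * w2 z) = (\<lambda>_. 0)" using 0 by auto
  ultimately have d: "a * deriv w1 0 + b * deriv w2 0 = 0" using DERIV_unique[OF _ DERIV_const] by metis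
  have e: "a * w1 0 + b * w2 0 = 0" using 0 by auto
  have "a = a * (deriv w1 0 * w2 0 - w1 0 * deriv w2 0)" using wr by simp
  also have "\<dots> = (a * deriv w1 0 + b * deriv w2 0) * w2 0 - (a * w1 0 + b * w2 0) * deriv w2 0" by (simp add: algebra_simps)
  finally have "a = 0" unfolding d e by simp
  have "b = b * (deriv w1 0 * w2 0 - w1 0 * deriv w2 0)" using wr by simp
  also have "\<dots> = (a * w1 0 + b * w2 0) * deriv w1 0 - (a * deriv w1 0 + b * deriv w2 0) * w1 0" by (simp add: algebra_simps)
  finally have "b = 0" unfolding d e by simp
  with \<open>a = 0\<close> show "a = 0 \<and> b = 0" by simp
qed

section \<open>The classification\<close>

theorem theorem1p9:
  shows
    "(\<forall>k::real. N k \<noteq> {} \<longleftrightarrow> k = -2 \<or> (\<exists>n::nat. 2 * k = real n))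
     \<and>
     (\<forall>u f. liouville_solution u \<and> developing_map f u \<longrightarrow>
        (u \<in> N (-2) \<longleftrightarrow> linear_fractional f) \<and>
        (u \<notin> N (-2) \<longrightarrow> transcendental f))
     \<and>
     (\<forall>k::real. \<forall>u f. k \<ge> 0 \<and> liouville_solution u \<and> developing_map f u \<longrightarrow>
        (u \<in> N k \<longleftrightarrow>
           (\<exists>P w1 w2. P \<noteq> 0 \<and> real (degree P) = 2 * k \<and>
              ode_solution P w1 \<and> ode_solution P w2 \<and> lin_indep_pair w1 w2 \<and>
              is_quotient f w1 w2)))
     \<and>
     (\<forall>k::real. \<forall>u. k \<ge> 0 \<and> u \<in> N k \<longrightarrow>
        (\<exists>c \<theta>0 :: real. c > 0 \<and>
           uniform_limit UNIV
             (\<lambda>r \<theta>. (u (complex_of_real r * cis \<theta>)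
                       - (- c * r powr (k + 1) * \<bar>sin ((k + 1) * (\<theta> - \<theta>0))\<bar>)) / r powr (k + 1))
             (\<lambda>\<theta>. 0) at_top \<and>
           (\<forall>\<theta>. sin ((k + 1) * (\<theta> - \<theta>0)) = 0 \<longrightarrow>
              (\<exists>\<gamma>. curve_to_infinity \<gamma> \<and> asymptotic_direction \<gamma> \<theta> \<and>
                   ((\<lambda>t. u (\<gamma> t) / ln (norm (\<gamma> t))) \<longlongrightarrow> k) at_top))))"
proof (intro conjI allI impI)
  fix k :: real
  show "N k \<noteq> {} \<longleftrightarrow> k = -2 \<or> (\<exists>n::nat. 2 * k = real n)"
  proof
    assume "N k \<noteq> {}"
    then obtain u where u: "u \<in> N k" by auto
    then have "liouville_solution u" by (simp add: N_def)
    then obtain T w1 w2 where T: "T holomorphic_on UNIV" and w: "normalized_pair T w1 w2 UNIV" and uw: "u = pair_potential w1 w2"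
      by (rule liouville_solution_representation) blast
    from potential_of_N[OF u[unfolded uw] T w] show "k = -2 \<or> (\<exists>n::nat. 2 * k = real n)"
    proof (elim disjE conjE exE)
      fix P :: "complex poly" assume "k = real (degree P) / 2"
      then have "2 * k = real (degree P)" by simp
      then show ?thesis by blast
    qed simp
  next
    assume "k = -2 \<or> (\<exists>n::nat. 2 * k = real n)"
    then consider "k = - 2" | n :: nat where "2 * k = real n" by blast
    then show "N k \<noteq> {}"
    proof cases
      case 1
      obtain w1 w2 where "normalized_pair (\<lambda>_. 0) w1 w2 UNIV"
        by (rule normalized_pair_exists[of "\<lambda>_. 0" 1 1 0 0]) auto
      from zero_potential_in_N[OF this] show ?thesis using 1 by auto
    next
      case 2
      have "poly (monom 1 n) holomorphic_on (UNIV :: complex set)" by (intro holomorphic_intros)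
      then obtain w1 w2 where "normalized_pair (poly (monom 1 n)) w1 w2 UNIV"
        by (rule normalized_pair_exists[of "poly (monom 1 n)" 1 1 0 0]) auto
      from polynomial_potential_asymptotics(1)[OF _ this]
      have "pair_potential w1 w2 \<in> N (real (degree (monom (1::complex) n)) / 2)" by simp
      also have "real (degree (monom (1::complex) n)) / 2 = k" using 2 by (simp add: degree_monom_eq)
      finally show ?thesis by auto
    qed
  qed
next
  fix u f assume "liouville_solution u \<and> developing_map f u"
  then have u: "liouville_solution u" and dm: "developing_map f u" by auto
  obtain T w1 w2 where T: "T holomorphic_on UNIV" and w: "normalized_pair T w1 w2 UNIV" and uw: "u = pair_potential w1 w2"
    using u by (rule liouville_solution_representation) blast
  obtain V1 V2 where V: "normalized_pair T V1 V2 UNIV" and fV: "is_quotient f V1 V2"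
    by (rule developing_map_quotient[OF dm w uw]) blast
  \<comment> \<open>A nonzero polynomial potential would give a nonnegative \<open>k\<close>.\<close>
  have T0: "u \<in> N (- 2) \<longleftrightarrow> T = (\<lambda>_. 0)"
    using potential_of_N[OF _ T w, of "- 2"] zero_potential_in_N w unfolding uw by auto
  show "u \<in> N (-2) \<longleftrightarrow> linear_fractional f"
  proof
    assume "u \<in> N (- 2)"
    then have "normalized_pair (\<lambda>_. 0) V1 V2 UNIV" using T0 V by simp
    then obtain a b c d where abcd: "a * d - b * c = 1" "V1 = (\<lambda>z. a * z + b)" "V2 = (\<lambda>z. c * z + d)"
      by (rule normalized_pair_affine) blast
    have "a * d - b * c \<noteq> 0 \<and> (\<forall>z. c * z + d \<noteq> 0 \<longrightarrow> f z = (a * z + b) / (c * z + d))"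
      using fV abcd(1) unfolding is_quotient_def abcd(2,3) by simp
    then show "linear_fractional f" unfolding linear_fractional_def by blast
  next
    assume "linear_fractional f"
    then obtain a b c d where abcd: "a * d - b * c \<noteq> 0" "\<And>z. c * z + d \<noteq> 0 \<Longrightarrow> f z = (a * z + b) / (c * z + d)"
      by (auto simp: linear_fractional_def)
    have dl: "deriv (\<lambda>z. \<alpha> * z + \<beta>) = (\<lambda>_. \<alpha>)" for \<alpha> \<beta> :: complex
      by (rule ext, rule DERIV_imp_deriv) (auto intro!: derivative_eq_intros)
    have "\<exists>x. c * x + d \<noteq> 0"
    proof (rule ccontr)
      assume "\<not> ?thesis"
      then have "c * 0 + d = 0" "c * 1 + d = 0" by blast+
      then show False using abcd(1) by simp
    qed
    then obtain x where x: "c * x + d \<noteq> 0" by blast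
    have "T = (\<lambda>_. 0)"
      by (rule potential_eq_of_quotient[OF dm w uw T, of _ "\<lambda>z. a * z + b" "\<lambda>z. c * z + d", OF _ _ _ _ _ _ x])
        (use abcd in \<open>auto intro!: holomorphic_intros simp: dl is_quotient_def\<close>)
    then show "u \<in> N (- 2)" using T0 by simp
  qed
  assume "u \<notin> N (- 2)"
  then have "\<not> rational_function f" using rational_quotient_potential_zero[OF V T fV] T0 by blast
  then show "transcendental f"
    using dm by (simp add: transcendental_def developing_map_def locally_univalent_meromorphic_def nicely_meromorphic_on_def)
next
  fix k :: real and u f assume "k \<ge> 0 \<and> liouville_solution u \<and> developing_map f u"
  then have k: "0 \<le> k" and u: "liouville_solution u" and dm: "developing_map f u" by auto
  obtain T w1 w2 where T: "T holomorphic_on UNIV" and w: "normalized_pair T w1 w2 UNIV" and uw: "u = pair_potential w1 w2"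
    using u by (rule liouville_solution_representation) blast
  show "u \<in> N k \<longleftrightarrow> (\<exists>P w1 w2. P \<noteq> 0 \<and> real (degree P) = 2 * k \<and>
              ode_solution P w1 \<and> ode_solution P w2 \<and> lin_indep_pair w1 w2 \<and> is_quotient f w1 w2)"
  proof
    assume "u \<in> N k"
    then obtain P where P: "P \<noteq> 0" "T = poly P" "k = real (degree P) / 2"
      using potential_of_N[OF _ T w] k unfolding uw by force
    obtain V1 V2 where V: "normalized_pair T V1 V2 UNIV" and fV: "is_quotient f V1 V2"
      by (rule developing_map_quotient[OF dm w uw]) blast
    have "ode_solution P V1" "ode_solution P V2"
      using V unfolding ode_solution_def normalized_pair_def P(2) by auto
    then have "P \<noteq> 0 \<and> real (degree P) = 2 * k \<and>
              ode_solution P V1 \<and> ode_solution P V2 \<and> lin_indep_pair V1 V2 \<and> is_quotient f V1 V2"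
      using P(1,3) normalized_pair_lin_indep[OF V] fV by simp
    then show "\<exists>P w1 w2. P \<noteq> 0 \<and> real (degree P) = 2 * k \<and>
              ode_solution P w1 \<and> ode_solution P w2 \<and> lin_indep_pair w1 w2 \<and> is_quotient f w1 w2"
      by blast
  next
    assume "\<exists>P w1 w2. P \<noteq> 0 \<and> real (degree P) = 2 * k \<and>
              ode_solution P w1 \<and> ode_solution P w2 \<and> lin_indep_pair w1 w2 \<and> is_quotient f w1 w2"
    then obtain P v1 v2 where P: "P \<noteq> 0" "real (degree P) = 2 * k"
      and v: "ode_solution P v1" "ode_solution P v2" "lin_indep_pair v1 v2" "is_quotient f v1 v2" by auto
    have "\<exists>x. v2 x \<noteq> 0"
    proof (rule ccontr)
      assume "\<not> ?thesis"
      then have "\<forall>z. 0 * v1 z + 1 * v2 z = 0" by simp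
      then show False using v(3) unfolding lin_indep_pair_def by (metis zero_neq_one)
    qed
    then obtain x where x: "v2 x \<noteq> 0" by blast
    have ode: "deriv (deriv v) z = - poly P z * v z" if "ode_solution P v" for v z
      using that unfolding ode_solution_def by (metis add_eq_0_iff2 mult_minus_left)
    have "T = poly P"
      by (rule potential_eq_of_quotient[OF dm w uw T _ _ _ _ _ v(4) x])
        (use v ode in \<open>auto intro!: holomorphic_intros simp: ode_solution_def\<close>)
    then show "u \<in> N k"
      using polynomial_potential_asymptotics(1)[OF P(1)] w P(2) unfolding uw by force
  qed
next
  fix k :: real and u assume "k \<ge> 0 \<and> u \<in> N k"
  then have k: "0 \<le> k" and uN: "u \<in> N k" by auto
  then have "liouville_solution u" by (simp add: N_def)
  then obtain T w1 w2 where T: "T holomorphic_on UNIV" and w: "normalized_pair T w1 w2 UNIV" and uw: "u = pair_potential w1 w2"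
    by (rule liouville_solution_representation) blast
  obtain P where P: "P \<noteq> 0" "T = poly P" "k = real (degree P) / 2"
    using potential_of_N[OF uN[unfolded uw] T w] k by force
  show "\<exists>c \<theta>0 :: real. c > 0 \<and>
           uniform_limit UNIV
             (\<lambda>r \<theta>. (u (complex_of_real r * cis \<theta>)
                       - (- c * r powr (k + 1) * \<bar>sin ((k + 1) * (\<theta> - \<theta>0))\<bar>)) / r powr (k + 1))
             (\<lambda>\<theta>. 0) at_top \<and>
           (\<forall>\<theta>. sin ((k + 1) * (\<theta> - \<theta>0)) = 0 \<longrightarrow>
              (\<exists>\<gamma>. curve_to_infinity \<gamma> \<and> asymptotic_direction \<gamma> \<theta> \<and>
                   ((\<lambda>t. u (\<gamma> t) / ln (norm (\<gamma> t))) \<longlongrightarrow> k) at_top))"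
    using polynomial_potential_asymptotics(2)[OF P(1) w[unfolded P(2)]] unfolding uw P(3) .
qed

end
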